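(* Let $X$ be a compact geodesic semi-locally simply connected space and let $\mathbb F$ be a field. Assume $\alpha$ is a geodesic circle in $X$ satisfying the following properties: (1) $\alpha$ is a bottleneck loop; (2) $\alpha$ is homologous (in $H_1(X;\mathbb F)$) to a non-trivial $\mathbb F$-combination of loops $\beta_1,\dots,\beta_k$ in $X$ of length at most $|\alpha|$, none of which is homotopic to $\alpha$ or $\alpha^-$; (3) $\alpha$ has arbitrarily small geodesically convex neighborhoods. Then there exists $S>0$ such that for each $s$ with $0<s<S$ the persistent homology $$\{H_2(\mathrm{sRips}(X;r,2,s\cdot r);\mathbb F)\}_{r>0}$$ contains as a direct summand an elementary interval of the form $\{\mathbb F\}_{r\in(|\alpha|/3,\delta_\alpha\rangle}$ for some $\delta_\alpha>|\alpha|/3$.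
   Context: A metric space $X$ is geodesic if any $x,y\in X$ are joined by a geodesic, i.e. an isometric embedding $\gamma\colon[0,d(x,y)]\to X$ with $\gamma(0)=x$, $\gamma(d(x,y))=y$. A subset $A\subseteq X$ is geodesically convex if for all $x,y\in A$ all geodesics in $X$ from $x$ to $y$ lie in $A$. $X$ is semi-locally simply connected if for all $x\in X$ and $\varepsilon>0$ there is $\delta>0$ such that each loop in the open ball $N(x,\delta)$ is contractible in $N(x,\varepsilon)$. A loop is a continuous map from $S^1$ to $X$; loops are also identified with their images; $|\alpha|$ is the length of $\alpha$ and $\alpha^-$ the reversed loop; homotopies of loops are free. A geodesic circle in $X$ is an isometrically embedded $S^1_c$ for some $c>0$, where $S^1_c$ is the circle of circumference $c$ with its geodesic metric. A loop $\alpha$ of finite length is a bottleneck loop if there is a neighborhood $U$ of $\alpha$ in which $\alpha$ is the shortest representative of its free unoriented homotopy class: every loop in $U$ freely homotopic in $U$ to $\alpha$ or $\alpha^-$ that is of length at most $|\alpha|$ coincides with $\alpha$ up to reparameterization and orientation. "Arbitrarily small geodesically convex neighborhoods" means that every neighborhood of $\alpha$ contains a geodesically convex neighborhood of $\alpha$. A combination is non-trivial if not all coefficients are zero. For a metric space $Y$, reals $r_1\ge r_2>0$ and $n\in\mathbb N$, the selective Rips complex $\mathrm{sRips}(Y;r_1,n,r_2)$ is the abstract simplicial complex on vertex set $Y$ in which a finite non-empty subset $\sigma\subset Y$ is a simplex iff (1) $\mathrm{Diam}(\sigma)<r_1$ and (2) there exist subsets $U_0,\dots,U_n\subset Y$ of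 diameter less than $r_2$ with $\sigma\subset U_0\cup\dots\cup U_n$. The persistent homology $\{H_2(\cdot)\}_{r>0}$ is the persistence module with bonding maps induced by inclusions. For $0<p<q$ the elementary interval $\{\mathbb F\}_{r\in(p,q\rangle}$, where "$\rangle$" denotes either an open or a closed endpoint, is the persistence module $\{V_r\}_{r>0}$ with $V_r=\mathbb F$ for $r\in(p,q\rangle$, $V_r=0$ otherwise, and bonding maps $V_r\to V_{r'}$ $(r<r')$ that are identities whenever $r,r'\in(p,q\rangle$ and zero otherwise. *)

theory Defs
  imports "HOL-Analysis.Analysis" "HOL-Algebra.AbelCoset" "HOL-Algebra.Module" "HOL-Homology.Homology"
begin

section \<open>Geodesic spaces and loops\<close>

definition geodesic :: "(real \<Rightarrow> 'a::metric_space) \<Rightarrow> 'a \<Rightarrow> 'a \<Rightarrow> bool" where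
  "geodesic g x y \<longleftrightarrow> g 0 = x \<and> g (dist x y) = y \<and>
     (\<forall>s\<in>{0..dist x y}. \<forall>t\<in>{0..dist x y}. dist (g s) (g t) = \<bar>s - t\<bar>)"

definition geodesic_space :: "'a::metric_space itself \<Rightarrow> bool" where
  "geodesic_space _ \<longleftrightarrow> (\<forall>x y :: 'a. \<exists>g. geodesic g x y)"

definition geodesically_convex :: "'a::metric_space set \<Rightarrow> bool" where
  "geodesically_convex A \<longleftrightarrow>
     (\<forall>x\<in>A. \<forall>y\<in>A. \<forall>g. geodesic g x y \<longrightarrow> g ` {0..dist x y} \<subseteq> A)"

text \<open>As in the library, a loop is a path on the unit interval with equal end points, and
  \<^const>\<open>homotopic_loops\<close> is free homotopy of loops inside a given set.\<close>

definition loop :: "(real \<Rightarrow> 'a::topological_space) \<Rightarrow> bool" where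
  "loop p \<longleftrightarrow> path p \<and> pathfinish p = pathstart p"

definition semi_locally_simply_connected :: "'a::metric_space itself \<Rightarrow> bool" where
  "semi_locally_simply_connected _ \<longleftrightarrow>
     (\<forall>x::'a. \<forall>\<epsilon>>0. \<exists>\<delta>>0. \<forall>p. loop p \<and> path_image p \<subseteq> ball x \<delta> \<longrightarrow>
        (\<exists>a. homotopic_loops (ball x \<epsilon>) p (\<lambda>_. a)))"

definition path_length :: "(real \<Rightarrow> 'a::metric_space) \<Rightarrow> ennreal" where
  "path_length p =
     (SUP (n, t) \<in> {(n::nat, t::nat \<Rightarrow> real). t ` {..n} \<subseteq> {0..1} \<and> mono_on {..n} t}.
        ennreal (\<Sum>i<n. dist (p (t i)) (p (t (Suc i)))))"

text \<open>The circle of circumference \<open>c\<close> is the interval from \<open>0\<close> to \<open>c\<close> with its end points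
  identified.\<close>

definition circle_dist :: "real \<Rightarrow> real \<Rightarrow> real \<Rightarrow> real" where
  "circle_dist c u v = min \<bar>u - v\<bar> (c - \<bar>u - v\<bar>)"

definition geodesic_circle :: "(real \<Rightarrow> 'a::metric_space) \<Rightarrow> bool" where
  "geodesic_circle p \<longleftrightarrow>
     (\<exists>c>0. \<forall>s\<in>{0..1}. \<forall>t\<in>{0..1}. dist (p s) (p t) = circle_dist c (c * s) (c * t))"

definition nbhd_of :: "'a::topological_space set \<Rightarrow> 'a set \<Rightarrow> bool" where
  "nbhd_of U A \<longleftrightarrow> A \<subseteq> interior U"

text \<open>Lifts to the real line of the weakly monotone degree one maps from the circle (the reals
  modulo \<open>1\<close>) to itself. Weak monotonicity is needed because a loop may pause without
  changing its length; there is no fixed base point.\<close>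

definition monotone_circle_lift :: "(real \<Rightarrow> real) \<Rightarrow> bool" where
  "monotone_circle_lift \<phi> \<longleftrightarrow> continuous_on UNIV \<phi> \<and> mono \<phi> \<and> (\<forall>t. \<phi> (t + 1) = \<phi> t + 1)"

definition equal_up_to_reparam :: "(real \<Rightarrow> 'a) \<Rightarrow> (real \<Rightarrow> 'a) \<Rightarrow> bool" where
  "equal_up_to_reparam p q \<longleftrightarrow>
     (\<exists>\<phi> \<psi>. monotone_circle_lift \<phi> \<and> monotone_circle_lift \<psi> \<and>
        (\<forall>t. p (frac (\<phi> t)) = q (frac (\<psi> t))))"

definition bottleneck_loop :: "(real \<Rightarrow> 'a::metric_space) \<Rightarrow> bool" where
  "bottleneck_loop p \<longleftrightarrow> loop p \<and> path_length p < \<infinity> \<and>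
     (\<exists>U. nbhd_of U (path_image p) \<and>
        (\<forall>q. loop q \<and> path_image q \<subseteq> U \<and>
             (homotopic_loops U q p \<or> homotopic_loops U q (reversepath p)) \<and>
             path_length q \<le> path_length p \<longrightarrow>
             equal_up_to_reparam q p \<or> equal_up_to_reparam q (reversepath p)))"

section \<open>Homology with coefficients in a field\<close>

text \<open>Modules in HOL-Algebra carry unused multiplication and unit fields, left unspecified here.\<close>

definition free_module :: "('f, 'm) ring_scheme \<Rightarrow> 's set \<Rightarrow> ('f, 's \<Rightarrow> 'f) module" where
  "free_module F S =
     \<lparr>carrier = {c. (\<forall>x\<in>S. c x \<in> carrier F) \<and> (\<forall>x. x \<notin> S \<longrightarrow> c x = \<zero>\<^bsub>F\<^esub>) \<and>
                    finite {x. c x \<noteq> \<zero>\<^bsub>F\<^esub>}},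
      monoid.mult = undefined, one = undefined,
      zero = (\<lambda>_. \<zero>\<^bsub>F\<^esub>), add = (\<lambda>c d x. c x \<oplus>\<^bsub>F\<^esub> d x),
      smult = (\<lambda>a c x. a \<otimes>\<^bsub>F\<^esub> c x)\<rparr>"

definition quotient_module :: "('f, 'c) module \<Rightarrow> 'c set \<Rightarrow> ('f, 'c set) module" where
  "quotient_module M N =
     \<lparr>carrier = a_rcosets\<^bsub>M\<^esub> N, monoid.mult = undefined, one = undefined,
      zero = N, add = set_add M,
      smult = (\<lambda>a X. \<Union>x\<in>X. N +>\<^bsub>M\<^esub> (a \<odot>\<^bsub>M\<^esub> x))\<rparr>"

subsection \<open>Singular homology\<close>

definition singular_chains ::
  "('f, 'm) ring_scheme \<Rightarrow> nat \<Rightarrow> 'a topology \<Rightarrow> ('f, ((nat \<Rightarrow> real) \<Rightarrow> 'a) \<Rightarrow> 'f) module" where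
  "singular_chains F p X = free_module F (singular_simplex_set p X)"

definition singular_bd ::
  "('f, 'm) ring_scheme \<Rightarrow> nat \<Rightarrow> (((nat \<Rightarrow> real) \<Rightarrow> 'a) \<Rightarrow> 'f) \<Rightarrow> ((nat \<Rightarrow> real) \<Rightarrow> 'a) \<Rightarrow> 'f" where
  "singular_bd F p c =
     (if p = 0 then (\<lambda>_. \<zero>\<^bsub>F\<^esub>) else
      (\<lambda>\<tau>. \<Oplus>\<^bsub>F\<^esub>\<sigma> \<in> {\<sigma>. c \<sigma> \<noteq> \<zero>\<^bsub>F\<^esub>}. \<Oplus>\<^bsub>F\<^esub>k \<in> {k. k \<le> p \<and> singular_face p k \<sigma> = \<tau>}.
             ((\<ominus>\<^bsub>F\<^esub> \<one>\<^bsub>F\<^esub>) [^]\<^bsub>F\<^esub> k) \<otimes>\<^bsub>F\<^esub> c \<sigma>))"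

definition singular_cycles ::
  "('f, 'm) ring_scheme \<Rightarrow> nat \<Rightarrow> 'a topology \<Rightarrow> (((nat \<Rightarrow> real) \<Rightarrow> 'a) \<Rightarrow> 'f) set" where
  "singular_cycles F p X =
     {c \<in> carrier (singular_chains F p X). singular_bd F p c = (\<lambda>_. \<zero>\<^bsub>F\<^esub>)}"

definition singular_boundaries ::
  "('f, 'm) ring_scheme \<Rightarrow> nat \<Rightarrow> 'a topology \<Rightarrow> (((nat \<Rightarrow> real) \<Rightarrow> 'a) \<Rightarrow> 'f) set" where
  "singular_boundaries F p X = singular_bd F (Suc p) ` carrier (singular_chains F (Suc p) X)"

definition singular_homology ::
  "('f, 'm) ring_scheme \<Rightarrow> nat \<Rightarrow> 'a topology \<Rightarrow> ('f, (((nat \<Rightarrow> real) \<Rightarrow> 'a) \<Rightarrow> 'f) set) module" where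
  "singular_homology F p X =
     quotient_module ((singular_chains F p X)\<lparr>carrier := singular_cycles F p X\<rparr>)
       (singular_boundaries F p X)"

text \<open>A point \<open>x\<close> of the standard 1-simplex has coordinates \<open>x 0 = 1 - x 1\<close> and \<open>x 1\<close>.\<close>

definition loop_chain ::
  "('f, 'm) ring_scheme \<Rightarrow> (real \<Rightarrow> 'a) \<Rightarrow> ((nat \<Rightarrow> real) \<Rightarrow> 'a) \<Rightarrow> 'f" where
  "loop_chain F p =
     (\<lambda>\<sigma>. if \<sigma> = restrict (\<lambda>x. p (x 1)) (standard_simplex 1) then \<one>\<^bsub>F\<^esub> else \<zero>\<^bsub>F\<^esub>)"

definition loop_class ::
  "('f, 'm) ring_scheme \<Rightarrow> (real \<Rightarrow> 'a::topological_space) \<Rightarrow> (((nat \<Rightarrow> real) \<Rightarrow> 'a) \<Rightarrow> 'f) set" where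
  "loop_class F p =
     singular_boundaries F 1 euclidean +>\<^bsub>singular_chains F 1 euclidean\<^esub> loop_chain F p"

subsection \<open>Simplicial homology\<close>

text \<open>A complex is given by its set \<open>K\<close> of simplices. An oriented \<open>p\<close>-chain is
  a finitely supported function on ordered simplices, written as lists of \<open>p + 1\<close> distinct
  vertices, that changes sign when two vertices are swapped: \<open>c l\<close> is the coefficient of the
  oriented simplex \<open>l\<close>.\<close>

definition oriented_chains ::
  "('f, 'm) ring_scheme \<Rightarrow> nat \<Rightarrow> 'a set set \<Rightarrow> ('f, 'a list \<Rightarrow> 'f) module" where
  "oriented_chains F p K =
     (let C = free_module F {l. length l = Suc p \<and> distinct l \<and> set l \<in> K} in
      C\<lparr>carrier := {c \<in> carrier C. \<forall>l i j. length l = Suc p \<and> i < j \<and> j \<le> p \<longrightarrow>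
                       c (l[i := l ! j, j := l ! i]) = \<ominus>\<^bsub>F\<^esub> c l}\<rparr>)"

text \<open>The boundary of \<open>[v\<^sub>0, \<dots>, v\<^sub>p]\<close> is the alternating sum of its faces, so the face \<open>w\<close>
  receives the coefficient of \<open>v # w\<close> for every vertex \<open>v\<close>.\<close>

definition oriented_bd ::
  "('f, 'm) ring_scheme \<Rightarrow> nat \<Rightarrow> ('a list \<Rightarrow> 'f) \<Rightarrow> 'a list \<Rightarrow> 'f" where
  "oriented_bd F p c =
     (if p = 0 then (\<lambda>_. \<zero>\<^bsub>F\<^esub>)
      else (\<lambda>w. \<Oplus>\<^bsub>F\<^esub>v \<in> {v. c (v # w) \<noteq> \<zero>\<^bsub>F\<^esub>}. c (v # w)))"

definition simplicial_cycles ::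
  "('f, 'm) ring_scheme \<Rightarrow> nat \<Rightarrow> 'a set set \<Rightarrow> ('a list \<Rightarrow> 'f) set" where
  "simplicial_cycles F p K =
     {c \<in> carrier (oriented_chains F p K). oriented_bd F p c = (\<lambda>_. \<zero>\<^bsub>F\<^esub>)}"

definition simplicial_boundaries ::
  "('f, 'm) ring_scheme \<Rightarrow> nat \<Rightarrow> 'a set set \<Rightarrow> ('a list \<Rightarrow> 'f) set" where
  "simplicial_boundaries F p K = oriented_bd F (Suc p) ` carrier (oriented_chains F (Suc p) K)"

definition simplicial_homology ::
  "('f, 'm) ring_scheme \<Rightarrow> nat \<Rightarrow> 'a set set \<Rightarrow> ('f, ('a list \<Rightarrow> 'f) set) module" where
  "simplicial_homology F p K =
     quotient_module ((oriented_chains F p K)\<lparr>carrier := simplicial_cycles F p K\<rparr>)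
       (simplicial_boundaries F p K)"

text \<open>The map induced by the inclusion into a larger complex \<open>L\<close>: chains are extended by zero, so
  a coset \<open>X\<close> is sent to the coset of any of its elements.\<close>

definition inclusion_map ::
  "('f, 'm) ring_scheme \<Rightarrow> nat \<Rightarrow> 'a set set \<Rightarrow> ('a list \<Rightarrow> 'f) set \<Rightarrow> ('a list \<Rightarrow> 'f) set" where
  "inclusion_map F p L X =
     (\<Union>z\<in>X. simplicial_boundaries F p L +>\<^bsub>oriented_chains F p L\<^esub> z)"

section \<open>Persistence modules indexed by the positive reals\<close>

text \<open>Only the values of \<open>pspace\<close> at \<open>r > 0\<close> and of \<open>pbond\<close> at \<open>0 < r < r'\<close> matter.\<close>

record ('f, 'v) persistence =
  pspace :: "real \<Rightarrow> ('f, 'v) module"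
  pbond :: "real \<Rightarrow> real \<Rightarrow> 'v \<Rightarrow> 'v"

definition linear_iso ::
  "('f, 'm) ring_scheme \<Rightarrow> ('f, 'v) module \<Rightarrow> ('f, 'w) module \<Rightarrow> ('v \<Rightarrow> 'w) \<Rightarrow> bool" where
  "linear_iso F M N h \<longleftrightarrow> bij_betw h (carrier M) (carrier N) \<and>
     (\<forall>x\<in>carrier M. \<forall>y\<in>carrier M. h (x \<oplus>\<^bsub>M\<^esub> y) = h x \<oplus>\<^bsub>N\<^esub> h y) \<and>
     (\<forall>a\<in>carrier F. \<forall>x\<in>carrier M. h (a \<odot>\<^bsub>M\<^esub> x) = a \<odot>\<^bsub>N\<^esub> h x)"

definition persistence_iso ::
  "('f, 'm) ring_scheme \<Rightarrow> ('f, 'v) persistence \<Rightarrow> ('f, 'w) persistence \<Rightarrow> bool" where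
  "persistence_iso F P Q \<longleftrightarrow>
     (\<exists>h. (\<forall>r>0. linear_iso F (pspace P r) (pspace Q r) (h r)) \<and>
          (\<forall>r r'. 0 < r \<and> r < r' \<longrightarrow>
             (\<forall>x\<in>carrier (pspace P r). h r' (pbond P r r' x) = pbond Q r r' (h r x))))"

definition persistence_submodule ::
  "('f, 'm) ring_scheme \<Rightarrow> ('f, 'v) persistence \<Rightarrow> (real \<Rightarrow> 'v set) \<Rightarrow> bool" where
  "persistence_submodule F P A \<longleftrightarrow>
     (\<forall>r>0. submodule (A r) F (pspace P r)) \<and>
     (\<forall>r r'. 0 < r \<and> r < r' \<longrightarrow> pbond P r r' ` A r \<subseteq> A r')"

definition restrict_persistence ::
  "('f, 'v) persistence \<Rightarrow> (real \<Rightarrow> 'v set) \<Rightarrow> ('f, 'v) persistence" where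
  "restrict_persistence P A =
     \<lparr>pspace = (\<lambda>r. (pspace P r)\<lparr>carrier := A r\<rparr>), pbond = pbond P\<rparr>"

definition has_direct_summand ::
  "('f, 'm) ring_scheme \<Rightarrow> ('f, 'v) persistence \<Rightarrow> ('f, 'w) persistence \<Rightarrow> bool" where
  "has_direct_summand F P E \<longleftrightarrow>
     (\<exists>A B. persistence_submodule F P A \<and> persistence_submodule F P B \<and>
        (\<forall>r>0. A r \<inter> B r = {\<zero>\<^bsub>pspace P r\<^esub>} \<and>
                A r <+>\<^bsub>pspace P r\<^esub> B r = carrier (pspace P r)) \<and>
        persistence_iso F E (restrict_persistence P A))"

definition elementary_interval ::
  "('f, 'm) ring_scheme \<Rightarrow> real set \<Rightarrow> ('f, 'f) persistence" where
  "elementary_interval F J =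
     \<lparr>pspace = (\<lambda>r. \<lparr>carrier = (if r \<in> J then carrier F else {\<zero>\<^bsub>F\<^esub>}),
                      monoid.mult = undefined, one = undefined,
                      zero = \<zero>\<^bsub>F\<^esub>, add = add F, smult = monoid.mult F\<rparr>),
      pbond = (\<lambda>r r' x. if r \<in> J \<and> r' \<in> J then x else \<zero>\<^bsub>F\<^esub>)\<rparr>"

section \<open>Selective Rips complexes\<close>

text \<open>The boundedness condition is there because \<^const>\<open>diameter\<close> is only meaningful on bounded
  sets.\<close>

definition sRips :: "'a::metric_space set \<Rightarrow> real \<Rightarrow> nat \<Rightarrow> real \<Rightarrow> 'a set set" where
  "sRips Y r1 n r2 =
     {\<sigma>. \<sigma> \<subseteq> Y \<and> finite \<sigma> \<and> \<sigma> \<noteq> {} \<and> diameter \<sigma> < r1 \<and>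
         (\<exists>U. (\<forall>i\<le>n. U i \<subseteq> Y \<and> bounded (U i) \<and> diameter (U i) < r2) \<and>
              \<sigma> \<subseteq> (\<Union>i\<le>n. U i))}"

definition sRips_homology ::
  "('f, 'm) ring_scheme \<Rightarrow> nat \<Rightarrow> 'a::metric_space set \<Rightarrow> nat \<Rightarrow> real \<Rightarrow>
     ('f, ('a list \<Rightarrow> 'f) set) persistence" where
  "sRips_homology F p Y n s =
     \<lparr>pspace = (\<lambda>r. simplicial_homology F p (sRips Y r n (s * r))),
      pbond = (\<lambda>r r'. inclusion_map F p (sRips Y r' n (s * r')))\<rparr>"

end

theory Submission
  imports Defs
begin

text \<open>Let \<open>a\<close> be the length of \<open>\<alpha>\<close>. The proof exhibits a 2-cycle \<open>z\<close> that exists at every scale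
  \<open>r > a / 3\<close> and shows that for small \<open>s\<close> it is essential just above \<open>a / 3\<close>.

  A fine polygon inscribed in \<open>\<alpha>\<close> bounds the sum of one large triangle, with vertices \<open>\<alpha> 0\<close>, \<open>\<alpha> (1/3)\<close>
  and \<open>\<alpha> (2/3)\<close>, and of fans of thin triangles, all of diameter at most \<open>a / 3\<close>. The loops \<open>\<beta> i\<close> are
  not longer than \<open>\<alpha>\<close>, so they are filled in the same way (\<open>loop_filling\<close>). The singular 2-chain that
  makes \<open>\<alpha>\<close> homologous to the combination of the \<open>\<beta> i\<close> becomes, after a fine subdivision, a
  chain of tiny triangles. Together these chains form the cycle \<open>z\<close> (\<open>cycle_from_fillings\<close>,
  \<open>essential_cycle\<close>).

  The cycle is detected by a cocycle: a triangle whose vertices are close to the circle has a winding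
  number around it. A winding triangle with sides of length at most \<open>a / 3\<close> and vertices in the convex
  neighbourhood spans a geodesic triangle that is homotopic to the circle and has length at most \<open>a\<close>.
  The bottleneck property forces it to coincide with the circle, so its vertices lie on the circle and
  its sides have length exactly \<open>a / 3\<close> (\<open>winding_triangle_on_circle\<close>). Hence no triangle of diameter
  below \<open>a / 3\<close> winds, and by compactness the winding triangles of slightly larger diameter \<open>r0\<close> cluster
  around the circle, away from the rim of the neighbourhood (\<open>winding_triangles_isolated\<close>). In a
  tetrahedron of the selective Rips complex two of the four vertices lie in one of the three sets of
  diameter less than \<open>s * r\<close>. If a face winds, then exactly the two faces that differ by these
  vertices do, and they contribute opposite signs. Thus the winding number vanishes on boundaries
  (\<open>cocycle_vanishes_on_boundaries\<close>). It is one on the large triangle of \<open>\<alpha>\<close>, and zero on the one of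
  \<open>\<beta> i\<close>, since otherwise \<open>\<beta> i\<close> would be homotopic to \<open>\<alpha>\<close> or its reverse
  (\<open>loop_with_winding_thirds\<close>). So at scale \<open>r0\<close> the cycle \<open>z\<close> is not homologous to any cycle of scale
  \<open>a / 3\<close> (\<open>essential_cycle_not_early\<close>).

  The rest is linear algebra (\<open>persistent_class_gives_summand\<close>). Corrected by a cycle of scale \<open>a / 3\<close>
  that makes it die as early as possible, the class of \<open>z\<close> spans an interval module, and a complement
  that is compatible with the bonding maps comes from a maximal subspace that avoids it. That an
  optimal correction exists is a compactness statement: up to a small change of scale, cycles move to a
  finite net, so only finitely many dimensions matter (\<open>cycles_on_finite_net\<close>,
  \<open>common_killing_cycle\<close>).\<close>

section \<open>Finite sums in a field\<close>

lemma (in field) finsum_superset: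
  assumes "finite B" "A \<subseteq> B" "f \<in> B \<rightarrow> carrier R" "\<And>x. x \<in> B - A \<Longrightarrow> f x = \<zero>"
  shows "finsum R f A = finsum R f B"
  using assms by (intro add.finprod_mono_neutral_cong_left) auto

lemma (in field) finsum_swap:
  assumes "finite A" "finite B" "\<And>x y. x \<in> A \<Longrightarrow> y \<in> B \<Longrightarrow> f x y \<in> carrier R"
  shows "(\<Oplus>x\<in>A. \<Oplus>y\<in>B. f x y) = (\<Oplus>y\<in>B. \<Oplus>x\<in>A. f x y)"
  using assms(1,3)
proof (induction A rule: finite_induct)
  case empty
  then show ?case by simp
next
  case (insert a A)
  have a: "f a \<in> B \<rightarrow> carrier R" "(\<lambda>y. \<Oplus>x\<in>A. f x y) \<in> B \<rightarrow> carrier R"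
    using insert by (auto intro!: finsum_closed)
  have "(\<Oplus>y\<in>B. \<Oplus>x\<in>insert a A. f x y) = (\<Oplus>y\<in>B. f a y \<oplus> (\<Oplus>x\<in>A. f x y))"
    using insert a by (intro add.finprod_cong') (auto intro!: finsum_closed)
  also have "\<dots> = (\<Oplus>y\<in>B. f a y) \<oplus> (\<Oplus>y\<in>B. \<Oplus>x\<in>A. f x y)"
    using a by (rule finsum_addf)
  finally show ?case
    using insert a assms(2) by (auto intro!: finsum_closed)
qed

lemma (in field) finsum_diff:
  assumes "f \<in> A \<rightarrow> carrier R" "g \<in> A \<rightarrow> carrier R"
  shows "(\<Oplus>x\<in>A. f x \<ominus> g x) = finsum R f A \<ominus> finsum R g A"
proof (cases "finite A")
  case True
  then show ?thesis using assms
  proof (induction A rule: finite_induct)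
    case (insert a A)
    then have "f \<in> A \<rightarrow> carrier R" "g \<in> A \<rightarrow> carrier R" "f a \<in> carrier R" "g a \<in> carrier R"
       "finsum R f A \<in> carrier R" "finsum R g A \<in> carrier R"
      "(\<lambda>x. f x \<ominus> g x) \<in> A \<rightarrow> carrier R" by (auto intro!: finsum_closed)
    then show ?case using insert by (simp add: minus_eq minus_add a_ac)
  qed (simp add: minus_eq)
qed (simp add: minus_eq)

text \<open>The terms cancel in pairs. There is no division by two, so characteristic 2 is included.\<close>

lemma (in field) finsum_involution:
  assumes "finite A" "\<And>x. x \<in> A \<Longrightarrow> i x \<in> A \<and> i (i x) = x \<and> i x \<noteq> x"
    and "\<And>x. x \<in> A \<Longrightarrow> f x \<in> carrier R" "\<And>x. x \<in> A \<Longrightarrow> f (i x) = \<ominus> f x"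
  shows "finsum R f A = \<zero>"
  using assms
proof (induction "card A" arbitrary: A rule: less_induct)
  case less
  show ?case
  proof (cases "A = {}")
    case False
    then obtain x where x: "x \<in> A" by auto
    define B where "B = A - {x, i x}"
    have ix: "i x \<in> A" "i (i x) = x" "i x \<noteq> x" using less.prems(2)[OF x] by auto
    have A: "A = insert x (insert (i x) B)" "x \<notin> insert (i x) B" "i x \<notin> B" "finite B"
      using x ix less.prems(1) by (auto simp: B_def)
    have "card B < card A" using less.prems(1) x unfolding B_def by (intro psubset_card_mono) auto
    moreover have "i y \<in> B \<and> i (i y) = y \<and> i y \<noteq> y" if "y \<in> B" for y
      using that less.prems(2)[of y] ix unfolding B_def by auto
    ultimately have "finsum R f B = \<zero>"
      by (rule less.hyps[OF _ A(4)]) (use less.prems in \<open>auto simp: B_def\<close>)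
    moreover have "finsum R f A = f x \<oplus> (f (i x) \<oplus> finsum R f B)"
      using A less.prems(3) by (auto simp: Pi_iff intro!: finsum_closed)
    ultimately show ?thesis
      using less.prems(3,4)[OF x] by (simp add: r_neg)
  qed simp
qed

text \<open>Used for the square of the boundary operator, where the diagonal terms vanish because a
  simplex has distinct vertices.\<close>

lemma (in field) finsum_antisymmetric:
  assumes "finite A" "\<And>x y. x \<in> A \<Longrightarrow> y \<in> A \<Longrightarrow> g x y \<in> carrier R"
    and "\<And>x y. x \<in> A \<Longrightarrow> y \<in> A \<Longrightarrow> g x y = \<ominus> g y x" "\<And>x. x \<in> A \<Longrightarrow> g x x = \<zero>"
  shows "(\<Oplus>x\<in>A. \<Oplus>y\<in>A. g x y) = \<zero>"
  using assms
proof (induction A rule: finite_induct)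
  case (insert a A)
  have c: "(\<lambda>x. g x a) \<in> A \<rightarrow> carrier R" "g a \<in> A \<rightarrow> carrier R" "g a a = \<zero>"
     "(\<lambda>x. \<Oplus>y\<in>A. g x y) \<in> A \<rightarrow> carrier R"
    using insert.prems(1) insert.prems(3)[of a] by (auto intro!: finsum_closed)
  have "(\<Oplus>x\<in>A. \<Oplus>y\<in>insert a A. g x y) = (\<Oplus>x\<in>A. g x a \<oplus> (\<Oplus>y\<in>A. g x y))"
    using insert.hyps insert.prems(1) c by (intro add.finprod_cong') (auto intro!: finsum_closed)
  also have "\<dots> = (\<Oplus>x\<in>A. g x a) \<oplus> (\<Oplus>x\<in>A. \<Oplus>y\<in>A. g x y)"
    using c(1,4) by (rule finsum_addf)
  also have "(\<Oplus>x\<in>A. \<Oplus>y\<in>A. g x y) = \<zero>"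
    by (rule insert.IH) (use insert.prems in blast)+
  finally have 1: "(\<Oplus>x\<in>A. \<Oplus>y\<in>insert a A. g x y) = (\<Oplus>x\<in>A. g x a)" using c by simp
  have "(\<Oplus>x\<in>A. g a x) \<oplus> (\<Oplus>x\<in>A. g x a) = (\<Oplus>x\<in>A. g a x \<oplus> g x a)"
    using c by (simp add: finsum_addf)
  also have "\<dots> = (\<Oplus>x\<in>A. \<zero>)"
  proof (rule add.finprod_cong')
    fix x assume "x \<in> A"
    then show "g a x \<oplus> g x a = \<zero>"
      using insert.prems(1)[of x a] insert.prems(2)[of a x] by (simp add: l_neg)
  qed simp_all
  finally have 2: "(\<Oplus>x\<in>A. g a x) \<oplus> (\<Oplus>x\<in>A. g x a) = \<zero>" by simp
  have "(\<lambda>x. \<Oplus>y\<in>insert a A. g x y) \<in> A \<rightarrow> carrier R" "(\<Oplus>y\<in>insert a A. g a y) \<in> carrier R"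
    using insert.prems(1) by (auto intro!: finsum_closed)
  then have "(\<Oplus>x\<in>insert a A. \<Oplus>y\<in>insert a A. g x y)
      = (\<Oplus>y\<in>insert a A. g a y) \<oplus> (\<Oplus>x\<in>A. \<Oplus>y\<in>insert a A. g x y)"
    using insert.hyps by simp
  also have "\<dots> = \<zero>" using 1 2 c insert.hyps by simp
  finally show ?case .
qed (rule finsum_empty)

section \<open>Oriented chains\<close>

definition downward_closed :: "'a set set \<Rightarrow> bool" where
  "downward_closed K \<longleftrightarrow> (\<forall>\<sigma>\<in>K. \<forall>\<tau>. \<tau> \<subseteq> \<sigma> \<and> \<tau> \<noteq> {} \<longrightarrow> \<tau> \<in> K)"

context field
begin

abbreviation chains :: "nat \<Rightarrow> 'v set set \<Rightarrow> ('v list \<Rightarrow> 'a) set" where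
  "chains p K \<equiv> carrier (oriented_chains R p K)"

abbreviation cadd :: "('s \<Rightarrow> 'a) \<Rightarrow> ('s \<Rightarrow> 'a) \<Rightarrow> 's \<Rightarrow> 'a" where
  "cadd c d \<equiv> (\<lambda>l. c l \<oplus> d l)"

abbreviation csub :: "('s \<Rightarrow> 'a) \<Rightarrow> ('s \<Rightarrow> 'a) \<Rightarrow> 's \<Rightarrow> 'a" where
  "csub c d \<equiv> (\<lambda>l. c l \<ominus> d l)"

abbreviation cscale :: "'a \<Rightarrow> ('s \<Rightarrow> 'a) \<Rightarrow> 's \<Rightarrow> 'a" where
  "cscale k c \<equiv> (\<lambda>l. k \<otimes> c l)"

abbreviation czero :: "'s \<Rightarrow> 'a" where
  "czero \<equiv> (\<lambda>_. \<zero>)"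

abbreviation cycles :: "nat \<Rightarrow> 'v set set \<Rightarrow> ('v list \<Rightarrow> 'a) set" where
  "cycles p K \<equiv> simplicial_cycles R p K"

abbreviation bounds :: "nat \<Rightarrow> 'v set set \<Rightarrow> ('v list \<Rightarrow> 'a) set" where
  "bounds p K \<equiv> simplicial_boundaries R p K"

abbreviation bd :: "nat \<Rightarrow> ('v list \<Rightarrow> 'a) \<Rightarrow> 'v list \<Rightarrow> 'a" where
  "bd p c \<equiv> oriented_bd R p c"

lemma chains_iff:
  "c \<in> chains p K \<longleftrightarrow> (\<forall>l. c l \<in> carrier R) \<and>
     (\<forall>l. c l \<noteq> \<zero> \<longrightarrow> length l = Suc p \<and> distinct l \<and> set l \<in> K) \<and> finite {l. c l \<noteq> \<zero>} \<and>
     (\<forall>l i j. length l = Suc p \<and> i < j \<and> j \<le> p \<longrightarrow> c (l[i := l ! j, j := l ! i]) = \<ominus> c l)"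
proof -
  have *: "carrier (M\<lparr>carrier := X\<rparr>) = X" for M :: "('a, 'v list \<Rightarrow> 'a) module" and X by simp
  have key: "((\<forall>x. P x \<longrightarrow> c x \<in> carrier R) \<and> (\<forall>x. \<not> P x \<longrightarrow> c x = \<zero>) \<and> A) \<and> B
    \<longleftrightarrow> (\<forall>l. c l \<in> carrier R) \<and> (\<forall>l. c l \<noteq> \<zero> \<longrightarrow> P l) \<and> A \<and> B" for P A B
    by (metis zero_closed)
  show ?thesis
    unfolding oriented_chains_def free_module_def Let_def *
    unfolding partial_object.simps mem_Collect_eq Ball_def by (rule key)
qed

lemma chains_closed: "c \<in> chains p K \<Longrightarrow> c l \<in> carrier R"
  by (simp add: chains_iff)

lemma chains_supp: "c \<in> chains p K \<Longrightarrow> c l \<noteq> \<zero> \<Longrightarrow> length l = Suc p \<and> distinct l \<and> set l \<in> K"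
  by (simp add: chains_iff)

lemma chains_zero: "c \<in> chains p K \<Longrightarrow> \<not> (length l = Suc p \<and> distinct l \<and> set l \<in> K) \<Longrightarrow> c l = \<zero>"
  using chains_supp by blast

lemma chains_finite: "c \<in> chains p K \<Longrightarrow> finite {l. c l \<noteq> \<zero>}"
  by (simp add: chains_iff)

lemma chains_swap:
  "c \<in> chains p K \<Longrightarrow> length l = Suc p \<Longrightarrow> i < j \<Longrightarrow> j \<le> p \<Longrightarrow> c (l[i := l ! j, j := l ! i]) = \<ominus> c l"
  by (simp add: chains_iff)

lemma chains_mono: "K \<subseteq> L \<Longrightarrow> c \<in> chains p K \<Longrightarrow> c \<in> chains p L"
  unfolding chains_iff by blast

lemma chains_restrict:
  assumes "c \<in> chains p K" "\<And>l. c l \<noteq> \<zero> \<Longrightarrow> set l \<in> L"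
  shows "c \<in> chains p L"
  using assms unfolding chains_iff by blast

lemma czero_chain: "czero \<in> chains p K"
  unfolding chains_iff by simp

lemma cadd_chain:
  assumes "c \<in> chains p K" "d \<in> chains p K" shows "cadd c d \<in> chains p K"
  unfolding chains_iff
proof (intro conjI allI impI)
  show "finite {l. c l \<oplus> d l \<noteq> \<zero>}"
    by (rule finite_subset[OF _ finite_UnI[OF chains_finite[OF assms(1)] chains_finite[OF assms(2)]]]) auto
  fix l
  show "c l \<oplus> d l \<in> carrier R" using assms by (simp add: chains_closed)
  { assume "c l \<oplus> d l \<noteq> \<zero>"
    then have "c l \<noteq> \<zero> \<or> d l \<noteq> \<zero>" by auto
    then show "length l = Suc p" "distinct l" "set l \<in> K" using assms chains_supp by metis+ }
  fix i j assume "length l = Suc p \<and> i < j \<and> j \<le> p"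
  then show "c (l[i := l ! j, j := l ! i]) \<oplus> d (l[i := l ! j, j := l ! i]) = \<ominus> (c l \<oplus> d l)"
    using chains_swap[OF assms(1)] chains_swap[OF assms(2)] chains_closed[OF assms(1)] chains_closed[OF assms(2)]
    by (simp add: minus_add)
qed

lemma cscale_chain:
  assumes "k \<in> carrier R" "c \<in> chains p K" shows "cscale k c \<in> chains p K"
  unfolding chains_iff
proof (intro conjI allI impI)
  show "finite {l. k \<otimes> c l \<noteq> \<zero>}"
    by (rule finite_subset[OF _ chains_finite[OF assms(2)]]) (use assms in auto)
  fix l
  show "k \<otimes> c l \<in> carrier R" using assms by (simp add: chains_closed)
  { assume "k \<otimes> c l \<noteq> \<zero>"
    then have "c l \<noteq> \<zero>" using assms by auto
    then show "length l = Suc p" "distinct l" "set l \<in> K" using assms chains_supp by metis+ }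
  fix i j assume "length l = Suc p \<and> i < j \<and> j \<le> p"
  then show "k \<otimes> c (l[i := l ! j, j := l ! i]) = \<ominus> (k \<otimes> c l)"
    using chains_swap[OF assms(2)] chains_closed[OF assms(2)] assms(1) by (simp add: r_minus)
qed

lemma csub_eq_cadd:
  assumes "c \<in> chains p K" "d \<in> chains p K"
  shows "csub c d = cadd c (cscale (\<ominus> \<one>) d)"
  using chains_closed[OF assms(1)] chains_closed[OF assms(2)]
  by (simp add: minus_eq l_minus)

lemma csub_chain:
  assumes "c \<in> chains p K" "d \<in> chains p K" shows "csub c d \<in> chains p K"
  unfolding csub_eq_cadd[OF assms] by (intro cadd_chain cscale_chain assms) simp

lemma bd_eq_finsum:
  assumes "c \<in> chains (Suc p) K" "finite A" "\<And>v. c (v # w) \<noteq> \<zero> \<Longrightarrow> v \<in> A"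
  shows "bd (Suc p) c w = (\<Oplus>v\<in>A. c (v # w))"
  unfolding oriented_bd_def
  using assms(2,3) chains_closed[OF assms(1)]
  by (auto intro!: finsum_superset)

lemma bd_eq_support_vertices:
  assumes "c \<in> chains (Suc p) K" "finite A" "\<And>l. c l \<noteq> \<zero> \<Longrightarrow> set l \<subseteq> A"
  shows "bd (Suc p) c w = (\<Oplus>v\<in>A. c (v # w))"
  by (rule bd_eq_finsum[OF assms(1,2)]) (use assms(3) in force)

lemma support_vertices_finite:
  assumes "c \<in> chains p K"
  shows "finite (\<Union>l\<in>{l. c l \<noteq> \<zero>}. set l)"
  using chains_finite[OF assms] by auto

lemma bd_0: "bd 0 c = czero"
  by (simp add: oriented_bd_def)

lemma bd_closed: "c \<in> chains p K \<Longrightarrow> bd p c w \<in> carrier R"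
  by (cases p) (auto simp: oriented_bd_def chains_closed intro!: finsum_closed)

lemma bd_add:
  assumes "c \<in> chains p K" "d \<in> chains p K"
  shows "bd p (cadd c d) = cadd (bd p c) (bd p d)"
proof (cases p)
  case (Suc q)
  define A where "A = (\<Union>l\<in>{l. c l \<noteq> \<zero>}. set l) \<union> (\<Union>l\<in>{l. d l \<noteq> \<zero>}. set l)"
  have A: "finite A" using support_vertices_finite assms unfolding A_def by blast
  have "bd (Suc q) (cadd c d) w = (\<Oplus>v\<in>A. c (v # w) \<oplus> d (v # w))" for w
  proof (rule bd_eq_support_vertices[OF _ A])
    show "cadd c d \<in> chains (Suc q) K" using cadd_chain[OF assms] Suc by simp
    fix l assume "c l \<oplus> d l \<noteq> \<zero>"
    then have "c l \<noteq> \<zero> \<or> d l \<noteq> \<zero>" by auto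
    then show "set l \<subseteq> A" by (auto simp: A_def)
  qed
  moreover have "bd (Suc q) c w = (\<Oplus>v\<in>A. c (v # w))" "bd (Suc q) d w = (\<Oplus>v\<in>A. d (v # w))" for w
    using assms by (auto simp: A_def Suc intro!: bd_eq_support_vertices A[unfolded A_def])
  ultimately show ?thesis unfolding Suc
    using chains_closed[OF assms(1)] chains_closed[OF assms(2)] by (auto simp: finsum_addf)
qed (simp add: bd_0)

lemma bd_scale:
  assumes "k \<in> carrier R" "c \<in> chains p K"
  shows "bd p (cscale k c) = cscale k (bd p c)"
proof (cases p)
  case (Suc q)
  define A where "A = (\<Union>l\<in>{l. c l \<noteq> \<zero>}. set l)"
  have A: "finite A" using support_vertices_finite assms unfolding A_def by blast
  have "bd (Suc q) (cscale k c) w = (\<Oplus>v\<in>A. k \<otimes> c (v # w))" for w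
  proof (rule bd_eq_support_vertices[OF _ A])
    show "cscale k c \<in> chains (Suc q) K" using cscale_chain[OF assms] Suc by simp
    fix l assume "k \<otimes> c l \<noteq> \<zero>"
    then have "c l \<noteq> \<zero>" using assms by auto
    then show "set l \<subseteq> A" by (auto simp: A_def)
  qed
  moreover have "bd (Suc q) c w = (\<Oplus>v\<in>A. c (v # w))" for w
    using assms by (auto simp: A_def Suc intro!: bd_eq_support_vertices A[unfolded A_def])
  ultimately show ?thesis unfolding Suc
    using chains_closed[OF assms(2)] assms(1) A by (auto simp: finsum_rdistr)
qed (simp add: bd_0 assms)

lemma bd_sub:
  assumes "c \<in> chains p K" "d \<in> chains p K"
  shows "bd p (csub c d) = csub (bd p c) (bd p d)"
  unfolding csub_eq_cadd[OF assms]
  using bd_closed[OF assms(1)] bd_closed[OF assms(2)]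
  by (subst bd_add[OF assms(1) cscale_chain]) (simp_all add: assms bd_scale[OF _ assms(2)] minus_eq l_minus)

lemma bd_chain:
  assumes "c \<in> chains (Suc p) K" "downward_closed K"
  shows "bd (Suc p) c \<in> chains p K"
  unfolding chains_iff
proof (intro conjI allI impI)
  define A where "A = (\<Union>l\<in>{l. c l \<noteq> \<zero>}. set l)"
  have A: "finite A" using support_vertices_finite assms unfolding A_def by blast
  have eq: "bd (Suc p) c w = (\<Oplus>v\<in>A. c (v # w))" for w
    using assms by (auto simp: A_def intro!: bd_eq_support_vertices A[unfolded A_def])
  have nz: "\<exists>v. c (v # l) \<noteq> \<zero>" if "bd (Suc p) c l \<noteq> \<zero>" for l
    using that unfolding eq by (metis (no_types, lifting) add.finprod_one_eqI)
  show "finite {l. bd (Suc p) c l \<noteq> \<zero>}"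
  proof (rule finite_subset)
    show "{l. bd (Suc p) c l \<noteq> \<zero>} \<subseteq> tl ` {l. c l \<noteq> \<zero>}" using nz by force
  qed (use chains_finite[OF assms(1)] in simp)
  fix l
  show "bd (Suc p) c l \<in> carrier R" using bd_closed[OF assms(1)] .
  { assume "bd (Suc p) c l \<noteq> \<zero>"
    then obtain v where v: "c (v # l) \<noteq> \<zero>" using nz by blast
    from chains_supp[OF assms(1) this]
    have "length l = Suc p" "distinct l" "insert v (set l) \<in> K" by auto
    moreover from this have "set l \<noteq> {}" by auto
    ultimately show "length l = Suc p" "distinct l" "set l \<in> K"
      using assms(2) unfolding downward_closed_def by blast+ }
  fix i j assume ij: "length l = Suc p \<and> i < j \<and> j \<le> p"
  have "c (v # l[i := l ! j, j := l ! i]) = \<ominus> c (v # l)" for v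
    using chains_swap[OF assms(1), of "v # l" "Suc i" "Suc j"] ij by simp
  then have "bd (Suc p) c (l[i := l ! j, j := l ! i]) = (\<Oplus>v\<in>A. \<ominus> c (v # l))"
    unfolding eq by simp
  also have "\<dots> = (\<Oplus>v\<in>A. (\<ominus> \<one>) \<otimes> c (v # l))"
    using chains_closed[OF assms(1)] by (simp add: l_minus)
  also have "\<dots> = (\<ominus> \<one>) \<otimes> (\<Oplus>v\<in>A. c (v # l))"
    using chains_closed[OF assms(1)] A by (subst finsum_rdistr) auto
  also have "\<dots> = \<ominus> bd (Suc p) c l"
    using chains_closed[OF assms(1)] unfolding eq by (subst l_minus) (auto intro!: finsum_closed)
  finally show "bd (Suc p) c (l[i := l ! j, j := l ! i]) = \<ominus> bd (Suc p) c l" .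
qed

text \<open>The coefficient of \<open>w\<close> sums the values at \<open>u # v # w\<close>, which
  change sign when \<open>u\<close> and \<open>v\<close> are swapped.\<close>

lemma bd_bd:
  assumes "c \<in> chains (Suc p) K" "downward_closed K"
  shows "bd p (bd (Suc p) c) = czero"
proof (cases p)
  case (Suc q)
  define A where "A = (\<Union>l\<in>{l. c l \<noteq> \<zero>}. set l)"
  have A: "finite A" using support_vertices_finite assms unfolding A_def by blast
  have eq: "bd (Suc p) c w = (\<Oplus>v\<in>A. c (v # w))" for w
    using assms by (auto simp: A_def intro!: bd_eq_support_vertices A[unfolded A_def])
  have nz: "set l \<subseteq> A" if "bd (Suc p) c l \<noteq> \<zero>" for l
  proof -
    have "\<exists>v. c (v # l) \<noteq> \<zero>"
      using that unfolding eq by (metis (no_types, lifting) add.finprod_one_eqI)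
    then show ?thesis by (force simp: A_def)
  qed
  have "bd p (bd (Suc p) c) w = (\<Oplus>u\<in>A. \<Oplus>v\<in>A. c (v # u # w))" for w
    unfolding eq[symmetric] Suc
    by (rule bd_eq_support_vertices[OF _ A]) (use bd_chain[OF assms] nz in \<open>simp_all add: Suc\<close>)
  also have "\<dots> w = \<zero>" for w
  proof (rule finsum_antisymmetric[OF A])
    fix x y
    show "c (y # x # w) \<in> carrier R" using chains_closed[OF assms(1)] .
    show "c (x # x # w) = \<zero>" by (rule chains_zero[OF assms(1)]) simp
    show "c (y # x # w) = \<ominus> c (x # y # w)"
    proof (cases "length w = q + 1")
      case True
      then show ?thesis using chains_swap[OF assms(1), of "x # y # w" 0 1] by (simp add: Suc)
    next
      case False
      then have "c (y # x # w) = \<zero>" "c (x # y # w) = \<zero>"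
        by (auto intro!: chains_zero[OF assms(1)] simp: Suc)
      then show ?thesis by simp
    qed
  qed
  finally show ?thesis by blast
qed (simp add: bd_0)

lemma chains_adjacent:
  assumes "c \<in> chains p K"
  shows "c (l1 @ b # a # l2) = \<ominus> c (l1 @ a # b # l2)"
proof (cases "length (l1 @ a # b # l2) = Suc p")
  case True
  have "(l1 @ a # b # l2)[length l1 := (l1 @ a # b # l2) ! Suc (length l1), Suc (length l1) := (l1 @ a # b # l2) ! length l1]
    = l1 @ b # a # l2"
    by (simp add: nth_append list_update_append)
  then show ?thesis
    using chains_swap[OF assms True, of "length l1" "Suc (length l1)"] True by simp
next
  case False
  then have "c (l1 @ b # a # l2) = \<zero>" "c (l1 @ a # b # l2) = \<zero>"
    using chains_zero[OF assms] by auto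
  then show ?thesis by simp
qed

text \<open>A transposition is a product of adjacent ones, so alternation needs checking only there.\<close>

lemma alternating_of_adjacent:
  assumes cl: "\<And>l. c l \<in> carrier R"
    and adj: "\<And>l1 l2 a b. c (l1 @ b # a # l2) = \<ominus> c (l1 @ a # b # l2)"
    and "i < j" "j < length l"
  shows "c (l[i := l ! j, j := l ! i]) = \<ominus> c l"
proof -
  have step: "c (l[i := l ! Suc i, Suc i := l ! i]) = \<ominus> c l" if len: "Suc i < length l" for l i
  proof -
    obtain l1 x y l2 where l: "l = l1 @ x # y # l2" "length l1 = i"
    proof (rule that)
      show "l = take i l @ l ! i # l ! Suc i # drop (Suc (Suc i)) l"
        using len by (simp add: Cons_nth_drop_Suc)
    qed (use len in simp)
    then have "l[i := l ! Suc i, Suc i := l ! i] = l1 @ y # x # l2"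
      by (simp add: nth_append list_update_append flip: l(2))
    then show ?thesis using adj l by metis
  qed
  show ?thesis using assms(3,4)
  proof (induction j arbitrary: l)
    case (Suc j)
    show ?case
    proof (cases "i = j")
      case True
      then show ?thesis using step Suc by simp
    next
      case False
      define l1 where "l1 = l[j := l ! Suc j, Suc j := l ! j]"
      define l2 where "l2 = l1[i := l1 ! j, j := l1 ! i]"
      have "l2[j := l2 ! Suc j, Suc j := l2 ! j] = l[i := l ! Suc j, Suc j := l ! i]"
        using Suc.prems False unfolding l1_def l2_def
        by (intro nth_equalityI) (auto simp: nth_list_update)
      moreover have "c (l2[j := l2 ! Suc j, Suc j := l2 ! j]) = \<ominus> c l2"
        using Suc.prems by (intro step) (simp add: l1_def l2_def)
      moreover have "c l2 = \<ominus> c l1"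
        unfolding l2_def using Suc.prems False by (intro Suc.IH) (auto simp: l1_def)
      moreover have "c l1 = \<ominus> c l" unfolding l1_def using Suc.prems by (intro step) auto
      ultimately show ?thesis using cl by simp
    qed
  qed simp
qed

lemma chainsI:
  fixes c :: "'v list \<Rightarrow> 'a"
  assumes "\<And>l. c l \<in> carrier R"
    and "\<And>l. c l \<noteq> \<zero> \<Longrightarrow> length l = Suc p \<and> distinct l \<and> set l \<in> K"
    and "finite {l. c l \<noteq> \<zero>}"
    and "\<And>l1 l2 a b. c (l1 @ b # a # l2) = \<ominus> c (l1 @ a # b # l2)"
  shows "c \<in> chains p K"
  unfolding chains_iff
proof (intro conjI allI impI assms(1,3))
  fix l :: "'v list" and i j assume "length l = Suc p \<and> i < j \<and> j \<le> p"
  then show "c (l[i := l ! j, j := l ! i]) = \<ominus> c l"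
    by (intro alternating_of_adjacent[where c = c] assms(1,4)) auto
qed (use assms(2) in auto)

section \<open>Cones\<close>

text \<open>If \<open>y\<close> is the \<open>i\<close>-th entry of \<open>l\<close>, counted from
  zero, this is \<open>(-1)^i\<close> times the value at \<open>l\<close> without \<open>y\<close>;
  so the cone of the simplex \<open>w\<close> is the simplex \<open>y # w\<close>.\<close>

primrec cone_sign_rec :: "'v \<Rightarrow> 'v list \<Rightarrow> ('v list \<Rightarrow> 'a) \<Rightarrow> 'a" where
  "cone_sign_rec y [] c = \<zero>"
| "cone_sign_rec y (v # l) c = (if v = y then c l else \<ominus> cone_sign_rec y l (\<lambda>l'. c (v # l')))"

definition cone :: "'v \<Rightarrow> ('v list \<Rightarrow> 'a) \<Rightarrow> 'v list \<Rightarrow> 'a" where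
  "cone y c l = (if distinct l then cone_sign_rec y l c else \<zero>)"

lemma csr_closed: "(\<And>l. c l \<in> carrier R) \<Longrightarrow> cone_sign_rec y l c \<in> carrier R"
  by (induction l arbitrary: c) auto

lemma csr_neg: "(\<And>l. c l \<in> carrier R) \<Longrightarrow> cone_sign_rec y l (\<lambda>l'. \<ominus> c l') = \<ominus> cone_sign_rec y l c"
  by (induction l arbitrary: c) auto

lemma csr_nonzero:
  "cone_sign_rec y l c \<noteq> \<zero> \<Longrightarrow> \<exists>l1 l2. l = l1 @ y # l2 \<and> c (l1 @ l2) \<noteq> \<zero>"
proof (induction l arbitrary: c)
  case (Cons v l)
  show ?case
  proof (cases "v = y")
    case True
    then show ?thesis using Cons.prems by (intro exI[of _ "[]"] exI[of _ l]) auto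
  next
    case False
    with Cons.prems have "cone_sign_rec y l (\<lambda>l'. c (v # l')) \<noteq> \<zero>" by auto
    from Cons.IH[OF this] obtain l1 l2 where "l = l1 @ y # l2" "c (v # l1 @ l2) \<noteq> \<zero>" by auto
    then show ?thesis by (intro exI[of _ "v # l1"] exI[of _ l2]) auto
  qed
qed simp

lemma csr_zero:
  "(\<And>l'. set l - {y} \<subseteq> set l' \<Longrightarrow> c l' = \<zero>) \<Longrightarrow> cone_sign_rec y l c = \<zero>"
proof (induction l arbitrary: c)
  case (Cons v l)
  have "cone_sign_rec y l (\<lambda>l'. c (v # l')) = \<zero>" if "v \<noteq> y"
  proof (rule Cons.IH)
    fix l' assume "set l - {y} \<subseteq> set l'"
    then show "c (v # l') = \<zero>" by (intro Cons.prems) auto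
  qed
  then show ?case using Cons.prems[of l] by auto
qed simp

lemma csr_finsum:
  assumes "finite A" "\<And>v l. v \<in> A \<Longrightarrow> f v l \<in> carrier R"
  shows "cone_sign_rec y l (\<lambda>l'. \<Oplus>v\<in>A. f v l') = (\<Oplus>v\<in>A. cone_sign_rec y l (f v))"
  using assms(2)
proof (induction l arbitrary: f)
  case (Cons u l)
  have neg: "\<ominus> finsum R g A = (\<Oplus>v\<in>A. \<ominus> g v)" if "g \<in> A \<rightarrow> carrier R" for g
    using assms(1) that by (induction A rule: finite_induct) (auto simp: minus_add Pi_iff)
  show ?case
  proof (cases "u = y")
    case False
    have "cone_sign_rec y (u # l) (\<lambda>l'. \<Oplus>v\<in>A. f v l')
        = \<ominus> (\<Oplus>v\<in>A. cone_sign_rec y l (\<lambda>l'. f v (u # l')))"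
      using False Cons.IH[of "\<lambda>v l'. f v (u # l')"] Cons.prems by simp
    also have "\<dots> = (\<Oplus>v\<in>A. cone_sign_rec y (u # l) (f v))"
      using False Cons.prems by (subst neg) (auto intro!: csr_closed)
    finally show ?thesis .
  qed simp
qed simp

lemma csr_adjacent:
  assumes "\<And>l. c l \<in> carrier R" "\<And>l1 l2 a b. c (l1 @ b # a # l2) = \<ominus> c (l1 @ a # b # l2)" "a \<noteq> b"
  shows "cone_sign_rec y (l1 @ b # a # l2) c = \<ominus> cone_sign_rec y (l1 @ a # b # l2) c"
  using assms(1,2)
proof (induction l1 arbitrary: c)
  case Nil
  have sw: "c (b # a # l') = \<ominus> c (a # b # l')" for l'
    using Nil.prems(2)[of "[]" b a l'] by simp
  show ?case
    using assms(3) Nil.prems(1)  by (auto simp: sw csr_neg csr_closed)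
next
  case (Cons x l1)
  have "cone_sign_rec y (l1 @ b # a # l2) (\<lambda>l'. c (x # l'))
      = \<ominus> cone_sign_rec y (l1 @ a # b # l2) (\<lambda>l'. c (x # l'))"
  proof (rule Cons.IH)
    show "c (x # l1 @ b # a # l2) = \<ominus> c (x # l1 @ a # b # l2)" for l1 l2 a b
      using Cons.prems(2)[of "x # l1" b a l2] by simp
  qed (rule Cons.prems(1))
  moreover have "c (l1 @ b # a # l2) = \<ominus> c (l1 @ a # b # l2)" by (rule Cons.prems(2))
  ultimately show ?case by simp
qed

lemma csr_self:
  assumes "\<And>l. c l \<in> carrier R" "\<And>l1 l2 a b. c (l1 @ b # a # l2) = \<ominus> c (l1 @ a # b # l2)"
    "y \<in> set l"
  shows "cone_sign_rec y l (\<lambda>l'. c (y # l')) = c l"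
  using assms
proof (induction l arbitrary: c)
  case (Cons x l)
  show ?case
  proof (cases "x = y")
    case False
    have sw: "c (y # x # l') = \<ominus> c (x # y # l')" for l'
      using Cons.prems(2)[of "[]" y x l'] by simp
    have "cone_sign_rec y l (\<lambda>l'. c (x # y # l')) = c (x # l)"
    proof (rule Cons.IH[of "\<lambda>l'. c (x # l')"])
      show "c (x # l1 @ b # a # l2) = \<ominus> c (x # l1 @ a # b # l2)" for l1 l2 a b
        using Cons.prems(2)[of "x # l1" b a l2] by simp
    qed (use Cons.prems(1,3) False in auto)
    then show ?thesis using False Cons.prems(1) by (simp add: sw csr_neg csr_closed)
  qed simp
qed simp

lemma cone_chain:
  assumes c: "c \<in> chains p K"
    and L: "\<And>l. c l \<noteq> \<zero> \<Longrightarrow> y \<notin> set l \<Longrightarrow> insert y (set l) \<in> L"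
  shows "cone y c \<in> chains (Suc p) L"
proof (rule chainsI)
  have nz: "\<exists>l1 l2. l = l1 @ y # l2 \<and> c (l1 @ l2) \<noteq> \<zero> \<and> distinct l" if "cone y c l \<noteq> \<zero>" for l
    using that csr_nonzero[of y l c] by (auto simp: cone_def split: if_splits)
  fix l
  show "cone y c l \<in> carrier R" using chains_closed[OF c] by (simp add: cone_def csr_closed)
  show "length l = Suc (Suc p) \<and> distinct l \<and> set l \<in> L" if "cone y c l \<noteq> \<zero>"
  proof -
    from nz[OF that] obtain l1 l2 where l: "l = l1 @ y # l2" "c (l1 @ l2) \<noteq> \<zero>" "distinct l" by blast
    then show ?thesis using chains_supp[OF c l(2)] L[OF l(2)] by auto
  qed
  have "{l. cone y c l \<noteq> \<zero>} \<subseteq> (\<Union>m\<in>{l. c l \<noteq> \<zero>}. (\<lambda>i. take i m @ y # drop i m) ` {..length m})"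
  proof
    fix l assume "l \<in> {l. cone y c l \<noteq> \<zero>}"
    with nz[of l] obtain l1 l2 where l: "l = l1 @ y # l2" "c (l1 @ l2) \<noteq> \<zero>" by blast
    then show "l \<in> (\<Union>m\<in>{l. c l \<noteq> \<zero>}. (\<lambda>i. take i m @ y # drop i m) ` {..length m})"
      by (auto intro!: bexI[of _ "l1 @ l2"] image_eqI[of _ _ "length l1"])
  qed
  then show "finite {l. cone y c l \<noteq> \<zero>}"
    by (rule finite_subset) (use chains_finite[OF c] in auto)
next
  fix l1 l2 a b
  show "cone y c (l1 @ b # a # l2) = \<ominus> cone y c (l1 @ a # b # l2)"
  proof (cases "distinct (l1 @ a # b # l2)")
    case True
    have "cone_sign_rec y (l1 @ b # a # l2) c = \<ominus> cone_sign_rec y (l1 @ a # b # l2) c"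
      by (rule csr_adjacent) (use True in \<open>auto intro: chains_closed[OF c] chains_adjacent[OF c]\<close>)
    then show ?thesis using True by (auto simp: cone_def)
  qed (auto simp: cone_def)
qed

text \<open>The cone operator is a contracting homotopy, whether or not \<open>y\<close> already occurs in the chain.\<close>

lemma bd_cone:
  assumes c: "c \<in> chains p K" and p: "0 < p"
    and L: "\<And>l. c l \<noteq> \<zero> \<Longrightarrow> y \<notin> set l \<Longrightarrow> insert y (set l) \<in> L"
  shows "bd (Suc p) (cone y c) = csub c (cone y (bd p c))"
proof
  fix w
  define A where "A = insert y (\<Union>l\<in>{l. c l \<noteq> \<zero>}. set l)"
  have A: "finite A" using support_vertices_finite[OF c] unfolding A_def by blast
  note cl = chains_closed[OF c]
  have csr_cl: "cone_sign_rec y l (\<lambda>l'. c (v # l')) \<in> carrier R" for l v using cl by (rule csr_closed)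
  obtain q where q: "p = Suc q" using p by (cases p) auto
  have bdc: "bd p c w = (\<Oplus>v\<in>A. c (v # w))" for w
    unfolding q by (rule bd_eq_support_vertices[OF c[unfolded q] A]) (auto simp: A_def)
  have bdK: "bd (Suc p) (cone y c) w = (\<Oplus>v\<in>A. cone y c (v # w))"
  proof (rule bd_eq_support_vertices[OF cone_chain[OF c L] A])
    fix l assume "cone y c l \<noteq> \<zero>"
    then obtain l1 l2 where "l = l1 @ y # l2" "c (l1 @ l2) \<noteq> \<zero>"
      using csr_nonzero[of y l c] by (auto simp: cone_def split: if_splits)
    then show "set l \<subseteq> A" by (force simp: A_def)
  qed auto
  show "bd (Suc p) (cone y c) w = c w \<ominus> cone y (bd p c) w"
  proof (cases "distinct w")
    case False
    then have "(\<Oplus>v\<in>A. cone y c (v # w)) = \<zero>"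
      by (intro add.finprod_one_eqI) (simp add: cone_def)
    moreover have "c w = \<zero>" using False chains_zero[OF c] by blast
    ultimately show ?thesis using False bdK by (simp add: cone_def minus_eq)
  next
    case True
    define h where "h v = cone_sign_rec y w (\<lambda>l'. c (v # l'))" for v
    have h_cl: "h \<in> A \<rightarrow> carrier R" by (simp add: h_def csr_cl)
    have cw: "cone y (bd p c) w = finsum R h A"
      unfolding bdc[abs_def] cone_def h_def using True cl by (simp add: csr_finsum[OF A])
    have term_cl: "(\<lambda>v. cone y c (v # w)) \<in> A \<rightarrow> carrier R" using cl by (simp add: cone_def csr_closed)
    have summand: "cone y c (v # w) \<oplus> h v = (if v = y then c w else \<zero>)" if "v \<in> A" for v
    proof (cases "y \<in> set w")
      case y: True
      show ?thesis
      proof (cases "v \<in> set w")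
        case v: True
        have "h v = (if v = y then c w else \<zero>)"
        proof (cases "v = y")
          case True
          have "h y = c w" unfolding h_def
            by (rule csr_self) (auto intro: chains_closed[OF c] chains_adjacent[OF c] y)
          then show ?thesis using True by simp
        next
          case False
          have "h v = \<zero>" unfolding h_def
          proof (rule csr_zero)
            fix l' assume "set w - {y} \<subseteq> set l'"
            then show "c (v # l') = \<zero>" using v False chains_zero[OF c, of "v # l'"] by auto
          qed
          then show ?thesis using False by simp
        qed
        then show ?thesis using v cl by (simp add: cone_def)
      next
        case v: False
        then have "v \<noteq> y" using y by auto
        then show ?thesis using v True h_cl that by (simp add: cone_def h_def l_neg csr_cl)
      qed
    next
      case y: False
      have "cone_sign_rec y w d = \<zero>" for d using csr_nonzero[of y w d] y by force
      then show ?thesis using True y cl by (auto simp: cone_def h_def)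
    qed
    have "(\<Oplus>v\<in>A. cone y c (v # w)) \<oplus> finsum R h A = (\<Oplus>v\<in>A. if v = y then c w else \<zero>)"
      unfolding finsum_addf[OF term_cl h_cl, symmetric]
      by (rule add.finprod_cong') (use summand cl in auto)
    also have "\<dots> = (\<Oplus>v\<in>{y}. if v = y then c w else \<zero>)"
      by (rule finsum_superset[symmetric]) (use A cl in \<open>auto simp: A_def\<close>)
    also have "\<dots> = c w" using cl by simp
    finally have "bd (Suc p) (cone y c) w \<oplus> cone y (bd p c) w = c w" using bdK cw by simp
    moreover have "bd (Suc p) (cone y c) w \<in> carrier R" "cone y (bd p c) w \<in> carrier R"
      using bdK cw term_cl h_cl by (auto intro!: finsum_closed)
    ultimately show ?thesis
      using minus_eq r_neg a_assoc by force
  qed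
qed

section \<open>Subspaces of coordinate spaces and their quotients\<close>

definition subspace_of_functions :: "('s \<Rightarrow> 'a) set \<Rightarrow> bool" where
  "subspace_of_functions S \<longleftrightarrow> czero \<in> S \<and> (\<forall>c\<in>S. \<forall>l. c l \<in> carrier R) \<and>
     (\<forall>c\<in>S. \<forall>d\<in>S. cadd c d \<in> S) \<and> (\<forall>k\<in>carrier R. \<forall>c\<in>S. cscale k c \<in> S)"

lemma subspaceD:
  assumes "subspace_of_functions S"
  shows "czero \<in> S" "c \<in> S \<Longrightarrow> c l \<in> carrier R" "c \<in> S \<Longrightarrow> d \<in> S \<Longrightarrow> cadd c d \<in> S"
    "k \<in> carrier R \<Longrightarrow> c \<in> S \<Longrightarrow> cscale k c \<in> S"
  using assms unfolding subspace_of_functions_def by auto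

lemma subspace_sub:
  assumes "subspace_of_functions S" "c \<in> S" "d \<in> S" shows "csub c d \<in> S"
proof -
  have "csub c d = cadd c (cscale (\<ominus> \<one>) d)"
    using subspaceD(2)[OF assms(1,2)] subspaceD(2)[OF assms(1,3)] by (simp add: minus_eq l_minus)
  then show ?thesis using assms by (simp add: subspaceD)
qed

lemma subspace_cycles: "subspace_of_functions (cycles p (K :: 'v set set))"
proof -
  have "bd p czero = (czero :: 'v list \<Rightarrow> 'a)" by (simp add: oriented_bd_def)
  then show ?thesis
    unfolding subspace_of_functions_def simplicial_cycles_def
    by (auto simp: czero_chain cadd_chain cscale_chain chains_closed bd_add bd_scale)
qed

lemma subspace_bounds: "subspace_of_functions (bounds p K)"
  unfolding subspace_of_functions_def
proof (intro conjI ballI allI)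
  show "czero \<in> bounds p K"
    unfolding simplicial_boundaries_def
    by (intro image_eqI[of _ _ czero]) (auto simp: czero_chain oriented_bd_def)
  fix c l assume "c \<in> bounds p K"
  then show "c l \<in> carrier R" unfolding simplicial_boundaries_def using bd_closed by auto
next
  fix c d assume "c \<in> bounds p K" "d \<in> bounds p K"
  then show "cadd c d \<in> bounds p K" unfolding simplicial_boundaries_def
    using bd_add cadd_chain by (force simp: image_iff)
next
  fix k c assume "k \<in> carrier R" "c \<in> bounds p K"
  then show "cscale k c \<in> bounds p K" unfolding simplicial_boundaries_def
    using bd_scale cscale_chain by (force simp: image_iff)
qed

text \<open>Descending chains of subspaces of a finite-dimensional space become constant. The induction removes
  one coordinate: two nested subspaces agree if the same of their vectors vanish at that coordinate
  and neither consists of such vectors only.\<close>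

lemma chain_of_subspaces_has_least:
  fixes \<C> :: "('s \<Rightarrow> 'a) set set"
  assumes "finite D" "\<C> \<noteq> {}"
    and "\<And>U. U \<in> \<C> \<Longrightarrow> subspace_of_functions U"
    and "\<And>U c l. U \<in> \<C> \<Longrightarrow> c \<in> U \<Longrightarrow> l \<notin> D \<Longrightarrow> c l = \<zero>"
    and "\<And>U V. U \<in> \<C> \<Longrightarrow> V \<in> \<C> \<Longrightarrow> U \<subseteq> V \<or> V \<subseteq> U"
  shows "\<exists>U\<in>\<C>. \<forall>V\<in>\<C>. U \<subseteq> V"
  using assms
proof (induction D arbitrary: \<C> rule: finite_induct)
  case empty
  then have "U = {czero}" if "U \<in> \<C>" for U
    using that subspaceD(1)[of U] by fastforce
  then show ?case using empty.prems(1) by blast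
next
  case (insert i D)
  show ?case
  proof (cases "\<exists>C\<in>\<C>. \<forall>c\<in>C. c i = \<zero>")
    case True
    define \<C>' where "\<C>' = {C \<in> \<C>. \<forall>c\<in>C. c i = \<zero>}"
    have "\<exists>U\<in>\<C>'. \<forall>V\<in>\<C>'. U \<subseteq> V"
    proof (rule insert.IH)
      show "\<C>' \<noteq> {}" using True by (auto simp: \<C>'_def)
      show "c l = \<zero>" if "U \<in> \<C>'" "c \<in> U" "l \<notin> D" for U c l
        using that insert.prems(3)[of U c l] by (auto simp: \<C>'_def)
    qed (use insert.prems in \<open>auto simp: \<C>'_def\<close>)
    then obtain U where U: "U \<in> \<C>'" "\<And>V. V \<in> \<C>' \<Longrightarrow> U \<subseteq> V" by blast
    have "U \<subseteq> V" if "V \<in> \<C>" for V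
      using that U insert.prems(4)[of U V] by (auto simp: \<C>'_def)
    then show ?thesis using U by (auto simp: \<C>'_def)
  next
    case False
    \<comment> \<open>Every subspace attains a nonzero value at \<open>i\<close>, so it is determined within the chain by its
      vectors that vanish at \<open>i\<close>.\<close>
    define ker where "ker C = {c \<in> C. c i = \<zero>}" for C :: "('s \<Rightarrow> 'a) set"
    have "\<exists>U\<in>ker ` \<C>. \<forall>V\<in>ker ` \<C>. U \<subseteq> V"
    proof (rule insert.IH)
      show "ker ` \<C> \<noteq> {}" using insert.prems by auto
      show "subspace_of_functions U" if "U \<in> ker ` \<C>" for U
        using that insert.prems(2) unfolding subspace_of_functions_def ker_def by auto
      show "c l = \<zero>" if "U \<in> ker ` \<C>" "c \<in> U" "l \<notin> D" for U c l
        using that insert.prems(3)[of _ c l] by (auto simp: ker_def)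
      show "U \<subseteq> V \<or> V \<subseteq> U" if "U \<in> ker ` \<C>" "V \<in> ker ` \<C>" for U V
        using that insert.prems(4) by (force simp: ker_def)
    qed
    then obtain U where U: "U \<in> \<C>" "\<And>V. V \<in> \<C> \<Longrightarrow> ker U \<subseteq> ker V" by auto
    have "U \<subseteq> V" if V: "V \<in> \<C>" for V
    proof (rule ccontr)
      assume "\<not> U \<subseteq> V"
      then have VU: "V \<subseteq> U" using insert.prems(4)[OF U(1) V] by blast
      have sU: "subspace_of_functions U" and sV: "subspace_of_functions V"
        using insert.prems(2) U(1) V by auto
      obtain v where v: "v \<in> V" "v i \<noteq> \<zero>" using False V by blast
      have "u \<in> V" if u: "u \<in> U" for u
      proof -
        define k where "k = u i \<otimes> inv (v i)"
        have vi: "v i \<in> Units R" using v subspaceD(2)[OF sV] by (simp add: field_Units)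
        have k: "k \<in> carrier R" using vi subspaceD(2)[OF sU u] by (simp add: k_def)
        have "k \<otimes> v i = u i" unfolding k_def
          using vi subspaceD(2)[OF sU u] by (simp add: m_assoc Units_closed)
        moreover have "csub u (cscale k v) \<in> U"
          using sU u v VU k by (intro subspace_sub subspaceD(4)) auto
        ultimately have "csub u (cscale k v) \<in> ker U"
          using subspaceD(2)[OF sU u] by (simp add: ker_def r_neg minus_eq)
        then have "csub u (cscale k v) \<in> V" using U(2)[OF V] by (auto simp: ker_def)
        then have "cadd (csub u (cscale k v)) (cscale k v) \<in> V"
          using sV v k by (intro subspaceD(3) subspaceD(4)) auto
        moreover have "cadd (csub u (cscale k v)) (cscale k v) = u"
          using subspaceD(2)[OF sU u] subspaceD(2)[OF sV v(1)] k
          by (auto simp: minus_eq a_assoc l_neg)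
        ultimately show ?thesis by simp
      qed
      then show False using \<open>\<not> U \<subseteq> V\<close> by blast
    qed
    then show ?thesis using U(1) by blast
  qed
qed

text \<open>A subspace maximal among those that avoid a vector is a complement of its line.\<close>

lemma exists_complement_of_line:
  assumes S: "subspace_of_functions S" and z: "z \<notin> S" "\<And>l. z l \<in> carrier R"
  obtains M where "subspace_of_functions M" "S \<subseteq> M" "z \<notin> M"
    "\<And>u. (\<And>l. u l \<in> carrier R) \<Longrightarrow> \<exists>k\<in>carrier R. csub u (cscale k z) \<in> M"
proof -
  define \<A> where "\<A> = {M. subspace_of_functions M \<and> S \<subseteq> M \<and> z \<notin> M}"
  have "\<exists>M\<in>\<A>. \<forall>X\<in>\<A>. M \<subseteq> X \<longrightarrow> X = M"
  proof (rule subset_Zorn_nonempty)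
    show "\<A> \<noteq> {}" using S z by (auto simp: \<A>_def)
    fix \<C> assume C: "\<C> \<noteq> {}" "subset.chain \<A> \<C>"
    then have sub: "\<And>M. M \<in> \<C> \<Longrightarrow> subspace_of_functions M \<and> S \<subseteq> M \<and> z \<notin> M"
      and tot: "\<And>M N. M \<in> \<C> \<Longrightarrow> N \<in> \<C> \<Longrightarrow> M \<subseteq> N \<or> N \<subseteq> M"
      unfolding subset.chain_def \<A>_def by auto
    have "subspace_of_functions (\<Union>\<C>)"
      unfolding subspace_of_functions_def
    proof (intro conjI ballI allI)
      obtain M0 where "M0 \<in> \<C>" using C(1) by blast
      then show "czero \<in> \<Union>\<C>" using sub[of M0] subspaceD(1)[of M0] by blast
      show "c l \<in> carrier R" if "c \<in> \<Union>\<C>" for c l using that sub subspaceD(2)[of _ c l] by blast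
      show "cadd c d \<in> \<Union>\<C>" if cd: "c \<in> \<Union>\<C>" "d \<in> \<Union>\<C>" for c d
      proof -
        obtain M N where "M \<in> \<C>" "N \<in> \<C>" "c \<in> M" "d \<in> N" using cd by blast
        then obtain Q where "Q \<in> \<C>" "c \<in> Q" "d \<in> Q" using tot by blast
        then show ?thesis using sub[of Q] subspaceD(3)[of Q c d] by blast
      qed
      show "cscale k c \<in> \<Union>\<C>" if "k \<in> carrier R" "c \<in> \<Union>\<C>" for k c
        using that sub subspaceD(4)[of _ k c] by blast
    qed
    then show "\<Union>\<C> \<in> \<A>" using C(1) sub by (auto simp: \<A>_def)
  qed
  then obtain M where M: "M \<in> \<A>" and max: "\<And>X. X \<in> \<A> \<Longrightarrow> M \<subseteq> X \<Longrightarrow> X = M" by blast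
  have sM: "subspace_of_functions M" "S \<subseteq> M" "z \<notin> M" using M by (auto simp: \<A>_def)
  have "\<exists>k\<in>carrier R. csub u (cscale k z) \<in> M" if u: "\<And>l. u l \<in> carrier R" for u
  proof (cases "u \<in> M")
    case True
    moreover have "csub u (cscale \<zero> z) = u" using u z(2) by (simp add: minus_eq)
    ultimately show ?thesis by (metis zero_closed)
  next
    case False
    define X where "X = {cadd m (cscale k u) | m k. m \<in> M \<and> k \<in> carrier R}"
    have XI: "cadd m (cscale k u) \<in> X" if "m \<in> M" "k \<in> carrier R" for m k
      unfolding X_def using that by blast
    have XE: "\<exists>m k. m \<in> M \<and> k \<in> carrier R \<and> c = cadd m (cscale k u)" if "c \<in> X" for c
      using that unfolding X_def by blast
    note cM = subspaceD(2)[OF sM(1)]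
    have "subspace_of_functions X"
      unfolding subspace_of_functions_def
    proof (intro conjI ballI allI)
      show "czero \<in> X" using XI[OF subspaceD(1)[OF sM(1)], of \<zero>] u by simp
      show "c l \<in> carrier R" if "c \<in> X" for c l
        using XE[OF that] u cM by auto
      show "cadd c d \<in> X" if cd: "c \<in> X" "d \<in> X" for c d
      proof -
        obtain m k where m: "m \<in> M" "k \<in> carrier R" "c = cadd m (cscale k u)" using XE[OF cd(1)] by blast
        obtain n j where n: "n \<in> M" "j \<in> carrier R" "d = cadd n (cscale j u)" using XE[OF cd(2)] by blast
        have "cadd c d = cadd (cadd m n) (cscale (k \<oplus> j) u)"
          unfolding m n using u m n cM by (simp add: l_distr a_ac)
        then show ?thesis using XI[of "cadd m n" "k \<oplus> j"] m n subspaceD(3)[OF sM(1)] by simp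
      qed
      show "cscale k c \<in> X" if k: "k \<in> carrier R" and c: "c \<in> X" for k c
      proof -
        obtain m j where m: "m \<in> M" "j \<in> carrier R" "c = cadd m (cscale j u)" using XE[OF c] by blast
        have "cscale k c = cadd (cscale k m) (cscale (k \<otimes> j) u)"
          unfolding m using u m cM k by (simp add: r_distr m_assoc)
        then show ?thesis using XI[of "cscale k m" "k \<otimes> j"] m k subspaceD(4)[OF sM(1)] by simp
      qed
    qed
    moreover have MX: "M \<subseteq> X"
    proof
      fix m assume m: "m \<in> M"
      then have "cadd m (cscale \<zero> u) = m" using u cM by simp
      then show "m \<in> X" using XI[OF m zero_closed] by simp
    qed
    moreover have "u \<in> X"
      using XI[OF subspaceD(1)[OF sM(1)] one_closed] u by simp
    ultimately have "z \<in> X" using max[of X] False sM by (auto simp: \<A>_def)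
    then obtain m k where mk: "m \<in> M" "k \<in> carrier R" "z = cadd m (cscale k u)" using XE by blast
    have m: "m l \<in> carrier R" for l using subspaceD(2)[OF sM(1) mk(1)] .
    have "k \<noteq> \<zero>"
    proof
      assume "k = \<zero>"
      then have "z = m" using mk(3) u m by simp
      then show False using sM(3) mk(1) by simp
    qed
    then have k: "k \<in> Units R" using mk(2) by (simp add: field_Units)
    have ik: "inv k \<in> carrier R" using k by simp
    have "csub u (cscale (inv k) z) = cscale (\<ominus> (inv k)) m"
    proof
      fix l
      have "inv k \<otimes> (m l \<oplus> k \<otimes> u l) = inv k \<otimes> m l \<oplus> u l"
        using k ik m[of l] u[of l] mk(2) by (simp add: r_distr m_assoc[symmetric])
      then show "u l \<ominus> inv k \<otimes> z l = (\<ominus> (inv k)) \<otimes> m l"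
        using mk(2) k ik m[of l] u[of l] unfolding mk(3)
        by (simp add: minus_eq minus_add l_minus a_comm[of "\<ominus> (inv k \<otimes> m l)"] r_neg1 a_assoc[symmetric] r_neg)
    qed
    then have "csub u (cscale (inv k) z) \<in> M"
      using subspaceD(4)[OF sM(1) a_inv_closed[OF ik] mk(1)] by simp
    then show ?thesis using ik by blast
  qed
  then show thesis by (rule that[OF sM])
qed

section \<open>Quotients of spaces of functions\<close>

definition coset :: "('s \<Rightarrow> 'a) set \<Rightarrow> ('s \<Rightarrow> 'a) \<Rightarrow> ('s \<Rightarrow> 'a) set" where
  "coset N c = (\<lambda>d. cadd d c) ` N"

lemma cosetE:
  assumes "x \<in> coset N c" obtains n where "n \<in> N" "x = cadd n c"
  using assms unfolding coset_def by (rule imageE) (rule that)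

lemma cosetI: "n \<in> N \<Longrightarrow> x = cadd n c \<Longrightarrow> x \<in> coset N c"
  unfolding coset_def by (rule image_eqI)

lemma a_r_coset_functions:
  assumes "add M = cadd" shows "N +>\<^bsub>M\<^esub> c = coset N c"
  unfolding a_r_coset_def' coset_def assms by auto

lemma coset_eq_iff:
  assumes N: "subspace_of_functions N" and c: "\<And>l. c l \<in> carrier R" and d: "\<And>l. d l \<in> carrier R"
  shows "coset N c = coset N d \<longleftrightarrow> csub c d \<in> N"
proof
  assume eq: "coset N c = coset N d"
  have "c \<in> coset N c"
    by (rule cosetI[OF subspaceD(1)[OF N]]) (use c in simp)
  then obtain n where n: "n \<in> N" "c = cadd n d" unfolding eq by (rule cosetE)
  have "csub c d = n" unfolding n(2) using subspaceD(2)[OF N n(1)] d by (simp add: minus_eq a_assoc r_neg)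
  then show "csub c d \<in> N" using n by simp
next
  assume cd: "csub c d \<in> N"
  then have dc: "cscale (\<ominus> \<one>) (csub c d) \<in> N" by (intro subspaceD(4)[OF N]) auto
  show "coset N c = coset N d"
  proof (intro equalityI subsetI)
    fix x assume "x \<in> coset N c"
    then obtain n where n: "n \<in> N" "x = cadd n c" by (rule cosetE)
    have "x = cadd (cadd n (csub c d)) d"
      unfolding n(2) using subspaceD(2)[OF N n(1)] c d by (simp add: minus_eq a_assoc l_neg)
    then show "x \<in> coset N d" by (rule cosetI[OF subspaceD(3)[OF N n(1) cd]])
  next
    fix x assume "x \<in> coset N d"
    then obtain n where n: "n \<in> N" "x = cadd n d" by (rule cosetE)
    have "n l \<oplus> d l = n l \<oplus> (\<ominus> \<one>) \<otimes> (c l \<ominus> d l) \<oplus> c l" for l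
    proof -
      have "(\<ominus> \<one>) \<otimes> (c l \<ominus> d l) \<oplus> c l = d l"
        using c[of l] d[of l] by (simp add: l_minus minus_eq minus_add a_comm[of "\<ominus> c l"] a_assoc l_neg)
      then show ?thesis using subspaceD(2)[OF N n(1)] c[of l] d[of l] by (simp add: a_assoc)
    qed
    then have "x = cadd (cadd n (cscale (\<ominus> \<one>) (csub c d))) c" unfolding n(2) by simp
    then show "x \<in> coset N c" by (rule cosetI[OF subspaceD(3)[OF N n(1) dc]])
  qed
qed

lemma coset_cadd:
  assumes N: "subspace_of_functions N" and c: "\<And>l. c l \<in> carrier R" and n: "n \<in> N"
  shows "coset N (cadd n c) = coset N c"
proof -
  have nc: "n l \<in> carrier R" for l using subspaceD(2)[OF N n] .
  have eq: "csub (cadd n c) c = n" using nc c by (simp add: minus_eq a_assoc r_neg)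
  show ?thesis
    by (subst coset_eq_iff[OF N]) (use nc c in \<open>simp_all only: eq n a_closed\<close>)
qed

lemma coset_zero:
  assumes "subspace_of_functions N" shows "coset N czero = N"
proof -
  have "cadd n czero = n" if "n \<in> N" for n using subspaceD(2)[OF assms that] by simp
  then show ?thesis unfolding coset_def by (simp cong: image_cong)
qed

end

locale function_quotient = field R for R :: "('a, 'b) ring_scheme" (structure) +
  fixes M :: "('a, 's \<Rightarrow> 'a) module" and N :: "('s \<Rightarrow> 'a) set"
  assumes Madd: "add M = cadd" and Msmult: "module.smult M = cscale"
    and Z: "subspace_of_functions (carrier M)" and N: "subspace_of_functions N"
begin

abbreviation "Q \<equiv> quotient_module M N"

lemma carrier_Q: "carrier Q = coset N ` carrier M"
  unfolding quotient_module_def by (auto simp: A_RCOSETS_def' a_r_coset_functions[OF Madd])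

lemma zero_Q: "\<zero>\<^bsub>Q\<^esub> = N" "\<zero>\<^bsub>Q\<^esub> = coset N czero"
  unfolding coset_zero[OF N] by (simp_all add: quotient_module_def)

lemma add_Q:
  assumes "\<And>l. c l \<in> carrier R" "\<And>l. d l \<in> carrier R"
  shows "coset N c \<oplus>\<^bsub>Q\<^esub> coset N d = coset N (cadd c d)"
proof -
  have cn: "n l \<in> carrier R" if "n \<in> N" for n l using subspaceD(2)[OF N that] .
  have "coset N c \<oplus>\<^bsub>Q\<^esub> coset N d = (\<Union>h\<in>coset N c. \<Union>k\<in>coset N d. {cadd h k})"
    by (simp add: quotient_module_def set_add_def' Madd)
  also have "\<dots> = coset N (cadd c d)"
  proof (intro equalityI subsetI)
    fix x assume "x \<in> (\<Union>h\<in>coset N c. \<Union>k\<in>coset N d. {cadd h k})"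
    then obtain h k where hk: "h \<in> coset N c" "k \<in> coset N d" "x = cadd h k" by blast
    obtain m where m: "m \<in> N" "h = cadd m c" using hk(1) by (rule cosetE)
    obtain n where n: "n \<in> N" "k = cadd n d" using hk(2) by (rule cosetE)
    show "x \<in> coset N (cadd c d)"
      by (rule cosetI[OF subspaceD(3)[OF N m(1) n(1)]])
        (use assms cn[OF m(1)] cn[OF n(1)] in \<open>simp add: hk(3) m(2) n(2) a_ac\<close>)
  next
    fix x assume "x \<in> coset N (cadd c d)"
    then obtain m where m: "m \<in> N" "x = cadd m (cadd c d)" by (rule cosetE)
    have "x = cadd (cadd m c) d"
      using assms cn[OF m(1)] by (simp add: m(2) a_ac)
    moreover have "cadd m c \<in> coset N c" by (rule cosetI[OF m(1) refl])
    moreover have "d \<in> coset N d" by (rule cosetI[OF subspaceD(1)[OF N]]) (use assms in simp)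
    ultimately show "x \<in> (\<Union>h\<in>coset N c. \<Union>k\<in>coset N d. {cadd h k})" by blast
  qed
  finally show ?thesis .
qed

lemma smult_Q:
  assumes k: "k \<in> carrier R" and c: "\<And>l. c l \<in> carrier R"
  shows "k \<odot>\<^bsub>Q\<^esub> coset N c = coset N (cscale k c)"
proof -
  have *: "coset N (cscale k (cadd n c)) = coset N (cscale k c)" if n: "n \<in> N" for n
  proof -
    have "cscale k (cadd n c) = cadd (cscale k n) (cscale k c)"
      using k c subspaceD(2)[OF N n] by (simp add: r_distr)
    then show ?thesis using coset_cadd[OF N _ subspaceD(4)[OF N k n], of "cscale k c"] k c by simp
  qed
  have "k \<odot>\<^bsub>Q\<^esub> coset N c = (\<Union>x\<in>coset N c. coset N (cscale k x))"
    by (simp add: quotient_module_def Msmult a_r_coset_functions[OF Madd])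
  also have "\<dots> = (\<Union>n\<in>N. coset N (cscale k (cadd n c)))" unfolding coset_def[of N c] by simp
  also have "\<dots> = (\<Union>n\<in>N. coset N (cscale k c))" by (rule SUP_cong[OF refl *])
  also have "\<dots> = coset N (cscale k c)" using subspaceD(1)[OF N] by auto
  finally show ?thesis .
qed

lemma carrier_M: "c \<in> carrier M \<Longrightarrow> c l \<in> carrier R"
  by (rule subspaceD(2)[OF Z])

lemma module_Q: "module R Q"
proof (rule moduleI)
  show "cring R" by (rule is_cring)
  show "abelian_group Q"
  proof (rule abelian_groupI)
    fix x y z assume "x \<in> carrier Q" "y \<in> carrier Q" "z \<in> carrier Q"
    then obtain c d e where *: "c \<in> carrier M" "x = coset N c" "d \<in> carrier M" "y = coset N d"
        "e \<in> carrier M" "z = coset N e" unfolding carrier_Q by blast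
    note cl = carrier_M[OF *(1)] carrier_M[OF *(3)] carrier_M[OF *(5)]
    show "(x \<oplus>\<^bsub>Q\<^esub> y) \<oplus>\<^bsub>Q\<^esub> z = x \<oplus>\<^bsub>Q\<^esub> (y \<oplus>\<^bsub>Q\<^esub> z)"
      using * cl by (simp add: add_Q a_assoc)
  next
    fix x y assume "x \<in> carrier Q" "y \<in> carrier Q"
    then obtain c d where *: "c \<in> carrier M" "x = coset N c" "d \<in> carrier M" "y = coset N d"
        unfolding carrier_Q by blast
    note cl = carrier_M[OF *(1)] carrier_M[OF *(3)]
    show "x \<oplus>\<^bsub>Q\<^esub> y = y \<oplus>\<^bsub>Q\<^esub> x"
      using * cl by (simp add: add_Q a_comm)
    show "x \<oplus>\<^bsub>Q\<^esub> y \<in> carrier Q"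
      using * cl subspaceD(3)[OF Z] by (simp add: add_Q carrier_Q)
  next
    show "\<zero>\<^bsub>Q\<^esub> \<in> carrier Q" unfolding carrier_Q zero_Q(2) using subspaceD(1)[OF Z] by blast
  next
    fix x assume "x \<in> carrier Q"
    then obtain c where *: "c \<in> carrier M" "x = coset N c" unfolding carrier_Q by blast
    note cl = carrier_M[OF *(1)]
    show "\<zero>\<^bsub>Q\<^esub> \<oplus>\<^bsub>Q\<^esub> x = x"
      unfolding zero_Q(2) using * cl by (simp add: add_Q)
    show "\<exists>y\<in>carrier Q. y \<oplus>\<^bsub>Q\<^esub> x = \<zero>\<^bsub>Q\<^esub>"
    proof (rule bexI)
      show "coset N (cscale (\<ominus> \<one>) c) \<oplus>\<^bsub>Q\<^esub> x = \<zero>\<^bsub>Q\<^esub>"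
        unfolding zero_Q(2) using * cl by (simp add: add_Q l_minus l_neg)
      show "coset N (cscale (\<ominus> \<one>) c) \<in> carrier Q"
        unfolding carrier_Q by (intro imageI subspaceD(4)[OF Z]) (auto simp: *)
    qed
  qed
next
  fix a b x assume ab: "a \<in> carrier R" "b \<in> carrier R" and "x \<in> carrier Q"
  then obtain c where *: "c \<in> carrier M" "x = coset N c" unfolding carrier_Q by blast
  note cl = carrier_M[OF *(1)]
  show "(a \<oplus> b) \<odot>\<^bsub>Q\<^esub> x = a \<odot>\<^bsub>Q\<^esub> x \<oplus>\<^bsub>Q\<^esub> b \<odot>\<^bsub>Q\<^esub> x"
    using * cl ab by (simp add: add_Q smult_Q l_distr)
  show "(a \<otimes> b) \<odot>\<^bsub>Q\<^esub> x = a \<odot>\<^bsub>Q\<^esub> (b \<odot>\<^bsub>Q\<^esub> x)"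
    using * cl ab by (simp add: smult_Q m_assoc)
next
  fix a x assume a: "a \<in> carrier R" and "x \<in> carrier Q"
  then obtain c where *: "c \<in> carrier M" "x = coset N c" unfolding carrier_Q by blast
  note cl = carrier_M[OF *(1)]
  show "a \<odot>\<^bsub>Q\<^esub> x \<in> carrier Q"
    using * cl a subspaceD(4)[OF Z a] by (simp add: smult_Q carrier_Q)
next
  fix a x y assume a: "a \<in> carrier R" and "x \<in> carrier Q" "y \<in> carrier Q"
  then obtain c d where *: "c \<in> carrier M" "x = coset N c" "d \<in> carrier M" "y = coset N d"
    unfolding carrier_Q by blast
  note cl = carrier_M[OF *(1)] carrier_M[OF *(3)]
  show "a \<odot>\<^bsub>Q\<^esub> (x \<oplus>\<^bsub>Q\<^esub> y) = a \<odot>\<^bsub>Q\<^esub> x \<oplus>\<^bsub>Q\<^esub> a \<odot>\<^bsub>Q\<^esub> y"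
    using * cl a by (simp add: add_Q smult_Q r_distr)
next
  fix x assume "x \<in> carrier Q"
  then obtain c where *: "c \<in> carrier M" "x = coset N c" unfolding carrier_Q by blast
  then show "\<one> \<odot>\<^bsub>Q\<^esub> x = x" using carrier_M[OF *(1)] by (simp add: smult_Q)
qed

lemma subspace_gives_submodule:
  assumes "subspace_of_functions S" "S \<subseteq> carrier M"
  shows "submodule (coset N ` S) R Q"
proof (rule module.submoduleI[OF module_Q])
  note cl = subspaceD(2)[OF assms(1)]
  show "coset N ` S \<subseteq> carrier Q" unfolding carrier_Q using assms(2) by blast
  show "\<zero>\<^bsub>Q\<^esub> \<in> coset N ` S" unfolding zero_Q(2) using subspaceD(1)[OF assms(1)] by blast
  show sm: "a \<odot>\<^bsub>Q\<^esub> x \<in> coset N ` S" if "a \<in> carrier R" "x \<in> coset N ` S" for a x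
    using that cl subspaceD(4)[OF assms(1)] by (auto simp: smult_Q)
  show "x \<oplus>\<^bsub>Q\<^esub> y \<in> coset N ` S" if "x \<in> coset N ` S" "y \<in> coset N ` S" for x y
    using that cl subspaceD(3)[OF assms(1)] by (auto simp: add_Q)
  show "\<ominus>\<^bsub>Q\<^esub> x \<in> coset N ` S" if x: "x \<in> coset N ` S" for x
  proof -
    interpret Q: module R Q by (rule module_Q)
    have "x \<in> carrier Q" using x assms(2) unfolding carrier_Q by blast
    then have "\<ominus>\<^bsub>Q\<^esub> x = (\<ominus> \<one>) \<odot>\<^bsub>Q\<^esub> x" by (simp add: Q.smult_l_minus)
    then show ?thesis using sm[OF _ x] by simp
  qed
qed

end

section \<open>Moving the vertices of a cycle\<close>

context field
begin

text \<open>Coning the part of the cycle around \<open>x\<close> off from \<open>y\<close> replaces \<open>x\<close> by \<open>y\<close>.\<close>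

lemma move_vertex:
  fixes c :: "'v list \<Rightarrow> 'a"
  assumes L: "downward_closed L" and c: "c \<in> cycles p L" and p: "0 < p" and xy: "x \<noteq> y"
    and star: "\<And>l. c l \<noteq> \<zero> \<Longrightarrow> x \<in> set l \<Longrightarrow> insert y (set l) \<in> L"
  obtains c' where "c' \<in> cycles p L" "csub c c' \<in> bounds p L"
    "\<And>l. c' l \<noteq> \<zero> \<Longrightarrow> (c l \<noteq> \<zero> \<and> x \<notin> set l) \<or>
       (\<exists>l0. c l0 \<noteq> \<zero> \<and> x \<in> set l0 \<and> set l \<subseteq> insert y (set l0 - {x}))"
proof -
  have cc: "c \<in> chains p L" and cz: "bd p c = czero" using c by (auto simp: simplicial_cycles_def)
  note cl = chains_closed[OF cc]
  obtain q where q: "p = Suc q" using p by (cases p) auto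
  \<comment> \<open>\<open>cx\<close> is the star of \<open>x\<close> in the cycle; its boundary is the link of \<open>x\<close>, because the cycle is closed.\<close>
  define cx where "cx l = (if x \<in> set l then c l else \<zero>)" for l
  define co where "co = csub c cx"
  have cxc: "cx \<in> chains p L"
  proof (rule chainsI)
    show "finite {l. cx l \<noteq> \<zero>}"
      by (rule finite_subset[OF _ chains_finite[OF cc]]) (auto simp: cx_def)
    fix l1 l2 a b
    show "cx (l1 @ b # a # l2) = \<ominus> cx (l1 @ a # b # l2)"
      unfolding cx_def using chains_adjacent[OF cc, of l1 b a l2] by auto
  qed (use cl chains_supp[OF cc] in \<open>auto simp: cx_def split: if_splits\<close>)
  have coc: "co \<in> chains p L" unfolding co_def by (rule csub_chain[OF cc cxc])
  have co: "co l = (if x \<in> set l then \<zero> else c l)" for l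
    using cl by (auto simp: co_def cx_def minus_eq r_neg)
  have bdco: "bd p co w = \<ominus> bd p cx w" for w
    unfolding co_def bd_sub[OF cc cxc] cz using bd_closed[OF cxc] by (simp add: minus_eq)
  define P where "P = cone y cx"
  have star': "insert y (set l) \<in> L" if "cx l \<noteq> \<zero>" for l
    using that star by (auto simp: cx_def split: if_splits)
  have Pc: "P \<in> chains (Suc p) L" unfolding P_def by (rule cone_chain[OF cxc star'])
  have bdP: "bd (Suc p) P = csub cx (cone y (bd p cx))"
    unfolding P_def by (rule bd_cone[OF cxc p star'])
  define c' where "c' = csub c (bd (Suc p) P)"
  have bdPc: "bd (Suc p) P \<in> chains p L" by (rule bd_chain[OF Pc L])
  have cone_cl: "cone y (bd p cx) l \<in> carrier R" for l
    unfolding cone_def using bd_closed[OF cxc] by (auto intro: csr_closed)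
  have c'_eq: "c' l = co l \<oplus> cone y (bd p cx) l" for l
    unfolding c'_def bdP co_def using cl chains_closed[OF cxc] cone_cl
    by (simp add: minus_eq minus_add a_assoc)
  have "c' \<in> cycles p L"
    unfolding simplicial_cycles_def c'_def
    using csub_chain[OF cc bdPc] bd_sub[OF cc bdPc] cz bd_bd[OF Pc L] by (simp add: minus_eq)
  moreover have "csub c c' = bd (Suc p) P"
    unfolding c'_def using cl chains_closed[OF bdPc] by (simp add: minus_eq minus_add a_assoc[symmetric] r_neg)
  then have "csub c c' \<in> bounds p L" unfolding simplicial_boundaries_def using Pc by blast
  moreover have "(c l \<noteq> \<zero> \<and> x \<notin> set l) \<or>
       (\<exists>l0. c l0 \<noteq> \<zero> \<and> x \<in> set l0 \<and> set l \<subseteq> insert y (set l0 - {x}))" if "c' l \<noteq> \<zero>" for l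
  proof (cases "co l = \<zero>")
    case False
    then show ?thesis by (auto simp: co split: if_splits)
  next
    case True
    then have "cone y (bd p cx) l \<noteq> \<zero>" using that c'_eq cone_cl by auto
    then obtain l1 l2 where l: "l = l1 @ y # l2" "bd p cx (l1 @ l2) \<noteq> \<zero>"
      using csr_nonzero[of y l "bd p cx"] by (auto simp: cone_def split: if_splits)
    have nz: "\<exists>v. d (v # w) \<noteq> \<zero>" if "bd p d w \<noteq> \<zero>" for d :: "'v list \<Rightarrow> 'a" and w
      using that unfolding q oriented_bd_def by (auto, metis (no_types, lifting) add.finprod_one_eqI)
    obtain u where u: "cx (u # l1 @ l2) \<noteq> \<zero>" using nz[OF l(2)] by blast
    have "bd p co (l1 @ l2) \<noteq> \<zero>" unfolding bdco using l(2) bd_closed[OF cxc] by simp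
    then obtain v where "co (v # l1 @ l2) \<noteq> \<zero>" using nz by blast
    then have "x \<notin> set (l1 @ l2)" by (auto simp: co split: if_splits)
    moreover have "x \<in> set (u # l1 @ l2)" "c (u # l1 @ l2) \<noteq> \<zero>" using u by (auto simp: cx_def split: if_splits)
    ultimately show ?thesis using l(1) by (intro disjI2 exI[of _ "u # l1 @ l2"]) auto
  qed
  ultimately show thesis using that by blast
qed

text \<open>The vertices that \<open>\<phi>\<close> does not fix are moved one at a time. At each
  stage the simplices stay inside some \<open>\<sigma> \<union> \<phi> ` \<sigma>\<close>, where
  \<open>\<sigma>\<close> is a simplex of the original cycle.\<close>

lemma move_vertices:
  assumes L: "downward_closed L" and KL: "K \<subseteq> L" and c: "c \<in> cycles p K" and p: "0 < p"
    and \<phi>: "\<And>v. \<phi> (\<phi> v) = \<phi> v" and big: "\<And>\<sigma>. \<sigma> \<in> K \<Longrightarrow> \<sigma> \<union> \<phi> ` \<sigma> \<in> L"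
  obtains c' where "c' \<in> cycles p L" "csub c c' \<in> bounds p L" "\<And>l. c' l \<noteq> \<zero> \<Longrightarrow> set l \<subseteq> range \<phi>"
proof -
  have cc: "c \<in> chains p K" and cz: "bd p c = czero" using c by (auto simp: simplicial_cycles_def)
  note sB = subspace_bounds[of p L]
  have *: "\<exists>c'. c' \<in> cycles p L \<and> csub c c' \<in> bounds p L \<and>
      (\<forall>l. c' l \<noteq> \<zero> \<longrightarrow> (\<exists>l0. c l0 \<noteq> \<zero> \<and> set l \<subseteq> (set l0 - A) \<union> \<phi> ` set l0))"
    if "finite A" "\<forall>x\<in>A. \<phi> x \<noteq> x" for A
    using that
  proof (induction A rule: finite_induct)
    case empty
    have "csub c c = czero" using chains_closed[OF cc] by (simp add: minus_eq r_neg)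
    then show ?case
      using cc cz chains_mono[OF KL cc] subspaceD(1)[OF sB]
      by (intro exI[of _ c]) (auto simp: simplicial_cycles_def)
  next
    case (insert x A)
    then obtain c1 where c1: "c1 \<in> cycles p L" "csub c c1 \<in> bounds p L"
      "\<And>l. c1 l \<noteq> \<zero> \<Longrightarrow> \<exists>l0. c l0 \<noteq> \<zero> \<and> set l \<subseteq> (set l0 - A) \<union> \<phi> ` set l0" by auto
    have x: "x \<noteq> \<phi> x" "x \<notin> range \<phi>" using insert.prems \<phi> by force+
    have star: "insert (\<phi> x) (set l) \<in> L" if l: "c1 l \<noteq> \<zero>" "x \<in> set l" for l
    proof -
      obtain l0 where l0: "c l0 \<noteq> \<zero>" "set l \<subseteq> (set l0 - A) \<union> \<phi> ` set l0" using c1(3)[OF l(1)] by blast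
      then have "x \<in> set l0" using l(2) x by auto
      then have "insert (\<phi> x) (set l) \<subseteq> set l0 \<union> \<phi> ` set l0" using l0 by auto
      then show ?thesis using L big[of "set l0"] chains_supp[OF cc l0(1)] unfolding downward_closed_def by blast
    qed
    obtain c2 where c2: "c2 \<in> cycles p L" "csub c1 c2 \<in> bounds p L"
      "\<And>l. c2 l \<noteq> \<zero> \<Longrightarrow> (c1 l \<noteq> \<zero> \<and> x \<notin> set l) \<or>
       (\<exists>l0. c1 l0 \<noteq> \<zero> \<and> x \<in> set l0 \<and> set l \<subseteq> insert (\<phi> x) (set l0 - {x}))"
      using move_vertex[OF L c1(1) p x(1) star] by blast
    have cl: "c l \<in> carrier R" "c1 l \<in> carrier R" "c2 l \<in> carrier R" for l
      using chains_closed[OF cc] subspaceD(2)[OF subspace_cycles c1(1)] subspaceD(2)[OF subspace_cycles c2(1)] by auto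
    have "csub c c2 = cadd (csub c c1) (csub c1 c2)"
    proof
      fix l
      have "c l \<oplus> \<ominus> c1 l \<oplus> (c1 l \<oplus> \<ominus> c2 l) = c l \<oplus> (\<ominus> c1 l \<oplus> c1 l) \<oplus> \<ominus> c2 l"
        using cl[of l] by (simp add: a_assoc)
      then show "c l \<ominus> c2 l = c l \<ominus> c1 l \<oplus> (c1 l \<ominus> c2 l)" using cl[of l] by (simp add: minus_eq l_neg)
    qed
    then have "csub c c2 \<in> bounds p L" using subspaceD(3)[OF sB c1(2) c2(2)] by simp
    moreover have "\<exists>l0. c l0 \<noteq> \<zero> \<and> set l \<subseteq> (set l0 - insert x A) \<union> \<phi> ` set l0" if "c2 l \<noteq> \<zero>" for l
      using c2(3)[OF that]
    proof
      assume "c1 l \<noteq> \<zero> \<and> x \<notin> set l"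
      then show ?thesis using c1(3)[of l] by blast
    next
      assume "\<exists>l0. c1 l0 \<noteq> \<zero> \<and> x \<in> set l0 \<and> set l \<subseteq> insert (\<phi> x) (set l0 - {x})"
      then obtain l0 where l0: "c1 l0 \<noteq> \<zero>" "x \<in> set l0" "set l \<subseteq> insert (\<phi> x) (set l0 - {x})" by blast
      obtain l1 where l1: "c l1 \<noteq> \<zero>" "set l0 \<subseteq> (set l1 - A) \<union> \<phi> ` set l1" using c1(3)[OF l0(1)] by blast
      have "x \<in> set l1" using l0(2) l1(2) x by auto
      then have "set l \<subseteq> (set l1 - insert x A) \<union> \<phi> ` set l1" using l0(3) l1(2) by auto
      then show ?thesis using l1(1) by blast
    qed
    ultimately show ?case using c2(1) by blast
  qed
  define V where "V = (\<Union>l\<in>{l. c l \<noteq> \<zero>}. set l)"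
  have "finite V" unfolding V_def by (rule support_vertices_finite[OF cc])
  then have "finite {v\<in>V. \<phi> v \<noteq> v}" by simp
  then obtain c' where c': "c' \<in> cycles p L" "csub c c' \<in> bounds p L"
    "\<And>l. c' l \<noteq> \<zero> \<Longrightarrow> \<exists>l0. c l0 \<noteq> \<zero> \<and> set l \<subseteq> (set l0 - {v\<in>V. \<phi> v \<noteq> v}) \<union> \<phi> ` set l0"
    using *[of "{v\<in>V. \<phi> v \<noteq> v}", OF _ ballI] by blast
  have "set l \<subseteq> range \<phi>" if nz: "c' l \<noteq> \<zero>" for l
  proof -
    obtain l0 where "c l0 \<noteq> \<zero>" "set l \<subseteq> (set l0 - {v\<in>V. \<phi> v \<noteq> v}) \<union> \<phi> ` set l0" using c'(3)[OF nz] by blast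
    moreover from this have "set l0 \<subseteq> V" by (auto simp: V_def)
    ultimately have "\<phi> v = v \<or> v \<in> range \<phi>" if "v \<in> set l" for v using that by blast
    then show ?thesis by (metis rangeI subsetI)
  qed
  then show thesis using that c' by blast
qed

section \<open>Splitting off an interval\<close>

lemma bounds_mono: "K \<subseteq> L \<Longrightarrow> bounds p K \<subseteq> bounds p L"
  unfolding simplicial_boundaries_def using chains_mono by blast

lemma cycles_mono: "K \<subseteq> L \<Longrightarrow> cycles p K \<subseteq> cycles p L"
  unfolding simplicial_cycles_def using chains_mono by blast

lemma homology_quotient:
  "function_quotient R ((oriented_chains R p K)\<lparr>carrier := cycles p K\<rparr>) (bounds p K)"
proof unfold_locales
  show "add ((oriented_chains R p K)\<lparr>carrier := cycles p K\<rparr>) = cadd"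
    by (simp add: oriented_chains_def free_module_def Let_def)
  show "module.smult ((oriented_chains R p K)\<lparr>carrier := cycles p K\<rparr>) = cscale"
    by (simp add: oriented_chains_def free_module_def Let_def)
  show "subspace_of_functions (carrier ((oriented_chains R p K)\<lparr>carrier := cycles p K\<rparr>))"
    using subspace_cycles by simp
qed (rule subspace_bounds)

lemma inclusion_map_coset:
  assumes "K \<subseteq> L" "\<And>l. c l \<in> carrier R"
  shows "inclusion_map R p L (coset (bounds p K) c) = coset (bounds p L) c"
proof -
  have oadd: "add (oriented_chains R p L) = cadd"
    by (simp add: oriented_chains_def free_module_def Let_def)
  have *: "coset (bounds p L) (cadd n c) = coset (bounds p L) c" if "n \<in> bounds p K" for n
    by (rule coset_cadd[OF subspace_bounds assms(2)]) (use that bounds_mono[OF assms(1)] in blast)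
  have "inclusion_map R p L (coset (bounds p K) c) = (\<Union>n\<in>bounds p K. coset (bounds p L) (cadd n c))"
    unfolding inclusion_map_def a_r_coset_functions[OF oadd] coset_def[of "bounds p K"] by simp
  also have "\<dots> = (\<Union>n\<in>bounds p K. coset (bounds p L) c)" by (rule SUP_cong[OF refl *])
  also have "\<dots> = coset (bounds p L) c" using subspaceD(1)[OF subspace_bounds] by auto
  finally show ?thesis .
qed

lemma minus_minus_cancel:
  "a \<in> carrier R \<Longrightarrow> b \<in> carrier R \<Longrightarrow> c \<in> carrier R \<Longrightarrow> (a \<ominus> b) \<ominus> (c \<ominus> b) = a \<ominus> c"
  by (simp add: minus_eq minus_add a_assoc) (simp add: a_lcomm[of "\<ominus> b"] r_neg1 r_neg2 l_neg a_comm[of "\<ominus> c"])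

lemma minus_minus_cancel_left:
  assumes "a \<in> carrier R" "b \<in> carrier R" "c \<in> carrier R"
  shows "(c \<ominus> a) \<ominus> (c \<ominus> b) = b \<ominus> a"
proof -
  have "(c \<ominus> a) \<ominus> (c \<ominus> b) = \<ominus> a \<oplus> (c \<oplus> (\<ominus> c \<oplus> b))"
    using assms by (simp add: minus_eq minus_add a_assoc a_lcomm[of c "\<ominus> a"])
  also have "c \<oplus> (\<ominus> c \<oplus> b) = b" using assms by (simp add: a_assoc[symmetric] r_neg)
  also have "\<ominus> a \<oplus> b = b \<ominus> a" using assms by (simp add: minus_eq a_comm)
  finally show ?thesis .
qed

lemma minus_plus_cancel:
  "a \<in> carrier R \<Longrightarrow> b \<in> carrier R \<Longrightarrow> c \<in> carrier R \<Longrightarrow> (a \<ominus> b) \<oplus> (b \<ominus> c) = a \<ominus> c"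
  by (simp add: minus_eq a_assoc r_neg1 r_neg2)

text \<open>The corrections \<open>w\<close> for which \<open>z - w\<close> bounds at stage \<open>r\<close> form an affine space. By \<open>fin\<close> they can be
  replaced by cycles supported on a finite set, so these spaces lie in finitely many dimensions and stop
  shrinking as \<open>r\<close> decreases to \<open>\<delta>\<close>; a correction from the smallest one works for all \<open>r\<close>.\<close>

lemma common_killing_cycle:
  fixes K :: "real \<Rightarrow> 'v set set"
  assumes mono: "\<And>r r'. 0 < r \<Longrightarrow> r \<le> r' \<Longrightarrow> K r \<subseteq> K r'"
    and z: "\<And>l. z l \<in> carrier R"
    and D: "finite D" and r1: "0 < r1" "r1 \<le> \<delta>"
    and fin: "\<And>w. w \<in> cycles p (K b) \<Longrightarrow>
        \<exists>w'\<in>cycles p (K r1). (\<forall>l. l \<notin> D \<longrightarrow> w' l = \<zero>) \<and> csub w w' \<in> bounds p (K r1)"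
    and kill: "\<And>r. r > \<delta> \<Longrightarrow> \<exists>w\<in>cycles p (K b). csub z w \<in> bounds p (K r)"
  shows "\<exists>w\<in>cycles p (K b). \<forall>r>\<delta>. csub z w \<in> bounds p (K r)"
proof -
  define V where "V = {u \<in> cycles p (K r1). (\<forall>l. l \<notin> D \<longrightarrow> u l = \<zero>) \<and>
      (\<exists>w\<in>cycles p (K b). csub w u \<in> bounds p (K r1))}"
  define U where "U r = V \<inter> bounds p (K r)" for r
  note sB = subspace_bounds and sC = subspace_cycles
  have Bmono: "bounds p (K r) \<subseteq> bounds p (K r')" if "0 < r" "r \<le> r'" for r r'
    using mono that by (intro bounds_mono) auto
  have V: "subspace_of_functions V"
    unfolding subspace_of_functions_def
  proof (intro conjI ballI allI)
    have "csub czero czero = (czero :: 'v list \<Rightarrow> 'a)" by (simp add: minus_eq)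
    then show "czero \<in> V" unfolding V_def
      using subspaceD(1)[OF sC, of p "K r1"] subspaceD(1)[OF sC, of p "K b"] subspaceD(1)[OF sB, of p "K r1"]
      by (auto intro!: bexI[of _ czero])
    show "c l \<in> carrier R" if "c \<in> V" for c l using that subspaceD(2)[OF sC, of c p "K r1"] by (simp add: V_def)
    show "cadd c d \<in> V" if cd: "c \<in> V" "d \<in> V" for c d
    proof -
      from cd obtain u v where uv: "u \<in> cycles p (K b)" "csub u c \<in> bounds p (K r1)"
        "v \<in> cycles p (K b)" "csub v d \<in> bounds p (K r1)" unfolding V_def by auto
      have cl: "u l \<in> carrier R" "v l \<in> carrier R" "c l \<in> carrier R" "d l \<in> carrier R" for l
        using uv cd subspaceD(2)[OF sC] by (auto simp: V_def)
      have "csub (cadd u v) (cadd c d) = cadd (csub u c) (csub v d)"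
        using cl by (simp add: minus_eq minus_add a_ac)
      then have "csub (cadd u v) (cadd c d) \<in> bounds p (K r1)"
        using subspaceD(3)[OF sB uv(2,4)] by simp
      moreover have "cadd u v \<in> cycles p (K b)" using uv by (intro subspaceD(3)[OF sC])
      moreover have "cadd c d \<in> cycles p (K r1)" using cd by (intro subspaceD(3)[OF sC]) (auto simp: V_def)
      ultimately show ?thesis using cd unfolding V_def by auto
    qed
    show "cscale k c \<in> V" if k: "k \<in> carrier R" and c: "c \<in> V" for k c
    proof -
      from c obtain u where u: "u \<in> cycles p (K b)" "csub u c \<in> bounds p (K r1)" unfolding V_def by auto
      have cl: "u l \<in> carrier R" "c l \<in> carrier R" for l
        using u c subspaceD(2)[OF sC] by (auto simp: V_def)
      have "csub (cscale k u) (cscale k c) = cscale k (csub u c)"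
        using cl k by (simp add: minus_eq r_distr r_minus)
      then have "csub (cscale k u) (cscale k c) \<in> bounds p (K r1)"
        using subspaceD(4)[OF sB k u(2)] by simp
      moreover have "cscale k u \<in> cycles p (K b)" using u k by (intro subspaceD(4)[OF sC])
      moreover have "cscale k c \<in> cycles p (K r1)" using c k by (intro subspaceD(4)[OF sC]) (auto simp: V_def)
      ultimately show ?thesis using c k unfolding V_def by auto
    qed
  qed
  have Ur: "subspace_of_functions (U r)" for r
    using V sB[of p "K r"] unfolding U_def subspace_of_functions_def by auto
  have Umono: "U r \<subseteq> U r'" if "0 < r" "r \<le> r'" for r r'
    using Bmono[OF that] by (auto simp: U_def)
  have "\<exists>A\<in>U ` {\<delta><..}. \<forall>B\<in>U ` {\<delta><..}. A \<subseteq> B"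
  proof (rule chain_of_subspaces_has_least[OF D])
    show "U ` {\<delta><..} \<noteq> {}" using gt_ex[of \<delta>] by auto
    show "subspace_of_functions A" if "A \<in> U ` {\<delta><..}" for A using that Ur by auto
    show "c l = \<zero>" if "A \<in> U ` {\<delta><..}" "c \<in> A" "l \<notin> D" for A c l
      using that by (auto simp: U_def V_def)
    fix A B assume "A \<in> U ` {\<delta><..}" "B \<in> U ` {\<delta><..}"
    then obtain r s where rs: "A = U r" "B = U s" "r > \<delta>" "s > \<delta>" by auto
    then show "A \<subseteq> B \<or> B \<subseteq> A"
      using Umono[of r s] Umono[of s r] r1 by (cases "r \<le> s") auto
  qed
  then obtain q where q: "q > \<delta>" "\<And>r. r > \<delta> \<Longrightarrow> U q \<subseteq> U r" by auto
  have ex: "\<exists>u\<in>V. csub z u \<in> bounds p (K r)" if r: "r > \<delta>" for r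
  proof -
    obtain w where w: "w \<in> cycles p (K b)" "csub z w \<in> bounds p (K r)" using kill[OF r] by auto
    obtain u where u: "u \<in> cycles p (K r1)" "\<forall>l. l \<notin> D \<longrightarrow> u l = \<zero>" "csub w u \<in> bounds p (K r1)"
      using fin[OF w(1)] by auto
    then have "u \<in> V" unfolding V_def using w by auto
    moreover have "cadd (csub z w) (csub w u) = csub z u"
      using z subspaceD(2)[OF sC w(1)] subspaceD(2)[OF sC u(1)] by (simp add: minus_plus_cancel)
    moreover have "cadd (csub z w) (csub w u) \<in> bounds p (K r)"
      using w(2) u(3) Bmono[of r1 r] r r1 by (intro subspaceD(3)[OF sB]) auto
    ultimately show ?thesis by auto
  qed
  obtain u where u: "u \<in> V" "csub z u \<in> bounds p (K q)" using ex[OF q(1)] by blast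
  obtain w where w: "w \<in> cycles p (K b)" "csub w u \<in> bounds p (K r1)" using u(1) by (auto simp: V_def)
  have "csub z w \<in> bounds p (K r)" if r: "r > \<delta>" for r
  proof -
    define r' where "r' = min r q"
    have r': "r' > \<delta>" "r' \<le> r" "r' \<le> q" "0 < r'" using r q r1 by (auto simp: r'_def)
    obtain v where v: "v \<in> V" "csub z v \<in> bounds p (K r')" using ex[OF r'(1)] by blast
    have cl: "u l \<in> carrier R" "v l \<in> carrier R" "w l \<in> carrier R" for l
      using subspaceD(2)[OF V u(1)] subspaceD(2)[OF V v(1)] subspaceD(2)[OF sC w(1)] by auto
    have "csub (csub z v) (csub z u) \<in> bounds p (K q)"
      by (rule subspace_sub[OF sB _ u(2)]) (use v(2) Bmono[of r' q] r' in auto)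
    moreover have eq: "csub (csub z v) (csub z u) = csub u v"
      using cl z by (simp add: minus_minus_cancel_left)
    ultimately have "csub u v \<in> U q" using subspace_sub[OF V u(1) v(1)] by (simp add: U_def)
    then have uv: "csub u v \<in> bounds p (K r)" using q(2)[OF r] by (auto simp: U_def)
    have zv: "csub z v \<in> bounds p (K r)" using v(2) Bmono[of r' r] r' by auto
    have wu: "csub w u \<in> bounds p (K r)" using w(2) Bmono[of r1 r] r r1 by auto
    have "csub z w = csub (csub z v) (cadd (csub w u) (csub u v))"
      using cl z by (simp add: minus_plus_cancel minus_minus_cancel)
    then show ?thesis using subspace_sub[OF sB zv subspaceD(3)[OF sB wu uv]] by simp
  qed
  then show ?thesis using w(1) by blast
qed

text \<open>A class that is born right after \<open>b\<close> and is not homologous to an older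
  cycle for a while splits off an interval. Let \<open>\<delta>\<close> be the infimum of the stages
  at which \<open>z\<close> becomes homologous to some cycle \<open>w\<close> of stage
  \<open>b\<close>. Whether the interval contains \<open>\<delta>\<close> depends on whether this
  already happens at \<open>\<delta>\<close>. In either case a single \<open>w\<close> serves for
  all stages after the interval, and \<open>z - w\<close> generates the summand. The complement
  consists of the classes of a hyperplane \<open>M\<close> of the space of all functions; since
  \<open>M\<close> does not depend on the stage, the bonding maps respect it.\<close>

theorem persistent_class_gives_summand:
  fixes K :: "real \<Rightarrow> 'v set set"
  assumes mono: "\<And>r r'. 0 < r \<Longrightarrow> r \<le> r' \<Longrightarrow> K r \<subseteq> K r'"
    and b: "0 < b" and z: "\<And>r. b < r \<Longrightarrow> z \<in> cycles p (K r)"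
    and r0: "b < r0" and ess: "\<And>w. w \<in> cycles p (K b) \<Longrightarrow> csub z w \<notin> bounds p (K r0)"
    and D: "finite D" and r1: "b < r1" "r1 \<le> r0"
    and fin: "\<And>w. w \<in> cycles p (K b) \<Longrightarrow>
        \<exists>w'\<in>cycles p (K r1). (\<forall>l. l \<notin> D \<longrightarrow> w' l = \<zero>) \<and> csub w w' \<in> bounds p (K r1)"
    and die: "0 < rd" "z \<in> bounds p (K rd)"
  shows "\<exists>\<delta>>b. \<exists>J. (J = {b<..<\<delta>} \<or> J = {b<..\<delta>}) \<and>
     has_direct_summand R \<lparr>pspace = (\<lambda>r. simplicial_homology R p (K r)),
         pbond = (\<lambda>r r'. inclusion_map R p (K r'))\<rparr> (elementary_interval R J)"
proof -
  note sB = subspace_bounds and sC = subspace_cycles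
  have Bmono: "bounds p (K r) \<subseteq> bounds p (K r')" if "0 < r" "r \<le> r'" for r r'
    using mono that by (intro bounds_mono) auto
  have Cmono: "cycles p (K r) \<subseteq> cycles p (K r')" if "0 < r" "r \<le> r'" for r r'
    using mono that by (intro cycles_mono) auto
  have zc: "z l \<in> carrier R" for l using subspaceD(2)[OF sC z[OF r0]] .
  define W where "W r = {w \<in> cycles p (K b). csub z w \<in> bounds p (K r)}" for r
  have Wmono: "W r \<subseteq> W r'" if "0 < r" "r \<le> r'" for r r' using Bmono[OF that] by (auto simp: W_def)
  have W0: "W r = {}" if "0 < r" "r \<le> r0" for r
    using Wmono[OF that] ess by (auto simp: W_def)
  define T where "T = {r. 0 < r \<and> W r \<noteq> {}}"
  define \<delta> where "\<delta> = Inf T"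
  have "csub z czero = z" using zc by (simp add: minus_eq)
  then have "czero \<in> W rd" using die subspaceD(1)[OF sC] by (simp add: W_def)
  then have rd: "rd \<in> T" using die by (auto simp: T_def)
  have Tr0: "r0 \<le> r" if "r \<in> T" for r using that W0[of r] by (force simp: T_def)
  then have bdd: "bdd_below T" by (auto simp: bdd_below_def)
  have \<delta>: "r0 \<le> \<delta>" unfolding \<delta>_def using rd Tr0 by (intro cInf_greatest) auto
  have above: "W r \<noteq> {}" if r: "r > \<delta>" for r
  proof -
    obtain r' where r': "r' \<in> T" "r' < r" using r rd cInf_lessD[of T r] unfolding \<delta>_def by blast
    then show ?thesis using Wmono[of r' r] by (auto simp: T_def)
  qed
  have below: "W r = {}" if "0 < r" "r < \<delta>" for r
    using that cInf_lower[OF _ bdd, of r] by (force simp: T_def \<delta>_def)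
  obtain w J where w: "w \<in> cycles p (K b)" and J: "J = {b<..<\<delta>} \<or> J = {b<..\<delta>}"
    and dead: "\<And>r. b < r \<Longrightarrow> r \<notin> J \<Longrightarrow> csub z w \<in> bounds p (K r)"
    and alive: "\<And>r. r \<in> J \<Longrightarrow> W r = {}"
  proof (cases "W \<delta> = {}")
    case False
    then obtain w where w: "w \<in> W \<delta>" by blast
    have "csub z w \<in> bounds p (K r)" if "\<delta> \<le> r" for r
      using w Wmono[of \<delta> r] that \<delta> r0 b by (auto simp: W_def)
    then show thesis using that[of w "{b<..<\<delta>}"] w below b by (auto simp: W_def)
  next
    case True
    have "\<exists>w\<in>cycles p (K b). \<forall>r>\<delta>. csub z w \<in> bounds p (K r)"
      by (rule common_killing_cycle[where K = K and z = z, OF mono zc D _ _ fin])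
        (use r1 \<delta> b above in \<open>auto simp: W_def\<close>)
    then obtain w where "w \<in> cycles p (K b)" "\<And>r. r > \<delta> \<Longrightarrow> csub z w \<in> bounds p (K r)" by blast
    then show thesis using that[of w "{b<..\<delta>}"] below b True by (force simp: le_less)
  qed
  have Jb: "b < r" if "r \<in> J" for r using J that by auto
  have Jdown: "r \<in> J" if "r' \<in> J" "b < r" "r \<le> r'" for r r' using J that by auto
  define z' where "z' = csub z w"
  have wc: "w l \<in> carrier R" for l using subspaceD(2)[OF sC w] .
  have z'c: "z' l \<in> carrier R" for l using zc wc by (simp add: z'_def)
  have z': "z' \<in> cycles p (K r)" if "b < r" for r
    unfolding z'_def using z[OF that] w Cmono[of b r] that b by (intro subspace_sub[OF sC]) auto
  \<comment> \<open>The complement has to contain the cycles of stage \<open>b\<close>, which are present throughout the interval,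
    and everything that bounds at a stage of the interval.\<close>
  define N0 where "N0 = {cadd u d | u d. u \<in> cycles p (K b) \<and> (\<exists>r\<in>J. d \<in> bounds p (K r))}"
  have N0I: "cadd u d \<in> N0" if "u \<in> cycles p (K b)" "r \<in> J" "d \<in> bounds p (K r)" for u d r
    unfolding N0_def using that by blast
  have N0E: "\<exists>u d r. u \<in> cycles p (K b) \<and> r \<in> J \<and> d \<in> bounds p (K r) \<and> c = cadd u d" if "c \<in> N0" for c
    using that unfolding N0_def by blast
  define m where "m = (b + \<delta>) / 2"
  have m: "m \<in> J" using J \<delta> r0 by (auto simp: m_def)
  have N0: "subspace_of_functions N0"
    unfolding subspace_of_functions_def
  proof (intro conjI ballI allI)
    show "czero \<in> N0" using N0I[OF subspaceD(1)[OF sC] m subspaceD(1)[OF sB]] by simp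
    show "c l \<in> carrier R" if "c \<in> N0" for c l
      using N0E[OF that] subspaceD(2)[OF sC] subspaceD(2)[OF sB] by (metis a_closed)
    show "cadd c c' \<in> N0" if cc: "c \<in> N0" "c' \<in> N0" for c c'
    proof -
      obtain u d r where 1: "u \<in> cycles p (K b)" "r \<in> J" "d \<in> bounds p (K r)" "c = cadd u d"
        using N0E[OF cc(1)] by blast
      obtain u' d' r' where 2: "u' \<in> cycles p (K b)" "r' \<in> J" "d' \<in> bounds p (K r')" "c' = cadd u' d'"
        using N0E[OF cc(2)] by blast
      define s where "s = max r r'"
      have s: "s \<in> J" "r \<le> s" "r' \<le> s" using 1 2 by (auto simp: s_def max_def)
      have ds: "cadd d d' \<in> bounds p (K s)"
        using 1 2 s Bmono[of r s] Bmono[of r' s] Jb b by (intro subspaceD(3)[OF sB]) force+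
      have "cadd c c' = cadd (cadd u u') (cadd d d')"
        unfolding 1(4) 2(4) using subspaceD(2)[OF sC 1(1)] subspaceD(2)[OF sC 2(1)]
          subspaceD(2)[OF sB 1(3)] subspaceD(2)[OF sB 2(3)] by (simp add: a_ac)
      then show ?thesis using N0I[OF subspaceD(3)[OF sC 1(1) 2(1)] s(1) ds] by simp
    qed
    show "cscale k c \<in> N0" if k: "k \<in> carrier R" and c: "c \<in> N0" for k c
    proof -
      obtain u d r where 1: "u \<in> cycles p (K b)" "r \<in> J" "d \<in> bounds p (K r)" "c = cadd u d"
        using N0E[OF c] by blast
      have "cscale k c = cadd (cscale k u) (cscale k d)"
        unfolding 1(4) using subspaceD(2)[OF sC 1(1)] subspaceD(2)[OF sB 1(3)] k by (simp add: r_distr)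
      then show ?thesis
        using N0I[OF subspaceD(4)[OF sC k 1(1)] 1(2) subspaceD(4)[OF sB k 1(3)]] by simp
    qed
  qed
  have z'N0: "z' \<notin> N0"
  proof
    assume "z' \<in> N0"
    then obtain u d r where 1: "u \<in> cycles p (K b)" "r \<in> J" "d \<in> bounds p (K r)" "z' = cadd u d"
      using N0E by blast
    have uc: "u l \<in> carrier R" "d l \<in> carrier R" for l
      using subspaceD(2)[OF sC 1(1)] subspaceD(2)[OF sB 1(3)] by auto
    have "csub z (cadd w u) = csub z' u"
      unfolding z'_def using zc wc uc by (simp add: minus_eq minus_add a_ac)
    also have "\<dots> = d" unfolding 1(4) using uc by (simp add: minus_eq a_ac r_neg1 r_neg2 r_neg)
    finally have "cadd w u \<in> W r" using 1 subspaceD(3)[OF sC w 1(1)] by (simp add: W_def)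
    then show False using alive[OF 1(2)] by simp
  qed
  obtain M where M: "subspace_of_functions M" "N0 \<subseteq> M" "z' \<notin> M"
    "\<And>u. (\<And>l. u l \<in> carrier R) \<Longrightarrow> \<exists>k\<in>carrier R. csub u (cscale k z') \<in> M"
    using exists_complement_of_line[OF N0 z'N0 z'c] by blast
  have MC: "cycles p (K b) \<subseteq> M"
  proof
    fix u assume u: "u \<in> cycles p (K b)"
    have "cadd u czero = u" using subspaceD(2)[OF sC u] by simp
    then show "u \<in> M" using N0I[OF u m subspaceD(1)[OF sB]] M(2) by auto
  qed
  have MB: "bounds p (K r) \<subseteq> M" if r: "r \<in> J" for r
  proof
    fix d assume d: "d \<in> bounds p (K r)"
    have "cadd czero d = d" using subspaceD(2)[OF sB d] by simp
    then show "d \<in> M" using N0I[OF subspaceD(1)[OF sC] r d] M(2) by auto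
  qed
  have kz'M: "k = \<zero>" if k: "k \<in> carrier R" and kz: "cscale k z' \<in> M" for k
  proof (rule ccontr)
    assume "k \<noteq> \<zero>"
    then have ku: "k \<in> Units R" using k by (simp add: field_Units)
    have "cscale (inv k) (cscale k z') \<in> M" by (rule subspaceD(4)[OF M(1) _ kz]) (use ku in simp)
    moreover have "cscale (inv k) (cscale k z') = z'"
      using ku k z'c by (simp add: m_assoc[symmetric] Units_closed)
    ultimately show False using M(3) by simp
  qed
  define q where "q r = coset (bounds p (K r))" for r
  define L where "L = {cscale k z' | k. k \<in> carrier R}"
  have LI: "cscale k z' \<in> L" if "k \<in> carrier R" for k unfolding L_def using that by blast
  have LE: "\<exists>k. k \<in> carrier R \<and> c = cscale k z'" if "c \<in> L" for c using that unfolding L_def by blast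
  have sL: "subspace_of_functions L"
    unfolding subspace_of_functions_def
  proof (intro conjI ballI allI)
    show "czero \<in> L" using LI[OF zero_closed] z'c by simp
    show "c l \<in> carrier R" if "c \<in> L" for c l using LE[OF that] z'c by auto
    show "cadd c d \<in> L" if cd: "c \<in> L" "d \<in> L" for c d
    proof -
      obtain k j where "k \<in> carrier R" "j \<in> carrier R" "c = cscale k z'" "d = cscale j z'"
        using LE[OF cd(1)] LE[OF cd(2)] by blast
      moreover from this have "cadd c d = cscale (k \<oplus> j) z'" using z'c by (simp add: l_distr)
      ultimately show ?thesis using LI[of "k \<oplus> j"] by simp
    qed
    show "cscale k c \<in> L" if kc: "k \<in> carrier R" "c \<in> L" for k c
    proof -
      obtain j where "j \<in> carrier R" "c = cscale j z'" using LE[OF kc(2)] by blast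
      moreover from this have "cscale k c = cscale (k \<otimes> j) z'" using z'c kc by (simp add: m_assoc)
      ultimately show ?thesis using LI[of "k \<otimes> j"] kc by simp
    qed
  qed
  have LC: "L \<subseteq> cycles p (K r)" if "b < r" for r
  proof
    fix c assume "c \<in> L"
    then obtain k where "k \<in> carrier R" "c = cscale k z'" using LE by blast
    then show "c \<in> cycles p (K r)" using subspaceD(4)[OF sC _ z'[OF that]] by simp
  qed
  define A where "A r = (if r \<in> J then q r ` L else {bounds p (K r)})" for r
  define B where "B r = (if r \<in> J then q r ` (M \<inter> cycles p (K r)) else q r ` cycles p (K r))" for r
  let ?H = "\<lambda>r. simplicial_homology R p (K r)"
  have fq: "function_quotient R ((oriented_chains R p (K r))\<lparr>carrier := cycles p (K r)\<rparr>) (bounds p (K r))" for r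
    by (rule homology_quotient)
  have Hdef: "?H r = quotient_module ((oriented_chains R p (K r))\<lparr>carrier := cycles p (K r)\<rparr>) (bounds p (K r))" for r
    by (simp add: simplicial_homology_def)
  have Hcar: "carrier (?H r) = q r ` cycles p (K r)" for r
    using function_quotient.carrier_Q[OF fq, of r] by (simp add: Hdef q_def)
  have Hzero: "\<zero>\<^bsub>?H r\<^esub> = bounds p (K r)" "q r czero = bounds p (K r)" for r
    using function_quotient.zero_Q[OF fq, of r] by (simp_all add: Hdef q_def)
  have Hadd: "q r c \<oplus>\<^bsub>?H r\<^esub> q r d = q r (cadd c d)" if "\<And>l. c l \<in> carrier R" "\<And>l. d l \<in> carrier R" for r c d
    using function_quotient.add_Q[OF fq that, of r] by (simp add: Hdef q_def)
  have Hsm: "k \<odot>\<^bsub>?H r\<^esub> q r c = q r (cscale k c)" if "k \<in> carrier R" "\<And>l. c l \<in> carrier R" for r c k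
    using function_quotient.smult_Q[OF fq that, of r] by (simp add: Hdef q_def)
  have Hsub: "submodule (q r ` S) R (?H r)" if "subspace_of_functions S" "S \<subseteq> cycles p (K r)" for r S
    using function_quotient.subspace_gives_submodule[OF fq that(1), of r] that(2) by (simp add: Hdef q_def)
  have Hinc: "inclusion_map R p (K r') (q r c) = q r' c" if "0 < r" "r < r'" "\<And>l. c l \<in> carrier R" for r r' c
    unfolding q_def using mono[of r r'] that by (intro inclusion_map_coset) auto
  have qeq: "q r c = q r d \<longleftrightarrow> csub c d \<in> bounds p (K r)" if "\<And>l. c l \<in> carrier R" "\<And>l. d l \<in> carrier R" for r c d
    unfolding q_def by (rule coset_eq_iff[OF sB that])
  have q0: "q r c = bounds p (K r) \<longleftrightarrow> c \<in> bounds p (K r)" if "\<And>l. c l \<in> carrier R" for r c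
  proof -
    have "csub c czero = c" using that by (simp add: minus_eq)
    then show ?thesis using qeq[of c czero r] that by (simp add: Hzero)
  qed
  have Cc: "c l \<in> carrier R" if "c \<in> cycles p (K r)" for c l r using subspaceD(2)[OF sC that] .
  have Lc: "c l \<in> carrier R" if "c \<in> L" for c l using subspaceD(2)[OF sL that] .
  have sMC: "subspace_of_functions (M \<inter> cycles p (K r))" for r
    using M(1) sC[of p "K r"] unfolding subspace_of_functions_def by auto
  have subA: "submodule (A r) R (?H r)" for r
  proof (cases "r \<in> J")
    case True
    then show ?thesis unfolding A_def using Hsub[OF sL LC[OF Jb]] by simp
  next
    case False
    have "subspace_of_functions {czero :: 'v list \<Rightarrow> 'a}" unfolding subspace_of_functions_def by auto
    then have "submodule (q r ` {czero}) R (?H r)"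
      by (rule Hsub) (use subspaceD(1)[OF sC] in auto)
    then show ?thesis using False by (simp add: A_def Hzero)
  qed
  have subB: "submodule (B r) R (?H r)" for r
    unfolding B_def using Hsub[OF sMC, of r r] Hsub[OF sC order_refl] by simp
  have dead_L: "q r c = bounds p (K r)" if br: "b < r" "r \<notin> J" "c \<in> L" for r c
  proof -
    obtain k where k: "k \<in> carrier R" "c = cscale k z'" using LE[OF br(3)] by blast
    have "z' \<in> bounds p (K r)" using dead[OF br(1,2)] by (simp add: z'_def)
    then have "c \<in> bounds p (K r)" unfolding k(2) by (rule subspaceD(4)[OF sB k(1)])
    then show ?thesis using q0[OF Lc[OF br(3)]] by simp
  qed
  have zero_inc: "inclusion_map R p (K r') (bounds p (K r)) = bounds p (K r')" if "0 < r" "r < r'" for r r'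
    using Hinc[OF that, of czero] by (simp add: Hzero)
  have bondA: "inclusion_map R p (K r') ` A r \<subseteq> A r'" if r: "0 < r" "r < r'" for r r'
  proof (cases "r \<in> J")
    case True
    have "inclusion_map R p (K r') (q r c) \<in> A r'" if c: "c \<in> L" for c
    proof (cases "r' \<in> J")
      case True
      then show ?thesis using Hinc[OF r Lc[OF c]] c by (simp add: A_def)
    next
      case False
      then show ?thesis using Hinc[OF r Lc[OF c]] dead_L[OF _ False c] Jb[OF \<open>r \<in> J\<close>] r by (simp add: A_def)
    qed
    then show ?thesis using True by (auto simp: A_def)
  next
    case False
    have "\<zero>\<^bsub>?H r'\<^esub> \<in> A r'"
      using submodule.axioms(1)[OF subA[of r']] subgroup.one_closed by fastforce
    then show ?thesis using False zero_inc[OF r] by (simp add: A_def Hzero)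
  qed
  have bondB: "inclusion_map R p (K r') ` B r \<subseteq> B r'" if r: "0 < r" "r < r'" for r r'
  proof -
    have "inclusion_map R p (K r') (q r c) \<in> B r'" if c: "c \<in> cycles p (K r)" "r \<in> J \<Longrightarrow> c \<in> M" for c
    proof -
      have c': "c \<in> cycles p (K r')" using c Cmono[of r r'] r by auto
      have "c \<in> M" if "r' \<in> J"
      proof (cases "b < r")
        case True
        then show ?thesis using Jdown[OF that] r c by auto
      next
        case False
        then show ?thesis using Cmono[of r b] r c MC by auto
      qed
      then show ?thesis using Hinc[OF r Cc[OF c(1)]] c' by (auto simp: B_def)
    qed
    then show ?thesis by (auto simp: B_def)
  qed
  have inter: "A r \<inter> B r = {\<zero>\<^bsub>?H r\<^esub>}" if "0 < r" for r
  proof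
    show "{\<zero>\<^bsub>?H r\<^esub>} \<subseteq> A r \<inter> B r"
      using submodule.axioms(1)[OF subA[of r]] submodule.axioms(1)[OF subB[of r]] subgroup.one_closed by fastforce
    show "A r \<inter> B r \<subseteq> {\<zero>\<^bsub>?H r\<^esub>}"
    proof (cases "r \<in> J")
      case True
      show ?thesis
      proof
        fix x assume "x \<in> A r \<inter> B r"
        then have "x \<in> q r ` L" "x \<in> q r ` (M \<inter> cycles p (K r))" using True by (simp_all add: A_def B_def)
        then obtain k c where k: "k \<in> carrier R" "x = q r (cscale k z')"
          and c: "c \<in> M" "c \<in> cycles p (K r)" "x = q r c" using LE by blast
        have cc: "c l \<in> carrier R" "cscale k z' l \<in> carrier R" for l using Cc[OF c(2)] k z'c by auto
        have "q r (cscale k z') = q r c \<longleftrightarrow> csub (cscale k z') c \<in> bounds p (K r)"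
          by (rule qeq) (use cc in simp_all)
        then have "csub (cscale k z') c \<in> M"
          using k(2) c(3) MB[OF True] by auto
        then have "cadd (csub (cscale k z') c) c \<in> M" by (rule subspaceD(3)[OF M(1) _ c(1)])
        moreover have "cadd (csub (cscale k z') c) c = cscale k z'"
          using cc by (simp add: minus_eq a_assoc l_neg)
        ultimately have "k = \<zero>" using kz'M[OF k(1)] by simp
        then have "x = q r czero" using k(2) z'c by simp
        then show "x \<in> {\<zero>\<^bsub>?H r\<^esub>}" by (simp add: Hzero)
      qed
    qed (auto simp: A_def Hzero)
  qed
  have sum: "A r <+>\<^bsub>?H r\<^esub> B r = carrier (?H r)" if "0 < r" for r
  proof
    interpret H: module R "?H r" using function_quotient.module_Q[OF fq, of r] by (simp add: Hdef)
    have "A r \<subseteq> carrier (?H r)" "B r \<subseteq> carrier (?H r)"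
      using H.submoduleE(1)[OF subA] H.submoduleE(1)[OF subB] by auto
    then show "A r <+>\<^bsub>?H r\<^esub> B r \<subseteq> carrier (?H r)" by (auto simp: set_add_def')
    show "carrier (?H r) \<subseteq> A r <+>\<^bsub>?H r\<^esub> B r"
    proof
      fix x assume "x \<in> carrier (?H r)"
      then obtain c where c: "c \<in> cycles p (K r)" "x = q r c" unfolding Hcar by blast
      note cc = Cc[OF c(1)]
      have "\<exists>y\<in>A r. \<exists>y'\<in>B r. x = y \<oplus>\<^bsub>?H r\<^esub> y'"
      proof (cases "r \<in> J")
        case True
        from M(4)[of c, OF cc] obtain k where k: "k \<in> carrier R" "csub c (cscale k z') \<in> M"
          by (rule bexE)
        have kL: "cscale k z' \<in> L" using k by (intro LI)
        have "csub c (cscale k z') \<in> cycles p (K r)"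
          using c(1) kL LC[OF Jb[OF True]] by (intro subspace_sub[OF sC]) auto
        moreover have "cadd (cscale k z') (csub c (cscale k z')) = c"
          using cc z'c k by (simp add: minus_eq a_lcomm[of _ "c _"] r_neg)
        then have "x = q r (cscale k z') \<oplus>\<^bsub>?H r\<^esub> q r (csub c (cscale k z'))"
          using Hadd[of "cscale k z'" "csub c (cscale k z')" r] cc z'c k c by simp
        moreover have "q r (cscale k z') \<in> A r" using True kL by (simp add: A_def)
        ultimately show ?thesis using True k by (auto simp: B_def)
      next
        case False
        have "x = q r czero \<oplus>\<^bsub>?H r\<^esub> q r c" using Hadd[of czero c r] cc c by simp
        then show ?thesis using False c by (auto simp: A_def B_def Hzero)
      qed
      then show "x \<in> A r <+>\<^bsub>?H r\<^esub> B r" by (auto simp: set_add_def')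
    qed
  qed
  let ?P = "\<lparr>pspace = ?H, pbond = (\<lambda>r r'. inclusion_map R p (K r'))\<rparr>"
  define h where "h r k = q r (if r \<in> J then cscale k z' else czero)" for r k
  have lin: "linear_iso R (pspace (elementary_interval R J) r) (pspace (restrict_persistence ?P A) r) (h r)" for r
  proof (cases "r \<in> J")
    case True
    have "inj_on (h r) (carrier R)"
    proof (rule inj_onI)
      fix k j assume kj: "k \<in> carrier R" "j \<in> carrier R" "h r k = h r j"
      then have "csub (cscale k z') (cscale j z') \<in> bounds p (K r)"
        using qeq[of "cscale k z'" "cscale j z'" r] True z'c by (simp add: h_def)
      moreover have "csub (cscale k z') (cscale j z') = cscale (k \<ominus> j) z'"
        using kj z'c by (simp add: minus_eq l_distr l_minus)
      ultimately have "k \<ominus> j = \<zero>" using kz'M[of "k \<ominus> j"] MB[OF True] kj by auto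
      then show "k = j" using kj by (simp add: r_right_minus_eq)
    qed
    moreover have "L = (\<lambda>k. cscale k z') ` carrier R" unfolding L_def by (rule Setcompr_eq_image)
    then have "h r ` carrier R = A r" using True by (simp add: h_def A_def image_image)
    ultimately show ?thesis
      using True z'c unfolding linear_iso_def bij_betw_def
      by (simp add: elementary_interval_def restrict_persistence_def h_def Hadd Hsm l_distr m_assoc)
  next
    case False
    then show ?thesis unfolding linear_iso_def bij_betw_def
      using Hadd[of czero czero r] Hsm[of _ czero r]
      by (simp add: elementary_interval_def restrict_persistence_def h_def A_def Hzero)
  qed
  have nat: "h r' (pbond (elementary_interval R J) r r' k) = pbond (restrict_persistence ?P A) r r' (h r k)"
    if r: "0 < r" "r < r'" and k: "k \<in> carrier (pspace (elementary_interval R J) r)" for r r' k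
  proof -
    have kR: "k \<in> carrier R" using k by (auto simp: elementary_interval_def split: if_splits)
    have "inclusion_map R p (K r') (h r k) = q r' (if r \<in> J then cscale k z' else czero)"
      unfolding h_def using kR z'c by (intro Hinc[OF r]) auto
    also have "\<dots> = h r' (if r \<in> J \<and> r' \<in> J then k else \<zero>)"
    proof (cases "r \<in> J")
      case True
      show ?thesis
      proof (cases "r' \<in> J")
        case False
        have "cscale k z' \<in> L" using kR by (rule LI)
        then show ?thesis using dead_L[OF _ False] Jb[OF True] r False True by (simp add: h_def Hzero)
      qed (use True in \<open>simp add: h_def\<close>)
    next
      case False
      then show ?thesis using z'c by (simp add: h_def)
    qed
    finally show ?thesis by (simp add: elementary_interval_def restrict_persistence_def)
  qed
  have "has_direct_summand R ?P (elementary_interval R J)"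
    unfolding has_direct_summand_def persistence_submodule_def persistence_iso_def
    using subA subB bondA bondB inter sum lin nat
    by (intro exI[of _ A] exI[of _ B] conjI exI[of _ h]) (simp_all del: One_nat_def)
  moreover have "b < \<delta>" using r0 \<delta> by simp
  ultimately show ?thesis using J by blast
qed

end

section \<open>Integral chains of triangles\<close>

text \<open>Chains are first built with integral coefficients, so that identities between them are
  checked by arithmetic; multiples in the field are taken afterwards.\<close>

definition unit_chain :: "'v list \<Rightarrow> 'v list \<Rightarrow> int" where
  "unit_chain m l = (if l = m then 1 else 0)"

definition edge :: "'v \<Rightarrow> 'v \<Rightarrow> 'v list \<Rightarrow> int" where
  "edge x y l = unit_chain [x, y] l - unit_chain [y, x] l"

definition triangle :: "'v \<Rightarrow> 'v \<Rightarrow> 'v \<Rightarrow> 'v list \<Rightarrow> int" where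
  "triangle x y z l = unit_chain [x, y, z] l + unit_chain [y, z, x] l + unit_chain [z, x, y] l
     - unit_chain [y, x, z] l - unit_chain [x, z, y] l - unit_chain [z, y, x] l"

lemma edge_swap: "edge y x l = - edge x y l"
  by (simp add: edge_def)

lemma edge_self: "edge x x l = 0"
  by (simp add: edge_def)

lemma triangle_support_list:
  assumes "triangle x y z l \<noteq> 0"
  shows "l \<in> {[x, y, z], [y, z, x], [z, x, y], [y, x, z], [x, z, y], [z, y, x]}"
  by (rule ccontr) (use assms in \<open>simp add: triangle_def unit_chain_def\<close>)

lemma triangle_support:
  assumes "triangle x y z l \<noteq> 0"
  shows "length l = 3" "distinct l" "set l = {x, y, z}" "x \<noteq> y" "y \<noteq> z" "z \<noteq> x"
proof -
  show d: "x \<noteq> y" "y \<noteq> z" "z \<noteq> x" using assms by (auto simp: triangle_def)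
  show "length l = 3" "distinct l" "set l = {x, y, z}"
    using triangle_support_list[OF assms] d by auto
qed

lemma triangle_cases:
  assumes "triangle x y z [u, v, w] \<noteq> 0"
  shows "(u, v, w) \<in> {(x, y, z), (y, z, x), (z, x, y), (y, x, z), (x, z, y), (z, y, x)}"
  using triangle_support_list[OF assms] by auto

lemma sum_unit_chain:
  assumes "finite A" "x \<in> A"
  shows "(\<Sum>v\<in>A. unit_chain (x # m) (v # w)) = unit_chain m w"
proof -
  have "(\<Sum>v\<in>A. unit_chain (x # m) (v # w)) = (\<Sum>v\<in>A. if v = x then unit_chain m w else 0)"
    by (rule sum.cong) (auto simp: unit_chain_def)
  then show ?thesis using assms by simp
qed

lemma sum_triangle:
  assumes "finite A" "x \<in> A" "y \<in> A" "z \<in> A"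
  shows "(\<Sum>v\<in>A. triangle x y z (v # w)) = edge y z w - edge x z w + edge x y w"
  unfolding triangle_def edge_def
  using assms by (simp add: sum.distrib sum_subtractf sum_unit_chain)

definition alternating_chain :: "'v set set \<Rightarrow> ('v list \<Rightarrow> int) \<Rightarrow> bool" where
  "alternating_chain K C \<longleftrightarrow> (\<forall>l. C l \<noteq> 0 \<longrightarrow> length l = 3 \<and> distinct l \<and> set l \<in> K) \<and>
     finite {l. C l \<noteq> 0} \<and> (\<forall>l1 l2 a b. C (l1 @ b # a # l2) = - C (l1 @ a # b # l2))"

lemma alternating_chain_triangle:
  assumes "x \<noteq> y \<Longrightarrow> y \<noteq> z \<Longrightarrow> z \<noteq> x \<Longrightarrow> {x, y, z} \<in> K"
  shows "alternating_chain K (triangle x y z)"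
  unfolding alternating_chain_def
proof (intro conjI allI impI)
  fix l assume "triangle x y z l \<noteq> 0"
  from triangle_support[OF this] show "length l = 3" "distinct l" "set l \<in> K" using assms by auto
next
  have "{l. triangle x y z l \<noteq> 0} \<subseteq> {[x, y, z], [y, z, x], [z, x, y], [y, x, z], [x, z, y], [z, y, x]}"
    by (rule subsetI) (rule triangle_support_list, simp)
  then show "finite {l. triangle x y z l \<noteq> 0}" by (rule finite_subset) simp
next
  fix l1 l2 a b
  have sw: "triangle x y z [b, a, c] = - triangle x y z [a, b, c]"
    "triangle x y z [c, b, a] = - triangle x y z [c, a, b]" for c
    by (simp_all add: triangle_def unit_chain_def conj_commute conj_left_commute)
  show "triangle x y z (l1 @ b # a # l2) = - triangle x y z (l1 @ a # b # l2)"
  proof (cases "length (l1 @ a # b # l2) = 3")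
    case True
    then consider c where "l1 = []" "l2 = [c]" | c where "l1 = [c]" "l2 = []"
      by (cases l1; cases l2; auto)
    then show ?thesis using sw by cases auto
  next
    case False
    then have "triangle x y z (l1 @ b # a # l2) = 0" "triangle x y z (l1 @ a # b # l2) = 0"
      using triangle_support(1) by fastforce+
    then show ?thesis by simp
  qed
qed

lemma alternating_chain_add:
  assumes "alternating_chain K C" "alternating_chain K D"
  shows "alternating_chain K (\<lambda>l. C l + D l)"
  unfolding alternating_chain_def
proof (intro conjI allI impI)
  show "finite {l. C l + D l \<noteq> 0}"
    by (rule finite_subset[of _ "{l. C l \<noteq> 0} \<union> {l. D l \<noteq> 0}"])
      (use assms in \<open>auto simp: alternating_chain_def\<close>)
  fix l assume "C l + D l \<noteq> 0"
  then have "C l \<noteq> 0 \<or> D l \<noteq> 0" by auto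
  then show "length l = 3" "distinct l" "set l \<in> K" using assms by (auto simp: alternating_chain_def)
next
  fix l1 l2 a b
  have "C (l1 @ b # a # l2) = - C (l1 @ a # b # l2)" "D (l1 @ b # a # l2) = - D (l1 @ a # b # l2)"
    using assms unfolding alternating_chain_def by blast+
  then show "C (l1 @ b # a # l2) + D (l1 @ b # a # l2) = - (C (l1 @ a # b # l2) + D (l1 @ a # b # l2))"
    by simp
qed

lemma alternating_chain_sum:
  assumes "finite I" "\<And>i. i \<in> I \<Longrightarrow> alternating_chain K (C i)"
  shows "alternating_chain K (\<lambda>l. \<Sum>i\<in>I. C i l)"
  using assms
proof (induction I rule: finite_induct)
  case empty
  then show ?case by (simp add: alternating_chain_def)
next
  case (insert i I)
  then show ?case using alternating_chain_add[of K "C i" "\<lambda>l. \<Sum>i\<in>I. C i l"] by simp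
qed

subsection \<open>Fans\<close>

definition fan :: "'v \<Rightarrow> (nat \<Rightarrow> 'v) \<Rightarrow> nat \<Rightarrow> nat \<Rightarrow> 'v list \<Rightarrow> int" where
  "fan x p j k l = (\<Sum>i=j..<k. triangle x (p i) (p (Suc i)) l)"

lemma sum_fan:
  assumes "finite A" "x \<in> A" "\<And>i. p i \<in> A" "j \<le> k"
  shows "(\<Sum>v\<in>A. fan x p j k (v # w)) = (\<Sum>i=j..<k. edge (p i) (p (Suc i)) w) + edge x (p j) w - edge x (p k) w"
proof -
  have "(\<Sum>v\<in>A. fan x p j k (v # w)) = (\<Sum>i=j..<k. \<Sum>v\<in>A. triangle x (p i) (p (Suc i)) (v # w))"
    unfolding fan_def by (rule sum.swap)
  also have "\<dots> = (\<Sum>i=j..<k. edge (p i) (p (Suc i)) w - edge x (p (Suc i)) w + edge x (p i) w)"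
    using assms by (simp add: sum_triangle)
  also have "\<dots> = (\<Sum>i=j..<k. edge (p i) (p (Suc i)) w) + edge x (p j) w - edge x (p k) w"
    using assms(4) by (induction k rule: dec_induct) auto
  finally show ?thesis .
qed

text \<open>A closed polygon \<open>p 0, \<dots>, p n = p 0\<close> with intermediate points \<open>y\<close> after the vertex \<open>p j\<close> and \<open>z\<close>
  after the vertex \<open>p k\<close> is filled by one large triangle and three fans over its sides.\<close>

definition polygon_filling :: "(nat \<Rightarrow> 'v) \<Rightarrow> nat \<Rightarrow> nat \<Rightarrow> nat \<Rightarrow> 'v \<Rightarrow> 'v \<Rightarrow> 'v list \<Rightarrow> int" where
  "polygon_filling p j k n y z l = triangle (p 0) y z l + (fan (p 0) p 0 j l + triangle (p 0) (p j) y l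
     + (fan y p j k l + triangle y (p k) z l) + fan z p k n l)"

lemma sum_polygon_filling:
  assumes "finite A" "y \<in> A" "z \<in> A" "\<And>i. p i \<in> A" "j \<le> k" "k \<le> n" "p n = p 0"
  shows "(\<Sum>v\<in>A. polygon_filling p j k n y z (v # w)) = (\<Sum>i<n. edge (p i) (p (Suc i)) w)"
proof -
  have "(\<Sum>i<n. edge (p i) (p (Suc i)) w) = (\<Sum>i=0..<j. edge (p i) (p (Suc i)) w)
      + (\<Sum>i=j..<k. edge (p i) (p (Suc i)) w) + (\<Sum>i=k..<n. edge (p i) (p (Suc i)) w)"
    using assms(5,6) by (simp add: atLeast0LessThan[symmetric] sum.atLeastLessThan_concat)
  then show ?thesis
    unfolding polygon_filling_def
    using assms edge_swap[of "p j" y w] edge_swap[of "p k" z w] edge_swap[of "p 0" z w]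
    by (simp add: sum.distrib sum_triangle sum_fan edge_self)
qed

lemma alternating_chain_fan:
  assumes "\<And>i. j \<le> i \<Longrightarrow> i < k \<Longrightarrow> {x, p i, p (Suc i)} \<in> K"
  shows "alternating_chain K (fan x p j k)"
  unfolding fan_def[abs_def]
  by (intro alternating_chain_sum alternating_chain_triangle) (use assms in auto)

lemma alternating_chain_polygon_filling:
  assumes "{p 0, y, z} \<in> K" "{p 0, p j, y} \<in> K" "{y, p k, z} \<in> K"
    and "\<And>i. i < j \<Longrightarrow> {p 0, p i, p (Suc i)} \<in> K" "\<And>i. j \<le> i \<Longrightarrow> i < k \<Longrightarrow> {y, p i, p (Suc i)} \<in> K"
      "\<And>i. k \<le> i \<Longrightarrow> i < n \<Longrightarrow> {z, p i, p (Suc i)} \<in> K"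
  shows "alternating_chain K (polygon_filling p j k n y z)"
  unfolding polygon_filling_def[abs_def]
  by (intro alternating_chain_add alternating_chain_fan alternating_chain_triangle) (use assms in auto)

subsection \<open>Triangular grids\<close>

definition triangle_grid :: "(nat \<Rightarrow> nat \<Rightarrow> 'v) \<Rightarrow> nat \<Rightarrow> 'v list \<Rightarrow> int" where
  "triangle_grid f m l =
     (\<Sum>s\<le>m. \<Sum>j\<le>s. triangle (f (s - j) j) (f (Suc s - j) j) (f (s - j) (Suc j)) l) +
     (\<Sum>s<m. \<Sum>j\<le>s. triangle (f (Suc s - j) j) (f (Suc s - j) (Suc j)) (f (s - j) (Suc j)) l)"

text \<open>An inner edge of the grid belongs to two triangles that induce opposite orientations on
  it. The sums are arranged along the diagonals \<open>i + j = s\<close>: \<open>bU\<close> collects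
  the triangles below and \<open>bD\<close> those above a diagonal, and adding one more diagonal
  moves the hypotenuse by one step.\<close>

lemma grid_boundary_identity:
  fixes E :: "'v \<Rightarrow> 'v \<Rightarrow> int" and f :: "nat \<Rightarrow> nat \<Rightarrow> 'v"
  assumes sw: "\<And>x y. E y x = - E x y"
  defines "bU \<equiv> \<lambda>s. \<Sum>j\<le>s. E (f (Suc s - j) j) (f (s - j) (Suc j)) - E (f (s - j) j) (f (s - j) (Suc j))
              + E (f (s - j) j) (f (Suc s - j) j)"
    and "bD \<equiv> \<lambda>s. \<Sum>j\<le>s. E (f (Suc s - j) (Suc j)) (f (s - j) (Suc j)) - E (f (Suc s - j) j) (f (s - j) (Suc j))
              + E (f (Suc s - j) j) (f (Suc s - j) (Suc j))"
  shows "(\<Sum>s\<le>m. bU s) + (\<Sum>s<m. bD s) = (\<Sum>j\<le>m. E (f (Suc m - j) j) (f (m - j) (Suc j)))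
     + (\<Sum>s\<le>m. E (f s 0) (f (Suc s) 0)) - (\<Sum>s\<le>m. E (f 0 s) (f 0 (Suc s)))"
proof -
  define D where "D s = (\<Sum>j\<le>s. E (f (Suc s - j) j) (f (s - j) (Suc j)))" for s
  define H where "H s = (\<Sum>j\<le>s. E (f (s - j) j) (f (Suc s - j) j))" for s
  define V where "V s = (\<Sum>j\<le>s. E (f (s - j) j) (f (s - j) (Suc j)))" for s
  have bU: "bU s = D s - V s + H s" for s
    by (simp add: bU_def D_def V_def H_def sum.distrib sum_subtractf)
  have V: "V (Suc s) = (\<Sum>j\<le>s. E (f (Suc s - j) j) (f (Suc s - j) (Suc j))) + E (f 0 (Suc s)) (f 0 (Suc (Suc s)))" for s
    by (simp add: V_def)
  have H: "H (Suc s) = E (f (Suc s) 0) (f (Suc (Suc s)) 0) + (\<Sum>j\<le>s. E (f (s - j) (Suc j)) (f (Suc s - j) (Suc j)))" for s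
    unfolding H_def by (subst sum.atMost_Suc_shift) simp
  have bD: "bD s = V (Suc s) - E (f 0 (Suc s)) (f 0 (Suc (Suc s))) - (H (Suc s) - E (f (Suc s) 0) (f (Suc (Suc s)) 0)) - D s" for s
  proof -
    have "bD s = (\<Sum>j\<le>s. - E (f (s - j) (Suc j)) (f (Suc s - j) (Suc j)) - E (f (Suc s - j) j) (f (s - j) (Suc j))
              + E (f (Suc s - j) j) (f (Suc s - j) (Suc j)))"
      unfolding bD_def by (intro sum.cong refl) (simp add: sw[of "f (s - _) (Suc _)"])
    then show ?thesis by (simp add: V H D_def sum.distrib sum_subtractf sum_negf)
  qed
  have "(\<Sum>s\<le>m. bU s) + (\<Sum>s<m. bD s) = D m + (\<Sum>s\<le>m. E (f s 0) (f (Suc s) 0)) - (\<Sum>s\<le>m. E (f 0 s) (f 0 (Suc s)))"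
  proof (induction m)
    case 0
    then show ?case by (simp add: bU V_def H_def)
  next
    case (Suc m)
    then show ?case by (simp add: bU[of "Suc m"] bD)
  qed
  then show ?thesis by (simp add: D_def)
qed

lemma sum_triangle_grid:
  assumes "finite A" "\<And>i j. f i j \<in> A"
  shows "(\<Sum>v\<in>A. triangle_grid f m (v # w)) = (\<Sum>j\<le>m. edge (f (Suc m - j) j) (f (m - j) (Suc j)) w)
     - (\<Sum>s\<le>m. edge (f 0 s) (f 0 (Suc s)) w) + (\<Sum>s\<le>m. edge (f s 0) (f (Suc s) 0) w)"
proof -
  have sw: "(\<Sum>v\<in>A. \<Sum>s\<in>S. \<Sum>j\<le>s. g v s j) = (\<Sum>s\<in>S. \<Sum>j\<le>s. \<Sum>v\<in>A. g v s j)" for g :: "'a \<Rightarrow> nat \<Rightarrow> nat \<Rightarrow> int" and S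
    by (subst sum.swap, intro sum.cong refl, rule sum.swap)
  note id = grid_boundary_identity[where E = "\<lambda>x y. edge x y w" and f = f and m = m, OF edge_swap]
  have tri: "(\<Sum>v\<in>A. triangle (f i j) (f i' j') (f i'' j'') (v # w)) =
      edge (f i' j') (f i'' j'') w - edge (f i j) (f i'' j'') w + edge (f i j) (f i' j') w" for i j i' j' i'' j''
    by (rule sum_triangle) (use assms in auto)
  show ?thesis
    unfolding triangle_grid_def sum.distrib sw tri using id unfolding sum.distrib by linarith
qed

lemma alternating_chain_grid:
  assumes "\<And>i j. i + j \<le> m \<Longrightarrow> {f i j, f (Suc i) j, f i (Suc j)} \<in> K"
    "\<And>i j. i + j < m \<Longrightarrow> {f (Suc i) j, f (Suc i) (Suc j), f i (Suc j)} \<in> K"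
  shows "alternating_chain K (triangle_grid f m)"
  unfolding triangle_grid_def[abs_def]
proof (intro alternating_chain_add alternating_chain_sum alternating_chain_triangle)
  fix s j assume "s \<in> {..m}" "j \<in> {..s}"
  then show "{f (s - j) j, f (Suc s - j) j, f (s - j) (Suc j)} \<in> K"
    using assms(1)[of "s - j" j] by (simp add: Suc_diff_le)
next
  fix s j assume "s \<in> {..<m}" "j \<in> {..s}"
  then show "{f (Suc s - j) j, f (Suc s - j) (Suc j), f (s - j) (Suc j)} \<in> K"
    using assms(2)[of "s - j" j] by (simp add: Suc_diff_le)
qed auto

abbreviation loop_simplex :: "(real \<Rightarrow> 'x) \<Rightarrow> (nat \<Rightarrow> real) \<Rightarrow> 'x" where
  "loop_simplex p \<equiv> restrict (\<lambda>x. p (x 1)) (standard_simplex 1)"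

context field
begin

section \<open>Linear combinations of integral chains\<close>

definition of_Z :: "int \<Rightarrow> 'a" where "of_Z n = [n] \<cdot> \<one>"

lemma of_Z_closed [simp]: "of_Z n \<in> carrier R"
  by (simp add: of_Z_def)

lemma of_Z_0 [simp]: "of_Z 0 = \<zero>"
  by (simp add: of_Z_def add_pow_def)

lemma of_Z_1 [simp]: "of_Z 1 = \<one>"
  by (simp add: of_Z_def)

lemma of_Z_add: "of_Z (m + n) = of_Z m \<oplus> of_Z n"
  by (simp add: of_Z_def add.int_pow_mult)

lemma of_Z_minus: "of_Z (- n) = \<ominus> of_Z n"
  by (simp add: of_Z_def add.int_pow_neg)

lemma of_Z_sum: "finite S \<Longrightarrow> of_Z (\<Sum>i\<in>S. f i) = (\<Oplus>i\<in>S. of_Z (f i))"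
  by (induction S rule: finite_induct) (simp_all add: of_Z_add)

lemma of_Z_mult: "of_Z (m * n) = of_Z m \<otimes> of_Z n"
proof -
  have "of_Z m \<otimes> of_Z n = [m] \<cdot> (\<one> \<otimes> of_Z n)" unfolding of_Z_def[of m] by (rule add_pow_ldistr_int) auto
  also have "\<dots> = [m] \<cdot> ([n] \<cdot> \<one>)" by (simp add: of_Z_def)
  also have "\<dots> = [(n * m)] \<cdot> \<one>" by (rule add.int_pow_pow) simp
  finally show ?thesis by (simp add: of_Z_def mult.commute)
qed

lemma of_Z_sign: "(\<ominus> \<one>) [^] (k :: nat) = of_Z ((-1) ^ k)"
proof (induction k)
  case (Suc k)
  have "(\<ominus> \<one>) [^] Suc k = of_Z ((-1) ^ k) \<otimes> of_Z (-1)" by (simp add: Suc of_Z_minus[of 1, simplified])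
  then show ?case by (simp add: of_Z_mult[symmetric])
qed simp

definition combination :: "'i set \<Rightarrow> ('i \<Rightarrow> 'a) \<Rightarrow> ('i \<Rightarrow> 's \<Rightarrow> int) \<Rightarrow> 's \<Rightarrow> 'a" where
  "combination I k C l = (\<Oplus>i\<in>I. k i \<otimes> of_Z (C i l))"

lemma combination_zero:
  assumes "\<And>i. i \<in> I \<Longrightarrow> k i \<in> carrier R" "\<And>i. i \<in> I \<Longrightarrow> C i l = 0"
  shows "combination I k C l = \<zero>"
  unfolding combination_def by (rule add.finprod_one_eqI) (use assms in simp)

lemma combination_chain:
  fixes C :: "'i \<Rightarrow> 'v list \<Rightarrow> int"
  assumes I: "finite I" and k: "\<And>i. i \<in> I \<Longrightarrow> k i \<in> carrier R"
    and C: "\<And>i. i \<in> I \<Longrightarrow> alternating_chain K (C i)"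
  shows "combination I k C \<in> chains 2 K"
proof (rule chainsI)
  have cl: "(\<lambda>i. k i \<otimes> of_Z (C i l)) \<in> I \<rightarrow> carrier R" for l using k by auto
  show "combination I k C l \<in> carrier R" for l unfolding combination_def by (rule finsum_closed[OF cl])
  have nz: "\<exists>i\<in>I. C i l \<noteq> 0" if "combination I k C l \<noteq> \<zero>" for l
    using combination_zero[of I k C l] k that by blast
  show "length l = Suc 2 \<and> distinct l \<and> set l \<in> K" if "combination I k C l \<noteq> \<zero>" for l
    using nz[OF that] C by (auto simp: alternating_chain_def)
  have "{l. combination I k C l \<noteq> \<zero>} \<subseteq> (\<Union>i\<in>I. {l. C i l \<noteq> 0})" using nz by auto
  then show "finite {l. combination I k C l \<noteq> \<zero>}"
    by (rule finite_subset) (use I C in \<open>auto simp: alternating_chain_def\<close>)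
  fix l1 l2 a b
  have "combination I k C (l1 @ b # a # l2) = (\<Oplus>i\<in>I. \<zero> \<ominus> k i \<otimes> of_Z (C i (l1 @ a # b # l2)))"
    unfolding combination_def
  proof (rule add.finprod_cong')
    fix i assume i: "i \<in> I"
    have "C i (l1 @ b # a # l2) = - C i (l1 @ a # b # l2)"
      using C[OF i] unfolding alternating_chain_def by blast
    then show "k i \<otimes> of_Z (C i (l1 @ b # a # l2)) = \<zero> \<ominus> k i \<otimes> of_Z (C i (l1 @ a # b # l2))"
      using k[OF i] by (simp add: of_Z_minus r_minus minus_eq)
  qed (use k in auto)
  also have "\<dots> = \<ominus> combination I k C (l1 @ a # b # l2)"
    unfolding combination_def
    by (subst finsum_diff) (use cl in \<open>auto simp: minus_eq intro: finsum_closed\<close>)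
  finally show "combination I k C (l1 @ b # a # l2) = \<ominus> combination I k C (l1 @ a # b # l2)" .
qed

lemma bd_combination:
  assumes I: "finite I" and k: "\<And>i. i \<in> I \<Longrightarrow> k i \<in> carrier R"
    and C: "\<And>i. i \<in> I \<Longrightarrow> alternating_chain K (C i)"
    and A: "finite A" "\<And>i l. i \<in> I \<Longrightarrow> C i l \<noteq> 0 \<Longrightarrow> set l \<subseteq> A"
  shows "bd 2 (combination I k C) w = (\<Oplus>i\<in>I. k i \<otimes> of_Z (\<Sum>v\<in>A. C i (v # w)))"
proof -
  have "combination I k C \<in> chains 2 K" by (rule combination_chain[OF I k C])
  then have "combination I k C \<in> chains (Suc 1) K" by (simp add: numeral_2_eq_2)
  then have "bd (Suc 1) (combination I k C) w = (\<Oplus>v\<in>A. combination I k C (v # w))"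
  proof (rule bd_eq_finsum[OF _ A(1)])
    fix v assume "combination I k C (v # w) \<noteq> \<zero>"
    then obtain i where "i \<in> I" "C i (v # w) \<noteq> 0" using combination_zero[of I k C "v # w"] k by blast
    then show "v \<in> A" using A(2)[of i "v # w"] by auto
  qed
  also have "\<dots> = (\<Oplus>i\<in>I. \<Oplus>v\<in>A. k i \<otimes> of_Z (C i (v # w)))"
    unfolding combination_def by (rule finsum_swap[OF A(1) I]) (use k in auto)
  also have "\<dots> = (\<Oplus>i\<in>I. k i \<otimes> of_Z (\<Sum>v\<in>A. C i (v # w)))"
  proof (rule add.finprod_cong')
    fix i assume i: "i \<in> I"
    show "(\<Oplus>v\<in>A. k i \<otimes> of_Z (C i (v # w))) = k i \<otimes> of_Z (\<Sum>v\<in>A. C i (v # w))"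
      unfolding of_Z_sum[OF A(1)] by (rule finsum_rdistr[symmetric]) (use k i A in auto)
  qed (use k in auto)
  finally show ?thesis by (simp add: numeral_2_eq_2)
qed

section \<open>Singular chains\<close>

lemma singular_chains_iff:
  "c \<in> carrier (singular_chains R p X) \<longleftrightarrow> (\<forall>l. c l \<in> carrier R) \<and>
     (\<forall>l. c l \<noteq> \<zero> \<longrightarrow> singular_simplex p X l) \<and> finite {l. c l \<noteq> \<zero>}"
proof -
  have key: "(\<forall>x. P x \<longrightarrow> c x \<in> carrier R) \<and> (\<forall>x. \<not> P x \<longrightarrow> c x = \<zero>) \<and> A
    \<longleftrightarrow> (\<forall>l. c l \<in> carrier R) \<and> (\<forall>l. c l \<noteq> \<zero> \<longrightarrow> P l) \<and> A" for P A
    by (metis zero_closed)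
  show ?thesis
    unfolding singular_chains_def free_module_def partial_object.simps mem_Collect_eq Ball_def by (rule key)
qed

text \<open>The incidence number of a simplex and a face.\<close>

definition face_coefficient :: "nat \<Rightarrow> ((nat \<Rightarrow> real) \<Rightarrow> 'x) \<Rightarrow> ((nat \<Rightarrow> real) \<Rightarrow> 'x) \<Rightarrow> int" where
  "face_coefficient p \<sigma> \<tau> = (\<Sum>k\<in>{k. k \<le> p \<and> singular_face p k \<sigma> = \<tau>}. (-1) ^ k)"

lemma singular_bd_eq:
  assumes c: "c \<in> carrier (singular_chains R (Suc p) X)" and S: "finite S" "\<And>\<sigma>. c \<sigma> \<noteq> \<zero> \<Longrightarrow> \<sigma> \<in> S"
  shows "singular_bd R (Suc p) c \<tau> = (\<Oplus>\<sigma>\<in>S. c \<sigma> \<otimes> of_Z (face_coefficient (Suc p) \<sigma> \<tau>))"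
proof -
  have cl: "c \<sigma> \<in> carrier R" for \<sigma> using c by (simp add: singular_chains_iff)
  have inner: "(\<Oplus>k\<in>{k. k \<le> Suc p \<and> singular_face (Suc p) k \<sigma> = \<tau>}. ((\<ominus> \<one>) [^] k) \<otimes> c \<sigma>)
      = c \<sigma> \<otimes> of_Z (face_coefficient (Suc p) \<sigma> \<tau>)" for \<sigma>
  proof -
    have "(\<Oplus>k\<in>{k. k \<le> Suc p \<and> singular_face (Suc p) k \<sigma> = \<tau>}. ((\<ominus> \<one>) [^] k) \<otimes> c \<sigma>)
        = (\<Oplus>k\<in>{k. k \<le> Suc p \<and> singular_face (Suc p) k \<sigma> = \<tau>}. of_Z ((-1) ^ k)) \<otimes> c \<sigma>"
      unfolding of_Z_sign by (rule finsum_ldistr[symmetric]) (use cl in auto)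
    also have "\<dots> = of_Z (face_coefficient (Suc p) \<sigma> \<tau>) \<otimes> c \<sigma>"
      unfolding face_coefficient_def by (subst of_Z_sum) auto
    finally show ?thesis using cl by (simp add: m_comm)
  qed
  have "singular_bd R (Suc p) c \<tau> = (\<Oplus>\<sigma>\<in>{\<sigma>. c \<sigma> \<noteq> \<zero>}.
      \<Oplus>k\<in>{k. k \<le> Suc p \<and> singular_face (Suc p) k \<sigma> = \<tau>}. ((\<ominus> \<one>) [^] k) \<otimes> c \<sigma>)"
    by (simp add: singular_bd_def)
  also have "\<dots> = (\<Oplus>\<sigma>\<in>{\<sigma>. c \<sigma> \<noteq> \<zero>}. c \<sigma> \<otimes> of_Z (face_coefficient (Suc p) \<sigma> \<tau>))"
    unfolding inner ..
  also have "\<dots> = (\<Oplus>\<sigma>\<in>S. c \<sigma> \<otimes> of_Z (face_coefficient (Suc p) \<sigma> \<tau>))"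
    by (rule finsum_superset) (use S cl in auto)
  finally show ?thesis .
qed

lemma subspace_singular_chains: "subspace_of_functions (carrier (singular_chains R p X))"
  unfolding subspace_of_functions_def
proof (intro conjI ballI allI)
  show "czero \<in> carrier (singular_chains R p X)" by (simp add: singular_chains_iff)
  show "c l \<in> carrier R" if "c \<in> carrier (singular_chains R p X)" for c l
    using that by (simp add: singular_chains_iff)
  show "cadd c d \<in> carrier (singular_chains R p X)"
    if cd: "c \<in> carrier (singular_chains R p X)" "d \<in> carrier (singular_chains R p X)" for c d
    unfolding singular_chains_iff
  proof (intro conjI allI impI)
    show "finite {l. c l \<oplus> d l \<noteq> \<zero>}"
      by (rule finite_subset[of _ "{l. c l \<noteq> \<zero>} \<union> {l. d l \<noteq> \<zero>}"]) (use cd in \<open>auto simp: singular_chains_iff\<close>)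
    fix l
    show "c l \<oplus> d l \<in> carrier R" using cd by (simp add: singular_chains_iff)
    assume "c l \<oplus> d l \<noteq> \<zero>"
    then have "c l \<noteq> \<zero> \<or> d l \<noteq> \<zero>" by auto
    then show "singular_simplex p X l" using cd by (auto simp: singular_chains_iff)
  qed
  show "cscale k c \<in> carrier (singular_chains R p X)"
    if kc: "k \<in> carrier R" "c \<in> carrier (singular_chains R p X)" for k c
    unfolding singular_chains_iff
  proof (intro conjI allI impI)
    show "finite {l. k \<otimes> c l \<noteq> \<zero>}"
      by (rule finite_subset[of _ "{l. c l \<noteq> \<zero>}"]) (use kc in \<open>auto simp: singular_chains_iff\<close>)
    fix l
    show "k \<otimes> c l \<in> carrier R" using kc by (simp add: singular_chains_iff)
    assume "k \<otimes> c l \<noteq> \<zero>"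
    then have "c l \<noteq> \<zero>" using kc by auto
    then show "singular_simplex p X l" using kc by (auto simp: singular_chains_iff)
  qed
qed

lemma singular_bd_closed:
  assumes "c \<in> carrier (singular_chains R (Suc p) X)"
  shows "singular_bd R (Suc p) c \<tau> \<in> carrier R"
  by (subst singular_bd_eq[OF assms, of "{\<sigma>. c \<sigma> \<noteq> \<zero>}"])
    (use assms in \<open>auto simp: singular_chains_iff intro!: finsum_closed\<close>)

lemma singular_bd_add:
  assumes "c \<in> carrier (singular_chains R (Suc p) X)" "d \<in> carrier (singular_chains R (Suc p) X)"
  shows "singular_bd R (Suc p) (cadd c d) = cadd (singular_bd R (Suc p) c) (singular_bd R (Suc p) d)"
proof
  fix \<tau>
  define S where "S = {\<sigma>. c \<sigma> \<noteq> \<zero>} \<union> {\<sigma>. d \<sigma> \<noteq> \<zero>}"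
  have S: "finite S" using assms by (auto simp: S_def singular_chains_iff)
  have cl: "c \<sigma> \<in> carrier R" "d \<sigma> \<in> carrier R" for \<sigma> using assms by (auto simp: singular_chains_iff)
  have "singular_bd R (Suc p) (cadd c d) \<tau> = (\<Oplus>\<sigma>\<in>S. (c \<sigma> \<oplus> d \<sigma>) \<otimes> of_Z (face_coefficient (Suc p) \<sigma> \<tau>))"
    by (rule singular_bd_eq[OF subspaceD(3)[OF subspace_singular_chains assms] S]) (auto simp: S_def)
  also have "\<dots> = (\<Oplus>\<sigma>\<in>S. c \<sigma> \<otimes> of_Z (face_coefficient (Suc p) \<sigma> \<tau>) \<oplus> d \<sigma> \<otimes> of_Z (face_coefficient (Suc p) \<sigma> \<tau>))"
    using cl by (simp add: l_distr)
  also have "\<dots> = (\<Oplus>\<sigma>\<in>S. c \<sigma> \<otimes> of_Z (face_coefficient (Suc p) \<sigma> \<tau>)) \<oplus> (\<Oplus>\<sigma>\<in>S. d \<sigma> \<otimes> of_Z (face_coefficient (Suc p) \<sigma> \<tau>))"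
    by (rule finsum_addf) (use cl in auto)
  also have "(\<Oplus>\<sigma>\<in>S. c \<sigma> \<otimes> of_Z (face_coefficient (Suc p) \<sigma> \<tau>)) = singular_bd R (Suc p) c \<tau>"
    by (rule singular_bd_eq[OF assms(1) S, symmetric]) (simp add: S_def)
  also have "(\<Oplus>\<sigma>\<in>S. d \<sigma> \<otimes> of_Z (face_coefficient (Suc p) \<sigma> \<tau>)) = singular_bd R (Suc p) d \<tau>"
    by (rule singular_bd_eq[OF assms(2) S, symmetric]) (simp add: S_def)
  finally show "singular_bd R (Suc p) (cadd c d) \<tau> = singular_bd R (Suc p) c \<tau> \<oplus> singular_bd R (Suc p) d \<tau>" .
qed

lemma singular_bd_scale:
  assumes "k \<in> carrier R" "c \<in> carrier (singular_chains R (Suc p) X)"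
  shows "singular_bd R (Suc p) (cscale k c) = cscale k (singular_bd R (Suc p) c)"
proof
  fix \<tau>
  define S where "S = {\<sigma>. c \<sigma> \<noteq> \<zero>}"
  have S: "finite S" using assms by (auto simp: S_def singular_chains_iff)
  have cl: "c \<sigma> \<in> carrier R" for \<sigma> using assms by (auto simp: singular_chains_iff)
  have "singular_bd R (Suc p) (cscale k c) \<tau> = (\<Oplus>\<sigma>\<in>S. (k \<otimes> c \<sigma>) \<otimes> of_Z (face_coefficient (Suc p) \<sigma> \<tau>))"
    by (rule singular_bd_eq[OF subspaceD(4)[OF subspace_singular_chains assms] S]) (use assms in \<open>auto simp: S_def\<close>)
  also have "\<dots> = (\<Oplus>\<sigma>\<in>S. k \<otimes> (c \<sigma> \<otimes> of_Z (face_coefficient (Suc p) \<sigma> \<tau>)))"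
    using cl assms(1) by (simp add: m_assoc)
  also have "\<dots> = k \<otimes> (\<Oplus>\<sigma>\<in>S. c \<sigma> \<otimes> of_Z (face_coefficient (Suc p) \<sigma> \<tau>))"
    by (rule finsum_rdistr[symmetric]) (use S cl assms in auto)
  also have "(\<Oplus>\<sigma>\<in>S. c \<sigma> \<otimes> of_Z (face_coefficient (Suc p) \<sigma> \<tau>)) = singular_bd R (Suc p) c \<tau>"
    by (rule singular_bd_eq[OF assms(2) S, symmetric]) (simp add: S_def)
  finally show "singular_bd R (Suc p) (cscale k c) \<tau> = k \<otimes> singular_bd R (Suc p) c \<tau>" .
qed

lemma singular_bd_zero: "singular_bd R p czero = czero"
  by (simp add: singular_bd_def)

lemma subspace_singular_cycles: "subspace_of_functions (singular_cycles R (Suc p) X)"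
proof -
  note s = subspace_singular_chains[of "Suc p" X]
  show ?thesis unfolding subspace_of_functions_def singular_cycles_def mem_Collect_eq
  proof (intro conjI ballI allI; (elim conjE)?)
    fix c d k
    assume c: "c \<in> {c \<in> carrier (singular_chains R (Suc p) X). singular_bd R (Suc p) c = czero}"
    { assume d: "d \<in> {c \<in> carrier (singular_chains R (Suc p) X). singular_bd R (Suc p) c = czero}"
      show "cadd c d \<in> carrier (singular_chains R (Suc p) X)" using c d by (intro subspaceD(3)[OF s]) auto
      have "singular_bd R (Suc p) (cadd c d) = cadd (singular_bd R (Suc p) c) (singular_bd R (Suc p) d)"
        using c d by (intro singular_bd_add) auto
      then show "singular_bd R (Suc p) (cadd c d) = czero" using c d by auto }
    { assume k: "k \<in> carrier R"
      show "cscale k c \<in> carrier (singular_chains R (Suc p) X)" using c k by (intro subspaceD(4)[OF s]) auto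
      have "singular_bd R (Suc p) (cscale k c) = cscale k (singular_bd R (Suc p) c)"
        using c k by (intro singular_bd_scale) auto
      then show "singular_bd R (Suc p) (cscale k c) = czero" using c k by auto }
    fix l show "c l \<in> carrier R" using c subspaceD(2)[OF s] by auto
  qed (use subspaceD(1)[OF s] in \<open>simp_all add: singular_bd_zero\<close>)
qed

lemma subspace_singular_boundaries: "subspace_of_functions (singular_boundaries R p X)"
  unfolding subspace_of_functions_def
proof (intro conjI ballI allI)
  note s = subspace_singular_chains[of "Suc p" X]
  show "czero \<in> singular_boundaries R p X" unfolding singular_boundaries_def
    by (rule image_eqI[OF _ subspaceD(1)[OF s]]) (simp add: singular_bd_zero)
  show "c l \<in> carrier R" if "c \<in> singular_boundaries R p X" for c l
    using that singular_bd_closed unfolding singular_boundaries_def by auto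
  show "cadd c d \<in> singular_boundaries R p X" if "c \<in> singular_boundaries R p X" "d \<in> singular_boundaries R p X" for c d
    using that singular_bd_add subspaceD(3)[OF s] unfolding singular_boundaries_def by (force simp: image_iff)
  show "cscale k c \<in> singular_boundaries R p X" if "k \<in> carrier R" "c \<in> singular_boundaries R p X" for k c
    using that singular_bd_scale subspaceD(4)[OF s] unfolding singular_boundaries_def by (force simp: image_iff)
qed

lemma singular_homology_quotient:
  "function_quotient R ((singular_chains R 1 X)\<lparr>carrier := singular_cycles R 1 X\<rparr>) (singular_boundaries R 1 X)"
  by unfold_locales
    (use subspace_singular_cycles[of 0 X] subspace_singular_boundaries[of 1 X] in
      \<open>simp_all add: singular_chains_def free_module_def\<close>)

section \<open>Loops as singular cycles\<close>

lemma continuous_coordinate: "continuous_map (subtopology (powertop_real UNIV) S) euclideanreal (\<lambda>x. x i)"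
  by (rule continuous_map_from_subtopology) (rule continuous_map_product_projection, simp)

lemma loop_chain_cycle:
  fixes p :: "real \<Rightarrow> 'x::topological_space"
  assumes "loop p" shows "loop_chain R p \<in> singular_cycles R 1 euclidean"
proof -
  let ?S = "subtopology (powertop_real UNIV) (standard_simplex 1)"
  have "continuous_map ?S (top_of_set {0..1}) (\<lambda>x. x 1)"
    unfolding continuous_map_in_subtopology
    using continuous_coordinate by (auto simp: standard_simplex_def)
  moreover have "continuous_map (top_of_set {0..1}) euclidean p"
    using assms by (simp add: loop_def path_def)
  ultimately have "continuous_map ?S euclidean (p \<circ> (\<lambda>x. x 1))" by (rule continuous_map_compose)
  then have "continuous_map ?S euclidean (loop_simplex p)"
    by (rule continuous_map_eq) (simp add: topspace_standard_simplex)
  then have ss: "singular_simplex 1 euclidean (loop_simplex p)" by (simp add: singular_simplex_def)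
  have lc: "loop_chain R p \<in> carrier (singular_chains R (Suc 0) euclidean)"
    using ss by (auto simp: singular_chains_iff loop_chain_def)
  have p01: "p 1 = p 0" using assms by (simp add: loop_def pathfinish_def pathstart_def)
  have x0: "x 0 = 1" if "x \<in> standard_simplex 0" for x :: "nat \<Rightarrow> real" using that by (simp add: standard_simplex_def)
  have in1: "simplical_face k x \<in> standard_simplex (Suc 0)" if "k \<le> 1" "x \<in> standard_simplex 0" for k and x :: "nat \<Rightarrow> real"
    using simplical_face_in_standard_simplex[of "Suc 0" k x] that by simp
  have faces: "singular_face (Suc 0) 0 (loop_simplex p) = singular_face (Suc 0) (Suc 0) (loop_simplex p)"
    unfolding singular_face_def
  proof (rule restrict_ext)
    fix x :: "nat \<Rightarrow> real" assume "x \<in> standard_simplex (Suc 0 - Suc 0)"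
    then have x: "x \<in> standard_simplex 0" by simp
    show "(loop_simplex p \<circ> simplical_face 0) x = (loop_simplex p \<circ> simplical_face (Suc 0)) x"
      using in1[OF _ x, of 0] in1[OF _ x, of 1] x0[OF x] p01 by (simp add: simplical_face_def)
  qed
  have "singular_bd R (Suc 0) (loop_chain R p) \<tau> = \<zero>" for \<tau>
  proof -
    have "{k. k \<le> Suc 0 \<and> singular_face (Suc 0) k (loop_simplex p) = \<tau>} =
       (if singular_face (Suc 0) 0 (loop_simplex p) = \<tau> then {0, Suc 0} else {})"
      using faces by (auto simp: le_Suc_eq)
    then have "face_coefficient (Suc 0) (loop_simplex p) \<tau> = 0" by (simp add: face_coefficient_def)
    moreover have "singular_bd R (Suc 0) (loop_chain R p) \<tau> =
      (\<Oplus>\<sigma>\<in>{loop_simplex p}. loop_chain R p \<sigma> \<otimes> of_Z (face_coefficient (Suc 0) \<sigma> \<tau>))"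
      by (rule singular_bd_eq[OF lc]) (auto simp: loop_chain_def split: if_splits)
    ultimately show ?thesis by (simp add: loop_chain_def)
  qed
  then show ?thesis using lc by (auto simp: singular_cycles_def)
qed

text \<open>Equality of cosets means that the difference of representatives is a boundary; the sum
  in the homology module is the coset of the sum of loop chains.\<close>

lemma homologous_loops_bound:
  fixes \<alpha> :: "real \<Rightarrow> 'x::topological_space" and k :: nat
  assumes \<alpha>: "loop \<alpha>" and \<beta>: "\<And>i. i \<in> {1..k} \<Longrightarrow> loop (\<beta> i)"
    and coef: "\<And>i. i \<in> {1..k} \<Longrightarrow> coef i \<in> carrier R"
    and eq: "loop_class R \<alpha> =
           (\<Oplus>\<^bsub>singular_homology R 1 (euclidean :: 'x topology)\<^esub>i\<in>{1..k}.
              coef i \<odot>\<^bsub>singular_homology R 1 (euclidean :: 'x topology)\<^esub> loop_class R (\<beta> i))"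
  obtains c where "c \<in> carrier (singular_chains R 2 (euclidean :: 'x topology))"
    "\<And>\<tau>. loop_chain R \<alpha> \<tau> \<ominus> (\<Oplus>i\<in>{1..k}. coef i \<otimes> loop_chain R (\<beta> i) \<tau>) = singular_bd R 2 c \<tau>"
proof -
  let ?M = "(singular_chains R 1 (euclidean :: 'x topology))\<lparr>carrier := singular_cycles R 1 (euclidean :: 'x topology)\<rparr>"
  let ?N = "singular_boundaries R 1 (euclidean :: 'x topology)"
  interpret fq: function_quotient R ?M ?N by (rule singular_homology_quotient)
  let ?H = "singular_homology R 1 (euclidean :: 'x topology)"
  have H: "?H = quotient_module ?M ?N" by (simp add: singular_homology_def)
  interpret Hm: module R ?H unfolding H by (rule fq.module_Q)
  have sadd: "add (singular_chains R 1 (euclidean :: 'x topology)) = cadd"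
    by (simp add: singular_chains_def free_module_def)
  have lc: "loop_class R p = coset ?N (loop_chain R p)" for p :: "real \<Rightarrow> 'x"
    unfolding loop_class_def by (rule a_r_coset_functions[OF sadd])
  note sZ = subspace_singular_cycles[of 0 "euclidean :: 'x topology", simplified]
  have cyc: "loop_chain R (\<beta> i) \<in> carrier ?M" if "i \<in> {1..k}" for i
    using loop_chain_cycle[OF \<beta>[OF that]] by simp
  have cl: "loop_chain R p \<tau> \<in> carrier R" for p :: "real \<Rightarrow> 'x" and \<tau> by (simp add: loop_chain_def)
  have car: "coset ?N z \<in> carrier ?H" if "z \<in> carrier ?M" for z
    unfolding H fq.carrier_Q using that by blast
  have sum: "(\<Oplus>\<^bsub>?H\<^esub>i\<in>I. coef i \<odot>\<^bsub>?H\<^esub> loop_class R (\<beta> i)) = coset ?N (\<lambda>\<tau>. \<Oplus>i\<in>I. coef i \<otimes> loop_chain R (\<beta> i) \<tau>)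
      \<and> (\<lambda>\<tau>. \<Oplus>i\<in>I. coef i \<otimes> loop_chain R (\<beta> i) \<tau>) \<in> carrier ?M"
    if "finite I" "I \<subseteq> {1..k}" for I
    using that
  proof (induction I rule: finite_induct)
    case empty
    have "\<zero>\<^bsub>?H\<^esub> = coset ?N czero" unfolding H by (rule fq.zero_Q(2))
    then show ?case using subspaceD(1)[OF sZ] by (simp add: Hm.M.finsum_empty del: One_nat_def) simp
  next
    case (insert i I)
    let ?s = "\<lambda>\<tau>. \<Oplus>i\<in>I. coef i \<otimes> loop_chain R (\<beta> i) \<tau>" and ?t = "cscale (coef i) (loop_chain R (\<beta> i))"
    have i: "i \<in> {1..k}" and I: "I \<subseteq> {1..k}" using insert.prems by auto
    have t: "?t \<in> carrier ?M" using subspaceD(4)[OF sZ coef[OF i]] cyc[OF i] by simp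
    have s: "?s \<in> carrier ?M" and IH: "(\<Oplus>\<^bsub>?H\<^esub>i\<in>I. coef i \<odot>\<^bsub>?H\<^esub> loop_class R (\<beta> i)) = coset ?N ?s"
      using insert.IH[OF I] by auto
    have sm: "coef j \<odot>\<^bsub>?H\<^esub> loop_class R (\<beta> j) = coset ?N (cscale (coef j) (loop_chain R (\<beta> j)))" if "j \<in> {1..k}" for j
      unfolding H lc by (rule fq.smult_Q[OF coef[OF that] cl])
    have term_car: "coef j \<odot>\<^bsub>?H\<^esub> loop_class R (\<beta> j) \<in> carrier ?H" if "j \<in> {1..k}" for j
      unfolding sm[OF that] using subspaceD(4)[OF sZ coef[OF that]] cyc[OF that] by (intro car) simp
    have ext: "(\<lambda>\<tau>. \<Oplus>i\<in>insert i I. coef i \<otimes> loop_chain R (\<beta> i) \<tau>) = cadd ?t ?s"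
      using insert.hyps coef i I cl by (auto simp: subset_iff Pi_iff intro!: finsum_insert)
    have "(\<Oplus>\<^bsub>?H\<^esub>i\<in>insert i I. coef i \<odot>\<^bsub>?H\<^esub> loop_class R (\<beta> i))
        = coef i \<odot>\<^bsub>?H\<^esub> loop_class R (\<beta> i) \<oplus>\<^bsub>?H\<^esub> (\<Oplus>\<^bsub>?H\<^esub>i\<in>I. coef i \<odot>\<^bsub>?H\<^esub> loop_class R (\<beta> i))"
      using insert.hyps term_car i I by (intro Hm.M.finsum_insert) auto
    also have "\<dots> = coset ?N (cadd ?t ?s)"
      unfolding IH sm[OF i] unfolding H
      by (rule fq.add_Q) (use fq.carrier_M[OF t] fq.carrier_M[OF s] in auto)
    finally show ?case unfolding ext using subspaceD(3)[OF sZ] t s by simp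
  qed
  define S where "S = (\<lambda>\<tau>. \<Oplus>i\<in>{1..k}. coef i \<otimes> loop_chain R (\<beta> i) \<tau>)"
  note sum_k = sum[of "{1..k}", OF finite_atLeastAtMost order_refl, folded S_def]
  have S: "S \<in> carrier ?M" by (rule conjunct2[OF sum_k])
  have "coset ?N (loop_chain R \<alpha>) = loop_class R \<alpha>" by (rule lc[symmetric])
  also have "\<dots> = coset ?N S" unfolding eq by (rule conjunct1[OF sum_k])
  finally have eqS: "coset ?N (loop_chain R \<alpha>) = coset ?N S" .
  have "coset ?N (loop_chain R \<alpha>) = coset ?N S \<longleftrightarrow> csub (loop_chain R \<alpha>) S \<in> ?N"
    by (rule coset_eq_iff[OF fq.N cl fq.carrier_M[OF S]])
  then have "csub (loop_chain R \<alpha>) S \<in> ?N" using eqS by (rule iffD1)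
  then obtain c where c: "c \<in> carrier (singular_chains R (Suc 1) (euclidean :: 'x topology))"
    "csub (loop_chain R \<alpha>) S = singular_bd R (Suc 1) c"
    unfolding singular_boundaries_def by blast
  have "loop_chain R \<alpha> \<tau> \<ominus> S \<tau> = singular_bd R 2 c \<tau>" for \<tau>
    using fun_cong[OF c(2), of \<tau>] by (simp add: numeral_2_eq_2)
  then show thesis using that[of c] c(1) by (simp add: S_def numeral_2_eq_2)
qed

end

section \<open>From singular chains to fine simplicial chains\<close>

definition edge_point :: "real \<Rightarrow> nat \<Rightarrow> real" where
  "edge_point u = (\<lambda>j. if j = 0 then 1 - u else if j = 1 then u else 0)"

definition face_point :: "real \<Rightarrow> real \<Rightarrow> nat \<Rightarrow> real" where
  "face_point s t = (\<lambda>j. if j = 0 then 1 - s - t else if j = 1 then s else if j = 2 then t else 0)"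

lemma edge_point_in: "0 \<le> u \<Longrightarrow> u \<le> 1 \<Longrightarrow> edge_point u \<in> standard_simplex (Suc 0)"
  by (auto simp: edge_point_def standard_simplex_def)

lemma face_point_in: "0 \<le> s \<Longrightarrow> 0 \<le> t \<Longrightarrow> s + t \<le> 1 \<Longrightarrow> face_point s t \<in> standard_simplex 2"
  by (auto simp: face_point_def standard_simplex_def numeral_2_eq_2)

definition edge_polygon :: "nat \<Rightarrow> ((nat \<Rightarrow> real) \<Rightarrow> 'v) \<Rightarrow> 'v list \<Rightarrow> int" where
  "edge_polygon n \<tau> w = (\<Sum>i<n. edge (\<tau> (edge_point (real i / real n))) (\<tau> (edge_point (real (Suc i) / real n))) w)"

lemma edge_polygon_loop:
  "edge_polygon n (loop_simplex p) w = (\<Sum>i<n. edge (p (real i / real n)) (p (real (Suc i) / real n)) w)"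
  unfolding edge_polygon_def
proof (rule sum.cong[OF refl])
  have e: "loop_simplex p (edge_point u) = p u" if "0 \<le> u" "u \<le> 1" for u
  proof -
    have "loop_simplex p (edge_point u) = p (edge_point u 1)"
      by (rule restrict_apply') (use edge_point_in[OF that] in simp)
    then show ?thesis by (simp add: edge_point_def)
  qed
  fix i assume i: "i \<in> {..<n}"
  then have "real i / real n \<le> 1" "real (Suc i) / real n \<le> 1" by (simp_all add: field_simps)
  then show "edge (loop_simplex p (edge_point (real i / real n))) (loop_simplex p (edge_point (real (Suc i) / real n))) w
     = edge (p (real i / real n)) (p (real (Suc i) / real n)) w"
    using e[of "real i / real n"] e[of "real (Suc i) / real n"] by simp
qed

text \<open>Outside the triangle \<open>i + j \<le> Suc m\<close> the value is a vertex of the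
  singular simplex, so that all values lie in one finite set of grid points.\<close>

definition simplex_grid :: "((nat \<Rightarrow> real) \<Rightarrow> 'v) \<Rightarrow> nat \<Rightarrow> nat \<Rightarrow> nat \<Rightarrow> 'v" where
  "simplex_grid \<sigma> m i j = (if i + j \<le> Suc m then \<sigma> (face_point (real i / real (Suc m)) (real j / real (Suc m)))
     else \<sigma> (face_point 0 0))"

lemma singular_face_edge_point:
  assumes "0 \<le> u" "u \<le> 1"
  shows "singular_face 2 0 \<sigma> (edge_point u) = \<sigma> (face_point (1 - u) u)"
    "singular_face 2 1 \<sigma> (edge_point u) = \<sigma> (face_point 0 u)"
    "singular_face 2 2 \<sigma> (edge_point u) = \<sigma> (face_point u 0)"
proof -
  have e: "edge_point u \<in> standard_simplex (2 - Suc 0)" using edge_point_in[OF assms] by simp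
  have "simplical_face 0 (edge_point u) = face_point (1 - u) u"
    "simplical_face 1 (edge_point u) = face_point 0 u"
    "simplical_face 2 (edge_point u) = face_point u 0"
    by (auto simp: simplical_face_def edge_point_def face_point_def fun_eq_iff)
  then show "singular_face 2 0 \<sigma> (edge_point u) = \<sigma> (face_point (1 - u) u)"
    "singular_face 2 1 \<sigma> (edge_point u) = \<sigma> (face_point 0 u)"
    "singular_face 2 2 \<sigma> (edge_point u) = \<sigma> (face_point u 0)"
    unfolding singular_face_def using e by simp_all
qed

text \<open>The boundary of the subdivided simplex depends only on its singular faces, with the
  signs of the singular boundary. This makes the subdivision compatible with boundaries.\<close>

lemma sum_simplex_grid:
  assumes A: "finite A" "\<And>i j. simplex_grid \<sigma> m i j \<in> A"
  shows "(\<Sum>v\<in>A. triangle_grid (simplex_grid \<sigma> m) m (v # w)) =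
     (\<Sum>k\<le>2. (-1) ^ k * edge_polygon (Suc m) (singular_face 2 k \<sigma>) w)"
proof -
  let ?n = "Suc m" and ?f = "simplex_grid \<sigma> m"
  have u: "0 \<le> real i / real ?n" "real i / real ?n \<le> 1" if "i \<le> ?n" for i
    using that by (auto simp: field_simps)
  have f0: "singular_face 2 0 \<sigma> (edge_point (real j / real ?n)) = ?f (?n - j) j" if j: "j \<le> ?n" for j
  proof -
    have "real (?n - j) / real ?n = 1 - real j / real ?n" using j by (simp add: of_nat_diff diff_divide_distrib del: of_nat_Suc)
    then show ?thesis using j by (simp add: singular_face_edge_point(1)[OF u[OF j]] simplex_grid_def del: of_nat_Suc)
  qed
  have f1: "singular_face 2 1 \<sigma> (edge_point (real j / real ?n)) = ?f 0 j" if j: "j \<le> ?n" for j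
    using j unfolding singular_face_edge_point(2)[OF u[OF j]] by (simp add: simplex_grid_def)
  have f2: "singular_face 2 2 \<sigma> (edge_point (real j / real ?n)) = ?f j 0" if j: "j \<le> ?n" for j
    using j unfolding singular_face_edge_point(3)[OF u[OF j]] by (simp add: simplex_grid_def)
  have "edge_polygon ?n (singular_face 2 0 \<sigma>) w = (\<Sum>j\<le>m. edge (?f (?n - j) j) (?f (m - j) (Suc j)) w)"
    unfolding edge_polygon_def lessThan_Suc_atMost
    by (intro sum.cong refl) (subst f0, simp, subst f0, simp_all del: of_nat_Suc)
  moreover have "edge_polygon ?n (singular_face 2 1 \<sigma>) w = (\<Sum>j\<le>m. edge (?f 0 j) (?f 0 (Suc j)) w)"
    unfolding edge_polygon_def lessThan_Suc_atMost
    by (intro sum.cong refl) (subst f1, simp, subst f1, simp_all del: of_nat_Suc)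
  moreover have "edge_polygon ?n (singular_face 2 2 \<sigma>) w = (\<Sum>j\<le>m. edge (?f j 0) (?f (Suc j) 0) w)"
    unfolding edge_polygon_def lessThan_Suc_atMost
    by (intro sum.cong refl) (subst f2, simp, subst f2, simp_all del: of_nat_Suc)
  ultimately show ?thesis
    unfolding sum_triangle_grid[where f = ?f, OF A] by (simp add: numeral_2_eq_2)
qed

text \<open>Singular simplices are uniformly continuous on the compact standard simplex.\<close>

lemma simplex_grid_fine:
  fixes S :: "((nat \<Rightarrow> real) \<Rightarrow> 'x::metric_space) set"
  assumes S: "finite S" "\<And>\<sigma>. \<sigma> \<in> S \<Longrightarrow> singular_simplex 2 euclidean \<sigma>" and \<epsilon>: "0 < \<epsilon>"
  shows "\<exists>m0. \<forall>m\<ge>m0. \<forall>\<sigma>\<in>S. \<forall>i j i' j'. i + j \<le> Suc m \<longrightarrow> i' + j' \<le> Suc m \<longrightarrow>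
     \<bar>int i - int i'\<bar> \<le> 1 \<longrightarrow> \<bar>int j - int j'\<bar> \<le> 1 \<longrightarrow> dist (simplex_grid \<sigma> m i j) (simplex_grid \<sigma> m i' j') < \<epsilon>"
  using S
proof (induction S rule: finite_induct)
  case (insert \<sigma> S)
  define T where "T = ({0..1} \<times> {0..1}) \<inter> {p :: real \<times> real. fst p + snd p \<le> 1}"
  define G where "G p = \<sigma> (face_point (fst p) (snd p))" for p
  have "compact T"
    unfolding T_def by (intro compact_Int_closed compact_Times closed_Collect_le) (auto intro!: continuous_intros)
  have "continuous_map (top_of_set T) (subtopology (powertop_real UNIV) (standard_simplex 2)) (\<lambda>p. face_point (fst p) (snd p))"
    unfolding continuous_map_in_subtopology continuous_map_componentwise_UNIV
  proof (intro conjI allI)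
    fix j
    have "continuous_on T (\<lambda>p. face_point (fst p) (snd p) j)"
      unfolding face_point_def by (cases "j = 0"; cases "j = 1"; cases "j = 2"; simp; intro continuous_intros)
    then show "continuous_map (top_of_set T) euclideanreal (\<lambda>p. face_point (fst p) (snd p) j)"
      by simp
  next
    show "(\<lambda>p. face_point (fst p) (snd p)) \<in> topspace (top_of_set T) \<rightarrow> standard_simplex 2"
      by (auto simp: T_def intro!: face_point_in)
  qed
  moreover have "continuous_map (subtopology (powertop_real UNIV) (standard_simplex 2)) euclidean \<sigma>"
    using insert.prems by (simp add: singular_simplex_def)
  ultimately have "continuous_map (top_of_set T) euclidean (\<sigma> \<circ> (\<lambda>p. face_point (fst p) (snd p)))"
    by (rule continuous_map_compose)
  then have "continuous_on T G" by (simp add: G_def[abs_def] o_def)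
  then have "uniformly_continuous_on T G" using \<open>compact T\<close> by (rule compact_uniformly_continuous)
  then obtain d where d: "d > 0" "\<And>p q. p \<in> T \<Longrightarrow> q \<in> T \<Longrightarrow> dist q p < d \<Longrightarrow> dist (G q) (G p) < \<epsilon>"
    unfolding uniformly_continuous_on_def using \<epsilon> by metis
  obtain m0 where m0: "\<And>m \<sigma> i j i' j'. m \<ge> m0 \<Longrightarrow> \<sigma> \<in> S \<Longrightarrow> i + j \<le> Suc m \<Longrightarrow> i' + j' \<le> Suc m \<Longrightarrow>
     \<bar>int i - int i'\<bar> \<le> 1 \<Longrightarrow> \<bar>int j - int j'\<bar> \<le> 1 \<Longrightarrow> dist (simplex_grid \<sigma> m i j) (simplex_grid \<sigma> m i' j') < \<epsilon>"
    using insert.IH insert.prems by (metis insertI2)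
  obtain m1 :: nat where m1: "2 / d < real m1" using reals_Archimedean2 by blast
  have new: "dist (simplex_grid \<sigma> m i j) (simplex_grid \<sigma> m i' j') < \<epsilon>"
    if m: "m \<ge> m1" and ij: "i + j \<le> Suc m" "i' + j' \<le> Suc m" "\<bar>int i - int i'\<bar> \<le> 1" "\<bar>int j - int j'\<bar> \<le> 1"
    for m i j i' j'
  proof -
    let ?n = "real (Suc m)"
    have n: "0 < ?n" by simp
    have inT: "(real i / ?n, real j / ?n) \<in> T" if "i + j \<le> Suc m" for i j
    proof -
      have "real i + real j \<le> ?n" using that by linarith
      then show ?thesis unfolding T_def by (auto simp: add_divide_distrib[symmetric] divide_le_eq_1 simp del: of_nat_Suc)
    qed
    have small: "\<bar>real a / ?n - real b / ?n\<bar> \<le> 1 / ?n" if "\<bar>int a - int b\<bar> \<le> 1" for a b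
    proof -
      have "\<bar>real a - real b\<bar> \<le> 1" using that by linarith
      then show ?thesis unfolding diff_divide_distrib[symmetric] abs_divide using n by (simp add: divide_right_mono)
    qed
    have "dist (real i / ?n, real j / ?n) (real i' / ?n, real j' / ?n) \<le> dist (real i / ?n) (real i' / ?n) + dist (real j / ?n) (real j' / ?n)"
      unfolding dist_Pair_Pair by (intro order_trans[OF sqrt_sum_squares_le_sum]) auto
    also have "\<dots> \<le> 1 / ?n + 1 / ?n"
      unfolding dist_real_def by (intro add_mono small ij)
    also have "\<dots> < d"
    proof -
      have "2 / d < ?n" using m1 m by linarith
      then show ?thesis using d(1) n by (simp add: field_simps del: of_nat_Suc)
    qed
    finally have "dist (G (real i / ?n, real j / ?n)) (G (real i' / ?n, real j' / ?n)) < \<epsilon>"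
      by (intro d(2) inT ij)
    then show ?thesis using ij by (simp add: simplex_grid_def G_def)
  qed
  show ?case
  proof (intro exI[of _ "max m0 m1"] allI ballI impI)
    fix m \<sigma>' i j i' j'
    assume "max m0 m1 \<le> m" "\<sigma>' \<in> insert \<sigma> S" "i + j \<le> Suc m" "i' + j' \<le> Suc m"
      "\<bar>int i - int i'\<bar> \<le> 1" "\<bar>int j - int j'\<bar> \<le> 1"
    then show "dist (simplex_grid \<sigma>' m i j) (simplex_grid \<sigma>' m i' j') < \<epsilon>"
      using new m0[of m \<sigma>'] by auto
  qed
qed simp

context field
begin

text \<open>Grouping the faces of the simplices by the singular simplex that they are turns their signs into
  incidence numbers. So such a sum over a singular chain depends only on its boundary.\<close>

lemma pairing_with_singular_boundary:
  assumes c: "c \<in> carrier (singular_chains R 2 X)" and S: "finite S" "\<And>\<sigma>. c \<sigma> \<noteq> \<zero> \<Longrightarrow> \<sigma> \<in> S"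
    and T: "finite T" "\<And>\<sigma> k. \<sigma> \<in> S \<Longrightarrow> k \<le> 2 \<Longrightarrow> singular_face 2 k \<sigma> \<in> T"
  shows "(\<Oplus>\<tau>\<in>T. singular_bd R 2 c \<tau> \<otimes> of_Z (g \<tau>)) =
     (\<Oplus>\<sigma>\<in>S. c \<sigma> \<otimes> of_Z (\<Sum>k\<le>2. (-1) ^ k * g (singular_face 2 k \<sigma>)))"
proof -
  have cl: "c \<sigma> \<in> carrier R" for \<sigma> using c by (simp add: singular_chains_iff)
  have c': "c \<in> carrier (singular_chains R (Suc 1) X)" using c by (simp add: numeral_2_eq_2)
  have bd2: "singular_bd R 2 c \<tau> = (\<Oplus>\<sigma>\<in>S. c \<sigma> \<otimes> of_Z (face_coefficient 2 \<sigma> \<tau>))" for \<tau>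
    using singular_bd_eq[OF c' S, of \<tau>] by (simp add: numeral_2_eq_2)
  have "singular_bd R 2 c \<tau> \<otimes> of_Z (g \<tau>) = (\<Oplus>\<sigma>\<in>S. c \<sigma> \<otimes> of_Z (face_coefficient 2 \<sigma> \<tau> * g \<tau>))" for \<tau>
  proof -
    have "singular_bd R 2 c \<tau> \<otimes> of_Z (g \<tau>) = (\<Oplus>\<sigma>\<in>S. c \<sigma> \<otimes> of_Z (face_coefficient 2 \<sigma> \<tau>) \<otimes> of_Z (g \<tau>))"
      unfolding bd2 by (rule finsum_ldistr) (use S cl in auto)
    then show ?thesis using cl by (simp add: of_Z_mult m_assoc)
  qed
  then have "(\<Oplus>\<tau>\<in>T. singular_bd R 2 c \<tau> \<otimes> of_Z (g \<tau>)) = (\<Oplus>\<sigma>\<in>S. \<Oplus>\<tau>\<in>T. c \<sigma> \<otimes> of_Z (face_coefficient 2 \<sigma> \<tau> * g \<tau>))"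
    by (simp add: finsum_swap[OF T(1) S(1)] cl)
  also have "\<dots> = (\<Oplus>\<sigma>\<in>S. c \<sigma> \<otimes> of_Z (\<Sum>k\<le>2. (-1) ^ k * g (singular_face 2 k \<sigma>)))"
  proof (rule add.finprod_cong')
    fix \<sigma> assume \<sigma>: "\<sigma> \<in> S"
    have "(\<Oplus>\<tau>\<in>T. c \<sigma> \<otimes> of_Z (face_coefficient 2 \<sigma> \<tau> * g \<tau>)) = c \<sigma> \<otimes> of_Z (\<Sum>\<tau>\<in>T. face_coefficient 2 \<sigma> \<tau> * g \<tau>)"
      unfolding of_Z_sum[OF T(1)] by (rule finsum_rdistr[symmetric]) (use cl T in auto)
    also have "(\<Sum>\<tau>\<in>T. face_coefficient 2 \<sigma> \<tau> * g \<tau>)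
        = (\<Sum>\<tau>\<in>T. \<Sum>k\<in>{k \<in> {..2}. singular_face 2 k \<sigma> = \<tau>}. (-1) ^ k * g (singular_face 2 k \<sigma>))"
      unfolding face_coefficient_def sum_distrib_right by (intro sum.cong refl) auto
    also have "\<dots> = (\<Sum>k\<le>2. (-1) ^ k * g (singular_face 2 k \<sigma>))"
      by (rule sum.group) (use T \<sigma> in auto)
    finally show "(\<Oplus>\<tau>\<in>T. c \<sigma> \<otimes> of_Z (face_coefficient 2 \<sigma> \<tau> * g \<tau>)) = c \<sigma> \<otimes> of_Z (\<Sum>k\<le>2. (-1) ^ k * g (singular_face 2 k \<sigma>))" .
  qed (use cl in auto)
  finally show ?thesis .
qed

text \<open>The boundaries of \<open>D\<close> and \<open>E i\<close> are fine polygons along the loops. The subdivision of the singular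
  chain that bounds \<open>\<alpha> - \<Sum> coef i * \<beta> i\<close> has the same combination of polygons as its boundary.\<close>

lemma cycle_from_fillings:
  fixes \<alpha> :: "real \<Rightarrow> 'x::metric_space" and k :: nat
  assumes c: "c \<in> carrier (singular_chains R 2 (euclidean :: 'x topology))"
    and coef: "\<And>i. i \<in> {1..k} \<Longrightarrow> coef i \<in> carrier R"
    and eq: "\<And>\<tau>. loop_chain R \<alpha> \<tau> \<ominus> (\<Oplus>i\<in>{1..k}. coef i \<otimes> loop_chain R (\<beta> i) \<tau>) = singular_bd R 2 c \<tau>"
    and A: "finite A"
    and D: "alternating_chain K D" "\<And>l. D l \<noteq> 0 \<Longrightarrow> set l \<subseteq> A"
      "\<And>w. (\<Sum>v\<in>A. D (v # w)) = (\<Sum>i<Suc m. edge (\<alpha> (real i / real (Suc m))) (\<alpha> (real (Suc i) / real (Suc m))) w)"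
    and E: "\<And>i. i \<in> {1..k} \<Longrightarrow> alternating_chain K (E i)" "\<And>i l. i \<in> {1..k} \<Longrightarrow> E i l \<noteq> 0 \<Longrightarrow> set l \<subseteq> A"
      "\<And>i w. i \<in> {1..k} \<Longrightarrow> (\<Sum>v\<in>A. E i (v # w)) =
          (\<Sum>j<Suc m. edge (\<beta> i (real j / real (Suc m))) (\<beta> i (real (Suc j) / real (Suc m))) w)"
    and grid: "\<And>\<sigma>. c \<sigma> \<noteq> \<zero> \<Longrightarrow> alternating_chain K (triangle_grid (simplex_grid \<sigma> m) m)"
      "\<And>\<sigma> i j. c \<sigma> \<noteq> \<zero> \<Longrightarrow> simplex_grid \<sigma> m i j \<in> A"
      "\<And>\<sigma> l. c \<sigma> \<noteq> \<zero> \<Longrightarrow> triangle_grid (simplex_grid \<sigma> m) m l \<noteq> 0 \<Longrightarrow> set l \<subseteq> A"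
  shows "csub (csub (combination {()} (\<lambda>_. \<one>) (\<lambda>_. D)) (combination {1..k} coef E))
     (combination {\<sigma>. c \<sigma> \<noteq> \<zero>} c (\<lambda>\<sigma>. triangle_grid (simplex_grid \<sigma> m) m)) \<in> cycles 2 K"
proof -
  define S where "S = {\<sigma>. c \<sigma> \<noteq> \<zero>}"
  have S: "finite S" "\<And>\<sigma>. c \<sigma> \<noteq> \<zero> \<Longrightarrow> \<sigma> \<in> S" using c by (auto simp: S_def singular_chains_iff)
  have ccl: "c \<sigma> \<in> carrier R" for \<sigma> using c by (simp add: singular_chains_iff)
  let ?a = "combination {()} (\<lambda>_. \<one>) (\<lambda>_. D)" and ?b = "combination {1..k} coef E"
    and ?g = "combination S c (\<lambda>\<sigma>. triangle_grid (simplex_grid \<sigma> m) m)"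
  have a: "?a \<in> chains 2 K" by (rule combination_chain) (use D in auto)
  have b: "?b \<in> chains 2 K" by (rule combination_chain) (use E coef in auto)
  have g: "?g \<in> chains 2 K" by (rule combination_chain) (use S ccl grid in \<open>auto simp: S_def\<close>)
  have bda: "bd 2 ?a w = of_Z (edge_polygon (Suc m) (loop_simplex \<alpha>) w)" for w
  proof -
    have "bd 2 ?a w = (\<Oplus>i\<in>{()}. \<one> \<otimes> of_Z (\<Sum>v\<in>A. D (v # w)))"
      by (rule bd_combination[where K = K]) (use D A in auto)
    then show ?thesis unfolding edge_polygon_loop D(3)[symmetric] by simp
  qed
  have bdb: "bd 2 ?b w = (\<Oplus>i\<in>{1..k}. coef i \<otimes> of_Z (edge_polygon (Suc m) (loop_simplex (\<beta> i)) w))" for w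
  proof -
    have "bd 2 ?b w = (\<Oplus>i\<in>{1..k}. coef i \<otimes> of_Z (\<Sum>v\<in>A. E i (v # w)))"
      by (rule bd_combination[where K = K]) (use E A coef in auto)
    also have "\<dots> = (\<Oplus>i\<in>{1..k}. coef i \<otimes> of_Z (edge_polygon (Suc m) (loop_simplex (\<beta> i)) w))"
    proof (rule add.finprod_cong')
      fix i assume i: "i \<in> {1..k}"
      show "coef i \<otimes> of_Z (\<Sum>v\<in>A. E i (v # w)) = coef i \<otimes> of_Z (edge_polygon (Suc m) (loop_simplex (\<beta> i)) w)"
        unfolding edge_polygon_loop E(3)[OF i] ..
    qed (use coef in auto)
    finally show ?thesis .
  qed
  have bdg: "bd 2 ?g w = of_Z (edge_polygon (Suc m) (loop_simplex \<alpha>) w)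
      \<ominus> (\<Oplus>i\<in>{1..k}. coef i \<otimes> of_Z (edge_polygon (Suc m) (loop_simplex (\<beta> i)) w))" for w
  proof -
    define G where "G \<tau> = edge_polygon (Suc m) \<tau> w" for \<tau>
    define T where "T = (\<Union>\<sigma>\<in>S. (\<lambda>k. singular_face 2 k \<sigma>) ` {..2}) \<union> {loop_simplex \<alpha>} \<union> (\<lambda>i. loop_simplex (\<beta> i)) ` {1..k}"
    have T: "finite T" "\<And>\<sigma> k. \<sigma> \<in> S \<Longrightarrow> k \<le> 2 \<Longrightarrow> singular_face 2 k \<sigma> \<in> T" using S(1) by (auto simp: T_def)
    have lcl: "loop_chain R p \<tau> \<in> carrier R" for p :: "real \<Rightarrow> 'x" and \<tau> by (simp add: loop_chain_def)
    have pick: "(\<Oplus>\<tau>\<in>T. loop_chain R p \<tau> \<otimes> of_Z (G \<tau>)) = of_Z (G (loop_simplex p))" if "loop_simplex p \<in> T" for p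
    proof -
      have "(\<Oplus>\<tau>\<in>{loop_simplex p}. loop_chain R p \<tau> \<otimes> of_Z (G \<tau>)) = (\<Oplus>\<tau>\<in>T. loop_chain R p \<tau> \<otimes> of_Z (G \<tau>))"
        by (rule finsum_superset) (use T that lcl in \<open>auto simp: loop_chain_def\<close>)
      then show ?thesis by (simp add: loop_chain_def)
    qed
    have "bd 2 ?g w = (\<Oplus>\<sigma>\<in>S. c \<sigma> \<otimes> of_Z (\<Sum>v\<in>A. triangle_grid (simplex_grid \<sigma> m) m (v # w)))"
      by (rule bd_combination[where K = K]) (use S(1) A ccl grid in \<open>auto simp: S_def\<close>)
    also have "\<dots> = (\<Oplus>\<sigma>\<in>S. c \<sigma> \<otimes> of_Z (\<Sum>k\<le>2. (-1) ^ k * G (singular_face 2 k \<sigma>)))"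
    proof (rule add.finprod_cong')
      fix \<sigma> assume "\<sigma> \<in> S"
      then have "c \<sigma> \<noteq> \<zero>" by (simp add: S_def)
      then show "c \<sigma> \<otimes> of_Z (\<Sum>v\<in>A. triangle_grid (simplex_grid \<sigma> m) m (v # w)) = c \<sigma> \<otimes> of_Z (\<Sum>k\<le>2. (-1) ^ k * G (singular_face 2 k \<sigma>))"
        using sum_simplex_grid[OF A grid(2), of \<sigma> w] by (simp add: G_def)
    qed (use ccl in auto)
    also have "\<dots> = (\<Oplus>\<tau>\<in>T. singular_bd R 2 c \<tau> \<otimes> of_Z (G \<tau>))"
      by (rule pairing_with_singular_boundary[OF c S T, symmetric])
    also have "\<dots> = (\<Oplus>\<tau>\<in>T. loop_chain R \<alpha> \<tau> \<otimes> of_Z (G \<tau>) \<ominus> (\<Oplus>i\<in>{1..k}. coef i \<otimes> (loop_chain R (\<beta> i) \<tau> \<otimes> of_Z (G \<tau>))))"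
    proof (rule add.finprod_cong')
      fix \<tau> assume "\<tau> \<in> T"
      have sc: "(\<Oplus>i\<in>{1..k}. coef i \<otimes> loop_chain R (\<beta> i) \<tau>) \<in> carrier R" using coef lcl by (intro finsum_closed) auto
      have "(\<Oplus>i\<in>{1..k}. coef i \<otimes> loop_chain R (\<beta> i) \<tau>) \<otimes> of_Z (G \<tau>) = (\<Oplus>i\<in>{1..k}. coef i \<otimes> loop_chain R (\<beta> i) \<tau> \<otimes> of_Z (G \<tau>))"
        by (rule finsum_ldistr) (use coef lcl in auto)
      also have "\<dots> = (\<Oplus>i\<in>{1..k}. coef i \<otimes> (loop_chain R (\<beta> i) \<tau> \<otimes> of_Z (G \<tau>)))"
        by (rule add.finprod_cong') (use coef lcl in \<open>auto simp: m_assoc\<close>)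
      finally show "singular_bd R 2 c \<tau> \<otimes> of_Z (G \<tau>) =
          loop_chain R \<alpha> \<tau> \<otimes> of_Z (G \<tau>) \<ominus> (\<Oplus>i\<in>{1..k}. coef i \<otimes> (loop_chain R (\<beta> i) \<tau> \<otimes> of_Z (G \<tau>)))"
        unfolding eq[symmetric] using sc lcl by (simp add: minus_eq l_distr l_minus)
    qed (use coef lcl in \<open>auto intro!: finsum_closed\<close>)
    also have "\<dots> = (\<Oplus>\<tau>\<in>T. loop_chain R \<alpha> \<tau> \<otimes> of_Z (G \<tau>)) \<ominus> (\<Oplus>\<tau>\<in>T. \<Oplus>i\<in>{1..k}. coef i \<otimes> (loop_chain R (\<beta> i) \<tau> \<otimes> of_Z (G \<tau>)))"
      by (rule finsum_diff) (use coef lcl in \<open>auto intro!: finsum_closed\<close>)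
    also have "(\<Oplus>\<tau>\<in>T. \<Oplus>i\<in>{1..k}. coef i \<otimes> (loop_chain R (\<beta> i) \<tau> \<otimes> of_Z (G \<tau>)))
        = (\<Oplus>i\<in>{1..k}. \<Oplus>\<tau>\<in>T. coef i \<otimes> (loop_chain R (\<beta> i) \<tau> \<otimes> of_Z (G \<tau>)))"
      by (rule finsum_swap) (use T coef lcl in auto)
    also have "\<dots> = (\<Oplus>i\<in>{1..k}. coef i \<otimes> of_Z (G (loop_simplex (\<beta> i))))"
    proof (rule add.finprod_cong')
      fix i assume i: "i \<in> {1..k}"
      have "(\<Oplus>\<tau>\<in>T. coef i \<otimes> (loop_chain R (\<beta> i) \<tau> \<otimes> of_Z (G \<tau>))) = coef i \<otimes> (\<Oplus>\<tau>\<in>T. loop_chain R (\<beta> i) \<tau> \<otimes> of_Z (G \<tau>))"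
        by (rule finsum_rdistr[symmetric]) (use T coef[OF i] lcl in auto)
      also have "(\<Oplus>\<tau>\<in>T. loop_chain R (\<beta> i) \<tau> \<otimes> of_Z (G \<tau>)) = of_Z (G (loop_simplex (\<beta> i)))"
        by (rule pick) (use i in \<open>auto simp: T_def\<close>)
      finally show "(\<Oplus>\<tau>\<in>T. coef i \<otimes> (loop_chain R (\<beta> i) \<tau> \<otimes> of_Z (G \<tau>))) = coef i \<otimes> of_Z (G (loop_simplex (\<beta> i)))" .
    qed (use coef in auto)
    also have "(\<Oplus>\<tau>\<in>T. loop_chain R \<alpha> \<tau> \<otimes> of_Z (G \<tau>)) = of_Z (G (loop_simplex \<alpha>))"
      by (rule pick) (auto simp: T_def)
    finally show ?thesis unfolding G_def .
  qed
  have scl: "(\<Oplus>i\<in>{1..k}. coef i \<otimes> of_Z (edge_polygon (Suc m) (loop_simplex (\<beta> i)) w)) \<in> carrier R" for w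
    using coef by (intro finsum_closed) auto
  have "bd 2 (csub (csub ?a ?b) ?g) w = \<zero>" for w
    unfolding bd_sub[OF csub_chain[OF a b] g] bd_sub[OF a b] bda bdb bdg
    using scl[of w] by (simp add: minus_eq r_neg)
  then show ?thesis
    using csub_chain[OF csub_chain[OF a b] g] unfolding simplicial_cycles_def S_def by auto
qed

end

section \<open>Free homotopies assembled from a ladder of small loops\<close>

lemma loop_null_imp_homotopic_paths:
  fixes p1 p2 :: "real \<Rightarrow> 'b::real_normed_vector"
  assumes "homotopic_loops S (p1 +++ reversepath p2) (\<lambda>_. a)" "path p2"
  shows "homotopic_paths S p1 p2"
  using homotopic_paths_loop_parts[of S p1 p2 a] assms by (simp add: linepath_refl)

text \<open>The loop \<open>q\<close> and the curve \<open>B\<close> along a segment are the rails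
  of a ladder with rungs \<open>c j\<close>. Homotopies across the squares push \<open>q\<close> to
  \<open>B\<close> up to conjugation by the rung \<open>c 0 = c m\<close>, which a free homotopy
  removes.\<close>

lemma ladder_homotopy_normed:
  fixes q B :: "real \<Rightarrow> 'b::real_normed_vector"
  assumes q: "path q" "path_image q \<subseteq> S" "pathfinish q = pathstart q"
    and B: "continuous_on UNIV B" "range B \<subseteq> S"
    and t: "t 0 = 0" "t m = 1" "\<And>j. j < m \<Longrightarrow> t j \<le> t (Suc j)"
    and c: "\<And>j. j \<le> m \<Longrightarrow> path (c j) \<and> path_image (c j) \<subseteq> S \<and> pathstart (c j) = q (t j) \<and> pathfinish (c j) = B (\<theta> j)"
    and cm: "c m = c 0"
    and sq: "\<And>j. j < m \<Longrightarrow> homotopic_paths S (subpath (t j) (t (Suc j)) q +++ c (Suc j))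
                  (c j +++ (B \<circ> linepath (\<theta> j) (\<theta> (Suc j))))"
  shows "homotopic_loops S q (B \<circ> linepath (\<theta> 0) (\<theta> m))"
proof -
  have t01: "t j \<in> {0..1}" if "j \<le> m" for j
  proof -
    have "t 0 \<le> t j" if "j \<le> m" for j using that
      by (induction j) (use t(3) in \<open>auto intro: order_trans\<close>)
    moreover have "t j \<le> t m" using that
      by (induction rule: inc_induct) (use t(3) in \<open>auto intro: order_trans\<close>)
    ultimately show ?thesis using t that by auto
  qed
  have pBl: "path (B \<circ> linepath x y)" "path_image (B \<circ> linepath x y) \<subseteq> S" for x y
    using B by (auto intro!: path_continuous_image continuous_on_subset[OF B(1)] simp: path_image_compose)
  have psub: "path (subpath (t i) (t j) q)" "path_image (subpath (t i) (t j) q) \<subseteq> S" if "i \<le> m" "j \<le> m" for i j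
    using that t01 q path_image_subpath_subset[of "t i" "t j" q] by (auto intro!: path_subpath)
  note ends = pathstart_compose pathfinish_compose pathstart_def pathfinish_def linepath_def subpath_def
  have Bend: "pathstart (B \<circ> linepath x y) = B x" "pathfinish (B \<circ> linepath x y) = B y" for x y
    by (simp_all add: pathstart_compose pathfinish_compose)
  have *: "homotopic_paths S (subpath 0 (t j) q +++ c j) (c 0 +++ (B \<circ> linepath (\<theta> 0) (\<theta> j)))" if "j \<le> m" for j
    using that
  proof (induction j)
    case 0
    have q0: "path (subpath 0 0 q)" "path_image (subpath 0 0 q) \<subseteq> S"
      using psub[of 0 0] t by auto
    have "subpath 0 0 q = linepath (q 0) (q 0)" by (simp add: subpath_refl)
    then have 1: "homotopic_paths S (subpath 0 0 q +++ c 0) (c 0)"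
      using homotopic_paths_lid[of "c 0" S] c[of 0] t by simp
    have "B \<circ> linepath (\<theta> 0) (\<theta> 0) = linepath (B (\<theta> 0)) (B (\<theta> 0))"
      by (simp add: linepath_refl o_def)
    then have "homotopic_paths S (c 0 +++ (B \<circ> linepath (\<theta> 0) (\<theta> 0))) (c 0)"
      using homotopic_paths_rid[of "c 0" S] c[of 0] by simp
    then show ?case unfolding t by (rule homotopic_paths_trans[OF 1 homotopic_paths_sym])
  next
    case (Suc j)
    then have j: "j \<le> m" "j < m" by auto
    let ?s = "subpath (t j) (t (Suc j)) q" and ?l = "B \<circ> linepath (\<theta> j) (\<theta> (Suc j))"
    let ?r = "subpath 0 (t j) q" and ?k = "B \<circ> linepath (\<theta> 0) (\<theta> j)"
    have r: "path ?r" "path_image ?r \<subseteq> S" using psub[of 0 j] t j by auto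
    note s = psub[OF j(1) Suc.prems]
    note cj = c[OF j(1)] and cs = c[OF Suc.prems] and c0 = c[of 0, simplified]
    have e: "pathstart ?s = q (t j)" "pathfinish ?s = q (t (Suc j))" "pathfinish ?r = q (t j)" "pathstart ?r = q 0" by auto
    have "homotopic_paths S (subpath 0 (t (Suc j)) q) (?r +++ ?s)"
      using homotopic_join_subpaths[OF q(1,2), of 0 "t j" "t (Suc j)"] t01[of j] t01[of "Suc j"] Suc.prems
      by (simp add: homotopic_paths_sym)
    then have "homotopic_paths S (subpath 0 (t (Suc j)) q +++ c (Suc j)) ((?r +++ ?s) +++ c (Suc j))"
      by (rule homotopic_paths_join) (use cs  in auto)
    also have "homotopic_paths S ((?r +++ ?s) +++ c (Suc j)) (?r +++ (?s +++ c (Suc j)))"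
      using r s cs e by (intro homotopic_paths_sym[OF homotopic_paths_assoc]) auto
    also (homotopic_paths_trans) have "homotopic_paths S (?r +++ (?s +++ c (Suc j))) (?r +++ (c j +++ ?l))"
      by (rule homotopic_paths_join) (use r sq[OF j(2)] e  in auto)
    also (homotopic_paths_trans) have "homotopic_paths S (?r +++ (c j +++ ?l)) ((?r +++ c j) +++ ?l)"
      using r cj e pBl Bend by (intro homotopic_paths_assoc) auto
    also (homotopic_paths_trans) have "homotopic_paths S ((?r +++ c j) +++ ?l) ((c 0 +++ ?k) +++ ?l)"
    proof (rule homotopic_paths_join)
      show "homotopic_paths S (?r +++ c j) (c 0 +++ ?k)" by (rule Suc.IH[OF j(1)])
    qed (use pBl[of "\<theta> j" "\<theta> (Suc j)"] Bend cj in auto)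
    also (homotopic_paths_trans) have "homotopic_paths S ((c 0 +++ ?k) +++ ?l) (c 0 +++ (?k +++ ?l))"
      using c0 pBl Bend by (intro homotopic_paths_sym[OF homotopic_paths_assoc]) auto
    also (homotopic_paths_trans) have "homotopic_paths S (c 0 +++ (?k +++ ?l)) (c 0 +++ (B \<circ> linepath (\<theta> 0) (\<theta> (Suc j))))"
    proof (rule homotopic_paths_join)
      have "homotopic_paths UNIV (linepath (\<theta> 0) (\<theta> j) +++ linepath (\<theta> j) (\<theta> (Suc j))) (linepath (\<theta> 0) (\<theta> (Suc j)))"
        by (rule homotopic_paths_linear) (auto intro: path_join_imp)
      then have "homotopic_paths S (B \<circ> (linepath (\<theta> 0) (\<theta> j) +++ linepath (\<theta> j) (\<theta> (Suc j)))) (B \<circ> linepath (\<theta> 0) (\<theta> (Suc j)))"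
        by (rule homotopic_paths_continuous_image) (use B in auto)
      then show "homotopic_paths S (?k +++ ?l) (B \<circ> linepath (\<theta> 0) (\<theta> (Suc j)))"
        by (simp add: path_compose_join)
    qed (use c0 Bend in auto)
    finally (homotopic_paths_trans) show ?case .
  qed
  let ?k = "B \<circ> linepath (\<theta> 0) (\<theta> m)"
  note c0 = c[of 0, simplified] and cm' = c[of m, simplified, unfolded cm]
  have B0m: "B (\<theta> 0) = B (\<theta> m)" using c0 cm' by simp
  have main: "homotopic_paths S (q +++ c 0) (c 0 +++ ?k)"
    using *[of m] t by (simp add: cm)
  have qs: "pathfinish q = q 0" "pathstart q = q 0" using q(3) by (auto simp: pathstart_def)
  have "homotopic_paths S q (q +++ linepath (q 0) (q 0))"
    using homotopic_paths_rid[OF q(1,2)] qs by (simp add: homotopic_paths_sym)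
  also have "homotopic_paths S (q +++ linepath (q 0) (q 0)) (q +++ (c 0 +++ reversepath (c 0)))"
  proof (rule homotopic_paths_join)
    show "homotopic_paths S (linepath (q 0) (q 0)) (c 0 +++ reversepath (c 0))"
      using homotopic_paths_sym[OF homotopic_paths_rinv[of "c 0" S]] c0 t by simp
  qed (use q qs in auto)
  also (homotopic_paths_trans) have "homotopic_paths S (q +++ (c 0 +++ reversepath (c 0))) ((q +++ c 0) +++ reversepath (c 0))"
    using q c0 qs t by (intro homotopic_paths_assoc) auto
  also (homotopic_paths_trans) have "homotopic_paths S ((q +++ c 0) +++ reversepath (c 0)) ((c 0 +++ ?k) +++ reversepath (c 0))"
    by (rule homotopic_paths_join) (use main c0  in auto)
  also (homotopic_paths_trans) have "homotopic_paths S ((c 0 +++ ?k) +++ reversepath (c 0)) (c 0 +++ (?k +++ reversepath (c 0)))"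
    using c0 pBl Bend B0m by (intro homotopic_paths_sym[OF homotopic_paths_assoc]) auto
  finally (homotopic_paths_trans) have "homotopic_paths S q (c 0 +++ (?k +++ reversepath (c 0)))" .
  then have "homotopic_loops S q (c 0 +++ (?k +++ reversepath (c 0)))"
    by (rule homotopic_paths_imp_homotopic_loops) (use c0 qs t in auto)
  also have "homotopic_loops S (c 0 +++ (?k +++ reversepath (c 0))) ?k"
    using c0 pBl Bend B0m by (intro homotopic_loops_conjugate) auto
  finally (homotopic_loops_trans) show ?thesis .
qed

text \<open>The isometric embedding of Kuratowski into a normed space carries constructions with homotopies of
  paths over to compact metric spaces.\<close>

definition kuratowski :: "'a::metric_space \<Rightarrow> 'a \<Rightarrow>\<^sub>C real" where
  "kuratowski x = Bcontfun (dist x)"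

lemma apply_kuratowski:
  assumes "compact (UNIV :: 'a::metric_space set)"
  shows "apply_bcontfun (kuratowski (x :: 'a)) = dist x"
proof -
  obtain e where e: "\<And>y. dist x y \<le> e"
    using compact_imp_bounded[OF assms] unfolding bounded_any_center[where a = x] by auto
  have "dist x \<in> bcontfun"
    by (rule bcontfun_normI[of _ e]) (use e in \<open>auto intro!: continuous_intros\<close>)
  then show ?thesis unfolding kuratowski_def by (rule Bcontfun_inverse)
qed

lemma dist_kuratowski:
  assumes "compact (UNIV :: 'a::metric_space set)"
  shows "dist (kuratowski (x :: 'a)) (kuratowski y) = dist x y"
proof (rule antisym)
  show "dist (kuratowski x) (kuratowski y) \<le> dist x y"
  proof (rule dist_bound)
    fix z show "dist (apply_bcontfun (kuratowski x) z) (apply_bcontfun (kuratowski y) z) \<le> dist x y"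
      unfolding apply_kuratowski[OF assms] dist_real_def
      by (smt (verit) dist_triangle dist_commute)
  qed
  have "dist (apply_bcontfun (kuratowski x) y) (apply_bcontfun (kuratowski y) y) \<le> dist (kuratowski x) (kuratowski y)"
    by (rule dist_bounded)
  then show "dist x y \<le> dist (kuratowski x) (kuratowski y)"
    unfolding apply_kuratowski[OF assms] by (simp add: dist_real_def)
qed

definition path_segment :: "real \<Rightarrow> real \<Rightarrow> (real \<Rightarrow> 'a) \<Rightarrow> real \<Rightarrow> 'a" where
  "path_segment u v g = (\<lambda>x. g ((v - u) * x + u))"

lemma ladder_homotopy:
  fixes q B :: "real \<Rightarrow> 'a::metric_space"
  assumes comp: "compact (UNIV :: 'a set)"
    and q: "path q" "path_image q \<subseteq> S" "pathfinish q = pathstart q"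
    and B: "continuous_on UNIV B" "range B \<subseteq> S"
    and t: "t 0 = 0" "t m = 1" "\<And>j. j < m \<Longrightarrow> t j \<le> t (Suc j)"
    and c: "\<And>j. j \<le> m \<Longrightarrow> path (c j) \<and> path_image (c j) \<subseteq> S \<and> pathstart (c j) = q (t j) \<and> pathfinish (c j) = B (\<theta> j)"
    and cm: "c m = c 0"
    and sq: "\<And>j. j < m \<Longrightarrow> \<exists>a. homotopic_loops S ((path_segment (t j) (t (Suc j)) q +++ c (Suc j)) +++
                  reversepath (c j +++ (B \<circ> linepath (\<theta> j) (\<theta> (Suc j))))) (\<lambda>_. a)"
  shows "homotopic_loops S q (B \<circ> linepath (\<theta> 0) (\<theta> m))"
proof -
  let ?k = "kuratowski :: 'a \<Rightarrow> 'a \<Rightarrow>\<^sub>C real"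
  have k: "continuous_on T ?k" for T
    unfolding continuous_on_iff using dist_kuratowski[OF comp] by metis
  have inj: "inj ?k" using dist_kuratowski[OF comp] by (metis dist_eq_0_iff injI)
  have kp: "path (?k \<circ> p)" if "path p" for p using that k by (rule path_continuous_image)
  have "continuous_on (range ?k) (inv_into UNIV ?k)"
    by (rule continuous_on_inv[OF k comp]) (use inj in simp)
  then have ik: "continuous_on (?k ` S) (inv_into UNIV ?k)" by (rule continuous_on_subset) auto
  have t01: "t j \<in> {0..1}" if "j \<le> m" for j
  proof -
    have "t 0 \<le> t j" if "j \<le> m" for j using that
      by (induction j) (use t(3) in \<open>auto intro: order_trans\<close>)
    moreover have "t j \<le> t m" using that
      by (induction rule: inc_induct) (use t(3) in \<open>auto intro: order_trans\<close>)
    ultimately show ?thesis using t that by auto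
  qed
  have "homotopic_loops (?k ` S) (?k \<circ> q) ((?k \<circ> B) \<circ> linepath (\<theta> 0) (\<theta> m))"
  proof (rule ladder_homotopy_normed[where t = t and c = "\<lambda>j. ?k \<circ> c j"])
    fix j assume j: "j < m"
    obtain a where a: "homotopic_loops S ((path_segment (t j) (t (Suc j)) q +++ c (Suc j)) +++
                  reversepath (c j +++ (B \<circ> linepath (\<theta> j) (\<theta> (Suc j))))) (\<lambda>_. a)" using sq[OF j] by blast
    have *: "homotopic_loops (?k ` S) (?k \<circ> ((path_segment (t j) (t (Suc j)) q +++ c (Suc j)) +++
                  reversepath (c j +++ (B \<circ> linepath (\<theta> j) (\<theta> (Suc j)))))) (?k \<circ> (\<lambda>_. a))"
      by (rule homotopic_loops_continuous_image[OF a k]) auto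
    have comps: "?k \<circ> reversepath p = reversepath (?k \<circ> p)" "?k \<circ> path_segment u v p = path_segment u v (?k \<circ> p)" for p u v
      by (auto simp: reversepath_def path_segment_def)
    have **: "homotopic_loops (?k ` S) ((path_segment (t j) (t (Suc j)) (?k \<circ> q) +++ (?k \<circ> c (Suc j))) +++
                  reversepath ((?k \<circ> c j) +++ ((?k \<circ> B) \<circ> linepath (\<theta> j) (\<theta> (Suc j))))) (\<lambda>_. ?k a)"
      using * by (simp add: path_compose_join comps o_assoc)
    have ps: "path_segment u v p = subpath u v p" for u v and p :: "real \<Rightarrow> 'a \<Rightarrow>\<^sub>C real"
      by (simp add: path_segment_def subpath_def)
    show "homotopic_paths (?k ` S) (subpath (t j) (t (Suc j)) (?k \<circ> q) +++ (?k \<circ> c (Suc j)))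
         ((?k \<circ> c j) +++ ((?k \<circ> B) \<circ> linepath (\<theta> j) (\<theta> (Suc j))))"
    proof (rule loop_null_imp_homotopic_paths[OF **[unfolded ps]])
      have "path (B \<circ> linepath (\<theta> j) (\<theta> (Suc j)))"
        by (intro path_continuous_image continuous_on_subset[OF B(1)]) auto
      then have "path ((?k \<circ> B) \<circ> linepath (\<theta> j) (\<theta> (Suc j)))" using kp by (simp add: o_assoc[symmetric])
      then show "path ((?k \<circ> c j) +++ ((?k \<circ> B) \<circ> linepath (\<theta> j) (\<theta> (Suc j))))"
        using c[of j] j kp[of "c j"] by (intro path_join_imp) (auto simp: pathfinish_compose pathstart_compose)
    qed
  next
    show "path (?k \<circ> q)" using q(1) by (rule kp)
    show "path_image (?k \<circ> q) \<subseteq> ?k ` S" using q(2) by (auto simp: path_image_compose)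
    show "pathfinish (?k \<circ> q) = pathstart (?k \<circ> q)" using q(3) by (simp add: pathfinish_compose pathstart_compose)
    show "continuous_on UNIV (?k \<circ> B)" by (rule continuous_on_compose[OF B(1) k])
    show "range (?k \<circ> B) \<subseteq> ?k ` S" using B(2) by auto
    show "?k \<circ> c m = ?k \<circ> c 0" using cm by simp
    fix j assume "j \<le> m"
    then show "path (?k \<circ> c j) \<and> path_image (?k \<circ> c j) \<subseteq> ?k ` S \<and>
        pathstart (?k \<circ> c j) = (?k \<circ> q) (t j) \<and> pathfinish (?k \<circ> c j) = (?k \<circ> B) (\<theta> j)"
      using c[of j] kp[of "c j"] by (auto simp only: path_image_compose pathfinish_compose pathstart_compose o_apply image_mono)
  qed (rule t)+
  then have "homotopic_loops S (inv_into UNIV ?k \<circ> (?k \<circ> q)) (inv_into UNIV ?k \<circ> ((?k \<circ> B) \<circ> linepath (\<theta> 0) (\<theta> m)))"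
    by (rule homotopic_loops_continuous_image[OF _ ik]) (use inj in auto)
  moreover have "inv_into UNIV ?k \<circ> (?k \<circ> p) = p" for p :: "real \<Rightarrow> 'a" using inj by (auto simp: o_def)
  moreover have "inv_into UNIV ?k \<circ> ((?k \<circ> B) \<circ> r) = B \<circ> r" for r :: "real \<Rightarrow> real" using inj by (auto simp: o_def)
  ultimately show ?thesis by simp
qed

section \<open>Geodesics\<close>

lemma Lipschitz_imp_path:
  assumes "0 \<le> C" "\<And>s t. s \<in> {0..1} \<Longrightarrow> t \<in> {0..1} \<Longrightarrow> dist (p s) (p t) \<le> C * \<bar>s - t\<bar>"
  shows "path p"
proof -
  have "C-lipschitz_on {0..1} p" by (rule lipschitz_onI) (use assms in \<open>auto simp: dist_real_def\<close>)
  then show ?thesis unfolding path_def by (rule lipschitz_on_continuous_on)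
qed

lemma geodesic_path:
  assumes "geodesic g x y"
  defines "p \<equiv> (\<lambda>t. g (dist x y * t))"
  shows "path p" "pathstart p = x" "pathfinish p = y"
    "\<And>s t. s \<in> {0..1} \<Longrightarrow> t \<in> {0..1} \<Longrightarrow> dist (p s) (p t) = dist x y * \<bar>s - t\<bar>"
proof -
  show d: "dist (p s) (p t) = dist x y * \<bar>s - t\<bar>" if "s \<in> {0..1}" "t \<in> {0..1}" for s t
  proof -
    have "dist x y * s \<in> {0..dist x y}" "dist x y * t \<in> {0..dist x y}" using that by (auto intro: mult_left_le)
    then show ?thesis using assms(1) unfolding geodesic_def p_def
      by (simp add: abs_mult flip: right_diff_distrib)
  qed
  show "path p"
    by (rule Lipschitz_imp_path[of "dist x y"]) (use d in auto)
qed (use assms in \<open>auto simp: geodesic_def pathstart_def pathfinish_def\<close>)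

text \<open>Geodesics from \<open>x\<close> to \<open>p\<close> and from \<open>p\<close> to \<open>y\<close> join to a geodesic: a shortcut between their points would
  contradict the triangle inequality from \<open>x\<close> to \<open>y\<close>.\<close>

lemma between_on_geodesic:
  assumes X: "geodesic_space TYPE('a::metric_space)"
    and eq: "dist x p + dist p y = dist x (y::'a)"
  shows "\<exists>g. geodesic g x y \<and> p \<in> g ` {0..dist x y}"
proof -
  obtain g1 g2 where g: "geodesic g1 x p" "geodesic g2 p y" using X unfolding geodesic_space_def by metis
  define d where "d = dist x p"
  define g where "g t = (if t \<le> d then g1 t else g2 (t - d))" for t
  have d: "0 \<le> d" "d \<le> dist x y" "dist p y = dist x y - d" using eq zero_le_dist[of p y] zero_le_dist[of x p] unfolding d_def by linarith+
  have g1: "g1 0 = x" "g1 d = p" "\<And>s t. s \<in> {0..d} \<Longrightarrow> t \<in> {0..d} \<Longrightarrow> dist (g1 s) (g1 t) = \<bar>s - t\<bar>"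
    using g(1) unfolding geodesic_def d_def by auto
  have g2: "g2 0 = p" "g2 (dist x y - d) = y"
    "\<And>s t. s \<in> {0..dist x y - d} \<Longrightarrow> t \<in> {0..dist x y - d} \<Longrightarrow> dist (g2 s) (g2 t) = \<bar>s - t\<bar>"
    using g(2) unfolding geodesic_def d(3) by auto
  have mixed: "dist (g1 s) (g2 (t - d)) = t - s" if "0 \<le> s" "s \<le> d" "d \<le> t" "t \<le> dist x y" for s t
  proof (rule antisym)
    have "dist (g1 s) (g2 (t - d)) \<le> dist (g1 s) (g1 d) + dist (g2 0) (g2 (t - d))"
      unfolding g1 g2 by (rule dist_triangle)
    also have "\<dots> = t - s" using that d g1(3)[of s d] g2(3)[of 0 "t - d"] by auto
    finally show "dist (g1 s) (g2 (t - d)) \<le> t - s" .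
    have "dist x y \<le> dist (g1 0) (g1 s) + dist (g1 s) (g2 (t - d)) + dist (g2 (t - d)) (g2 (dist x y - d))"
      unfolding g1 g2 by (smt (verit) dist_triangle)
    also have "\<dots> = s + dist (g1 s) (g2 (t - d)) + (dist x y - t)"
      using that d g1(3)[of 0 s] g2(3)[of "t - d" "dist x y - d"] by auto
    finally show "t - s \<le> dist (g1 s) (g2 (t - d))" by simp
  qed
  have "geodesic g x y"
    unfolding geodesic_def
  proof (intro conjI ballI)
    show "g 0 = x" using g1 d by (simp add: g_def)
    show "g (dist x y) = y" using g1 g2 d by (cases "dist x y = d") (auto simp: g_def)
    fix s t assume st: "s \<in> {0..dist x y}" "t \<in> {0..dist x y}"
    consider "s \<le> d" "t \<le> d" | "s \<le> d" "t > d" | "s > d" "t \<le> d" | "s > d" "t > d" by linarith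
    then show "dist (g s) (g t) = \<bar>s - t\<bar>"
    proof cases
      case 1 then show ?thesis using g1(3)[of s t] st by (simp add: g_def)
    next
      case 2 then show ?thesis using mixed[of s t] st by (simp add: g_def)
    next
      case 3 then show ?thesis using mixed[of t s] st by (simp add: g_def dist_commute)
    next
      case 4 then show ?thesis using g2(3)[of "s - d" "t - d"] st by (simp add: g_def)
    qed
  qed
  moreover have "p = g d" using g1 by (simp add: g_def)
  ultimately show ?thesis using d by (intro exI[of _ g]) auto
qed

section \<open>Uniform semi-local simple connectedness\<close>

text \<open>The radius is a Lebesgue number of the cover by balls in which loops contract.\<close>

lemma uniformly_semi_locally_simply_connected:
  assumes X: "semi_locally_simply_connected TYPE('a::metric_space)" and comp: "compact (UNIV :: 'a set)"
    and \<epsilon>: "\<epsilon> > 0"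
  obtains \<delta> where "\<delta> > 0"
    "\<And>(x::'a) p. loop p \<Longrightarrow> path_image p \<subseteq> ball x \<delta> \<Longrightarrow> \<exists>a. homotopic_loops (ball x \<epsilon>) p (\<lambda>_. a)"
proof -
  have "\<forall>x::'a. \<exists>\<delta>>0. \<forall>p. loop p \<and> path_image p \<subseteq> ball x \<delta> \<longrightarrow> (\<exists>a. homotopic_loops (ball x (\<epsilon>/2)) p (\<lambda>_. a))"
    using X \<epsilon> unfolding semi_locally_simply_connected_def by (meson half_gt_zero)
  then obtain d where d: "\<And>x::'a. d x > 0"
    "\<And>(x::'a) p. loop p \<Longrightarrow> path_image p \<subseteq> ball x (d x) \<Longrightarrow> (\<exists>a. homotopic_loops (ball x (\<epsilon>/2)) p (\<lambda>_. a))"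
    by metis
  define r where "r x = min (d x) (\<epsilon>/2)" for x
  have r: "r x > 0" "r x \<le> d x" "r x \<le> \<epsilon>/2" for x using d(1)[of x] \<epsilon> by (auto simp: r_def)
  obtain e where e: "0 < e" "\<And>x::'a. x \<in> UNIV \<Longrightarrow> \<exists>G\<in>(\<lambda>x. ball x (r x)) ` UNIV. ball x e \<subseteq> G"
  proof (rule Heine_Borel_lemma[OF comp])
    show "UNIV \<subseteq> \<Union>(range (\<lambda>x. ball x (r x)))" using r(1) by (auto intro: centre_in_ball[THEN iffD2])
    show "open G" if "G \<in> range (\<lambda>x. ball x (r x))" for G using that by auto
  qed blast
  show thesis
  proof (rule that[OF e(1)])
    fix x :: 'a and p assume p: "loop p" "path_image p \<subseteq> ball x e"
    obtain y where y: "ball x e \<subseteq> ball y (r y)" using e(2)[of x] by auto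
    then have xy: "dist y x < \<epsilon>/2" using e(1) r(3)[of y] by (smt (verit) centre_in_ball mem_ball subsetD)
    have "path_image p \<subseteq> ball y (d y)" using p(2) y r(2)[of y] by (smt (verit) mem_ball subsetD subsetI)
    then obtain a where a: "homotopic_loops (ball y (\<epsilon>/2)) p (\<lambda>_. a)" using d(2)[OF p(1)] by blast
    have "ball y (\<epsilon>/2) \<subseteq> ball x \<epsilon>"
    proof
      fix z assume "z \<in> ball y (\<epsilon>/2)"
      then have "dist y z < \<epsilon>/2" by simp
      moreover have "dist x z \<le> dist y x + dist y z" by (metis dist_commute dist_triangle)
      ultimately show "z \<in> ball x \<epsilon>" using xy by simp
    qed
    then show "\<exists>a. homotopic_loops (ball x \<epsilon>) p (\<lambda>_. a)"
      using a homotopic_loops_subset by blast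
  qed
qed

section \<open>Winding numbers of triples of points on a circle\<close>

abbreviation circle_norm :: "real \<Rightarrow> real" where
  "circle_norm x \<equiv> \<bar>x - of_int (round x)\<bar>"

text \<open>Each difference is moved by an integer into the interval from \<open>-1/2\<close> to
  \<open>1/2\<close>. The sum of the three moved differences is an integer: the number of turns made
  by going through the points along short arcs of the circle of circumference 1.\<close>

definition winding :: "real \<Rightarrow> real \<Rightarrow> real \<Rightarrow> int" where
  "winding u v w = - (round (v - u) + round (w - v) + round (u - w))"

lemma winding_eq:
  "of_int (winding u v w) =
     ((v - u) - of_int (round (v - u))) + ((w - v) - of_int (round (w - v))) + ((u - w) - of_int (round (u - w)))"
  by (simp add: winding_def)

lemma winding_rotate: "winding v w u = winding u v w"
  by (simp add: winding_def)

lemma circle_norm_le: "circle_norm x \<le> \<bar>x - of_int n\<bar>"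
  by (rule round_diff_minimal)

lemma circle_norm_minus: "circle_norm (- x) = circle_norm x"
proof (rule antisym)
  show "circle_norm (- x) \<le> circle_norm x" using circle_norm_le[of "- x" "- round x"] by simp
  show "circle_norm x \<le> circle_norm (- x)" using circle_norm_le[of "x" "- round (- x)"] by simp
qed

lemma circle_norm_commute: "circle_norm (x - y) = circle_norm (y - x)"
  using circle_norm_minus[of "x - y"] by simp

lemma round_minus_eq: "circle_norm x < 1/2 \<Longrightarrow> round (- x) = - round x"
  by (rule round_unique') (simp add: abs_minus_commute)

lemma winding_swap:
  assumes "circle_norm (v - u) < 1/2" "circle_norm (w - v) < 1/2" "circle_norm (u - w) < 1/2"
  shows "winding v u w = - winding u v w"
  using round_minus_eq[OF assms(1)] round_minus_eq[OF assms(2)] round_minus_eq[OF assms(3)]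
  by (simp add: winding_def)

text \<open>A change of the integer would require one of the reduced differences to jump across
  \<open>1/2\<close>, but they are at most \<open>2/5\<close> and change by at most
  \<open>1/10\<close>.\<close>

lemma winding_stable:
  assumes "circle_norm (u' - u) \<le> 1/20" "circle_norm (v' - v) \<le> 1/20" "circle_norm (w' - w) \<le> 1/20"
    and "circle_norm (v - u) \<le> 2/5" "circle_norm (w - v) \<le> 2/5" "circle_norm (u - w) \<le> 2/5"
    and "circle_norm (v' - u') \<le> 2/5" "circle_norm (w' - v') \<le> 2/5" "circle_norm (u' - w') \<le> 2/5"
  shows "winding u' v' w' = winding u v w"
proof -
  have step: "((b' - a') - of_int (round (b' - a'))) - ((b - a) - of_int (round (b - a))) =
      ((b' - b) - of_int (round (b' - b))) - ((a' - a) - of_int (round (a' - a)))"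
    if "circle_norm (a' - a) \<le> 1/20" "circle_norm (b' - b) \<le> 1/20"
      "circle_norm (b - a) \<le> 2/5" "circle_norm (b' - a') \<le> 2/5" for a b a' b' :: real
  proof -
    define n where "n = round (b - a) + round (b' - b) - round (a' - a) - round (b' - a')"
    have "of_int n = (((b' - a') - of_int (round (b' - a'))) - ((b - a) - of_int (round (b - a)))) -
      (((b' - b) - of_int (round (b' - b))) - ((a' - a) - of_int (round (a' - a))))"
      by (simp add: n_def)
    moreover have "\<bar>\<dots>\<bar> < (1::real)" using that by linarith
    ultimately have "\<bar>of_int n\<bar> < (1::real)" by metis
    then have "n = 0" by linarith
    then show ?thesis by (simp add: n_def algebra_simps flip: of_int_add of_int_diff)
  qed
  have "of_int (winding u' v' w') = (of_int (winding u v w) :: real)"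
    unfolding winding_eq
    using step[OF assms(1,2,4,7)] step[OF assms(2,3,5,8)] step[OF assms(3,1,6,9)] by linarith
  then show ?thesis by simp
qed

locale circle_in_space =
  fixes \<alpha> :: "real \<Rightarrow> 'a::metric_space" and a :: real
  assumes a: "0 < a"
    and dist_\<alpha>: "\<And>s t. s \<in> {0..1} \<Longrightarrow> t \<in> {0..1} \<Longrightarrow> dist (\<alpha> s) (\<alpha> t) = circle_dist a (a * s) (a * t)"
begin

definition A :: "real \<Rightarrow> 'a" where "A u = \<alpha> (frac u)"

lemma dist_A: "dist (A u) (A v) = a * circle_norm (u - v)"
proof -
  define f where "f = frac u - frac v"
  define k where "k = \<lfloor>u\<rfloor> - \<lfloor>v\<rfloor>"
  have uv: "u - v = f + of_int k" by (simp add: f_def k_def frac_def)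
  have f: "\<bar>f\<bar> < 1" unfolding f_def using frac_ge_0[of u] frac_ge_0[of v] frac_lt_1[of u] frac_lt_1[of v] by linarith
  have "circle_norm (u - v) = min \<bar>f\<bar> (1 - \<bar>f\<bar>)"
  proof (rule antisym)
    have "circle_norm (u - v) \<le> \<bar>f\<bar>" using circle_norm_le[of "u - v" k] uv by simp
    moreover have "circle_norm (u - v) \<le> 1 - \<bar>f\<bar>"
      using circle_norm_le[of "u - v" "k + 1"] circle_norm_le[of "u - v" "k - 1"] uv f by (cases "0 \<le> f") auto
    ultimately show "circle_norm (u - v) \<le> min \<bar>f\<bar> (1 - \<bar>f\<bar>)" by simp
    define m where "m = round (u - v) - k"
    have "circle_norm (u - v) = \<bar>f - of_int m\<bar>" by (simp add: uv m_def)
    moreover have "min \<bar>f\<bar> (1 - \<bar>f\<bar>) \<le> \<bar>f - of_int m\<bar>"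
    proof (cases "m = 0")
      case False
      then have "1 \<le> \<bar>of_int m :: real\<bar>" by linarith
      then show ?thesis by linarith
    qed simp
    ultimately show "min \<bar>f\<bar> (1 - \<bar>f\<bar>) \<le> circle_norm (u - v)" by simp
  qed
  moreover have "dist (A u) (A v) = min (a * \<bar>f\<bar>) (a - a * \<bar>f\<bar>)"
    using frac_ge_0[of u] frac_ge_0[of v] frac_lt_1[of u] frac_lt_1[of v] a
    by (simp add: A_def dist_\<alpha> circle_dist_def f_def abs_mult flip: right_diff_distrib)
  moreover have "\<dots> = a * min \<bar>f\<bar> (1 - \<bar>f\<bar>)"
    using a by (simp add: min_mult_distrib_left algebra_simps)
  ultimately show ?thesis by simp
qed

lemma dist_A_le: "dist (A u) (A v) \<le> a * \<bar>u - v\<bar>"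
  unfolding dist_A using circle_norm_le[of "u - v" 0] a by simp

lemma A_add_int: "A (u + of_int n) = A u"
  by (simp add: A_def)

lemma continuous_A: "continuous_on UNIV A"
proof -
  have "a-lipschitz_on UNIV A" by (rule lipschitz_onI) (use dist_A_le a in \<open>auto simp: dist_real_def\<close>)
  then show ?thesis by (rule lipschitz_on_continuous_on)
qed

lemma \<alpha>_closed: "\<alpha> 1 = \<alpha> 0"
  using dist_\<alpha>[of 1 0] a by (simp add: circle_dist_def)

lemma A_eq_\<alpha>: "t \<in> {0..1} \<Longrightarrow> A t = \<alpha> t"
  using \<alpha>_closed by (cases "t = 1") (auto simp: A_def frac_eq[THEN iffD2])

lemma path_image_\<alpha>: "path_image \<alpha> = range A"
proof
  show "path_image \<alpha> \<subseteq> range A" unfolding path_image_def using A_eq_\<alpha> by (metis image_subsetI rangeI)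
  show "range A \<subseteq> path_image \<alpha>"
    unfolding path_image_def A_def using frac_ge_0 frac_lt_1 by (force intro: less_imp_le)
qed

lemma path_length_\<alpha>: "path_length \<alpha> = ennreal a"
proof (rule antisym)
  show "path_length \<alpha> \<le> ennreal a"
    unfolding path_length_def
  proof (rule SUP_least, clarify)
    fix n :: nat and t :: "nat \<Rightarrow> real" assume t: "t ` {..n} \<subseteq> {0..1}" "mono_on {..n} t"
    have "dist (\<alpha> (t i)) (\<alpha> (t (Suc i))) \<le> a * (t (Suc i) - t i)" if "i < n" for i
    proof -
      have "t i \<in> {0..1}" "t (Suc i) \<in> {0..1}" "t i \<le> t (Suc i)"
        using t that by (auto simp: mono_on_def image_subset_iff)
      then show ?thesis using dist_A_le[of "t i" "t (Suc i)"] by (simp add: A_eq_\<alpha>)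
    qed
    then have "(\<Sum>i<n. dist (\<alpha> (t i)) (\<alpha> (t (Suc i)))) \<le> (\<Sum>i<n. a * (t (Suc i) - t i))"
      by (intro sum_mono) auto
    also have "\<dots> = a * (t n - t 0)" by (simp add: sum_lessThan_telescope flip: sum_distrib_left)
    also have "\<dots> \<le> a * 1"
    proof -
      have "t n \<in> {0..1}" "t 0 \<in> {0..1}" using t(1) by auto
      then show ?thesis using a by (intro mult_left_mono) auto
    qed
    finally show "ennreal (\<Sum>i<n. dist (\<alpha> (t i)) (\<alpha> (t (Suc i)))) \<le> ennreal a" by (simp add: ennreal_leI)
  qed
  have "(\<Sum>i<3. dist (\<alpha> (real i / 3)) (\<alpha> (real (Suc i) / 3))) = a"
    using a by (simp add: eval_nat_numeral dist_\<alpha> circle_dist_def min_def)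
  then have "ennreal a = ennreal (\<Sum>i<3. dist (\<alpha> (real i / 3)) (\<alpha> (real (Suc i) / 3)))" by simp
  also have "\<dots> \<le> path_length \<alpha>"
    unfolding path_length_def
    by (rule SUP_upper2[where i = "(3, \<lambda>i. real i / 3)"]) (auto simp: mono_on_def)
  finally show "ennreal a \<le> path_length \<alpha>" .
qed

definition tube :: "real \<Rightarrow> 'a set" where
  "tube e = {x. \<exists>u. dist x (A u) < e}"

lemma open_tube: "open (tube e)"
proof -
  have "tube e = (\<Union>u. ball (A u) e)" by (auto simp: tube_def dist_commute)
  then show ?thesis by auto
qed

lemma range_A_tube: "0 < e \<Longrightarrow> range A \<subseteq> tube e"
  unfolding tube_def by (metis (mono_tags, lifting) dist_eq_0_iff image_subsetI mem_Collect_eq)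

lemma tube_mono: "d \<le> e \<Longrightarrow> tube d \<subseteq> tube e"
  unfolding tube_def by (auto intro: less_le_trans)

lemma tube_in_open:
  assumes "open U" "path_image \<alpha> \<subseteq> U" "compact (UNIV :: 'a set)"
  obtains e where "0 < e" "tube e \<subseteq> U"
proof -
  have "compact (path_image \<alpha>)"
    unfolding path_image_\<alpha>
  proof -
    have "range A = A ` {0..1}"
      using path_image_\<alpha> A_eq_\<alpha> unfolding path_image_def by (metis image_cong)
    then show "compact (range A)"
      using compact_continuous_image[OF continuous_on_subset[OF continuous_A], of "{0..1}"] by simp
  qed
  then obtain e where e: "e > 0" "\<And>x. x \<in> path_image \<alpha> \<Longrightarrow> ball x e \<subseteq> U"
    using Heine_Borel_lemma[of "path_image \<alpha>" "{U}"] assms by auto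
  have "tube e \<subseteq> U"
    using e(2) unfolding tube_def path_image_\<alpha> by (force simp: dist_commute)
  then show thesis using that e(1) by blast
qed

text \<open>Straight-line homotopies in the universal cover of the circle.\<close>

lemma homotopic_loops_A_line:
  assumes "\<sigma> = 1 \<or> \<sigma> = (-1::int)"
  shows "homotopic_loops (range A) (A \<circ> linepath x (x + of_int \<sigma>)) (if \<sigma> = 1 then \<alpha> else reversepath \<alpha>)"
proof -
  define h where "h = (\<lambda>y. A ((1 - fst y) * (x + snd y * of_int \<sigma>) + fst y * (snd y * of_int \<sigma>)))"
  show ?thesis
    unfolding homotopic_loops
  proof (intro exI[of _ h] conjI ballI)
    show "continuous_on ({0..1} \<times> {0..1}) h" unfolding h_def
      by (rule continuous_on_compose2[OF continuous_A]) (auto intro!: continuous_intros)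
    show "h \<in> {0..1} \<times> {0..1} \<rightarrow> range A" by (auto simp: h_def)
    fix t :: real assume t: "t \<in> {0..1}"
    show "h (0, t) = (A \<circ> linepath x (x + of_int \<sigma>)) t"
      by (simp add: h_def linepath_def algebra_simps)
    have "A (- t) = \<alpha> (1 - t)" using A_add_int[of "- t" 1] A_eq_\<alpha>[of "1 - t"] t by simp
    then show "h (1, t) = (if \<sigma> = 1 then \<alpha> else reversepath \<alpha>) t"
      using assms t A_eq_\<alpha>[of t] by (auto simp: h_def reversepath_def)
    have "(1 - t) * (x + of_int \<sigma>) + t * of_int \<sigma> = (1 - t) * x + of_int \<sigma>" by (simp add: algebra_simps)
    then show "pathfinish (h \<circ> Pair t) = pathstart (h \<circ> Pair t)"
      by (simp add: pathfinish_def pathstart_def h_def A_add_int)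
  qed
qed

end

section \<open>Subdivision of a path into arcs of equal length\<close>

lemma path_length_le_Lipschitz:
  assumes "0 \<le> C" "\<And>s t. s \<in> {0..1} \<Longrightarrow> t \<in> {0..1} \<Longrightarrow> s \<le> t \<Longrightarrow> dist (p s) (p t) \<le> C * (t - s)"
  shows "path_length p \<le> ennreal C"
  unfolding path_length_def
proof (rule SUP_least, clarify)
  fix n :: nat and t :: "nat \<Rightarrow> real" assume t: "t ` {..n} \<subseteq> {0..1}" "mono_on {..n} t"
  have "dist (p (t i)) (p (t (Suc i))) \<le> C * (t (Suc i) - t i)" if "i < n" for i
  proof -
    have "t i \<in> {0..1}" "t (Suc i) \<in> {0..1}" "t i \<le> t (Suc i)"
      using t that by (auto simp: mono_on_def image_subset_iff)
    then show ?thesis using assms(2) by simp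
  qed
  then have "(\<Sum>i<n. dist (p (t i)) (p (t (Suc i)))) \<le> (\<Sum>i<n. C * (t (Suc i) - t i))"
    by (intro sum_mono) auto
  also have "\<dots> = C * (t n - t 0)" by (simp add: sum_lessThan_telescope flip: sum_distrib_left)
  also have "\<dots> \<le> C * 1"
  proof -
    have "t n \<in> {0..1}" "t 0 \<in> {0..1}" using t(1) by auto
    then show ?thesis using assms(1) by (intro mult_left_mono) auto
  qed
  finally show "ennreal (\<Sum>i<n. dist (p (t i)) (p (t (Suc i)))) \<le> ennreal C" by (simp add: ennreal_leI)
qed

text \<open>The value at \<open>u\<close> is the length of \<open>p\<close> on the interval from
  \<open>0\<close> to \<open>u\<close>, the supremum of the lengths of inscribed polygons.\<close>

lemma arc_length_function:
  assumes C: "0 \<le> C" and p: "path_length p \<le> ennreal C"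
  obtains \<l> :: "real \<Rightarrow> real" where "\<l> 0 = 0" "\<l> 1 \<le> C"
    "\<And>u v. 0 \<le> u \<Longrightarrow> u \<le> v \<Longrightarrow> v \<le> 1 \<Longrightarrow> \<l> u + dist (p u) (p v) \<le> \<l> v"
proof -
  define L where "L x = {\<Sum>i<m. dist (p (s i)) (p (s (Suc i))) | (m::nat) s. s ` {..m} \<subseteq> {0..x} \<and> mono_on {..m} s}"
    for x :: real
  have LI: "(\<Sum>i<m. dist (p (s i)) (p (s (Suc i)))) \<in> L x"
    if "s ` {..m} \<subseteq> {0..x}" "mono_on {..m} s" for m :: nat and s x
    using that unfolding L_def by blast
  have ub: "e \<le> C" if eL: "e \<in> L x" "x \<le> 1" for e x
  proof -
    obtain m s where ms: "s ` {..m} \<subseteq> {0..x}" "mono_on {..m} s" "e = (\<Sum>i<m. dist (p (s i)) (p (s (Suc i))))"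
      using eL(1) unfolding L_def by blast
    have "s ` {..m} \<subseteq> {0..1}" using ms(1) eL(2) by fastforce
    then have "ennreal e \<le> path_length p"
      unfolding path_length_def ms(3) using ms(2)
      by (intro SUP_upper2[where i = "(m, s)"]) auto
    then have "ennreal e \<le> ennreal C" using p by (rule order_trans)
    then show ?thesis using C by simp
  qed
  have bdd: "bdd_above (L x)" if "x \<le> 1" for x using ub[OF _ that] by (auto simp: bdd_above_def)
  have ne: "0 \<in> L x" if "0 \<le> x" for x using LI[of "\<lambda>_. 0" 0 x] that by (simp add: mono_on_def)
  have "e = 0" if eL: "e \<in> L 0" for e
  proof -
    obtain m s where ms: "s ` {..m} \<subseteq> {0..0::real}" "e = (\<Sum>i<m. dist (p (s i)) (p (s (Suc i))))"
      using eL unfolding L_def by blast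
    have "s i = 0" if "i \<le> m" for i using ms(1) that by (auto simp: image_subset_iff)
    then show ?thesis by (simp add: ms(2))
  qed
  then have "L 0 = {0}" using ne[of 0] by auto
  then have "Sup (L 0) = 0" by simp
  moreover have "Sup (L 1) \<le> C" using ne[of 1] ub by (intro cSup_least) auto
  moreover have "Sup (L u) + dist (p u) (p v) \<le> Sup (L v)" if uv: "0 \<le> u" "u \<le> v" "v \<le> 1" for u v
  proof -
    have "Sup (L u) \<le> Sup (L v) - dist (p u) (p v)"
    proof (rule cSup_least)
      show "L u \<noteq> {}" using ne[OF uv(1)] by auto
      fix e assume "e \<in> L u"
      then obtain m s where ms: "s ` {..m} \<subseteq> {0..u}" "mono_on {..m} s" "e = (\<Sum>i<m. dist (p (s i)) (p (s (Suc i))))"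
        unfolding L_def by blast
      define s' where "s' i = (if i \<le> m then s i else if i = Suc m then u else v)" for i
      have sm: "s m \<le> u" "\<And>i. i \<le> m \<Longrightarrow> 0 \<le> s i \<and> s i \<le> u" using ms(1) by auto
      have "s' ` {..Suc (Suc m)} \<subseteq> {0..v}" using sm uv by (force simp: s'_def)
      moreover have "mono_on {..Suc (Suc m)} s'"
        using ms(2) sm uv unfolding mono_on_def s'_def by (auto intro: order_trans)
      ultimately have "(\<Sum>i<Suc (Suc m). dist (p (s' i)) (p (s' (Suc i)))) \<in> L v" by (rule LI)
      then have "(\<Sum>i<Suc (Suc m). dist (p (s' i)) (p (s' (Suc i)))) \<le> Sup (L v)"
        using bdd uv by (intro cSup_upper) auto
      moreover have "(\<Sum>i<m. dist (p (s' i)) (p (s' (Suc i)))) = e"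
        unfolding ms(3) by (rule sum.cong) (auto simp: s'_def)
      ultimately have "e + dist (p (s m)) (p u) + dist (p u) (p v) \<le> Sup (L v)" by (simp add: s'_def)
      then show "e \<le> Sup (L v) - dist (p u) (p v)" by (smt (verit) zero_le_dist)
    qed
    then show ?thesis by simp
  qed
  ultimately show thesis using that[of "\<lambda>x. Sup (L x)"] by blast
qed

text \<open>For \<open>j > 0\<close> the point \<open>t j\<close> is the supremum of the times at
  which the length travelled is at most \<open>j * C / n\<close>. Inside the arcs the bound follows
  from the additivity of length, and at their ends from the continuity of \<open>p\<close>.\<close>

lemma equal_length_subdivision:
  assumes C: "0 \<le> C" and p: "path_length p \<le> ennreal C" and pp: "path p" and n: "0 < (n::nat)"
  obtains t :: "nat \<Rightarrow> real" where "t 0 = 0" "t n = 1" "\<And>j. t j \<in> {0..1}" "\<And>i j. i \<le> j \<Longrightarrow> j \<le> n \<Longrightarrow> t i \<le> t j"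
    "\<And>j u v. j < n \<Longrightarrow> t j \<le> u \<Longrightarrow> u \<le> v \<Longrightarrow> v \<le> t (Suc j) \<Longrightarrow>
       dist (p (t j)) (p u) + dist (p u) (p v) + dist (p v) (p (t (Suc j))) \<le> C / real n"
proof -
  obtain \<l> :: "real \<Rightarrow> real" where l0: "\<l> 0 = 0" and l1: "\<l> 1 \<le> C"
    and add: "\<And>u v. 0 \<le> u \<Longrightarrow> u \<le> v \<Longrightarrow> v \<le> 1 \<Longrightarrow> \<l> u + dist (p u) (p v) \<le> \<l> v"
    using arc_length_function[OF C p] by blast
  have lmono: "\<l> u \<le> \<l> v" if "0 \<le> u" "u \<le> v" "v \<le> 1" for u v
    using add[OF that] zero_le_dist[of "p u" "p v"] by linarith
  define E where "E j = {x. 0 \<le> x \<and> x \<le> 1 \<and> \<l> x \<le> real j * (C / real n)}" for j :: nat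
  define t where "t j = (if j = 0 then 0 else Sup (E j))" for j
  have E: "0 \<in> E j" "bdd_above (E j)" for j
  proof -
    show "0 \<in> E j" using C l0 by (simp add: E_def)
    show "bdd_above (E j)" by (rule bdd_aboveI[of _ 1]) (simp add: E_def)
  qed
  have t01: "t j \<in> {0..1}" for j
  proof -
    have "0 \<le> Sup (E j)" by (rule cSup_upper[OF E])
    moreover have "Sup (E j) \<le> 1" 
    proof (rule cSup_least)
      show "E j \<noteq> {}" using E(1) by blast
    qed (simp add: E_def)
    ultimately show ?thesis by (simp add: t_def)
  qed
  have tn: "t n = 1"
  proof -
    have "1 \<in> E n" using l1 n by (simp add: E_def)
    then have "1 \<le> t n" using cSup_upper[OF _ E(2)] n by (simp add: t_def)
    then show ?thesis using t01[of n] by simp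
  qed
  have tmono: "t i \<le> t j" if "i \<le> j" for i j
  proof (cases "i = 0")
    case True
    then show ?thesis using t01[of j] by (simp add: t_def)
  next
    case False
    have "E i \<subseteq> E j"
      using that C mult_right_mono[of "real i" "real j" "C / real n"] by (auto simp: E_def intro: order_trans)
    then show ?thesis using False that E by (auto simp: t_def intro!: cSup_subset_mono)
  qed
  have lower: "real j * (C / real n) \<le> \<l> u" if "t j < u" "u \<le> 1" for j u
  proof (cases "j = 0")
    case True
    then show ?thesis using lmono[of 0 u] that l0 by (simp add: t_def)
  next
    case False
    then have "u \<notin> E j" using that cSup_upper[OF _ E(2), of u j] by (auto simp: t_def)
    then show ?thesis using that t01[of j] by (auto simp: E_def)
  qed
  have upper: "\<l> u \<le> real j * (C / real n)" if u: "0 \<le> u" "u < t j" for j u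
  proof -
    have "j \<noteq> 0"
    proof
      assume "j = 0"
      then show False using u by (simp add: t_def)
    qed
    then have "u < Sup (E j)" using u by (simp add: t_def)
    then obtain x where "x \<in> E j" "u < x" using less_cSup_iff[OF _ E(2)] E(1) by blast
    then show ?thesis using lmono[of u x] u by (simp add: E_def)
  qed
  have inner: "dist (p x) (p u) + dist (p u) (p v) + dist (p v) (p y) \<le> C / real n"
    if "t j < x" "x \<le> u" "u \<le> v" "v \<le> y" "y < t (Suc j)" for j x u v y
  proof -
    have b: "0 \<le> x" "y \<le> 1" using that t01[of j] t01[of "Suc j"] by auto
    have "\<l> x + dist (p x) (p u) + dist (p u) (p v) + dist (p v) (p y) \<le> \<l> y"
      using add[of x u] add[of u v] add[of v y] that b by linarith
    moreover have "real j * (C / real n) \<le> \<l> x" using lower[of j x] that b by auto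
    moreover have "\<l> y \<le> real (Suc j) * (C / real n)" using upper[of y "Suc j"] that b by auto
    moreover have "real (Suc j) * y - real j * y = y" for y by (simp add: algebra_simps)
    then have "real (Suc j) * (C / real n) - real j * (C / real n) = C / real n" .
    ultimately show ?thesis by linarith
  qed
  have "dist (p (t j)) (p u) + dist (p u) (p v) + dist (p v) (p (t (Suc j))) \<le> C / real n"
    if uv: "t j \<le> u" "u \<le> v" "v \<le> t (Suc j)" for j u v
  proof (cases "t j = t (Suc j)")
    case True
    then have "u = t j" "v = t j" using uv by auto
    then show ?thesis using True C by simp
  next
    case False
    then have lt: "t j < t (Suc j)" using tmono[of j "Suc j"] by auto
    define m where "m = (t j + t (Suc j)) / 2"
    define sq where "sq x k = m + (1 - 1 / real (Suc (Suc k))) * (x - m)" for x and k :: nat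
    have sq_lim: "(\<lambda>k. sq x k) \<longlonglongrightarrow> x" for x
    proof -
      have "(\<lambda>k. 1 / real (Suc (Suc k))) \<longlonglongrightarrow> 0"
        using LIMSEQ_Suc[OF lim_inverse_n'] LIMSEQ_Suc by blast
      then have "(\<lambda>k. m + (1 - 1 / real (Suc (Suc k))) * (x - m)) \<longlonglongrightarrow> m + (1 - 0) * (x - m)"
        by (intro tendsto_intros)
      then show ?thesis by (simp add: sq_def)
    qed
    have sq_mono: "sq x k \<le> sq y k" if "x \<le> y" for x y k
      unfolding sq_def using that by (intro add_left_mono mult_left_mono) auto
    have sq_ends: "t j < sq (t j) k" "sq (t (Suc j)) k < t (Suc j)" for k
    proof -
      define c where "c = 1 - 1 / real (Suc (Suc k))"
      have c: "c < 1" by (simp add: c_def)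
      have d: "0 < (t (Suc j) - t j) / 2" using lt by simp
      have "c * ((t (Suc j) - t j) / 2) < 1 * ((t (Suc j) - t j) / 2)" by (rule mult_strict_right_mono[OF c d])
      moreover have "t j - m = - ((t (Suc j) - t j) / 2)" "t (Suc j) - m = (t (Suc j) - t j) / 2"
        by (simp_all add: m_def field_simps)
      ultimately show "t j < sq (t j) k" "sq (t (Suc j)) k < t (Suc j)"
        unfolding sq_def c_def[symmetric] by (simp_all add: m_def field_simps)
    qed
    have sq01: "sq x k \<in> {0..1}" if "t j \<le> x" "x \<le> t (Suc j)" for x k
      using sq_mono[OF that(1), of k] sq_mono[OF that(2), of k] sq_ends[of k] t01[of j] t01[of "Suc j"] by auto
    have pl: "(\<lambda>k. p (sq x k)) \<longlonglongrightarrow> p x" if "t j \<le> x" "x \<le> t (Suc j)" for x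
      by (rule continuous_on_tendsto_compose[OF pp[unfolded path_def] sq_lim])
        (use sq01[OF that] that t01[of j] t01[of "Suc j"] in auto)
    have "(\<lambda>k. dist (p (sq (t j) k)) (p (sq u k)) + dist (p (sq u k)) (p (sq v k)) + dist (p (sq v k)) (p (sq (t (Suc j)) k)))
        \<longlonglongrightarrow> dist (p (t j)) (p u) + dist (p u) (p v) + dist (p v) (p (t (Suc j)))"
      using uv lt by (intro tendsto_add tendsto_dist pl) auto
    then show ?thesis
    proof (rule LIMSEQ_le_const2, intro exI[of _ 0] allI impI)
      fix k
      show "dist (p (sq (t j) k)) (p (sq u k)) + dist (p (sq u k)) (p (sq v k)) + dist (p (sq v k)) (p (sq (t (Suc j)) k)) \<le> C / real n"
        by (rule inner[of j]) (use uv sq_mono sq_ends in auto)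
    qed
  qed
  then show thesis using that[of t] t01 tn tmono by (simp add: t_def)
qed

text \<open>The following two lemmas add up consecutive arcs of length at most \<open>d\<close>. If their total length equals
  the distance of the end points, then the triangle inequality is sharp at every point in between.\<close>

lemma dist_along_arcs:
  fixes t :: "nat \<Rightarrow> real"
  assumes arcs: "\<And>j. i \<le> j \<Longrightarrow> j < i + n \<Longrightarrow> dist (p (t j)) (p (t (Suc j))) \<le> d"
  shows "dist (p (t i)) (p (t (i + n))) \<le> real n * d"
  using assms
proof (induction n)
  case (Suc n)
  have "dist (p (t i)) (p (t (i + Suc n))) \<le> dist (p (t i)) (p (t (i + n))) + dist (p (t (i + n))) (p (t (Suc (i + n))))"
    by (metis add_Suc_right dist_triangle)
  also have "\<dots> \<le> real n * d + d" using Suc by (intro add_mono) auto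
  finally show ?case by (simp add: algebra_simps)
qed simp

lemma dist_through_arc_point:
  fixes t :: "nat \<Rightarrow> real"
  assumes arcs: "\<And>j u v. j < m \<Longrightarrow> t j \<le> u \<Longrightarrow> u \<le> v \<Longrightarrow> v \<le> t (Suc j) \<Longrightarrow>
       dist (p (t j)) (p u) + dist (p u) (p v) + dist (p v) (p (t (Suc j))) \<le> d"
    and mono: "\<And>i j. i \<le> j \<Longrightarrow> j \<le> m \<Longrightarrow> t i \<le> t j"
    and i: "i + n \<le> m" and u: "t i \<le> u" "u \<le> t (i + n)" and n: "0 < n"
  shows "dist (p (t i)) (p u) + dist (p u) (p (t (i + n))) \<le> real n * d"
proof -
  define k where "k = (LEAST k. u \<le> t (i + Suc k))"
  have ex: "u \<le> t (i + Suc (n - 1))" using u n by simp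
  have k1: "u \<le> t (i + Suc k)" unfolding k_def by (rule LeastI[of _ "n - 1"]) (rule ex)
  have "k \<le> n - 1" unfolding k_def by (rule Least_le) (rule ex)
  then have kn: "k < n" using n by simp
  have k2: "t (i + k) \<le> u"
  proof (cases k)
    case 0
    then show ?thesis using u by simp
  next
    case (Suc k')
    then have "\<not> u \<le> t (i + Suc k')" using not_less_Least[of k' "\<lambda>k. u \<le> t (i + Suc k)"] by (simp add: k_def)
    then show ?thesis using Suc by simp
  qed
  have step: "dist (p (t j)) (p (t (Suc j))) \<le> d" if "j < m" for j
    using arcs[OF that, of "t j" "t j"] mono[of j "Suc j"] that by (auto simp: add.commute)
  have "dist (p (t i)) (p (t (i + k))) \<le> real k * d"
    by (rule dist_along_arcs) (use step i kn in auto)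
  moreover have "dist (p (t (i + Suc k))) (p (t (i + Suc k + (n - Suc k)))) \<le> real (n - Suc k) * d"
    by (rule dist_along_arcs) (use step i kn in auto)
  moreover have "dist (p (t (i + k))) (p u) + dist (p u) (p (t (i + Suc k))) \<le> d"
    using arcs[of "i + k" u u] k1 k2 i kn by simp
  moreover have "i + Suc k + (n - Suc k) = i + n" using kn by simp
  ultimately have "dist (p (t i)) (p (t (i + k))) + dist (p (t (i + k))) (p u) + dist (p u) (p (t (i + Suc k)))
       + dist (p (t (i + Suc k))) (p (t (i + n))) \<le> real k * d + d + real (n - Suc k) * d" by simp
  moreover have "real k * d + d + real (n - Suc k) * d = real n * d"
    using kn by (simp add: of_nat_diff algebra_simps)
  moreover have "dist (p (t i)) (p u) \<le> dist (p (t i)) (p (t (i + k))) + dist (p (t (i + k))) (p u)"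
    "dist (p u) (p (t (i + n))) \<le> dist (p u) (p (t (i + Suc k))) + dist (p (t (i + Suc k))) (p (t (i + n)))"
    by (rule dist_triangle)+
  ultimately show ?thesis by linarith
qed

section \<open>Loops near the circle that wind around it once\<close>

context circle_in_space
begin

lemma circle_norm_near:
  assumes "dist x (A s) \<le> e" "dist y (A t) \<le> e"
  shows "a * circle_norm (t - s) \<le> dist x y + 2 * e"
proof -
  have "dist (A t) (A s) \<le> dist (A t) y + dist y x + dist x (A s)"
    by (smt (verit) dist_triangle)
  then show ?thesis using assms unfolding dist_A by (simp add: dist_commute)
qed

text \<open>The angles at the points \<open>t j\<close> are lifted to the real line. As the arcs are
  short, the lift changes by the reduced difference of the angles, and over a third of the loop the
  total change stays below \<open>1/2\<close>. So over each third it is again the reduced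
  difference, and the total change is the winding number of the three points. The loop
  \<open>q\<close> and the circle along the lifted angles form a ladder whose rungs are geodesics of
  length below \<open>e\<close> and whose squares fit in balls of radius
  \<open>\<delta>\<close>.\<close>

lemma winding_loop_homotopic:
  fixes N :: nat
  assumes comp: "compact (UNIV :: 'a set)" and geo: "geodesic_space TYPE('a)"
    and slsc: "\<And>(x::'a) p. loop p \<Longrightarrow> path_image p \<subseteq> ball x \<delta> \<Longrightarrow> \<exists>b. homotopic_loops (ball x \<rho>) p (\<lambda>_. b)"
    and N: "0 < N" "a / (3 * real N) < \<delta> / 10"
    and e: "0 < e" "e \<le> \<delta> / 10" "e \<le> \<rho>" "e \<le> a / (100 * real N)"
    and ang: "\<And>x. x \<in> tube e \<Longrightarrow> dist x (A (ang x)) < e"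
    and q: "loop q" "path_image q \<subseteq> tube e"
    and t: "t 0 = 0" "t (3 * N) = 1" "\<And>i j. i \<le> j \<Longrightarrow> j \<le> 3 * N \<Longrightarrow> t i \<le> t j"
    and arcs: "\<And>j u v. j < 3 * N \<Longrightarrow> t j \<le> u \<Longrightarrow> u \<le> v \<Longrightarrow> v \<le> t (Suc j) \<Longrightarrow> dist (q u) (q v) \<le> a / (3 * real N)"
    and w: "winding (ang (q 0)) (ang (q (t N))) (ang (q (t (2 * N)))) = \<sigma>" and \<sigma>: "\<sigma> = 1 \<or> \<sigma> = -1"
  shows "homotopic_loops (tube \<rho>) q (if \<sigma> = 1 then \<alpha> else reversepath \<alpha>)"
proof -
  have qp: "path q" and q01: "q 1 = q 0" using q(1) by (auto simp: loop_def pathfinish_def pathstart_def)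
  have t01: "t j \<in> {0..1}" if "j \<le> 3 * N" for j using t(3)[of 0 j] t(3)[of j "3 * N"] t(1,2) that by auto
  have qt: "q u \<in> tube e" if "u \<in> {0..1}" for u using q(2) that by (auto simp: path_image_def)
  define P where "P j = ang (q (t j))" for j
  define d where "d i = (P (Suc i) - P i) - of_int (round (P (Suc i) - P i))" for i
  define \<theta> where "\<theta> j = P 0 + (\<Sum>i<j. d i)" for j
  have P: "dist (q (t j)) (A (P j)) < e" if "j \<le> 3 * N" for j
    unfolding P_def by (intro ang qt t01 that)
  have sumd: "\<exists>n::int. (\<Sum>i=j..<j+k. d i) = P (j + k) - P j - of_int n" for j k
  proof (induction k)
    case 0
    show ?case by (intro exI[of _ 0]) simp
  next
    case (Suc k)
    then obtain n :: int where "(\<Sum>i=j..<j+k. d i) = P (j + k) - P j - of_int n" by blast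
    then show ?case by (intro exI[of _ "n + round (P (Suc (j + k)) - P (j + k))"]) (simp add: d_def)
  qed
  have A\<theta>: "A (\<theta> j) = A (P j)" for j
  proof -
    obtain n :: int where "(\<Sum>i=0..<0+j. d i) = P (0 + j) - P 0 - of_int n" using sumd by blast
    then have "\<theta> j = P j + of_int (- n)" by (simp add: \<theta>_def atLeast0LessThan)
    then show ?thesis using A_add_int by metis
  qed
  have q\<theta>: "dist (q (t j)) (A (\<theta> j)) < e" if "j \<le> 3 * N" for j using P[OF that] A\<theta> by simp
  define \<mu> where "\<mu> = a / (3 * real N)"
  have ad: "a * \<bar>d i\<bar> \<le> \<mu> + 2 * e" if "i < 3 * N" for i
  proof -
    have "a * circle_norm (P (Suc i) - P i) \<le> dist (q (t i)) (q (t (Suc i))) + 2 * e"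
      by (rule circle_norm_near) (use P[of i] P[of "Suc i"] that in auto)
    also have "dist (q (t i)) (q (t (Suc i))) \<le> \<mu>"
      unfolding \<mu>_def using that t(3)[of i "Suc i"] by (intro arcs) auto
    finally show ?thesis by (simp add: d_def)
  qed
  have Ne: "real N * e \<le> a / 100" using e(4) N(1) by (simp add: field_simps)
  have block: "(\<Sum>i=j..<j+N. d i) = (P (j + N) - P j) - of_int (round (P (j + N) - P j))" if j: "j + N \<le> 3 * N" for j
  proof -
    obtain n :: int where n: "(\<Sum>i=j..<j+N. d i) = P (j + N) - P j - of_int n" using sumd by blast
    have "a * \<bar>\<Sum>i=j..<j+N. d i\<bar> \<le> a * (\<Sum>i=j..<j+N. \<bar>d i\<bar>)" using a by (intro mult_left_mono) auto
    also have "\<dots> = (\<Sum>i=j..<j+N. a * \<bar>d i\<bar>)" by (rule sum_distrib_left)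
    also have "\<dots> \<le> (\<Sum>i=j..<j+N. \<mu> + 2 * e)" using j by (intro sum_mono ad) auto
    also have "\<dots> = real N * \<mu> + 2 * (real N * e)" by (simp add: algebra_simps)
    also have "real N * \<mu> = a / 3" using N(1) by (simp add: \<mu>_def)
    finally have "a * \<bar>\<Sum>i=j..<j+N. d i\<bar> \<le> a / 3 + 2 * (real N * e)" .
    moreover have "a / 3 + 2 * (real N * e) < a * (1/2)" using Ne a by linarith
    ultimately have "a * \<bar>\<Sum>i=j..<j+N. d i\<bar> < a * (1/2)" by (rule le_less_trans)
    then have "\<bar>\<Sum>i=j..<j+N. d i\<bar> < 1/2" using a by (simp only: mult_less_cancel_left_pos)
    then have "round (P (j + N) - P j) = n" unfolding n by (intro round_unique') simp
    then show ?thesis using n by simp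
  qed
  have N3: "3 * N = N + N + N" by simp
  have P3: "P (N + N + N) = P 0" using q01 t(1) t(2)[unfolded N3] by (simp add: P_def)
  have "(\<Sum>i<3 * N. d i) = (\<Sum>i=0..<0+N. d i) + (\<Sum>i=N..<N+N. d i) + (\<Sum>i=N+N..<N+N+N. d i)"
    using sum.atLeastLessThan_concat[of 0 N "N + N" d] sum.atLeastLessThan_concat[of 0 "N + N" "N + N + N" d]
    unfolding N3 by (simp add: atLeast0LessThan)
  also have "\<dots> = of_int (winding (P 0) (P N) (P (N + N)))"
    unfolding winding_eq using block[of 0] block[of N] block[of "N + N"] P3 by simp
  also have "winding (P 0) (P N) (P (N + N)) = \<sigma>" using w t(1) by (simp add: P_def mult_2)
  finally have \<theta>3: "\<theta> (3 * N) = \<theta> 0 + of_int \<sigma>" by (simp add: \<theta>_def)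
  define g where "g x y = (SOME g. geodesic g x y)" for x y :: 'a
  have g: "geodesic (g x y) x y" for x y
    unfolding g_def using geo unfolding geodesic_space_def by (metis someI_ex)
  define c where "c j = (\<lambda>s. g (q (t j)) (A (\<theta> j)) (dist (q (t j)) (A (\<theta> j)) * s))" for j
  have c: "path (c j)" "pathstart (c j) = q (t j)" "pathfinish (c j) = A (\<theta> j)" for j
    unfolding c_def by (rule geodesic_path[OF g])+
  have cball: "path_image (c j) \<subseteq> ball (A (\<theta> j)) e" if "j \<le> 3 * N" for j
  proof -
    have "dist (A (\<theta> j)) (c j s) < e" if s: "s \<in> {0..1}" for s
    proof -
      have "dist (c j 1) (c j s) = dist (q (t j)) (A (\<theta> j)) * \<bar>1 - s\<bar>"
        unfolding c_def by (rule geodesic_path(4)[OF g]) (use s in auto)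
      also have "\<dots> \<le> dist (q (t j)) (A (\<theta> j)) * 1" using s by (intro mult_left_mono) auto
      finally show ?thesis using q\<theta>[OF \<open>j \<le> 3 * N\<close>] c(3)[of j] by (simp add: pathfinish_def)
    qed
    then show ?thesis by (auto simp: path_image_def)
  qed
  have balltube: "ball (A u) r \<subseteq> tube \<rho>" if "r \<le> \<rho>" for u r
    using that by (auto simp: tube_def dist_commute intro!: exI[of _ u])
  have "homotopic_loops (tube \<rho>) q (A \<circ> linepath (\<theta> 0) (\<theta> (3 * N)))"
  proof (rule ladder_homotopy[OF comp qp])
    show "path_image q \<subseteq> tube \<rho>" using q(2) tube_mono[OF e(3)] by auto
    show "pathfinish q = pathstart q" using q(1) by (simp add: loop_def)
    show "range A \<subseteq> tube \<rho>" using e by (intro range_A_tube) auto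
    show "t j \<le> t (Suc j)" if "j < 3 * N" for j using t(3)[of j "Suc j"] that by simp
    show "path (c j) \<and> path_image (c j) \<subseteq> tube \<rho> \<and> pathstart (c j) = q (t j) \<and> pathfinish (c j) = A (\<theta> j)"
      if "j \<le> 3 * N" for j
      using c[of j] cball[OF that] balltube[OF e(3)] by blast
    have "A (\<theta> (3 * N)) = A (\<theta> 0)" unfolding \<theta>3 by (rule A_add_int)
    then show "c (3 * N) = c 0" unfolding c_def using q01 t(1,2) by simp
    fix j assume j: "j < 3 * N"
    let ?l1 = "path_segment (t j) (t (Suc j)) q +++ c (Suc j)"
    let ?l2 = "c j +++ (A \<circ> linepath (\<theta> j) (\<theta> (Suc j)))"
    have tt: "t j \<le> t (Suc j)" using t(3)[of j "Suc j"] j by simp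
    have seg: "(t (Suc j) - t j) * x + t j \<in> {t j..t (Suc j)}" if x: "x \<in> {0..1}" for x
    proof -
      have "(t (Suc j) - t j) * x \<le> (t (Suc j) - t j) * 1" "0 \<le> (t (Suc j) - t j) * x"
        using x tt by (simp_all add: mult_left_le)
      then show ?thesis by simp
    qed
    have segp: "path (path_segment (t j) (t (Suc j)) q)"
      unfolding path_segment_def path_def
    proof (rule continuous_on_compose2[OF qp[unfolded path_def]])
      show "(\<lambda>x. (t (Suc j) - t j) * x + t j) ` {0..1} \<subseteq> {0..1}"
        using seg t01[of j] t01[of "Suc j"] j by fastforce
    qed (auto intro!: continuous_intros)
    have ends: "pathstart (path_segment (t j) (t (Suc j)) q) = q (t j)"
       "pathfinish (path_segment (t j) (t (Suc j)) q) = q (t (Suc j))"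
      by (auto simp: path_segment_def pathstart_def pathfinish_def)
    have d\<theta>: "a * \<bar>\<theta> (Suc j) - \<theta> j\<bar> \<le> \<mu> + 2 * e" using ad[OF j] by (simp add: \<theta>_def)
    have \<mu>: "\<mu> < \<delta> / 10" using N(2) by (simp add: \<mu>_def)
    have I1: "path_image (path_segment (t j) (t (Suc j)) q) \<subseteq> ball (A (\<theta> j)) \<delta>"
    proof -
      have "dist (A (\<theta> j)) (q u) < \<delta>" if "u \<in> {t j..t (Suc j)}" for u
      proof -
        have "dist (A (\<theta> j)) (q u) \<le> dist (A (\<theta> j)) (q (t j)) + dist (q (t j)) (q u)" by (rule dist_triangle)
        also have "\<dots> \<le> e + \<mu>"
          using q\<theta>[of j] j arcs[OF j, of "t j" u] that by (intro add_mono) (auto simp: dist_commute \<mu>_def)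
        finally show ?thesis using \<mu> e by linarith
      qed
      then show ?thesis using seg by (force simp: path_image_def path_segment_def)
    qed
    have Al: "dist (A (\<theta> j)) (A (linepath (\<theta> j) (\<theta> (Suc j)) x)) \<le> \<mu> + 2 * e" if x: "x \<in> {0..1}" for x
    proof -
      have "dist (A (\<theta> j)) (A (linepath (\<theta> j) (\<theta> (Suc j)) x)) \<le> a * \<bar>\<theta> j - linepath (\<theta> j) (\<theta> (Suc j)) x\<bar>"
        by (rule dist_A_le)
      also have "\<theta> j - linepath (\<theta> j) (\<theta> (Suc j)) x = - (x * (\<theta> (Suc j) - \<theta> j))"
        by (simp add: linepath_def algebra_simps)
      also have "a * \<bar>- (x * (\<theta> (Suc j) - \<theta> j))\<bar> = x * (a * \<bar>\<theta> (Suc j) - \<theta> j\<bar>)"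
        using x by (simp add: abs_mult)
      also have "\<dots> \<le> 1 * (a * \<bar>\<theta> (Suc j) - \<theta> j\<bar>)" using x a by (intro mult_right_mono) auto
      finally show ?thesis using d\<theta> by simp
    qed
    have I4: "path_image (A \<circ> linepath (\<theta> j) (\<theta> (Suc j))) \<subseteq> ball (A (\<theta> j)) \<delta>"
    proof -
      have "dist (A (\<theta> j)) (A (linepath (\<theta> j) (\<theta> (Suc j)) x)) < \<delta>" if "x \<in> {0..1}" for x
        using Al[OF that] \<mu> e by linarith
      then show ?thesis by (auto simp: path_image_def)
    qed
    have I3: "path_image (c j) \<subseteq> ball (A (\<theta> j)) \<delta>"
      using cball[of j] j e by (force simp: subset_iff)
    have I2: "path_image (c (Suc j)) \<subseteq> ball (A (\<theta> j)) \<delta>"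
    proof
      fix x assume "x \<in> path_image (c (Suc j))"
      then have "dist (A (\<theta> (Suc j))) x < e" using cball[of "Suc j"] j by auto
      moreover have "dist (A (\<theta> j)) (A (\<theta> (Suc j))) \<le> \<mu> + 2 * e" using Al[of 1] by (simp add: linepath_def)
      moreover have "dist (A (\<theta> j)) x \<le> dist (A (\<theta> j)) (A (\<theta> (Suc j))) + dist (A (\<theta> (Suc j))) x"
        by (rule dist_triangle)
      ultimately show "x \<in> ball (A (\<theta> j)) \<delta>" using \<mu> e by simp
    qed
    have pAl: "path (A \<circ> linepath (\<theta> j) (\<theta> (Suc j)))"
      by (intro path_continuous_image continuous_on_subset[OF continuous_A]) auto
    have Aends: "pathstart (A \<circ> linepath (\<theta> j) (\<theta> (Suc j))) = A (\<theta> j)" "pathfinish (A \<circ> linepath (\<theta> j) (\<theta> (Suc j))) = A (\<theta> (Suc j))"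
      by (auto simp: pathstart_compose pathfinish_compose)
    have p1: "path ?l1" using segp c ends by simp
    have p2: "path ?l2" using pAl c Aends by simp
    have "loop (?l1 +++ reversepath ?l2)"
      unfolding loop_def using p1 p2 c ends Aends by simp
    moreover have "path_image (?l1 +++ reversepath ?l2) \<subseteq> ball (A (\<theta> j)) \<delta>"
      using I1 I2 I3 I4 by (intro subset_path_image_join) (simp_all add: subset_path_image_join)
    ultimately obtain b where "homotopic_loops (ball (A (\<theta> j)) \<rho>) (?l1 +++ reversepath ?l2) (\<lambda>_. b)"
      using slsc by blast
    then show "\<exists>b. homotopic_loops (tube \<rho>) (?l1 +++ reversepath ?l2) (\<lambda>_. b)"
      using homotopic_loops_subset balltube[OF order_refl] by blast
  qed (rule continuous_A t)+
  also have "homotopic_loops (tube \<rho>) (A \<circ> linepath (\<theta> 0) (\<theta> (3 * N))) (if \<sigma> = 1 then \<alpha> else reversepath \<alpha>)"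
    unfolding \<theta>3 by (rule homotopic_loops_subset[OF homotopic_loops_A_line[OF \<sigma>] range_A_tube]) (use e in auto)
  finally (homotopic_loops_trans) show ?thesis .
qed

end

section \<open>Short triangles that wind around the circle\<close>

lemma monotone_circle_lift_surj:
  assumes "monotone_circle_lift \<phi>" shows "\<exists>t. \<phi> t = u"
proof -
  have c: "continuous_on UNIV \<phi>" and p: "\<And>t. \<phi> (t + 1) = \<phi> t + 1"
    using assms by (auto simp: monotone_circle_lift_def)
  have pn: "\<phi> (t + real n) = \<phi> t + real n" for t n
  proof (induction n)
    case (Suc n)
    then show ?case using p[of "t + real n"] by (simp add: algebra_simps)
  qed simp
  obtain n :: nat where n: "\<bar>u - \<phi> 0\<bar> \<le> real n" using real_arch_simple by blast
  have "\<phi> (real n) = \<phi> 0 + real n" using pn[of 0 n] by simp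
  moreover have "\<phi> (- real n) = \<phi> 0 - real n" using pn[of "- real n" n] by simp
  ultimately have "\<phi> (- real n) \<le> u" "u \<le> \<phi> (real n)" using n by auto
  then show ?thesis using IVT'[of \<phi> "- real n" u "real n"] continuous_on_subset[OF c] by auto
qed

text \<open>Monotone lifts of degree one are surjective by the intermediate value theorem.\<close>

lemma equal_up_to_reparam_image:
  assumes "equal_up_to_reparam q p" "loop q"
  shows "path_image q \<subseteq> path_image p"
proof -
  obtain \<phi> \<psi> where \<phi>: "monotone_circle_lift \<phi>" and eq: "\<And>t. q (frac (\<phi> t)) = p (frac (\<psi> t))"
    using assms(1) unfolding equal_up_to_reparam_def by blast
  have fr: "q (frac u) \<in> path_image p" for u
  proof -
    obtain t where "\<phi> t = u" using monotone_circle_lift_surj[OF \<phi>] by blast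
    then have "q (frac u) = p (frac (\<psi> t))" using eq by auto
    then show ?thesis using frac_ge_0[of "\<psi> t"] frac_lt_1[of "\<psi> t"] by (auto simp: path_image_def)
  qed
  have "q u \<in> path_image p" if u: "u \<in> {0..1}" for u
  proof (cases "u = 1")
    case True
    then have "q u = q (frac 0)" using assms(2) by (simp add: loop_def pathfinish_def pathstart_def)
    then show ?thesis using fr[of 0] by simp
  next
    case False
    then have "frac u = u" using u by (simp add: frac_eq)
    then show ?thesis using fr[of u] by simp
  qed
  then show ?thesis by (auto simp: path_image_def)
qed

lemma geodesic_triangle_loop:
  assumes g1: "geodesic g1 x y" and g2: "geodesic g2 y z" and g3: "geodesic g3 z (x::'a::metric_space)"
    and C: "3 * dist x y \<le> C" "3 * dist y z \<le> C" "3 * dist z x \<le> C"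
  obtains L where "L 0 = x" "L (1/3) = y" "L (2/3) = z" "L 1 = x"
    "\<And>s t. s \<in> {0..1} \<Longrightarrow> t \<in> {0..1} \<Longrightarrow> s \<le> t \<Longrightarrow> dist (L s) (L t) \<le> C * (t - s)"
    "L ` {0..1} \<subseteq> g1 ` {0..dist x y} \<union> g2 ` {0..dist y z} \<union> g3 ` {0..dist z x}"
proof -
  define L where "L t = (if t \<le> 1/3 then g1 (dist x y * (3 * t)) else if t \<le> 2/3 then g2 (dist y z * (3 * t - 1))
      else g3 (dist z x * (3 * t - 2)))" for t
  note p1 = geodesic_path[OF g1] and p2 = geodesic_path[OF g2] and p3 = geodesic_path[OF g3]
  have e: "g1 0 = x" "g1 (dist x y) = y" "g2 0 = y" "g2 (dist y z) = z" "g3 0 = z" "g3 (dist z x) = x"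
    using g1 g2 g3 by (auto simp: geodesic_def)
  have L: "L 0 = x" "L (1/3) = y" "L (2/3) = z" "L 1 = x"
    by (simp_all add: L_def e)
  have eq2: "L t = g2 (dist y z * (3 * t - 1))" if "1/3 \<le> t" "t \<le> 2/3" for t
  proof (cases "t = 1/3")
    case True
    show ?thesis unfolding True using L(2) e(3) by simp
  qed (use that in \<open>simp add: L_def\<close>)
  have eq3: "L t = g3 (dist z x * (3 * t - 2))" if "2/3 \<le> t" for t
  proof (cases "t = 2/3")
    case True
    show ?thesis unfolding True using L(3) e(5) by simp
  qed (use that in \<open>simp add: L_def\<close>)
  have l1: "dist (L s) (L t) \<le> C * (t - s)" if "0 \<le> s" "s \<le> t" "t \<le> 1/3" for s t
  proof -
    have "dist (L s) (L t) = dist x y * \<bar>3 * s - 3 * t\<bar>"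
      using p1(4)[of "3 * s" "3 * t"] that by (simp add: L_def)
    also have "\<dots> = 3 * dist x y * (t - s)" using that by simp
    also have "\<dots> \<le> C * (t - s)" using C that by (intro mult_right_mono) auto
    finally show ?thesis .
  qed
  have l2: "dist (L s) (L t) \<le> C * (t - s)" if "1/3 \<le> s" "s \<le> t" "t \<le> 2/3" for s t
  proof -
    have "dist (L s) (L t) = dist y z * \<bar>(3 * s - 1) - (3 * t - 1)\<bar>"
      using p2(4)[of "3 * s - 1" "3 * t - 1"] that by (simp add: eq2)
    also have "\<dots> = 3 * dist y z * (t - s)" using that by simp
    also have "\<dots> \<le> C * (t - s)" using C that by (intro mult_right_mono) auto
    finally show ?thesis .
  qed
  have l3: "dist (L s) (L t) \<le> C * (t - s)" if "2/3 \<le> s" "s \<le> t" "t \<le> 1" for s t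
  proof -
    have "dist (L s) (L t) = dist z x * \<bar>(3 * s - 2) - (3 * t - 2)\<bar>"
      using p3(4)[of "3 * s - 2" "3 * t - 2"] that by (simp add: eq3)
    also have "\<dots> = 3 * dist z x * (t - s)" using that by simp
    also have "\<dots> \<le> C * (t - s)" using C that by (intro mult_right_mono) auto
    finally show ?thesis .
  qed
  have l23: "dist (L s) (L t) \<le> C * (t - s)" if "1/3 \<le> s" "s \<le> t" "t \<le> 1" for s t
  proof -
    consider "t \<le> 2/3" | "2/3 \<le> s" | "s \<le> 2/3" "2/3 \<le> t" by linarith
    then show ?thesis
    proof cases
      case 3
      have "dist (L s) (L t) \<le> dist (L s) (L (2/3)) + dist (L (2/3)) (L t)" by (rule dist_triangle)
      also have "\<dots> \<le> C * (2/3 - s) + C * (t - 2/3)" using 3 that by (intro add_mono l2 l3) auto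
      finally show ?thesis by (simp add: algebra_simps)
    qed (use that l2 l3 in auto)
  qed
  have lip: "dist (L s) (L t) \<le> C * (t - s)" if "s \<in> {0..1}" "t \<in> {0..1}" "s \<le> t" for s t
  proof -
    consider "t \<le> 1/3" | "1/3 \<le> s" | "s \<le> 1/3" "1/3 \<le> t" by linarith
    then show ?thesis
    proof cases
      case 3
      have "dist (L s) (L t) \<le> dist (L s) (L (1/3)) + dist (L (1/3)) (L t)" by (rule dist_triangle)
      also have "\<dots> \<le> C * (1/3 - s) + C * (t - 1/3)" using 3 that by (intro add_mono l1 l23) auto
      finally show ?thesis by (simp add: algebra_simps)
    qed (use that l1 l23 in auto)
  qed
  have scale: "d * r \<in> {0..d}" if "0 \<le> d" "0 \<le> r" "r \<le> 1" for d r :: real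
    using that by (auto intro: mult_left_le)
  have "L t \<in> g1 ` {0..dist x y} \<union> g2 ` {0..dist y z} \<union> g3 ` {0..dist z x}" if t: "t \<in> {0..1}" for t
  proof -
    consider "t \<le> 1/3" | "1/3 < t" "t \<le> 2/3" | "2/3 < t" by linarith
    then show ?thesis
    proof cases
      case 1 then show ?thesis using scale[of "dist x y" "3 * t"] t by (auto simp: L_def)
    next
      case 2 then show ?thesis using scale[of "dist y z" "3 * t - 1"] t by (auto simp: L_def)
    next
      case 3 then show ?thesis using scale[of "dist z x" "3 * t - 2"] t by (auto simp: L_def)
    qed
  qed
  then show thesis using that[OF L lip] by blast
qed

text \<open>The constants are chosen in the order \<open>U\<close>, \<open>\<rho>\<close>,
  \<open>\<delta>\<close>, \<open>N\<close>, \<open>e\<close>, \<open>V\<close>: homotopies in the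
  \<open>\<rho>\<close>-tube stay in the bottleneck neighbourhood \<open>U\<close>, loops in balls
  of radius \<open>\<delta>\<close> contract in balls of radius \<open>\<rho>\<close>, a third of
  the circle is cut into \<open>N\<close> arcs that are short compared with \<open>\<delta>\<close>,
  and the points of the \<open>e\<close>-tube are so close to the circle that \<open>N\<close>
  errors of the angle are negligible. \<open>V\<close> is a convex neighbourhood in this
  tube.\<close>

locale bottleneck_circle = circle_in_space \<alpha> a for \<alpha> :: "real \<Rightarrow> 'a::metric_space" and a +
  fixes \<delta> \<rho> e :: real and N :: nat and ang :: "'a \<Rightarrow> real" and U V :: "'a set"
  assumes comp: "compact (UNIV :: 'a set)" and geo: "geodesic_space TYPE('a)"
    and slsc: "\<And>(x::'a) p. loop p \<Longrightarrow> path_image p \<subseteq> ball x \<delta> \<Longrightarrow> \<exists>b. homotopic_loops (ball x \<rho>) p (\<lambda>_. b)"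
    and N: "0 < N" "a / (3 * real N) < \<delta> / 10"
    and e: "0 < e" "e \<le> \<delta> / 10" "e \<le> \<rho>" "e \<le> a / (100 * real N)"
    and ang: "\<And>x. x \<in> tube e \<Longrightarrow> dist x (A (ang x)) < e"
    and U: "tube \<rho> \<subseteq> U"
    and bottleneck: "\<And>q. loop q \<Longrightarrow> path_image q \<subseteq> U \<Longrightarrow>
       homotopic_loops U q \<alpha> \<or> homotopic_loops U q (reversepath \<alpha>) \<Longrightarrow> path_length q \<le> path_length \<alpha> \<Longrightarrow>
       equal_up_to_reparam q \<alpha> \<or> equal_up_to_reparam q (reversepath \<alpha>)"
    and V: "V \<subseteq> tube e" "geodesically_convex V"
begin

lemma e_le: "e \<le> a / 100"
proof -
  have "a / (100 * real N) \<le> a / 100"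
    using N(1) a by (intro divide_left_mono) auto
  then show ?thesis using e(4) by linarith
qed

text \<open>The angle function is only approximately an inverse of \<open>A\<close>, but the errors are small compared
  with the distances of the vertices of the triangles considered.\<close>

lemma ang_near:
  assumes "x \<in> tube e" "y \<in> tube e"
  shows "circle_norm (ang y - ang x) \<le> dist x y / a + 1/50"
proof -
  have "a * circle_norm (ang y - ang x) \<le> dist x y + 2 * e"
    using ang[OF assms(1)] ang[OF assms(2)] by (intro circle_norm_near) auto
  also have "\<dots> \<le> a * (dist x y / a + 1/50)" using e_le a by (simp add: field_simps)
  finally show ?thesis using a by (simp only: mult_le_cancel_left_pos)
qed

lemma ang_A:
  assumes "A u \<in> tube e" shows "circle_norm (ang (A u) - u) \<le> 1/100"
proof -
  have "a * circle_norm (u - ang (A u)) < e" using ang[OF assms] by (simp add: dist_A)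
  also have "e \<le> a * (1/100)" using e_le by simp
  finally have "circle_norm (u - ang (A u)) < 1/100" using a by (simp only: mult_less_cancel_left_pos)
  then show ?thesis by (simp add: circle_norm_commute)
qed

abbreviation wind :: "'a \<Rightarrow> 'a \<Rightarrow> 'a \<Rightarrow> int" where
  "wind x y z \<equiv> winding (ang x) (ang y) (ang z)"

lemma wind_unit:
  assumes "x \<in> tube e" "y \<in> tube e" "z \<in> tube e"
    and d: "dist x y \<le> a * (1/3 + 1/50)" "dist y z \<le> a * (1/3 + 1/50)" "dist z x \<le> a * (1/3 + 1/50)"
    and nz: "wind x y z \<noteq> 0"
  shows "wind x y z = 1 \<or> wind x y z = -1"
proof -
  have "dist x y / a \<le> 1/3 + 1/50" "dist y z / a \<le> 1/3 + 1/50" "dist z x / a \<le> 1/3 + 1/50"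
    using d a by (auto simp: field_simps)
  then have "\<bar>of_int (wind x y z) :: real\<bar> < 2"
    unfolding winding_eq using ang_near[of x y] ang_near[of y z] ang_near[of z x] assms(1-3) by linarith
  then show ?thesis using nz by linarith
qed

text \<open>The reduced differences of the three angles add up to a nonzero integer, so the third one has absolute
  value at least one minus the other two. A triangle with a short side does not wind.\<close>

lemma wind_far:
  assumes "x \<in> tube e" "y \<in> tube e" "z \<in> tube e"
    and d: "dist y z \<le> a * (1/3 + 1/50)" "dist z x \<le> a * (1/3 + 1/50)"
    and nz: "wind x y z \<noteq> 0"
  shows "a / 5 < dist x y"
proof -
  have "1 \<le> \<bar>of_int (wind x y z) :: real\<bar>" using nz by linarith
  moreover have "dist y z / a \<le> 1/3 + 1/50" "dist z x / a \<le> 1/3 + 1/50"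
    using d a by (auto simp: field_simps)
  ultimately have "1/5 < dist x y / a"
    using winding_eq[of "ang x" "ang y" "ang z"] ang_near[of x y] ang_near[of y z] ang_near[of z x] assms(1-3)
    by linarith
  then show ?thesis using a by (simp add: field_simps)
qed

lemma wind_perturb:
  assumes t: "x \<in> tube e" "y \<in> tube e" "z \<in> tube e" "x' \<in> tube e" "y' \<in> tube e" "z' \<in> tube e"
    and s: "dist x x' \<le> a / 50" "dist y y' \<le> a / 50" "dist z z' \<le> a / 50"
    and d: "dist x y \<le> a * (1/3 + 1/50)" "dist y z \<le> a * (1/3 + 1/50)" "dist z x \<le> a * (1/3 + 1/50)"
    and d': "dist x' y' \<le> a * (1/3 + 1/50)" "dist y' z' \<le> a * (1/3 + 1/50)" "dist z' x' \<le> a * (1/3 + 1/50)"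
  shows "wind x' y' z' = wind x y z"
proof (rule winding_stable)
  have small: "circle_norm (ang v - ang u) \<le> 1/20" if "u \<in> tube e" "v \<in> tube e" "dist u v \<le> a / 50" for u v
  proof -
    have "dist u v / a \<le> 1/50" using that a by (simp add: field_simps)
    then show ?thesis using ang_near[OF that(1,2)] by linarith
  qed
  show "circle_norm (ang x' - ang x) \<le> 1/20" "circle_norm (ang y' - ang y) \<le> 1/20" "circle_norm (ang z' - ang z) \<le> 1/20"
    by (rule small; (rule t | rule s))+
  have big: "circle_norm (ang v - ang u) \<le> 2/5" if "u \<in> tube e" "v \<in> tube e" "dist u v \<le> a * (1/3 + 1/50)" for u v
  proof -
    have "dist u v / a \<le> 1/3 + 1/50" using that a by (simp add: field_simps)
    then show ?thesis using ang_near[OF that(1,2)] by linarith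
  qed
  show "circle_norm (ang y - ang x) \<le> 2/5" "circle_norm (ang z - ang y) \<le> 2/5" "circle_norm (ang x - ang z) \<le> 2/5"
    "circle_norm (ang y' - ang x') \<le> 2/5" "circle_norm (ang z' - ang y') \<le> 2/5" "circle_norm (ang x' - ang z') \<le> 2/5"
    by (rule big; (rule t | rule d | rule d'))+
qed

lemma wind_swap:
  assumes "x \<in> tube e" "y \<in> tube e" "z \<in> tube e"
    and d: "dist x y \<le> a * (1/3 + 1/50)" "dist y z \<le> a * (1/3 + 1/50)" "dist z x \<le> a * (1/3 + 1/50)"
  shows "wind y x z = - wind x y z"
proof (rule winding_swap)
  have big: "circle_norm (ang v - ang u) < 1/2" if "u \<in> tube e" "v \<in> tube e" "dist u v \<le> a * (1/3 + 1/50)" for u v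
  proof -
    have "dist u v / a \<le> 1/3 + 1/50" using that a by (simp add: field_simps)
    then show ?thesis using ang_near[OF that(1,2)] by linarith
  qed
  show "circle_norm (ang y - ang x) < 1/2" "circle_norm (ang z - ang y) < 1/2" "circle_norm (ang x - ang z) < 1/2"
    by (rule big; (rule assms(1-3) | rule d))+
qed

text \<open>A geodesic triangle of perimeter at most \<open>a\<close> that winds around the circle is homotopic to it,
  and the circle is the only such loop of this length.\<close>

lemma winding_triangle_on_circle:
  assumes xyz: "x \<in> V" "y \<in> V" "z \<in> V"
    and d: "dist x y \<le> a / 3" "dist y z \<le> a / 3" "dist z x \<le> a / 3"
    and nz: "wind x y z \<noteq> 0"
  shows "x \<in> range A" "y \<in> range A" "z \<in> range A" "dist x y = a / 3" "dist y z = a / 3" "dist z x = a / 3"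
proof -
  have t: "x \<in> tube e" "y \<in> tube e" "z \<in> tube e" using xyz V by auto
  have a50: "a / 3 \<le> a * (1/3 + 1/50)" using a by (simp add: field_simps)
  have unit: "wind x y z = 1 \<or> wind x y z = -1"
    using d a50 by (intro wind_unit t nz) linarith+
  obtain g1 g2 g3 where g: "geodesic g1 x y" "geodesic g2 y z" "geodesic g3 z x"
    using geo unfolding geodesic_space_def by metis
  obtain L where L: "L 0 = x" "L (1/3) = y" "L (2/3) = z" "L 1 = x"
    and lip: "\<And>s t. s \<in> {0..1} \<Longrightarrow> t \<in> {0..1} \<Longrightarrow> s \<le> t \<Longrightarrow> dist (L s) (L t) \<le> a * (t - s)"
    and im: "L ` {0..1} \<subseteq> g1 ` {0..dist x y} \<union> g2 ` {0..dist y z} \<union> g3 ` {0..dist z x}"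
    by (rule geodesic_triangle_loop[OF g, of a]) (use d in auto)
  have "dist (L s) (L t) \<le> a * \<bar>s - t\<bar>" if "s \<in> {0..1}" "t \<in> {0..1}" for s t
    using lip[of s t] lip[of t s] that by (cases "s \<le> t") (auto simp: dist_commute)
  then have "path L" using a by (intro Lipschitz_imp_path[of a]) auto
  then have loopL: "loop L" using L by (simp add: loop_def pathfinish_def pathstart_def)
  have "L ` {0..1} \<subseteq> V"
    using im g V(2) xyz unfolding geodesically_convex_def by blast
  then have imV: "path_image L \<subseteq> V" by (simp add: path_image_def)
  have len: "path_length L \<le> path_length \<alpha>"
    unfolding path_length_\<alpha> using a lip by (intro path_length_le_Lipschitz) auto
  define t where "t j = real j / (3 * real N)" for j :: nat
  have N3: "0 < 3 * real N" using N by simp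
  have "homotopic_loops (tube \<rho>) L (if wind x y z = 1 then \<alpha> else reversepath \<alpha>)"
  proof (rule winding_loop_homotopic[OF comp geo slsc N e ang loopL, where t = t])
    show "path_image L \<subseteq> tube e" using imV V by auto
    show "t 0 = 0" "t (3 * N) = 1" using N by (auto simp: t_def)
    show "t i \<le> t j" if "i \<le> j" "j \<le> 3 * N" for i j using that by (simp add: t_def divide_right_mono)
    show "dist (L u) (L v) \<le> a / (3 * real N)"
      if j: "j < 3 * N" and u: "t j \<le> u" "u \<le> v" "v \<le> t (Suc j)" for j u v
    proof -
      have "0 \<le> t j" by (simp add: t_def)
      moreover have "t (Suc j) \<le> 1" using j N3 by (simp add: t_def)
      ultimately have "dist (L u) (L v) \<le> a * (v - u)" using u by (intro lip) auto
      also have "\<dots> \<le> a * (t (Suc j) - t j)" using u a by (intro mult_left_mono) auto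
      also have "t (Suc j) - t j = 1 / (3 * real N)" by (simp add: t_def diff_divide_distrib[symmetric])
      finally show ?thesis by simp
    qed
    have tN: "t N = 1/3" "t (2 * N) = 2/3" using N by (auto simp: t_def)
    show "wind (L 0) (L (t N)) (L (t (2 * N))) = wind x y z" unfolding tN L ..
    show "wind x y z = 1 \<or> wind x y z = -1" by (rule unit)
  qed
  then have "homotopic_loops U L (if wind x y z = 1 then \<alpha> else reversepath \<alpha>)"
    by (rule homotopic_loops_subset[OF _ U])
  then have "homotopic_loops U L \<alpha> \<or> homotopic_loops U L (reversepath \<alpha>)" by (auto split: if_splits)
  moreover have "path_image L \<subseteq> U" using imV V tube_mono[OF e(3)] U by auto
  ultimately have "equal_up_to_reparam L \<alpha> \<or> equal_up_to_reparam L (reversepath \<alpha>)"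
    using bottleneck[OF loopL] len by blast
  then have "path_image L \<subseteq> range A"
    using equal_up_to_reparam_image[OF _ loopL] path_image_\<alpha> by fastforce
  then have LA: "L u \<in> range A" if "u \<in> {0..1}" for u using that by (auto simp: path_image_def)
  show xA: "x \<in> range A" and yA: "y \<in> range A" and zA: "z \<in> range A"
    using LA[of 0] LA[of "1/3"] LA[of "2/3"] L by auto
  obtain u v w where uvw: "x = A u" "y = A v" "z = A w" using xA yA zA by auto
  have cn: "circle_norm (v - u) = dist x y / a" "circle_norm (w - v) = dist y z / a" "circle_norm (u - w) = dist z x / a"
    using a by (simp_all add: uvw dist_A circle_norm_commute)
  have da: "dist x y / a \<le> 1/3" "dist y z / a \<le> 1/3" "dist z x / a \<le> 1/3" using d a by (auto simp: field_simps)
  have "wind x y z = winding u v w"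
  proof (rule winding_stable)
    show "circle_norm (ang x - u) \<le> 1/20" "circle_norm (ang y - v) \<le> 1/20" "circle_norm (ang z - w) \<le> 1/20"
      using ang_A[of u] ang_A[of v] ang_A[of w] t unfolding uvw by linarith+
    show "circle_norm (v - u) \<le> 2/5" "circle_norm (w - v) \<le> 2/5" "circle_norm (u - w) \<le> 2/5"
      using cn da by auto
    show "circle_norm (ang y - ang x) \<le> 2/5" "circle_norm (ang z - ang y) \<le> 2/5" "circle_norm (ang x - ang z) \<le> 2/5"
      using ang_near[OF t(1,2)] ang_near[OF t(2,3)] ang_near[OF t(3,1)] da by linarith+
  qed
  moreover have "1 \<le> \<bar>of_int (wind x y z) :: real\<bar>" using nz by linarith
  ultimately have "1 \<le> dist x y / a + dist y z / a + dist z x / a"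
    unfolding cn[symmetric] using winding_eq[of u v w] by linarith
  then have "a \<le> dist x y + dist y z + dist z x" using a by (simp add: field_simps)
  then show "dist x y = a / 3" "dist y z = a / 3" "dist z x = a / 3" using d by linarith+
qed

text \<open>A sequence of winding triangles whose sides are in the limit at most \<open>a / 3\<close> has a limit triangle, which
  winds too and hence has its vertices on the circle. So no such sequence avoids the \<open>\<eta>/4\<close>-tube, which
  separates winding triangles from the boundary of the region where the winding number is defined.\<close>

lemma winding_triangles_isolated:
  assumes \<eta>: "0 < \<eta>" "\<eta> \<le> e" "tube \<eta> \<subseteq> V"
  obtains r0 where "a / 3 < r0" "r0 \<le> a * (1/3 + 1/50)"
    "\<And>x y z. x \<in> tube (\<eta>/2) \<Longrightarrow> y \<in> tube (\<eta>/2) \<Longrightarrow> z \<in> tube (\<eta>/2) \<Longrightarrow>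
       dist x y < r0 \<Longrightarrow> dist y z < r0 \<Longrightarrow> dist z x < r0 \<Longrightarrow> wind x y z \<noteq> 0 \<Longrightarrow> x \<in> tube (\<eta>/4)"
proof -
  define bad where "bad r x y z \<longleftrightarrow> x \<in> tube (\<eta>/2) \<and> y \<in> tube (\<eta>/2) \<and> z \<in> tube (\<eta>/2) \<and>
     dist x y < r \<and> dist y z < r \<and> dist z x < r \<and> wind x y z \<noteq> 0 \<and> x \<notin> tube (\<eta>/4)" for r x y z
  \<comment> \<open>Sides bounded by \<open>r n\<close> keep the winding number stable, and \<open>r n\<close> tends to \<open>a / 3\<close>.\<close>
  define r where "r n = a / 3 + a / (50 * real (Suc n))" for n
  have rb: "a / 3 < r n" "r n \<le> a * (1/3 + 1/50)" for n
  proof -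
    show "a / 3 < r n" using a by (simp add: r_def)
    have "a / (50 * real (Suc n)) \<le> a / 50" using a by (intro divide_left_mono) auto
    then show "r n \<le> a * (1/3 + 1/50)" unfolding r_def distrib_left by linarith
  qed
  have "\<exists>n. \<forall>x y z. \<not> bad (r n) x y z"
  proof (rule ccontr)
    assume "\<not> ?thesis"
    then obtain X Y Z where bad: "\<And>n. bad (r n) (X n) (Y n) (Z n)" by metis
    have "compact (UNIV :: ('a \<times> 'a \<times> 'a) set)"
      using compact_Times[OF comp compact_Times[OF comp comp]] by (simp add: UNIV_Times_UNIV)
    then have "seq_compact (UNIV :: ('a \<times> 'a \<times> 'a) set)" by (simp add: compact_eq_seq_compact_metric)
    then obtain p f where f: "strict_mono (f :: nat \<Rightarrow> nat)" "((\<lambda>n. (X n, Y n, Z n)) \<circ> f) \<longlonglongrightarrow> p"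
      unfolding seq_compact_def by (metis UNIV_I)
    obtain x y z where p: "p = (x, y, z)" by (cases p)
    have lim: "(\<lambda>n. X (f n)) \<longlonglongrightarrow> x" "(\<lambda>n. Y (f n)) \<longlonglongrightarrow> y" "(\<lambda>n. Z (f n)) \<longlonglongrightarrow> z"
      using tendsto_fst[OF f(2)] tendsto_fst[OF tendsto_snd[OF f(2)]] tendsto_snd[OF tendsto_snd[OF f(2)]]
      by (simp_all add: p o_def)
    have rl: "(\<lambda>n. r (f n)) \<longlonglongrightarrow> a / 3"
    proof -
      have "(\<lambda>n. a / 50 * (1 / real (Suc n))) \<longlonglongrightarrow> a / 50 * 0"
        by (intro tendsto_mult tendsto_const LIMSEQ_Suc[OF lim_inverse_n'])
      then have "r \<longlonglongrightarrow> a / 3 + 0"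
        unfolding r_def by (intro tendsto_add tendsto_const) simp
      then show ?thesis using LIMSEQ_subseq_LIMSEQ[OF _ f(1), of r] by (simp add: o_def)
    qed
    have b: "X n \<in> tube (\<eta>/2)" "Y n \<in> tube (\<eta>/2)" "Z n \<in> tube (\<eta>/2)" "dist (X n) (Y n) < r n"
       "dist (Y n) (Z n) < r n" "dist (Z n) (X n) < r n" "wind (X n) (Y n) (Z n) \<noteq> 0" "X n \<notin> tube (\<eta>/4)" for n
      using bad[of n] by (auto simp: bad_def)
    have lim_le: "dist p q \<le> a / 3" if pq: "P \<longlonglongrightarrow> p" "Q \<longlonglongrightarrow> q" "\<And>n. dist (P n) (Q n) < r (f n)"
      for p q :: 'a and P Q
      by (rule LIMSEQ_le[OF tendsto_dist[OF pq(1,2)] rl]) (use pq(3) in \<open>auto intro: less_imp_le\<close>)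
    have d: "dist x y \<le> a / 3" "dist y z \<le> a / 3" "dist z x \<le> a / 3"
      using lim_le[OF lim(1,2)] lim_le[OF lim(2,3)] lim_le[OF lim(3,1)] b by blast+
    define s where "s = min (\<eta>/4) (a/50)"
    have s: "0 < s" using \<eta> a by (simp add: s_def)
    have "\<forall>\<^sub>F n in sequentially. dist (X (f n)) x < s \<and> dist (Y (f n)) y < s \<and> dist (Z (f n)) z < s"
      using lim[THEN tendstoD, OF s] by eventually_elim simp
    then obtain n where n: "dist (X (f n)) x < s" "dist (Y (f n)) y < s" "dist (Z (f n)) z < s"
      unfolding eventually_sequentially by blast
    have near: "q' \<in> tube \<eta>" if qq: "q \<in> tube (\<eta>/2)" "dist q q' < s" for q q'
    proof -
      obtain u where u: "dist q (A u) < \<eta>/2" using qq(1) by (auto simp: tube_def)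
      have "dist q' (A u) \<le> dist q q' + dist q (A u)" by (metis dist_commute dist_triangle)
      moreover have "s \<le> \<eta>/4" by (simp add: s_def)
      then have "dist q q' + dist q (A u) < \<eta>" using u qq(2) \<eta> by linarith
      ultimately have "dist q' (A u) < \<eta>" by linarith
      then show ?thesis by (auto simp: tube_def)
    qed
    have xyz: "x \<in> tube \<eta>" "y \<in> tube \<eta>" "z \<in> tube \<eta>" using near b n by blast+
    have te: "tube \<eta> \<subseteq> tube e" "tube (\<eta>/2) \<subseteq> tube e" using \<eta> by (auto intro!: tube_mono)
    have a50: "a / 3 \<le> a * (1/3 + 1/50)" using a by (simp add: field_simps)
    have "wind (X (f n)) (Y (f n)) (Z (f n)) = wind x y z"
    proof (rule wind_perturb)
      show "x \<in> tube e" "y \<in> tube e" "z \<in> tube e" "X (f n) \<in> tube e" "Y (f n) \<in> tube e" "Z (f n) \<in> tube e"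
        using xyz te b by blast+
      show "dist x (X (f n)) \<le> a/50" "dist y (Y (f n)) \<le> a/50" "dist z (Z (f n)) \<le> a/50"
        using n by (auto simp: s_def dist_commute)
    qed (use d a50 b(4-6)[of "f n"] rb(2)[of "f n"] in linarith)+
    then have "wind x y z \<noteq> 0" using b by metis
    then have "x \<in> range A" using winding_triangle_on_circle(1)[of x y z] xyz \<eta>(3) d by blast
    then obtain u where "x = A u" by auto
    then have "dist (X (f n)) (A u) < \<eta>/4" using n by (simp add: s_def)
    then show False using b(8)[of "f n"] by (auto simp: tube_def)
  qed
  then obtain n where "\<And>x y z. \<not> bad (r n) x y z" by blast
  then show thesis using that[of "r n"] rb[of n] unfolding bad_def by blast
qed

text \<open>A loop of length at most \<open>a\<close> whose thirds span a winding triangle consists of geodesics in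
  \<open>V\<close>, hence is homotopic to the circle.\<close>

lemma loop_with_winding_thirds:
  assumes q: "loop q"
    and t: "t 0 = 0" "t (3 * N) = 1" "\<And>i j. i \<le> j \<Longrightarrow> j \<le> 3 * N \<Longrightarrow> t i \<le> t j"
    and arcs: "\<And>j u v. j < 3 * N \<Longrightarrow> t j \<le> u \<Longrightarrow> u \<le> v \<Longrightarrow> v \<le> t (Suc j) \<Longrightarrow>
       dist (q (t j)) (q u) + dist (q u) (q v) + dist (q v) (q (t (Suc j))) \<le> a / real (3 * N)"
    and inV: "q 0 \<in> V" "q (t N) \<in> V" "q (t (2 * N)) \<in> V"
    and nz: "wind (q 0) (q (t N)) (q (t (2 * N))) \<noteq> 0"
  shows "homotopic_loops UNIV q \<alpha> \<or> homotopic_loops UNIV q (reversepath \<alpha>)"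
proof -
  have q01: "q 1 = q 0" using q by (simp add: loop_def pathfinish_def pathstart_def)
  have third: "dist (q (t i)) (q u) + dist (q u) (q (t (i + N))) \<le> a / 3"
    if "i + N \<le> 3 * N" "t i \<le> u" "u \<le> t (i + N)" for i u
  proof -
    have "dist (q (t i)) (q u) + dist (q u) (q (t (i + N))) \<le> real N * (a / real (3 * N))"
      by (rule dist_through_arc_point[where p = q and t = t, OF arcs t(3)]) (use that N in auto)
    also have "\<dots> = a / 3" using N(1) by simp
    finally show ?thesis .
  qed
  have NN: "N + N = 2 * N" "2 * N + N = 3 * N" by auto
  have d: "dist (q 0) (q (t N)) \<le> a / 3" "dist (q (t N)) (q (t (2 * N))) \<le> a / 3" "dist (q (t (2 * N))) (q 0) \<le> a / 3"
    using third[of 0 "t 0"] third[of N "t N"] third[of "2 * N" "t (2 * N)"]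
      t(3)[of 0 N] t(3)[of N "2 * N"] t(3)[of "2 * N" "3 * N"] t(1,2) q01 by (simp_all add: NN)
  note on = winding_triangle_on_circle[OF inV d nz]
  have seg: "q u \<in> V" if i: "i + N \<le> 3 * N" "t i \<le> u" "u \<le> t (i + N)" and V2: "q (t i) \<in> V" "q (t (i + N)) \<in> V"
      and eq: "dist (q (t i)) (q (t (i + N))) = a / 3" for i u
  proof -
    have "dist (q (t i)) (q u) + dist (q u) (q (t (i + N))) = dist (q (t i)) (q (t (i + N)))"
      using third[OF i] eq dist_triangle[of "q (t i)" "q (t (i + N))" "q u"] by linarith
    then obtain g where "geodesic g (q (t i)) (q (t (i + N)))" "q u \<in> g ` {0..dist (q (t i)) (q (t (i + N)))}"
      using between_on_geodesic[OF geo] by blast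
    then show ?thesis using V(2) V2 unfolding geodesically_convex_def by blast
  qed
  have qV: "q u \<in> V" if u: "u \<in> {0..1}" for u
  proof -
    consider "u \<le> t N" | "t N \<le> u" "u \<le> t (2 * N)" | "t (2 * N) \<le> u" by linarith
    then show ?thesis
    proof cases
      case 1 then show ?thesis using seg[of 0 u] u t(1) inV on(4) by simp
    next
      case 2 then show ?thesis using seg[of N u] inV on(5) by (simp add: NN)
    next
      case 3 then show ?thesis using seg[of "2 * N" u] u t(2) q01 inV on(6) by (simp add: NN)
    qed
  qed
  have im: "path_image q \<subseteq> tube e" using qV V by (auto simp: path_image_def)
  have a50: "a / 3 \<le> a * (1/3 + 1/50)" using a by (simp add: field_simps)
  have "homotopic_loops (tube \<rho>) q (if wind (q 0) (q (t N)) (q (t (2 * N))) = 1 then \<alpha> else reversepath \<alpha>)"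
  proof (rule winding_loop_homotopic[OF comp geo slsc N e ang q im t _ refl])
    show "dist (q u) (q v) \<le> a / (3 * real N)" if "j < 3 * N" "t j \<le> u" "u \<le> v" "v \<le> t (Suc j)" for j u v
      using arcs[OF that] zero_le_dist[of "q (t j)" "q u"] zero_le_dist[of "q v" "q (t (Suc j))"]
      unfolding of_nat_mult by (simp del: zero_le_dist)
    show "wind (q 0) (q (t N)) (q (t (2 * N))) = 1 \<or> wind (q 0) (q (t N)) (q (t (2 * N))) = - 1"
      by (rule wind_unit) (use inV V d a50 nz in \<open>auto intro: order_trans\<close>)
  qed
  then have "homotopic_loops UNIV q (if wind (q 0) (q (t N)) (q (t (2 * N))) = 1 then \<alpha> else reversepath \<alpha>)"
    by (rule homotopic_loops_subset) simp
  then show ?thesis by (auto split: if_splits)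
qed

end

section \<open>A cocycle supported near the circle\<close>

lemma (in field) finsum_product:
  assumes "finite A" "finite B" "\<And>x y. x \<in> A \<Longrightarrow> y \<in> B \<Longrightarrow> f x y \<in> carrier R"
  shows "(\<Oplus>x\<in>A. \<Oplus>y\<in>B. f x y) = (\<Oplus>p\<in>A \<times> B. f (fst p) (snd p))"
  using assms(1,3)
proof (induction A rule: finite_induct)
  case (insert a A)
  have e: "insert a A \<times> B = Pair a ` B \<union> A \<times> B" "Pair a ` B \<inter> A \<times> B = {}" using insert.hyps by auto
  have "(\<Oplus>p\<in>insert a A \<times> B. f (fst p) (snd p)) = (\<Oplus>p\<in>Pair a ` B. f (fst p) (snd p)) \<oplus> (\<Oplus>p\<in>A \<times> B. f (fst p) (snd p))"
    unfolding e(1) by (rule finsum_Un_disjoint) (use insert assms(2) e(2) in auto)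
  also have "(\<Oplus>p\<in>Pair a ` B. f (fst p) (snd p)) = (\<Oplus>y\<in>B. f (fst (a, y)) (snd (a, y)))"
    by (rule finsum_reindex) (use insert.prems in \<open>auto simp: inj_on_def\<close>)
  also have "(\<Oplus>p\<in>A \<times> B. f (fst p) (snd p)) = (\<Oplus>x\<in>A. \<Oplus>y\<in>B. f x y)" using insert by simp
  finally show ?case using insert by (auto intro!: finsum_closed)
qed simp

locale winding_cocycle = bottleneck_circle \<alpha> a \<delta> \<rho> e N ang U V
  for \<alpha> :: "real \<Rightarrow> 'a::metric_space" and a \<delta> \<rho> e and N :: nat and ang U V +
  fixes \<eta> r0 \<kappa> :: real
  assumes \<eta>: "0 < \<eta>" "\<eta> \<le> e" "tube \<eta> \<subseteq> V"
    and r0: "a / 3 < r0" "r0 \<le> a * (1/3 + 1/50)"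
    and isolated: "\<And>x y z. x \<in> tube (\<eta>/2) \<Longrightarrow> y \<in> tube (\<eta>/2) \<Longrightarrow> z \<in> tube (\<eta>/2) \<Longrightarrow>
       dist x y < r0 \<Longrightarrow> dist y z < r0 \<Longrightarrow> dist z x < r0 \<Longrightarrow> wind x y z \<noteq> 0 \<Longrightarrow> x \<in> tube (\<eta>/4)"
    and \<kappa>: "\<kappa> \<le> \<eta> / 4" "\<kappa> \<le> a / 50"
begin

text \<open>The 2-cochain is one on the triangles with this property, minus one on the reversed ones
  and zero on all others. It is represented by the set of its positively oriented triangles.\<close>

definition positive :: "'a \<Rightarrow> 'a \<Rightarrow> 'a \<Rightarrow> bool" where
  "positive x y z \<longleftrightarrow> x \<in> tube (\<eta>/2) \<and> y \<in> tube (\<eta>/2) \<and> z \<in> tube (\<eta>/2) \<and>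
     dist x y < r0 \<and> dist y z < r0 \<and> dist z x < r0 \<and> wind x y z = 1"

lemma tube_half: "tube (\<eta>/2) \<subseteq> tube e" "tube (\<eta>/2) \<subseteq> V"
  using \<eta> tube_mono[of "\<eta>/2" e] tube_mono[of "\<eta>/2" \<eta>] by auto

lemma positive_rotate: "positive x y z \<Longrightarrow> positive y z x"
  unfolding positive_def by (auto simp: winding_rotate)

lemma positive_far:
  assumes "positive x y z" shows "a / 5 < dist x y" "a / 5 < dist y z" "a / 5 < dist z x"
proof -
  have *: "a / 5 < dist x y" if "positive x y z" for x y z
  proof (rule wind_far)
    show "x \<in> tube e" "y \<in> tube e" "z \<in> tube e" using that tube_half by (auto simp: positive_def)
    show "dist y z \<le> a * (1/3 + 1/50)" "dist z x \<le> a * (1/3 + 1/50)" "wind x y z \<noteq> 0"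
      using that r0 by (auto simp: positive_def)
  qed
  show "a / 5 < dist x y" "a / 5 < dist y z" "a / 5 < dist z x"
    using *[OF assms] *[OF positive_rotate[OF assms]] *[OF positive_rotate[OF positive_rotate[OF assms]]] by auto
qed

lemma positive_distinct:
  assumes "positive x y z" shows "x \<noteq> y" "y \<noteq> z" "z \<noteq> x"
  using positive_far[OF assms] a by auto

lemma positive_swap:
  assumes "positive x y z" shows "\<not> positive y x z"
proof -
  have "wind y x z = - wind x y z"
    by (rule wind_swap) (use assms tube_half r0 in \<open>auto simp: positive_def\<close>)
  then show ?thesis using assms by (auto simp: positive_def)
qed

lemma positive_unique:
  assumes p: "positive x y z" and p': "positive x' y' z'" and eq: "{x', y', z'} = {x, y, z}"
  shows "(x', y', z') \<in> {(x, y, z), (y, z, x), (z, x, y)}"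
proof -
  note d = positive_distinct[OF p] and d' = positive_distinct[OF p']
  have "\<not> positive y x z" "\<not> positive x z y" "\<not> positive z y x"
    using positive_swap[OF p] positive_swap[OF positive_rotate[OF p]]
      positive_swap[OF positive_rotate[OF positive_rotate[OF p]]] positive_rotate by blast+
  moreover have "x' \<in> {x, y, z}" "y' \<in> {x, y, z}" "z' \<in> {x, y, z}" using eq by blast+
  ultimately show ?thesis using p' d' by auto
qed

text \<open>A fixed ordering of the vertices for every triangle of the support, so that the sum over
  the support takes each triangle once.\<close>

definition rep :: "'a set \<Rightarrow> 'a list" where
  "rep \<sigma> = (SOME l. \<exists>x y z. l = [x, y, z] \<and> \<sigma> = {x, y, z} \<and> positive x y z)"

lemma rep:
  assumes "positive x y z"
  obtains "rep {x, y, z} = [x, y, z]" | "rep {x, y, z} = [y, z, x]" | "rep {x, y, z} = [z, x, y]"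
proof -
  have "\<exists>x' y' z'. rep {x, y, z} = [x', y', z'] \<and> {x, y, z} = {x', y', z'} \<and> positive x' y' z'"
    unfolding rep_def by (rule someI_ex) (use assms in blast)
  then obtain x' y' z' where r: "rep {x, y, z} = [x', y', z']" "{x, y, z} = {x', y', z'}" "positive x' y' z'" by blast
  then have "(x', y', z') \<in> {(x, y, z), (y, z, x), (z, x, y)}" using positive_unique[OF assms] by metis
  then show thesis using that r(1) by auto
qed

definition positive_sets :: "'a set set" where
  "positive_sets = {{x, y, z} | x y z. positive x y z}"

lemma positive_setsE:
  assumes "\<sigma> \<in> positive_sets" obtains x y z where "\<sigma> = {x, y, z}" "positive x y z"
  using assms unfolding positive_sets_def by blast

lemma positive_setsI: "positive x y z \<Longrightarrow> {x, y, z} \<in> positive_sets"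
  unfolding positive_sets_def by blast

lemma rep_positive:
  assumes "\<sigma> \<in> positive_sets"
  obtains x y z where "rep \<sigma> = [x, y, z]" "\<sigma> = {x, y, z}" "positive x y z"
proof -
  obtain x y z where xyz: "\<sigma> = {x, y, z}" "positive x y z" using assms by (rule positive_setsE)
  note r = positive_rotate[OF xyz(2)]
  show thesis using xyz(2)
  proof (cases rule: rep)
    case 1 then show ?thesis using that xyz by auto
  next
    case 2 then show ?thesis using that[of y z x] xyz r by auto
  next
    case 3 then show ?thesis using that[of z x y] xyz positive_rotate[OF r] by auto
  qed
qed

text \<open>Since \<open>x\<close> lies even in the \<open>\<eta>/4\<close>-tube, a point at
  distance less than \<open>\<kappa> \<le> \<eta>/4\<close> is still in the
  \<open>\<eta>/2\<close>-tube.\<close>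

lemma positive_replace:
  assumes p: "positive x y z" and v: "dist v x < \<kappa>" and d: "dist v y < r0" "dist z v < r0"
  shows "positive v y z"
proof -
  have xq: "x \<in> tube (\<eta>/4)" using p by (intro isolated[of x y z]) (auto simp: positive_def)
  then obtain u where u: "dist x (A u) < \<eta>/4" by (auto simp: tube_def)
  have "dist v (A u) < \<eta>/2"
    using dist_triangle[of v "A u" x] u v \<kappa> by linarith
  then have vt: "v \<in> tube (\<eta>/2)" by (auto simp: tube_def)
  have "wind v y z = wind x y z"
    by (rule wind_perturb) (use p vt v d \<kappa> r0 a tube_half in \<open>auto simp: positive_def dist_commute\<close>)
  then show ?thesis using p vt d by (auto simp: positive_def dist_commute)
qed

end

locale winding_cocycle_field = winding_cocycle \<alpha> a \<delta> \<rho> e N ang U V \<eta> r0 \<kappa> + field R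
  for \<alpha> :: "real \<Rightarrow> 'a::metric_space" and a \<delta> \<rho> e and N :: nat and ang U V \<eta> r0 \<kappa>
    and R :: "('f, 'm) ring_scheme" (structure)
begin

lemma chain_rep:
  assumes c: "c \<in> chains 3 L" and p: "positive x y z"
  shows "c (v # rep {x, y, z}) = c [v, x, y, z]"
proof -
  note adj = chains_adjacent[OF c] and cl = chains_closed[OF c]
  have rot: "c [v, y, z, x] = c [v, x, y, z]" for v x y z
    using adj[of "[v, y]" x z "[]"] adj[of "[v]" x y "[z]"] cl by simp
  show ?thesis using p
  proof (cases rule: rep)
    case 2 then show ?thesis using rot[of v y z x] by simp
  next
    case 3 then show ?thesis using rot[of v x y z] by simp
  qed simp
qed

text \<open>If the face \<open>x, y, z\<close> of a tetrahedron winds, then its vertices are far apart, so the close pair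
  consists of \<open>v\<close> and just one of them, say \<open>x\<close>. Then \<open>v, y, z\<close> winds too, with the opposite sign in the
  boundary. The terms of the sum cancel in these pairs.\<close>

lemma cocycle_vanishes_on_boundaries:
  assumes L: "\<And>\<sigma> u v. \<sigma> \<in> L \<Longrightarrow> u \<in> \<sigma> \<Longrightarrow> v \<in> \<sigma> \<Longrightarrow> dist u v < r0"
    and close: "\<And>\<sigma>. \<sigma> \<in> L \<Longrightarrow> card \<sigma> = 4 \<Longrightarrow> \<exists>u\<in>\<sigma>. \<exists>v\<in>\<sigma>. u \<noteq> v \<and> dist u v < \<kappa>"
    and c: "c \<in> chains 3 L" and B: "finite B" "\<And>l. c l \<noteq> \<zero> \<Longrightarrow> set l \<subseteq> B"
  shows "(\<Oplus>\<sigma>\<in>positive_sets \<inter> Pow B. bd 3 c (rep \<sigma>)) = \<zero>"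
proof -
  define F where "F = positive_sets \<inter> Pow B"
  have F: "finite F" using B(1) by (simp add: F_def)
  note cl = chains_closed[OF c]
  have c': "c \<in> chains (Suc 2) L" using c by (simp add: numeral_3_eq_3 numeral_2_eq_2)
  have bd: "bd 3 c w = (\<Oplus>v\<in>B. c (v # w))" for w
    using bd_eq_support_vertices[OF c' B] by (simp add: numeral_3_eq_3 numeral_2_eq_2)
  define P where "P = {p \<in> F \<times> B. c (snd p # rep (fst p)) \<noteq> \<zero>}"
  have P: "finite P" using F B(1) by (simp add: P_def)
  have "(\<Oplus>\<sigma>\<in>F. bd 3 c (rep \<sigma>)) = (\<Oplus>p\<in>F \<times> B. c (snd p # rep (fst p)))"
    unfolding bd using cl by (intro finsum_product F B) auto
  also have "\<dots> = (\<Oplus>p\<in>P. c (snd p # rep (fst p)))"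
    by (rule finsum_superset[symmetric]) (use F B cl in \<open>auto simp: P_def\<close>)
  also have "\<dots> = \<zero>"
  proof -
    \<comment> \<open>The pairing exchanges the apex \<open>v\<close> of the tetrahedron with the vertex of the triangle next to it.\<close>
    define i where "i p = (THE q. \<exists>u. u \<in> fst p \<and> dist (snd p) u < \<kappa> \<and> q = (insert (snd p) (fst p - {u}), u))"
      for p :: "'a set \<times> 'a"
    have i: "i ({x, y, z}, v) = ({v, y, z}, x)" if p: "positive x y z" and v: "dist v x < \<kappa>" for x y z v
    proof -
      have "u = x" if "u \<in> {x, y, z}" "dist v u < \<kappa>" for u
      proof (rule ccontr)
        assume "u \<noteq> x"
        then have "a / 5 < dist u x" using that(1) positive_far[OF p] by (auto simp: dist_commute)
        moreover have "dist u x \<le> dist v u + dist v x" using dist_triangle[of u x v] by (simp add: dist_commute)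
        ultimately show False using that(2) v \<kappa>(2) a by linarith
      qed
      moreover have "{x, y, z} - {x} = {y, z}" using positive_distinct[OF p] by auto
      ultimately show ?thesis unfolding i_def using v by (intro the_equality) auto
    qed
    have key: "\<exists>x y z. \<sigma> = {x, y, z} \<and> positive x y z \<and> dist v x < \<kappa> \<and> positive v y z \<and>
        c (v # rep \<sigma>) = c [v, x, y, z] \<and> c (x # rep {v, y, z}) = \<ominus> c [v, x, y, z] \<and> v \<noteq> x \<and> v \<noteq> y \<and> v \<noteq> z"
      if p: "(\<sigma>, v) \<in> P" for \<sigma> v
    proof -
      have \<sigma>: "\<sigma> \<in> positive_sets" and nz: "c (v # rep \<sigma>) \<noteq> \<zero>" using p by (auto simp: P_def F_def)
      obtain x0 y0 z0 where r: "rep \<sigma> = [x0, y0, z0]" "\<sigma> = {x0, y0, z0}" "positive x0 y0 z0"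
        using rep_positive[OF \<sigma>] by blast
      have s: "distinct [v, x0, y0, z0]" "{v, x0, y0, z0} \<in> L"
        using chains_supp[OF c nz[unfolded r(1)]] by auto
      have "card {v, x0, y0, z0} = 4" using s(1) by simp
      then obtain u w where uw: "u \<in> {v, x0, y0, z0}" "w \<in> {v, x0, y0, z0}" "u \<noteq> w" "dist u w < \<kappa>"
        using close[OF s(2)] by blast
      have far: "\<not> dist p q < \<kappa>" if "p \<in> {x0, y0, z0}" "q \<in> {x0, y0, z0}" "p \<noteq> q" for p q
        using that positive_far[OF r(3)] \<kappa>(2) a by (auto simp: dist_commute)
      have "u = v \<or> w = v" using far[of u w] uw by auto
      then obtain x where x: "x \<in> {x0, y0, z0}" "dist v x < \<kappa>"
        using uw by (metis dist_commute insert_iff)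
      have "\<exists>y z. {x0, y0, z0} = {x, y, z} \<and> positive x y z"
      proof -
        consider "x = x0" | "x = y0" | "x = z0" using x(1) by blast
        then show ?thesis
        proof cases
          case 1 then show ?thesis using r(3) by blast
        next
          case 2 then show ?thesis using positive_rotate[OF r(3)] by blast
        next
          case 3 then show ?thesis using positive_rotate[OF positive_rotate[OF r(3)]] by blast
        qed
      qed
      then obtain y z where yz: "\<sigma> = {x, y, z}" "positive x y z" using r(2) by auto
      have vs: "{v, x, y, z} \<in> L" using s(2) yz(1) r(2) by simp
      have "v \<notin> \<sigma>" using s(1) r(2) by auto
      then have vd: "v \<noteq> x" "v \<noteq> y" "v \<noteq> z" using yz(1) by auto
      have pv: "positive v y z"
        by (rule positive_replace[OF yz(2) x(2)]) (use L[OF vs] in auto)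
      have "c (v # rep \<sigma>) = c [v, x, y, z]" unfolding yz(1) by (rule chain_rep[OF c yz(2)])
      moreover have "c (x # rep {v, y, z}) = c [x, v, y, z]" by (rule chain_rep[OF c pv])
      moreover have "c [x, v, y, z] = \<ominus> c [v, x, y, z]" using chains_adjacent[OF c, of "[]" x v "[y, z]"] by simp
      ultimately show ?thesis using yz x(2) pv vd by metis
    qed
    show ?thesis
    proof (rule finsum_involution[OF P, of i])
      fix p assume p: "p \<in> P"
      obtain \<sigma> v where pe: "p = (\<sigma>, v)" by (cases p)
      obtain x y z where k: "\<sigma> = {x, y, z}" "positive x y z" "dist v x < \<kappa>" "positive v y z"
        "c (v # rep \<sigma>) = c [v, x, y, z]" "c (x # rep {v, y, z}) = \<ominus> c [v, x, y, z]" "v \<noteq> x" "v \<noteq> y" "v \<noteq> z"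
        using key[of \<sigma> v] p pe by blast
      have ip: "i p = ({v, y, z}, x)" unfolding pe k(1) by (rule i[OF k(2,3)])
      have "i ({v, y, z}, x) = ({x, y, z}, v)" by (rule i[OF k(4)]) (use k(3) in \<open>simp add: dist_commute\<close>)
      then have iip: "i (i p) = p" unfolding ip by (simp add: pe k(1))
      show "c (snd p # rep (fst p)) \<in> carrier R" by (rule cl)
      show "c (snd (i p) # rep (fst (i p))) = \<ominus> c (snd p # rep (fst p))"
        unfolding ip using k(5,6) pe by simp
      have "c [v, x, y, z] \<noteq> \<zero>" using p pe k(5) by (auto simp: P_def)
      then have nz: "c (x # rep {v, y, z}) \<noteq> \<zero>" unfolding k(6) using cl by simp
      have "\<sigma> \<subseteq> B" "v \<in> B" using p pe by (auto simp: P_def F_def)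
      then have "({v, y, z}, x) \<in> P"
        using nz k(1) positive_setsI[OF k(4)] by (auto simp: P_def F_def)
      moreover have "i p \<noteq> p" unfolding ip unfolding pe using k(7) by simp
      ultimately show "i p \<in> P \<and> i (i p) = p \<and> i p \<noteq> p" using ip iip by simp
    qed
  qed
  finally show ?thesis by (simp add: F_def)
qed

end

section \<open>Selective Rips complexes\<close>

lemma diameter_less:
  fixes S :: "'a::metric_space set"
  assumes "finite S" "S \<noteq> {}" "\<And>x y. x \<in> S \<Longrightarrow> y \<in> S \<Longrightarrow> dist x y < r"
  shows "diameter S < r"
  unfolding diameter_def using assms by (auto intro!: finite_imp_Sup_less)

lemma diameter_le_bound:
  fixes S :: "'a::metric_space set"
  assumes "0 \<le> d" "\<And>x y. x \<in> S \<Longrightarrow> y \<in> S \<Longrightarrow> dist x y \<le> d"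
  shows "diameter S \<le> d"
  unfolding diameter_def using assms by (auto intro!: cSUP_least)

lemma sRips_dist: "\<sigma> \<in> sRips Y r n t \<Longrightarrow> x \<in> \<sigma> \<Longrightarrow> y \<in> \<sigma> \<Longrightarrow> dist x y < r"
  unfolding sRips_def using diameter_bounded_bound[of \<sigma> x y] finite_imp_bounded[of \<sigma>] by auto

lemma sRips_downward_closed: "downward_closed (sRips Y r n t)"
  unfolding downward_closed_def
proof (intro ballI allI impI)
  fix \<sigma> \<tau> assume \<sigma>: "\<sigma> \<in> sRips Y r n t" and \<tau>: "\<tau> \<subseteq> \<sigma> \<and> \<tau> \<noteq> {}"
  have "finite \<sigma>" using \<sigma> by (simp add: sRips_def)
  then have "diameter \<tau> \<le> diameter \<sigma>" using \<tau> by (intro diameter_subset finite_imp_bounded) auto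
  moreover obtain W where W: "\<forall>i\<le>n. W i \<subseteq> Y \<and> bounded (W i) \<and> diameter (W i) < t" "\<sigma> \<subseteq> (\<Union>i\<le>n. W i)"
    using \<sigma> unfolding sRips_def by blast
  moreover have "\<sigma> \<subseteq> Y" "diameter \<sigma> < r" using \<sigma> by (auto simp: sRips_def)
  moreover have "finite \<tau>" "\<tau> \<subseteq> Y" "\<tau> \<subseteq> (\<Union>i\<le>n. W i)" using \<tau> \<sigma> W(2) finite_subset by (auto simp: sRips_def)
  ultimately show "\<tau> \<in> sRips Y r n t" using \<tau> unfolding sRips_def mem_Collect_eq
    by (intro conjI exI[of _ W]) auto
qed

lemma sRips_mono:
  assumes "r \<le> r'" "t \<le> t'" shows "sRips Y r n t \<subseteq> sRips Y r' n t'"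
proof
  fix \<sigma> assume \<sigma>: "\<sigma> \<in> sRips Y r n t"
  then obtain W where "\<forall>i\<le>n. W i \<subseteq> Y \<and> bounded (W i) \<and> diameter (W i) < t" "\<sigma> \<subseteq> (\<Union>i\<le>n. W i)"
    unfolding sRips_def by blast
  then show "\<sigma> \<in> sRips Y r' n t'"
    using \<sigma> assms unfolding sRips_def by (auto intro!: exI[of _ W] intro: less_le_trans)
qed

lemma triple_in_sRips:
  fixes x y z :: "'a::metric_space"
  assumes "0 < t" "dist x y < r" "dist y z < r" "dist z x < r"
  shows "{x, y, z} \<in> sRips UNIV r 2 t"
proof -
  have "0 < r" using assms(2) zero_le_dist[of x y] by linarith
  then have "diameter {x, y, z} < r" using assms by (intro diameter_less) (auto simp: dist_commute)
  moreover have "{x, y, z} \<subseteq> (\<Union>i\<le>(2::nat). (\<lambda>i. if i = 0 then {x} else if i = 1 then {y} else {z}) i)"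
    by (auto simp: atMost_Suc numeral_2_eq_2)
  ultimately show ?thesis unfolding sRips_def
    using assms(1) by (auto intro!: exI[of _ "\<lambda>i. if i = 0 then {x} else if i = 1 then {y} else {z}"])
qed

text \<open>By the pigeonhole principle two of the four vertices lie in the same one of the three sets.\<close>

lemma sRips_close_pair:
  assumes \<sigma>: "\<sigma> \<in> sRips UNIV r 2 t" and card: "card \<sigma> = 4"
  shows "\<exists>u\<in>\<sigma>. \<exists>v\<in>\<sigma>. u \<noteq> v \<and> dist u v < t"
proof -
  obtain W where W: "\<forall>i\<le>2. bounded (W i) \<and> diameter (W i) < t" "\<sigma> \<subseteq> (\<Union>i\<le>(2::nat). W i)"
    using \<sigma> unfolding sRips_def by blast
  then have "\<forall>x\<in>\<sigma>. \<exists>i. i \<le> 2 \<and> x \<in> W i" by auto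
  then obtain f where f: "\<forall>x\<in>\<sigma>. f x \<le> 2 \<and> x \<in> W (f x)" by metis
  have "card (f ` \<sigma>) \<le> card {..2::nat}" using f by (intro card_mono) auto
  then have "card (f ` \<sigma>) < card \<sigma>" using card by simp
  then have "\<not> inj_on f \<sigma>" by (rule pigeonhole)
  then obtain u v where uv: "u \<in> \<sigma>" "v \<in> \<sigma>" "u \<noteq> v" "f u = f v" unfolding inj_on_def by blast
  have "u \<in> W (f u)" "v \<in> W (f u)" "f u \<le> 2" using f uv by auto
  then have "dist u v < t" using W(1) diameter_bounded_bound[of "W (f u)" u v] by fastforce
  then show ?thesis using uv by blast
qed

lemma sRips_add_net_points:
  assumes \<sigma>: "\<sigma> \<in> sRips UNIV r n t" and \<phi>: "\<And>x. dist x (\<phi> x) < k"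
    and r: "r + 2 * k \<le> r'" and t: "t + 2 * k \<le> t'"
  shows "\<sigma> \<union> \<phi> ` \<sigma> \<in> sRips UNIV r' n t'"
proof -
  have fin: "finite \<sigma>" "\<sigma> \<noteq> {}" and d: "\<And>x y. x \<in> \<sigma> \<Longrightarrow> y \<in> \<sigma> \<Longrightarrow> dist x y < r"
    using \<sigma> sRips_dist[OF \<sigma>] by (auto simp: sRips_def)
  obtain W where W: "\<And>i. i \<le> n \<Longrightarrow> bounded (W i) \<and> diameter (W i) < t" "\<sigma> \<subseteq> (\<Union>i\<le>n. W i)"
    using \<sigma> unfolding sRips_def by blast
  have near: "dist x y \<le> dist x' y' + 2 * k" if "x = x' \<or> x = \<phi> x'" "y = y' \<or> y = \<phi> y'" for x y x' y'
  proof -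
    have k: "0 < k" using \<phi>[of x] zero_le_dist[of x "\<phi> x"] by linarith
    have "dist x' x \<le> k" "dist y' y \<le> k" using that \<phi>[of x'] \<phi>[of y'] k by auto
    then show ?thesis using dist_triangle[of x y x'] dist_triangle[of x' y y'] by (simp add: dist_commute)
  qed
  have "diameter (\<sigma> \<union> \<phi> ` \<sigma>) < r'"
  proof (rule diameter_less)
    fix x y assume "x \<in> \<sigma> \<union> \<phi> ` \<sigma>" "y \<in> \<sigma> \<union> \<phi> ` \<sigma>"
    then obtain x' y' where xy: "x' \<in> \<sigma>" "y' \<in> \<sigma>" "x = x' \<or> x = \<phi> x'" "y = y' \<or> y = \<phi> y'" by blast
    show "dist x y < r'" using near[OF xy(3,4)] d[OF xy(1,2)] r by linarith
  qed (use fin in auto)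
  moreover have "\<sigma> \<union> \<phi> ` \<sigma> \<subseteq> (\<Union>i\<le>n. (W i \<inter> \<sigma>) \<union> \<phi> ` (W i \<inter> \<sigma>))" using W(2) by blast
  moreover have "diameter ((W i \<inter> \<sigma>) \<union> \<phi> ` (W i \<inter> \<sigma>)) < t'" "bounded ((W i \<inter> \<sigma>) \<union> \<phi> ` (W i \<inter> \<sigma>))" if i: "i \<le> n" for i
  proof -
    have "finite ((W i \<inter> \<sigma>) \<union> \<phi> ` (W i \<inter> \<sigma>))" using fin by simp
    then show "bounded ((W i \<inter> \<sigma>) \<union> \<phi> ` (W i \<inter> \<sigma>))" by (rule finite_imp_bounded)
    have k: "0 < k" using \<phi>[of undefined] zero_le_dist[of undefined "\<phi> undefined"] by linarith
    have D0: "0 \<le> diameter (W i)" using W(1)[OF i] by (intro diameter_ge_0) auto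
    have "diameter ((W i \<inter> \<sigma>) \<union> \<phi> ` (W i \<inter> \<sigma>)) \<le> diameter (W i) + 2 * k"
    proof (rule diameter_le_bound)
      fix x y assume "x \<in> (W i \<inter> \<sigma>) \<union> \<phi> ` (W i \<inter> \<sigma>)" "y \<in> (W i \<inter> \<sigma>) \<union> \<phi> ` (W i \<inter> \<sigma>)"
      then obtain x' y' where xy: "x' \<in> W i" "y' \<in> W i" "x = x' \<or> x = \<phi> x'" "y = y' \<or> y = \<phi> y'" by blast
      have "dist x' y' \<le> diameter (W i)" using W(1)[OF i] xy by (intro diameter_bounded_bound) auto
      then show "dist x y \<le> diameter (W i) + 2 * k" using near[OF xy(3,4)] by linarith
    qed (use D0 k in simp)
    then show "diameter ((W i \<inter> \<sigma>) \<union> \<phi> ` (W i \<inter> \<sigma>)) < t'" using W(1)[OF i] t by linarith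
  qed
  ultimately show ?thesis unfolding sRips_def
    using fin by (auto intro!: exI[of _ "\<lambda>i. (W i \<inter> \<sigma>) \<union> \<phi> ` (W i \<inter> \<sigma>)"])
qed

lemma sRips_full:
  fixes \<sigma> :: "'a::metric_space set"
  assumes "finite \<sigma>" "\<sigma> \<noteq> {}" "\<And>x y :: 'a. dist x y < r" "\<And>x y :: 'a. dist x y < t"
  shows "\<sigma> \<in> sRips UNIV r n t"
  unfolding sRips_def
  using assms diameter_less[of \<sigma> r] diameter_less[of \<sigma> t] finite_imp_bounded[of \<sigma>]
  by (auto intro!: exI[of _ "\<lambda>_. \<sigma>"])

context field
begin

text \<open>In a full simplex every cycle is the boundary of its cone from any point.\<close>

lemma cycles_bound_in_full_complex:
  fixes z :: "'v list \<Rightarrow> 'a"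
  assumes K: "\<And>\<sigma>. finite \<sigma> \<Longrightarrow> \<sigma> \<noteq> {} \<Longrightarrow> \<sigma> \<in> K" and z: "z \<in> cycles p K" and p: "0 < p"
  shows "z \<in> bounds p K"
proof -
  have zc: "z \<in> chains p K" "bd p z = czero" using z by (auto simp: simplicial_cycles_def)
  have "cone undefined czero = (czero :: 'v list \<Rightarrow> 'a)" by (intro ext) (use csr_zero[of _ undefined czero] in \<open>auto simp: cone_def\<close>)
  then have "bd (Suc p) (cone undefined z) = z"
    using bd_cone[OF zc(1) p, of undefined K] K zc chains_closed[OF zc(1)] by (auto simp: minus_eq)
  moreover have "cone undefined z \<in> chains (Suc p) K" by (rule cone_chain[OF zc(1)]) (use K in auto)
  ultimately show ?thesis unfolding simplicial_boundaries_def by (metis image_eqI)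
qed

text \<open>Moving each point to a point of a finite net enlarges distances by at most twice the mesh of the net.
  The mesh is chosen so small that both parameters of the complex leave room for this.\<close>

lemma cycles_on_finite_net:
  assumes comp: "compact (UNIV :: 'x::metric_space set)" and r: "r < r'" and s: "0 < s"
  obtains D :: "'x::metric_space list set" where "finite D"
    "\<And>w. w \<in> cycles 2 (sRips UNIV r 2 (s * r)) \<Longrightarrow>
       \<exists>w'\<in>cycles 2 (sRips UNIV r' 2 (s * r')). (\<forall>l. l \<notin> D \<longrightarrow> w' l = \<zero>) \<and>
         csub w w' \<in> bounds 2 (sRips UNIV r' 2 (s * r'))"
proof -
  define k where "k = min 1 s * (r' - r) / 2"
  have k: "0 < k" using r s by (simp add: k_def)
  have k1: "2 * k = min 1 s * (r' - r)" by (simp add: k_def)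
  have "2 * k \<le> 1 * (r' - r)" "2 * k \<le> s * (r' - r)"
    unfolding k1 using r by (auto intro!: mult_right_mono)
  then have k2: "r + 2 * k \<le> r'" "s * r + 2 * k \<le> s * r'" by (simp_all add: right_diff_distrib)
  obtain Y where Y: "finite Y" "(UNIV :: 'x set) \<subseteq> (\<Union>y\<in>Y. ball y k)"
    using comp k unfolding compact_eq_totally_bounded by blast
  have "\<forall>x::'x. \<exists>y\<in>Y. dist x y < k"
  proof
    fix x :: 'x
    have "x \<in> (\<Union>y\<in>Y. ball y k)" using Y(2) by blast
    then show "\<exists>y\<in>Y. dist x y < k" by (auto simp: dist_commute)
  qed
  then obtain f where f: "\<And>x::'x. f x \<in> Y \<and> dist x (f x) < k" by metis
  define \<phi> where "\<phi> x = (if x \<in> Y then x else f x)" for x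
  have \<phi>: "\<phi> (\<phi> x) = \<phi> x" "dist x (\<phi> x) < k" "range \<phi> \<subseteq> Y" for x
    using f k by (auto simp: \<phi>_def)
  define D where "D = {l. set l \<subseteq> Y \<and> length l = 3}"
  show thesis
  proof (rule that[of D])
    show "finite D" unfolding D_def by (rule finite_lists_length_eq[OF Y(1)])
    fix w :: "'x list \<Rightarrow> 'a" assume w: "w \<in> cycles 2 (sRips UNIV r 2 (s * r))"
    obtain w' where w': "w' \<in> cycles 2 (sRips UNIV r' 2 (s * r'))"
      "csub w w' \<in> bounds 2 (sRips UNIV r' 2 (s * r'))" "\<And>l. w' l \<noteq> \<zero> \<Longrightarrow> set l \<subseteq> range \<phi>"
    proof (rule move_vertices[OF sRips_downward_closed _ w _ \<phi>(1)])
      show "sRips UNIV r 2 (s * r) \<subseteq> sRips UNIV r' 2 (s * r')" using r s by (intro sRips_mono) auto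
      show "\<sigma> \<union> \<phi> ` \<sigma> \<in> sRips UNIV r' 2 (s * r')" if "\<sigma> \<in> sRips UNIV r 2 (s * r)" for \<sigma>
        by (rule sRips_add_net_points[OF that \<phi>(2) k2])
    qed auto
    have "w' l = \<zero>" if "l \<notin> D" for l
    proof (rule ccontr)
      assume nz: "w' l \<noteq> \<zero>"
      have "w' \<in> chains 2 (sRips UNIV r' 2 (s * r'))" using w'(1) by (simp add: simplicial_cycles_def)
      from chains_supp[OF this, of l] nz have "length l = 3" by simp
      then show False using w'(3)[OF nz] \<phi>(3) that by (auto simp: D_def)
    qed
    then show "\<exists>w'\<in>cycles 2 (sRips UNIV r' 2 (s * r')). (\<forall>l. l \<notin> D \<longrightarrow> w' l = \<zero>) \<and>
         csub w w' \<in> bounds 2 (sRips UNIV r' 2 (s * r'))" using w' by blast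
  qed
qed

end

section \<open>Filling loops of bounded length\<close>

text \<open>For \<open>d = a / 3\<close> the bound is attained by the large triangle of the circle, which belongs to the
  complexes of scale \<open>r\<close> just for \<open>r > a / 3\<close>.\<close>

definition small_sets :: "real \<Rightarrow> 'a::metric_space set set" where
  "small_sets d = {\<sigma>. \<forall>u\<in>\<sigma>. \<forall>v\<in>\<sigma>. dist u v \<le> d}"

lemma triple_small: "0 \<le> d \<Longrightarrow> dist x y \<le> d \<Longrightarrow> dist y z \<le> d \<Longrightarrow> dist x z \<le> d \<Longrightarrow> {x, y, z} \<in> small_sets d"
  by (auto simp: small_sets_def dist_commute)

lemma paths_uniformly_fine:
  fixes P :: "(real \<Rightarrow> 'a::metric_space) set"
  assumes "finite P" "\<And>p. p \<in> P \<Longrightarrow> path p" "0 < \<epsilon>"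
  shows "\<exists>m0. \<forall>m\<ge>m0. \<forall>p\<in>P. \<forall>u\<in>{0..1}. \<forall>v\<in>{0..1}. \<bar>u - v\<bar> \<le> 1 / real (Suc m) \<longrightarrow> dist (p u) (p v) < \<epsilon>"
  using assms(1,2)
proof (induction P rule: finite_induct)
  case (insert p P)
  have "uniformly_continuous_on {0..1} p"
    using insert.prems by (intro compact_uniformly_continuous) (auto simp: path_def)
  then obtain d where d: "d > 0" "\<And>u v. u \<in> {0..1} \<Longrightarrow> v \<in> {0..1} \<Longrightarrow> dist v u < d \<Longrightarrow> dist (p v) (p u) < \<epsilon>"
    unfolding uniformly_continuous_on_def using assms(3) by metis
  obtain m0 where m0: "\<And>m p u v. m \<ge> m0 \<Longrightarrow> p \<in> P \<Longrightarrow> u \<in> {0..1} \<Longrightarrow> v \<in> {0..1} \<Longrightarrow>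
      \<bar>u - v\<bar> \<le> 1 / real (Suc m) \<Longrightarrow> dist (p u) (p v) < \<epsilon>"
    using insert by (metis insertI2)
  obtain m1 :: nat where m1: "1 / d < real m1" using reals_Archimedean2 by blast
  have new: "dist (p u) (p v) < \<epsilon>" if "m \<ge> m1" "u \<in> {0..1}" "v \<in> {0..1}" "\<bar>u - v\<bar> \<le> 1 / real (Suc m)" for m u v
  proof -
    have "1 / d < real (Suc m)" using m1 that(1) by linarith
    then have "1 / real (Suc m) < d" using d(1) by (simp add: field_simps)
    then show ?thesis using d(2)[OF that(3,2)] that(4) by (simp add: dist_real_def)
  qed
  show ?case
    by (intro exI[of _ "max m0 m1"] allI ballI impI) (use m0 new in auto)
qed simp

text \<open>The points \<open>0\<close>, \<open>s1\<close> and \<open>s2\<close> cut the loop into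
  three arcs, each within distance \<open>d\<close> of its initial point. Apart from the triangle of
  the three points the filling consists of triangles with a side of length less than
  \<open>\<epsilon>\<close>: fans over the polygon with apex at the initial points of the arcs, and
  small corrections because \<open>s1\<close> and \<open>s2\<close> need not be vertices of the
  polygon.\<close>

lemma loop_filling:
  fixes q :: "real \<Rightarrow> 'a::metric_space"
  assumes q: "q 1 = q 0" and s: "0 \<le> s1" "s1 \<le> s2" "s2 \<le> 1"
    and d1: "\<And>u. 0 \<le> u \<Longrightarrow> u \<le> s1 \<Longrightarrow> dist (q 0) (q u) \<le> d"
    and d2: "\<And>u. s1 \<le> u \<Longrightarrow> u \<le> s2 \<Longrightarrow> dist (q s1) (q u) \<le> d"
    and d3: "\<And>u. s2 \<le> u \<Longrightarrow> u \<le> 1 \<Longrightarrow> dist (q s2) (q u) \<le> d"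
    and fine: "\<And>u v. u \<in> {0..1} \<Longrightarrow> v \<in> {0..1} \<Longrightarrow> \<bar>u - v\<bar> \<le> 1 / real (Suc m) \<Longrightarrow> dist (q u) (q v) < \<epsilon>"
    and \<epsilon>: "\<epsilon> \<le> d"
  obtains C B where "alternating_chain (small_sets d) C" "finite B" "\<And>l. C l \<noteq> 0 \<Longrightarrow> set l \<subseteq> B"
    "\<And>A w. finite A \<Longrightarrow> B \<subseteq> A \<Longrightarrow>
       (\<Sum>v\<in>A. C (v # w)) = (\<Sum>i<Suc m. edge (q (real i / real (Suc m))) (q (real (Suc i) / real (Suc m))) w)"
    "\<And>l. C l \<noteq> triangle (q 0) (q s1) (q s2) l \<Longrightarrow> \<exists>u\<in>set l. \<exists>v\<in>set l. u \<noteq> v \<and> dist u v < \<epsilon>"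
proof -
  let ?n = "Suc m"
  let ?N = "real ?n"
  have N: "0 < ?N" by simp
  define p where "p j = q (real (min j ?n) / ?N)" for j
  have pq: "p j = q (real j / ?N)" if "j \<le> ?n" for j using that by (simp add: p_def min_def del: of_nat_Suc)
  have in01: "real j / ?N \<in> {0..1}" if "j \<le> ?n" for j using that N by (simp add: divide_le_eq_1 del: of_nat_Suc)
  \<comment> \<open>the last vertices of the polygon before \<open>s1\<close> and \<open>s2\<close>\<close>
  define J where "J = nat \<lfloor>s1 * ?N\<rfloor>"
  define L where "L = nat \<lfloor>s2 * ?N\<rfloor>"
  have fl: "real (nat \<lfloor>t * ?N\<rfloor>) / ?N \<le> t" "t < real (Suc (nat \<lfloor>t * ?N\<rfloor>)) / ?N" if "0 \<le> t" for t
  proof -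
    have "0 \<le> t * ?N" using that by simp
    then have "real (nat \<lfloor>t * ?N\<rfloor>) = of_int \<lfloor>t * ?N\<rfloor>" by simp
    then have "real (nat \<lfloor>t * ?N\<rfloor>) \<le> t * ?N" "t * ?N < real (Suc (nat \<lfloor>t * ?N\<rfloor>))"
      unfolding of_nat_Suc[of "nat \<lfloor>t * ?N\<rfloor>"] by linarith+
    then show "real (nat \<lfloor>t * ?N\<rfloor>) / ?N \<le> t" "t < real (Suc (nat \<lfloor>t * ?N\<rfloor>)) / ?N"
      by (simp_all only: pos_divide_le_eq[OF N] pos_less_divide_eq[OF N])
  qed
  have J: "real J / ?N \<le> s1" "s1 < real (Suc J) / ?N" and L: "real L / ?N \<le> s2" "s2 < real (Suc L) / ?N"
    unfolding J_def L_def using fl s by auto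
  have JL: "J \<le> L" unfolding J_def L_def using s by (intro nat_mono floor_mono mult_right_mono) auto
  have "s2 * ?N \<le> 1 * ?N" using s by (intro mult_right_mono) auto
  then have "\<lfloor>s2 * ?N\<rfloor> \<le> \<lfloor>?N\<rfloor>" by (intro floor_mono) simp
  then have Ln: "L \<le> ?n" unfolding L_def floor_of_nat nat_le_iff .
  have \<epsilon>0: "0 < \<epsilon>" using fine[of 0 0] by simp
  then have d0: "0 \<le> d" using \<epsilon> by simp
  have step: "dist (p i) (p (Suc i)) < \<epsilon>" if "i < ?n" for i
  proof -
    have "\<bar>real i / ?N - real (Suc i) / ?N\<bar> = 1 / ?N" using N by (simp add: diff_divide_distrib[symmetric] abs_divide)
    then show ?thesis using that in01[of i] in01[of "Suc i"] by (simp add: pq fine del: of_nat_Suc)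
  qed
  have n1: "real (Suc j) / ?N = real j / ?N + 1 / ?N" for j by (simp add: add_divide_distrib)
  have pJ: "dist (p J) (q s1) < \<epsilon>"
  proof -
    have "\<bar>real J / ?N - s1\<bar> \<le> 1 / ?N" using J n1[of J] by linarith
    then show ?thesis using JL Ln s in01[of J] by (simp add: pq fine del: of_nat_Suc)
  qed
  have pL: "dist (p L) (q s2) < \<epsilon>"
  proof -
    have "\<bar>real L / ?N - s2\<bar> \<le> 1 / ?N" using L n1[of L] by linarith
    then show ?thesis using Ln s in01[of L] by (simp add: pq fine del: of_nat_Suc)
  qed
  have p0: "p 0 = q 0" by (simp add: p_def)
  have pn: "p ?n = p 0" using q by (simp add: p_def del: of_nat_Suc)
  have div_mono: "real i / ?N \<le> real j / ?N" if "i \<le> j" for i j using that by (intro divide_right_mono) auto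
  have D1: "dist (q 0) (p i) \<le> d" if "i \<le> J" for i
    using d1[of "real i / ?N"] J div_mono[OF that] that JL Ln by (simp add: pq del: of_nat_Suc)
  have D2: "dist (q s1) (p i) \<le> d" if "J \<le> i" "i \<le> L" for i
  proof (cases "i = J")
    case True
    then show ?thesis using pJ \<epsilon> by (simp add: dist_commute)
  next
    case False
    then show ?thesis using d2[of "real i / ?N"] J L div_mono[of "Suc J" i] div_mono[OF that(2)] that Ln
      by (simp add: pq del: of_nat_Suc)
  qed
  have D3: "dist (q s2) (p i) \<le> d" if "L \<le> i" "i \<le> ?n" for i
  proof (cases "i = L")
    case True
    then show ?thesis using pL \<epsilon> by (simp add: dist_commute)
  next
    case False
    then show ?thesis using d3[of "real i / ?N"] L div_mono[of "Suc L" i] in01[OF that(2)] that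
      by (simp add: pq del: of_nat_Suc)
  qed
  have big: "dist (q 0) (q s1) \<le> d" "dist (q s1) (q s2) \<le> d" "dist (q 0) (q s2) \<le> d"
    using d1[of s1] d2[of s2] d3[of 1] s q by (auto simp: dist_commute)
  define C where "C = polygon_filling p J L ?n (q s1) (q s2)"
  define B where "B = p ` {..?n} \<union> {q s1, q s2}"
  have B: "finite B" "\<And>i. p i \<in> B" "q s1 \<in> B" "q s2 \<in> B"
  proof -
    show "p i \<in> B" for i
    proof -
      have "p i = p (min i ?n)" by (simp add: p_def)
      then show ?thesis by (auto simp: B_def)
    qed
  qed (auto simp: B_def)
  have step': "dist (p i) (p (Suc i)) \<le> d" if "i < ?n" for i using step[OF that] \<epsilon> by simp
  have alt: "alternating_chain (small_sets d) C"
    unfolding C_def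
    by (intro alternating_chain_polygon_filling triple_small d0)
      (use big D1 D2 D3 step' p0 pJ pL JL Ln \<epsilon> in auto)
  have thin: "\<exists>u\<in>set l. \<exists>v\<in>set l. u \<noteq> v \<and> dist u v < \<epsilon>"
    if "triangle x y z l \<noteq> 0" "dist y z < \<epsilon>" for x y z l
    using triangle_support[OF that(1)] that(2) by auto
  have fanE: "\<exists>i. j \<le> i \<and> i < k \<and> triangle x (p i) (p (Suc i)) l \<noteq> 0" if "fan x p j k l \<noteq> 0" for x j k l
  proof (rule ccontr)
    assume "\<not> ?thesis"
    then have "fan x p j k l = 0" unfolding fan_def by (intro sum.neutral) auto
    then show False using that by simp
  qed
  have parts: "triangle (q 0) (q s1) (q s2) l \<noteq> 0 \<or> fan (p 0) p 0 J l \<noteq> 0 \<or> triangle (p 0) (p J) (q s1) l \<noteq> 0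
     \<or> fan (q s1) p J L l \<noteq> 0 \<or> triangle (q s1) (p L) (q s2) l \<noteq> 0 \<or> fan (q s2) p L ?n l \<noteq> 0" if "C l \<noteq> 0" for l
    using that p0 by (auto simp: C_def polygon_filling_def)
  have supp: "set l \<subseteq> B" if "C l \<noteq> 0" for l
  proof -
    have "\<exists>x y z. x \<in> B \<and> y \<in> B \<and> z \<in> B \<and> triangle x y z l \<noteq> 0"
      using parts[OF that] fanE B p0 by metis
    then show ?thesis using triangle_support(3) by fastforce
  qed
  have sum: "(\<Sum>v\<in>A. C (v # w)) = (\<Sum>i<?n. edge (q (real i / ?N)) (q (real (Suc i) / ?N)) w)"
    if "finite A" "B \<subseteq> A" for A w
  proof -
    have "(\<Sum>v\<in>A. C (v # w)) = (\<Sum>i<?n. edge (p i) (p (Suc i)) w)"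
      unfolding C_def by (rule sum_polygon_filling) (use that B JL Ln pn in auto)
    also have "\<dots> = (\<Sum>i<?n. edge (q (real i / ?N)) (q (real (Suc i) / ?N)) w)"
      by (rule sum.cong[OF refl]) (simp add: pq del: of_nat_Suc)
    finally show ?thesis .
  qed
  have "\<exists>u\<in>set l. \<exists>v\<in>set l. u \<noteq> v \<and> dist u v < \<epsilon>" if "C l \<noteq> triangle (q 0) (q s1) (q s2) l" for l
  proof -
    have "fan (p 0) p 0 J l \<noteq> 0 \<or> triangle (p 0) (p J) (q s1) l \<noteq> 0
     \<or> fan (q s1) p J L l \<noteq> 0 \<or> triangle (q s1) (p L) (q s2) l \<noteq> 0 \<or> fan (q s2) p L ?n l \<noteq> 0"
      using that p0 by (auto simp: C_def polygon_filling_def)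
    then have "\<exists>x y z. dist y z < \<epsilon> \<and> triangle x y z l \<noteq> 0"
    proof (elim disjE)
      assume "fan (p 0) p 0 J l \<noteq> 0"
      from fanE[OF this] show ?thesis using step JL Ln by (meson less_le_trans)
    next
      assume "fan (q s1) p J L l \<noteq> 0"
      from fanE[OF this] show ?thesis using step Ln by (meson less_le_trans)
    next
      assume "fan (q s2) p L ?n l \<noteq> 0"
      from fanE[OF this] show ?thesis using step by blast
    qed (use pJ pL in blast)+
    then show ?thesis using thin by blast
  qed
  then show thesis using that[OF alt B(1) supp sum] by blast
qed

lemma triangle_grid_support:
  assumes "triangle_grid f m l \<noteq> 0"
  shows "(\<exists>i j. i + j \<le> m \<and> triangle (f i j) (f (Suc i) j) (f i (Suc j)) l \<noteq> 0) \<or>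
    (\<exists>i j. i + j < m \<and> triangle (f (Suc i) j) (f (Suc i) (Suc j)) (f i (Suc j)) l \<noteq> 0)"
proof (rule ccontr)
  assume n: "\<not> ?thesis"
  have "(\<Sum>s\<le>m. \<Sum>j\<le>s. triangle (f (s - j) j) (f (Suc s - j) j) (f (s - j) (Suc j)) l) = 0"
  proof (intro sum.neutral ballI)
    fix s j assume "s \<in> {..m}" "j \<in> {..s}"
    then show "triangle (f (s - j) j) (f (Suc s - j) j) (f (s - j) (Suc j)) l = 0"
      using n by (metis Suc_diff_le atMost_iff le_add_diff_inverse2)
  qed
  moreover have "(\<Sum>s<m. \<Sum>j\<le>s. triangle (f (Suc s - j) j) (f (Suc s - j) (Suc j)) (f (s - j) (Suc j)) l) = 0"
  proof (intro sum.neutral ballI)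
    fix s j assume "s \<in> {..<m}" "j \<in> {..s}"
    then show "triangle (f (Suc s - j) j) (f (Suc s - j) (Suc j)) (f (s - j) (Suc j)) l = 0"
      using n by (metis Suc_diff_le atMost_iff lessThan_iff le_add_diff_inverse2)
  qed
  ultimately show False using assms by (simp add: triangle_grid_def)
qed

section \<open>The essential cycle\<close>

context winding_cocycle
begin

lemma positive_circle_triangle: "positive (\<alpha> 0) (\<alpha> (1/3)) (\<alpha> (2/3))"
proof -
  have in_tube: "A u \<in> tube d" if "0 < d" for u d using that by (auto simp: tube_def intro!: exI[of _ u])
  have cn: "circle_norm (1/3) = 1/3" "circle_norm (-1/3) = 1/3" "circle_norm (2/3) = 1/3" "circle_norm (-2/3) = 1/3"
    by (simp_all add: round_def)
  have d: "dist (A 0) (A (1/3)) = a/3" "dist (A (1/3)) (A (2/3)) = a/3" "dist (A (2/3)) (A 0) = a/3"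
    using cn by (simp_all add: dist_A)
  note t = in_tube[OF e(1), of 0] in_tube[OF e(1), of "1/3"] in_tube[OF e(1), of "2/3"]
  have near: "circle_norm (ang (A v) - ang (A u)) \<le> 2/5" if "dist (A u) (A v) = a/3" for u v
    using ang_near[OF in_tube[OF e(1), of u] in_tube[OF e(1), of v]] that a by simp
  have "wind (A 0) (A (1/3)) (A (2/3)) = winding 0 (1/3) (2/3)"
  proof (rule winding_stable[OF _ _ _ _ _ _ near[OF d(1)] near[OF d(2)] near[OF d(3)]])
    show "circle_norm (1/3 - 0) \<le> 2/5" "circle_norm (2/3 - 1/3) \<le> 2/5" "circle_norm (0 - 2/3) \<le> 2/5"
      by (simp_all add: round_def)
    show "circle_norm (ang (A 0) - 0) \<le> 1/20" "circle_norm (ang (A (1/3)) - 1/3) \<le> 1/20"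
      "circle_norm (ang (A (2/3)) - 2/3) \<le> 1/20"
      using ang_A[OF t(1)] ang_A[OF t(2)] ang_A[OF t(3)] by linarith+
  qed
  also have "\<dots> = 1" by (simp add: winding_def round_def)
  finally have "wind (A 0) (A (1/3)) (A (2/3)) = 1" .
  then have "positive (A 0) (A (1/3)) (A (2/3))"
    using in_tube[of "\<eta>/2"] \<eta> d r0 by (simp add: positive_def)
  then show ?thesis by (simp add: A_eq_\<alpha>)
qed

text \<open>With \<open>triangle_winding\<close> this shows which pieces of a filling the cocycle
  sees: only large triangles that wind.\<close>

lemma thin_not_positive:
  assumes "\<sigma> \<in> positive_sets" "u \<in> set (rep \<sigma>)" "v \<in> set (rep \<sigma>)" "u \<noteq> v"
  shows "\<not> dist u v < a / 100"
proof -
  obtain x y z where r: "rep \<sigma> = [x, y, z]" "positive x y z" using rep_positive[OF assms(1)] by metis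
  then show ?thesis using assms positive_far[OF r(2)] a by (auto simp: dist_commute)
qed

lemma triangle_winding:
  assumes "\<sigma> \<in> positive_sets" "triangle u v w (rep \<sigma>) \<noteq> 0"
  shows "u \<in> V" "v \<in> V" "w \<in> V" "wind u v w \<noteq> 0"
proof -
  obtain x y z where r: "rep \<sigma> = [x, y, z]" "positive x y z" using rep_positive[OF assms(1)] by metis
  have odd: "wind q p s \<noteq> 0" if "positive p q s" for p q s
  proof -
    have "wind q p s = - wind p q s"
      by (rule wind_swap) (use that tube_half r0 in \<open>auto simp: positive_def\<close>)
    then show ?thesis using that by (simp add: positive_def)
  qed
  note perm = triangle_cases[OF assms(2)[unfolded r(1)]]
  have "positive u v w \<or> positive v u w"
    using perm r(2) positive_rotate by (elim insertE) (auto 0 4)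
  then show "wind u v w \<noteq> 0" using odd by (auto simp: positive_def)
  show "u \<in> V" "v \<in> V" "w \<in> V" using perm r(2) tube_half(2) by (auto simp: positive_def)
qed

text \<open>The points cut the loop into three arcs of length at most \<open>a / 3\<close>. Their triangle cannot wind around
  the circle, since the loop would be homotopic to it.\<close>

lemma short_loop_thirds:
  assumes q: "loop q" "path_length q \<le> ennreal a"
    and nh: "\<not> homotopic_loops UNIV q \<alpha>" "\<not> homotopic_loops UNIV q (reversepath \<alpha>)"
  obtains s1 s2 where "0 \<le> s1" "s1 \<le> s2" "s2 \<le> 1"
    "\<And>u. 0 \<le> u \<Longrightarrow> u \<le> s1 \<Longrightarrow> dist (q 0) (q u) \<le> a / 3"
    "\<And>u. s1 \<le> u \<Longrightarrow> u \<le> s2 \<Longrightarrow> dist (q s1) (q u) \<le> a / 3"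
    "\<And>u. s2 \<le> u \<Longrightarrow> u \<le> 1 \<Longrightarrow> dist (q s2) (q u) \<le> a / 3"
    "\<And>\<sigma>. \<sigma> \<in> positive_sets \<Longrightarrow> triangle (q 0) (q s1) (q s2) (rep \<sigma>) = 0"
proof -
  have n: "0 < 3 * N" using N(1) by simp
  obtain t :: "nat \<Rightarrow> real" where t: "t 0 = 0" "t (3 * N) = 1" "\<And>j. t j \<in> {0..1}"
      "\<And>i j. i \<le> j \<Longrightarrow> j \<le> 3 * N \<Longrightarrow> t i \<le> t j"
    and arcs: "\<And>j u v. j < 3 * N \<Longrightarrow> t j \<le> u \<Longrightarrow> u \<le> v \<Longrightarrow> v \<le> t (Suc j) \<Longrightarrow>
       dist (q (t j)) (q u) + dist (q u) (q v) + dist (q v) (q (t (Suc j))) \<le> a / real (3 * N)"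
    using equal_length_subdivision[of a q "3 * N"] a q n unfolding loop_def by (metis less_imp_le)
  have third: "real N * (a / real (3 * N)) = a / 3" using N(1) by simp
  have d: "dist (q (t i)) (q u) \<le> a / 3" if "i + N \<le> 3 * N" "t i \<le> u" "u \<le> t (i + N)" for i u
  proof -
    have "dist (q (t i)) (q u) + dist (q u) (q (t (i + N))) \<le> real N * (a / real (3 * N))"
      by (rule dist_through_arc_point[OF arcs t(4) that N(1)])
    then show ?thesis unfolding third using zero_le_dist[of "q u" "q (t (i + N))"] by linarith
  qed
  show thesis
  proof (rule that[of "t N" "t (2 * N)"])
    show "0 \<le> t N" "t (2 * N) \<le> 1" using t(3) by auto
    show "t N \<le> t (2 * N)" by (rule t(4)) auto
    show "dist (q 0) (q u) \<le> a / 3" if "0 \<le> u" "u \<le> t N" for u using d[of 0 u] that t(1) by simp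
    show "dist (q (t N)) (q u) \<le> a / 3" if "t N \<le> u" "u \<le> t (2 * N)" for u
      using d[of N u] that by (simp add: mult_2)
    show "dist (q (t (2 * N))) (q u) \<le> a / 3" if "t (2 * N) \<le> u" "u \<le> 1" for u
      using d[of "2 * N" u] that t(2) by simp
    show "triangle (q 0) (q (t N)) (q (t (2 * N))) (rep \<sigma>) = 0" if \<sigma>: "\<sigma> \<in> positive_sets" for \<sigma>
    proof (rule ccontr)
      assume "triangle (q 0) (q (t N)) (q (t (2 * N))) (rep \<sigma>) \<noteq> 0"
      note w = triangle_winding[OF \<sigma> this]
      have "homotopic_loops UNIV q \<alpha> \<or> homotopic_loops UNIV q (reversepath \<alpha>)"
        by (rule loop_with_winding_thirds[OF q(1) t(1,2,4) arcs w])
      then show False using nh by blast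
    qed
  qed
qed

end

context winding_cocycle_field
begin

text \<open>The fillings of \<open>\<alpha>\<close> and of the \<open>\<beta> i\<close> and the
  subdivided singular chain use the same subdivision parameter \<open>m\<close>, so that their
  boundaries cancel. It is chosen so large that all sides of triangles of the grids, and one side of
  each thin triangle of a filling, are shorter than \<open>a / 100\<close>; the cocycle ignores
  these triangles.\<close>

lemma essential_cycle:
  fixes k :: nat
  assumes \<alpha>: "loop \<alpha>"
    and \<beta>: "\<And>i. i \<in> {1..k} \<Longrightarrow> loop (\<beta> i)" "\<And>i. i \<in> {1..k} \<Longrightarrow> path_length (\<beta> i) \<le> ennreal a"
      "\<And>i. i \<in> {1..k} \<Longrightarrow> \<not> homotopic_loops UNIV (\<beta> i) \<alpha>"
      "\<And>i. i \<in> {1..k} \<Longrightarrow> \<not> homotopic_loops UNIV (\<beta> i) (reversepath \<alpha>)"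
    and coef: "\<And>i. i \<in> {1..k} \<Longrightarrow> coef i \<in> carrier R"
    and c: "c \<in> carrier (singular_chains R 2 (euclidean :: 'a topology))"
    and eq: "\<And>\<tau>. loop_chain R \<alpha> \<tau> \<ominus> (\<Oplus>i\<in>{1..k}. coef i \<otimes> loop_chain R (\<beta> i) \<tau>) = singular_bd R 2 c \<tau>"
  obtains z where "\<And>r t. a / 3 < r \<Longrightarrow> 0 < t \<Longrightarrow> z \<in> cycles 2 (sRips UNIV r 2 t)"
    "\<And>\<sigma>. \<sigma> \<in> positive_sets \<Longrightarrow> z (rep \<sigma>) = (if \<sigma> = {\<alpha> 0, \<alpha> (1/3), \<alpha> (2/3)} then \<one> else \<zero>)"
proof -
  let ?K = "small_sets (a / 3) :: 'a set set"
  define S where "S = {\<sigma>. c \<sigma> \<noteq> \<zero>}"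
  have S: "finite S" "\<And>\<sigma>. \<sigma> \<in> S \<Longrightarrow> singular_simplex 2 euclidean \<sigma>"
    using c by (auto simp: S_def singular_chains_iff)
  have ccl: "c \<sigma> \<in> carrier R" for \<sigma> using c by (simp add: singular_chains_iff)
  have \<epsilon>: "0 < a / 100" "a / 100 \<le> a / 3" using a by auto
  obtain m1 where m1: "\<And>m p u v. m1 \<le> m \<Longrightarrow> p \<in> insert \<alpha> (\<beta> ` {1..k}) \<Longrightarrow> u \<in> {0..1} \<Longrightarrow> v \<in> {0..1} \<Longrightarrow>
      \<bar>u - v\<bar> \<le> 1 / real (Suc m) \<Longrightarrow> dist (p u) (p v) < a / 100"
  proof -
    have "\<exists>m0. \<forall>m\<ge>m0. \<forall>p\<in>insert \<alpha> (\<beta> ` {1..k}). \<forall>u\<in>{0..1}. \<forall>v\<in>{0..1}.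
        \<bar>u - v\<bar> \<le> 1 / real (Suc m) \<longrightarrow> dist (p u) (p v) < a / 100"
      by (rule paths_uniformly_fine) (use \<alpha> \<beta>(1) \<epsilon> in \<open>auto simp: loop_def\<close>)
    then show thesis using that by blast
  qed
  obtain m2 where m2: "\<And>m \<sigma> i j i' j'. m2 \<le> m \<Longrightarrow> \<sigma> \<in> S \<Longrightarrow> i + j \<le> Suc m \<Longrightarrow> i' + j' \<le> Suc m \<Longrightarrow>
      \<bar>int i - int i'\<bar> \<le> 1 \<Longrightarrow> \<bar>int j - int j'\<bar> \<le> 1 \<Longrightarrow> dist (simplex_grid \<sigma> m i j) (simplex_grid \<sigma> m i' j') < a / 100"
    using simplex_grid_fine[OF S \<epsilon>(1)] by blast
  define m where "m = max m1 m2"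
  have fine: "dist (p u) (p v) < a / 100"
    if "p \<in> insert \<alpha> (\<beta> ` {1..k})" "u \<in> {0..1}" "v \<in> {0..1}" "\<bar>u - v\<bar> \<le> 1 / real (Suc m)" for p u v
    using m1[of m p u v] that by (simp add: m_def)
  have mesh: "dist (simplex_grid \<sigma> m i j) (simplex_grid \<sigma> m i' j') < a / 100"
    if "\<sigma> \<in> S" "i + j \<le> Suc m" "i' + j' \<le> Suc m" "\<bar>int i - int i'\<bar> \<le> 1" "\<bar>int j - int j'\<bar> \<le> 1" for \<sigma> i j i' j'
    using m2[of m \<sigma> i j i' j'] that by (simp add: m_def)
  have closed: "q 1 = q 0" if "loop q" for q :: "real \<Rightarrow> 'a"
    using that by (simp add: loop_def pathfinish_def pathstart_def)

  \<comment> \<open>the filling of \<open>\<alpha>\<close>, whose big triangle is the one that is detected\<close>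
  have d\<alpha>: "dist (\<alpha> u) (\<alpha> v) \<le> a / 3" if "0 \<le> u" "u \<le> v" "v \<le> 1" "v \<le> u + 1/3" for u v
  proof -
    have "dist (A u) (A v) \<le> a * \<bar>u - v\<bar>" by (rule dist_A_le)
    also have "\<dots> \<le> a * (1/3)" using that a by (intro mult_left_mono) auto
    finally show ?thesis using that by (simp add: A_eq_\<alpha>)
  qed
  obtain D BD where D: "alternating_chain ?K D" "finite BD" "\<And>l. D l \<noteq> 0 \<Longrightarrow> set l \<subseteq> BD"
    "\<And>B w. finite B \<Longrightarrow> BD \<subseteq> B \<Longrightarrow>
       (\<Sum>v\<in>B. D (v # w)) = (\<Sum>i<Suc m. edge (\<alpha> (real i / real (Suc m))) (\<alpha> (real (Suc i) / real (Suc m))) w)"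
    "\<And>l. D l \<noteq> triangle (\<alpha> 0) (\<alpha> (1/3)) (\<alpha> (2/3)) l \<Longrightarrow> \<exists>u\<in>set l. \<exists>v\<in>set l. u \<noteq> v \<and> dist u v < a / 100"
  proof (rule loop_filling[where q = \<alpha> and ?s1.0 = "1/3" and ?s2.0 = "2/3" and d = "a/3" and \<epsilon> = "a/100" and m = m])
    show "dist (\<alpha> u) (\<alpha> v) < a / 100" if "u \<in> {0..1}" "v \<in> {0..1}" "\<bar>u - v\<bar> \<le> 1 / real (Suc m)" for u v
      using that by (intro fine) auto
  qed (use closed[OF \<alpha>] d\<alpha> \<epsilon> in auto)

  have "\<forall>i\<in>{1..k}. \<exists>E B. alternating_chain ?K E \<and> finite B \<and> (\<forall>l. E l \<noteq> 0 \<longrightarrow> set l \<subseteq> B) \<and>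
      (\<forall>B' w. finite B' \<longrightarrow> B \<subseteq> B' \<longrightarrow> (\<Sum>v\<in>B'. E (v # w)) =
         (\<Sum>j<Suc m. edge (\<beta> i (real j / real (Suc m))) (\<beta> i (real (Suc j) / real (Suc m))) w)) \<and>
      (\<forall>\<sigma>\<in>positive_sets. E (rep \<sigma>) = 0)"
  proof
    fix i assume i: "i \<in> {1..k}"
    obtain s1 s2 where s: "0 \<le> s1" "s1 \<le> s2" "s2 \<le> 1"
      "\<And>u. 0 \<le> u \<Longrightarrow> u \<le> s1 \<Longrightarrow> dist (\<beta> i 0) (\<beta> i u) \<le> a / 3"
      "\<And>u. s1 \<le> u \<Longrightarrow> u \<le> s2 \<Longrightarrow> dist (\<beta> i s1) (\<beta> i u) \<le> a / 3"
      "\<And>u. s2 \<le> u \<Longrightarrow> u \<le> 1 \<Longrightarrow> dist (\<beta> i s2) (\<beta> i u) \<le> a / 3"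
      "\<And>\<sigma>. \<sigma> \<in> positive_sets \<Longrightarrow> triangle (\<beta> i 0) (\<beta> i s1) (\<beta> i s2) (rep \<sigma>) = 0"
      using short_loop_thirds[OF \<beta>(1)[OF i] \<beta>(2)[OF i] \<beta>(3)[OF i] \<beta>(4)[OF i]] by metis
    have fi: "dist (\<beta> i u) (\<beta> i v) < a / 100" if "u \<in> {0..1}" "v \<in> {0..1}" "\<bar>u - v\<bar> \<le> 1 / real (Suc m)" for u v
      using that i by (intro fine) auto
    obtain E B where E: "alternating_chain ?K E" "finite B" "\<And>l. E l \<noteq> 0 \<Longrightarrow> set l \<subseteq> B"
      "\<And>B' w. finite B' \<Longrightarrow> B \<subseteq> B' \<Longrightarrow> (\<Sum>v\<in>B'. E (v # w)) =
         (\<Sum>j<Suc m. edge (\<beta> i (real j / real (Suc m))) (\<beta> i (real (Suc j) / real (Suc m))) w)"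
      "\<And>l. E l \<noteq> triangle (\<beta> i 0) (\<beta> i s1) (\<beta> i s2) l \<Longrightarrow> \<exists>u\<in>set l. \<exists>v\<in>set l. u \<noteq> v \<and> dist u v < a / 100"
    proof (rule loop_filling[where q = "\<beta> i" and ?s1.0 = s1 and ?s2.0 = s2 and d = "a/3" and \<epsilon> = "a/100" and m = m])
    qed (use closed[OF \<beta>(1)[OF i]] s(1-6) fi \<epsilon>(2) in auto)
    have "E (rep \<sigma>) = 0" if "\<sigma> \<in> positive_sets" for \<sigma>
      using E(5)[of "rep \<sigma>"] thin_not_positive[OF that] s(7)[OF that] by fastforce
    then show "\<exists>E B. alternating_chain ?K E \<and> finite B \<and> (\<forall>l. E l \<noteq> 0 \<longrightarrow> set l \<subseteq> B) \<and>
      (\<forall>B' w. finite B' \<longrightarrow> B \<subseteq> B' \<longrightarrow> (\<Sum>v\<in>B'. E (v # w)) =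
         (\<Sum>j<Suc m. edge (\<beta> i (real j / real (Suc m))) (\<beta> i (real (Suc j) / real (Suc m))) w)) \<and>
      (\<forall>\<sigma>\<in>positive_sets. E (rep \<sigma>) = 0)"
      using E(1-4) by (intro exI[of _ E] exI[of _ B]) blast
  qed
  from bchoice[OF this] obtain E where "\<forall>i\<in>{1..k}. \<exists>B. alternating_chain ?K (E i) \<and> finite B \<and> (\<forall>l. E i l \<noteq> 0 \<longrightarrow> set l \<subseteq> B) \<and>
      (\<forall>B' w. finite B' \<longrightarrow> B \<subseteq> B' \<longrightarrow> (\<Sum>v\<in>B'. E i (v # w)) =
         (\<Sum>j<Suc m. edge (\<beta> i (real j / real (Suc m))) (\<beta> i (real (Suc j) / real (Suc m))) w)) \<and>
      (\<forall>\<sigma>\<in>positive_sets. E i (rep \<sigma>) = 0)" by blast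
  from bchoice[OF this] obtain BE where E0: "\<forall>i\<in>{1..k}. alternating_chain ?K (E i) \<and> finite (BE i) \<and>
      (\<forall>l. E i l \<noteq> 0 \<longrightarrow> set l \<subseteq> BE i) \<and>
      (\<forall>B' w. finite B' \<longrightarrow> BE i \<subseteq> B' \<longrightarrow> (\<Sum>v\<in>B'. E i (v # w)) =
         (\<Sum>j<Suc m. edge (\<beta> i (real j / real (Suc m))) (\<beta> i (real (Suc j) / real (Suc m))) w)) \<and>
      (\<forall>\<sigma>\<in>positive_sets. E i (rep \<sigma>) = 0)" by blast
  have E: "alternating_chain ?K (E i)" "finite (BE i)" "\<And>l. E i l \<noteq> 0 \<Longrightarrow> set l \<subseteq> BE i"
      "\<And>B' w. finite B' \<Longrightarrow> BE i \<subseteq> B' \<Longrightarrow> (\<Sum>v\<in>B'. E i (v # w)) =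
         (\<Sum>j<Suc m. edge (\<beta> i (real j / real (Suc m))) (\<beta> i (real (Suc j) / real (Suc m))) w)"
      "\<And>\<sigma>. \<sigma> \<in> positive_sets \<Longrightarrow> E i (rep \<sigma>) = 0" if "i \<in> {1..k}" for i
    using bspec[OF E0 that] by blast+

  let ?g = "\<lambda>\<sigma>. triangle_grid (simplex_grid \<sigma> m) m"
  define BG where "BG = (\<Union>\<sigma>\<in>S. (\<lambda>p. simplex_grid \<sigma> m (fst p) (snd p)) ` ({..Suc m} \<times> {..Suc m}))"
  have BG: "finite BG" using S(1) by (simp add: BG_def)
  have inBG: "simplex_grid \<sigma> m i j \<in> BG" if "\<sigma> \<in> S" for \<sigma> i j
  proof -
    have "\<exists>p\<in>{..Suc m} \<times> {..Suc m}. simplex_grid \<sigma> m i j = simplex_grid \<sigma> m (fst p) (snd p)"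
    proof (cases "i + j \<le> Suc m")
      case True
      then show ?thesis by (intro bexI[of _ "(i, j)"]) auto
    next
      case False
      then show ?thesis by (intro bexI[of _ "(0, 0)"]) (auto simp: simplex_grid_def)
    qed
    then show ?thesis using that unfolding BG_def by blast
  qed
  have grid: "alternating_chain ?K (?g \<sigma>)" if \<sigma>: "\<sigma> \<in> S" for \<sigma>
  proof (rule alternating_chain_grid)
    have le: "x \<le> a / 3" if "x < a / 100" for x using that \<epsilon> by linarith
    show "{simplex_grid \<sigma> m i j, simplex_grid \<sigma> m (Suc i) j, simplex_grid \<sigma> m i (Suc j)} \<in> ?K" if "i + j \<le> m" for i j
      by (intro triple_small le mesh[OF \<sigma>]) (use that a in auto)
    show "{simplex_grid \<sigma> m (Suc i) j, simplex_grid \<sigma> m (Suc i) (Suc j), simplex_grid \<sigma> m i (Suc j)} \<in> ?K" if "i + j < m" for i j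
      by (intro triple_small le mesh[OF \<sigma>]) (use that a in auto)
  qed
  have gsupp: "set l \<subseteq> BG" if "\<sigma> \<in> S" "?g \<sigma> l \<noteq> 0" for \<sigma> l
  proof -
    have "\<exists>x\<in>BG. \<exists>y\<in>BG. \<exists>w\<in>BG. triangle x y w l \<noteq> 0"
      using triangle_grid_support[OF that(2)] inBG[OF that(1)] by metis
    then show ?thesis using triangle_support(3) by fastforce
  qed
  have gthin: "?g \<sigma> (rep \<tau>) = 0" if \<sigma>: "\<sigma> \<in> S" and \<tau>: "\<tau> \<in> positive_sets" for \<sigma> \<tau>
  proof (rule ccontr)
    have thin: False if "triangle u v w (rep \<tau>) \<noteq> 0" "dist u v < a / 100" for u v w
      using thin_not_positive[OF \<tau>, of u v] triangle_support[OF that(1)] that(2) by auto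
    assume "?g \<sigma> (rep \<tau>) \<noteq> 0"
    from triangle_grid_support[OF this] show False
    proof (elim disjE exE conjE)
      fix i j assume ij: "i + j \<le> m"
        and t: "triangle (simplex_grid \<sigma> m i j) (simplex_grid \<sigma> m (Suc i) j) (simplex_grid \<sigma> m i (Suc j)) (rep \<tau>) \<noteq> 0"
      show False by (rule thin[OF t], rule mesh[OF \<sigma>]) (use ij in auto)
    next
      fix i j assume ij: "i + j < m"
        and t: "triangle (simplex_grid \<sigma> m (Suc i) j) (simplex_grid \<sigma> m (Suc i) (Suc j)) (simplex_grid \<sigma> m i (Suc j)) (rep \<tau>) \<noteq> 0"
      show False by (rule thin[OF t], rule mesh[OF \<sigma>]) (use ij in auto)
    qed
  qed

  define B where "B = BD \<union> (\<Union>i\<in>{1..k}. BE i) \<union> BG"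
  have B: "finite B" using D(2) E(2) BG by (auto simp: B_def)
  have sub: "BD \<subseteq> B" "BG \<subseteq> B" "\<And>i. i \<in> {1..k} \<Longrightarrow> BE i \<subseteq> B" by (auto simp: B_def)
  define z where "z = csub (csub (combination {()} (\<lambda>_. \<one>) (\<lambda>_. D)) (combination {1..k} coef E)) (combination S c ?g)"
  have z: "z \<in> cycles 2 ?K" unfolding z_def S_def
  proof (rule cycle_from_fillings[OF c coef eq B])
    show "alternating_chain ?K D" by (rule D(1))
    show "set l \<subseteq> B" if "D l \<noteq> 0" for l using D(3)[OF that] sub by blast
    show "(\<Sum>v\<in>B. D (v # w)) = (\<Sum>i<Suc m. edge (\<alpha> (real i / real (Suc m))) (\<alpha> (real (Suc i) / real (Suc m))) w)" for w
      by (rule D(4)[OF B sub(1)])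
    show "alternating_chain ?K (E i)" if "i \<in> {1..k}" for i by (rule E(1)[OF that])
    show "set l \<subseteq> B" if "i \<in> {1..k}" "E i l \<noteq> 0" for i l using E(3)[OF that] sub(3)[OF that(1)] by blast
    show "(\<Sum>v\<in>B. E i (v # w)) = (\<Sum>j<Suc m. edge (\<beta> i (real j / real (Suc m))) (\<beta> i (real (Suc j) / real (Suc m))) w)"
      if "i \<in> {1..k}" for i w by (rule E(4)[OF that B sub(3)[OF that]])
    show "alternating_chain ?K (?g \<sigma>)" if "c \<sigma> \<noteq> \<zero>" for \<sigma> using that by (intro grid) (simp add: S_def)
    show "simplex_grid \<sigma> m i j \<in> B" if "c \<sigma> \<noteq> \<zero>" for \<sigma> i j using inBG[of \<sigma>] that sub(2) by (auto simp: S_def)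
    show "set l \<subseteq> B" if "c \<sigma> \<noteq> \<zero>" "?g \<sigma> l \<noteq> 0" for \<sigma> l using gsupp[of \<sigma> l] that sub(2) by (auto simp: S_def)
  qed
  show thesis
  proof (rule that)
    fix r t :: real assume r: "a / 3 < r" and t: "0 < t"
    have zc: "z \<in> chains 2 ?K" "bd 2 z = czero" using z by (auto simp: simplicial_cycles_def)
    have "set l \<in> sRips UNIV r 2 t" if "z l \<noteq> \<zero>" for l
    proof -
      have l: "length l = 3" "set l \<in> ?K" using chains_supp[OF zc(1), of l] that by auto
      obtain x y w where xyw: "l = [x, y, w]" using l(1) by (auto simp: numeral_3_eq_3 length_Suc_conv)
      have "dist x y \<le> a / 3" "dist y w \<le> a / 3" "dist w x \<le> a / 3" using l(2) by (auto simp: xyw small_sets_def)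
      then show ?thesis using r by (simp add: xyw triple_in_sRips[OF t])
    qed
    then have "z \<in> chains 2 (sRips UNIV r 2 t)" by (rule chains_restrict[OF zc(1)])
    then show "z \<in> cycles 2 (sRips UNIV r 2 t)" using zc(2) by (simp add: simplicial_cycles_def)
  next
    fix \<sigma> assume \<sigma>: "\<sigma> \<in> positive_sets"
    have D\<sigma>: "D (rep \<sigma>) = triangle (\<alpha> 0) (\<alpha> (1/3)) (\<alpha> (2/3)) (rep \<sigma>)"
      using D(5)[of "rep \<sigma>"] thin_not_positive[OF \<sigma>] by blast
    have "D (rep \<sigma>) = (if \<sigma> = {\<alpha> 0, \<alpha> (1/3), \<alpha> (2/3)} then 1 else 0)"
    proof (cases "\<sigma> = {\<alpha> 0, \<alpha> (1/3), \<alpha> (2/3)}")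
      case True
      note dis = positive_distinct[OF positive_circle_triangle]
      show ?thesis unfolding D\<sigma> unfolding True
        using positive_circle_triangle by (cases rule: rep) (use dis in \<open>auto simp: triangle_def unit_chain_def\<close>)
    next
      case False
      obtain x y w where r: "rep \<sigma> = [x, y, w]" "\<sigma> = {x, y, w}" using rep_positive[OF \<sigma>] by metis
      then have "set (rep \<sigma>) = \<sigma>" by simp
      then show ?thesis unfolding D\<sigma> using triangle_support(3)[of "\<alpha> 0" "\<alpha> (1/3)" "\<alpha> (2/3)" "rep \<sigma>"] False by auto
    qed
    moreover have "combination {1..k} coef E (rep \<sigma>) = \<zero>"
      by (rule combination_zero) (use coef E(5) \<sigma> in auto)
    moreover have "combination S c ?g (rep \<sigma>) = \<zero>"
      by (rule combination_zero) (use ccl gthin \<sigma> in auto)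
    moreover have "combination {()} (\<lambda>_. \<one>) (\<lambda>_. D) (rep \<sigma>) = of_Z (D (rep \<sigma>))"
      by (simp add: combination_def)
    ultimately show "z (rep \<sigma>) = (if \<sigma> = {\<alpha> 0, \<alpha> (1/3), \<alpha> (2/3)} then \<one> else \<zero>)"
      by (simp add: z_def minus_eq)
  qed
qed

text \<open>A cycle of scale \<open>a / 3\<close> has no winding triangles, as their sides are at
  least \<open>a / 3\<close>, while simplices of that scale have smaller diameter. So the cocycle
  takes the value one on \<open>z - w\<close> but vanishes on boundaries.\<close>

lemma essential_cycle_not_early:
  assumes s: "s * r0 \<le> \<kappa>"
    and z: "\<And>\<sigma>. \<sigma> \<in> positive_sets \<Longrightarrow> z (rep \<sigma>) = (if \<sigma> = {\<alpha> 0, \<alpha> (1/3), \<alpha> (2/3)} then \<one> else \<zero>)"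
    and w: "w \<in> cycles 2 (sRips UNIV (a / 3) 2 (s * (a / 3)))"
  shows "csub z w \<notin> bounds 2 (sRips UNIV r0 2 (s * r0))"
proof
  let ?L = "sRips UNIV r0 2 (s * r0) :: 'a set set"
  let ?T = "{\<alpha> 0, \<alpha> (1/3), \<alpha> (2/3)}"
  assume "csub z w \<in> bounds 2 ?L"
  then obtain c where c: "c \<in> chains 3 ?L" "csub z w = bd 3 c"
    unfolding simplicial_boundaries_def by (auto simp: numeral_3_eq_3 numeral_2_eq_2)
  have wc: "w \<in> chains 2 (sRips UNIV (a / 3) 2 (s * (a / 3)))" using w by (simp add: simplicial_cycles_def)
  have w0: "w (rep \<sigma>) = \<zero>" if \<sigma>: "\<sigma> \<in> positive_sets" for \<sigma>
  proof (rule ccontr)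
    obtain x y v where r: "rep \<sigma> = [x, y, v]" "positive x y v" using rep_positive[OF \<sigma>] by metis
    assume "w (rep \<sigma>) \<noteq> \<zero>"
    then have "{x, y, v} \<in> sRips UNIV (a / 3) 2 (s * (a / 3))" using chains_supp[OF wc, of "[x, y, v]"] r(1) by simp
    note d = sRips_dist[OF this]
    have "dist x y = a / 3"
      by (rule winding_triangle_on_circle(4)[of x y v])
        (use r(2) tube_half d[of x y] d[of y v] d[of v x] in \<open>auto simp: positive_def\<close>)
    then show False using d[of x y] by simp
  qed
  define B where "B = ?T \<union> (\<Union>l\<in>{l. c l \<noteq> \<zero>}. set l)"
  have B: "finite B" using support_vertices_finite[OF c(1)] unfolding B_def by blast
  define P where "P = positive_sets \<inter> Pow B"
  have P: "finite P" "?T \<in> P" using B positive_setsI[OF positive_circle_triangle] by (auto simp: P_def B_def)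
  have val: "bd 3 c (rep \<sigma>) = (if \<sigma> = ?T then \<one> else \<zero>)" if "\<sigma> \<in> P" for \<sigma>
  proof -
    have \<sigma>: "\<sigma> \<in> positive_sets" using that by (simp add: P_def)
    have "bd 3 c (rep \<sigma>) = z (rep \<sigma>) \<ominus> w (rep \<sigma>)" using fun_cong[OF c(2), of "rep \<sigma>"] by simp
    then show ?thesis by (simp add: z[OF \<sigma>] w0[OF \<sigma>] minus_eq)
  qed
  have "(\<Oplus>\<sigma>\<in>P. bd 3 c (rep \<sigma>)) = \<zero>" unfolding P_def
  proof (rule cocycle_vanishes_on_boundaries[OF _ _ c(1) B])
    show "dist u v < r0" if "\<sigma> \<in> ?L" "u \<in> \<sigma>" "v \<in> \<sigma>" for \<sigma> u v by (rule sRips_dist[OF that])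
    show "\<exists>u\<in>\<sigma>. \<exists>v\<in>\<sigma>. u \<noteq> v \<and> dist u v < \<kappa>" if "\<sigma> \<in> ?L" "card \<sigma> = 4" for \<sigma>
      using sRips_close_pair[OF that] s by (meson less_le_trans)
    show "set l \<subseteq> B" if "c l \<noteq> \<zero>" for l using that by (auto simp: B_def)
  qed
  moreover have "(\<Oplus>\<sigma>\<in>P. bd 3 c (rep \<sigma>)) = (\<Oplus>\<sigma>\<in>{?T}. bd 3 c (rep \<sigma>))"
    by (rule finsum_superset[symmetric]) (use P val in auto)
  moreover have "(\<Oplus>\<sigma>\<in>{?T}. bd 3 c (rep \<sigma>)) = \<one>" using val[OF P(2)] by simp
  ultimately show False by simp
qed

text \<open>At a scale beyond the diameter of the space the complex is a full simplex, so
  \<open>z\<close> dies there.\<close>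

lemma summand_from_essential_cycle:
  assumes s: "0 < s" "s * r0 \<le> \<kappa>"
    and zc: "\<And>r t. a / 3 < r \<Longrightarrow> 0 < t \<Longrightarrow> z \<in> cycles 2 (sRips UNIV r 2 t)"
    and z: "\<And>\<sigma>. \<sigma> \<in> positive_sets \<Longrightarrow> z (rep \<sigma>) = (if \<sigma> = {\<alpha> 0, \<alpha> (1/3), \<alpha> (2/3)} then \<one> else \<zero>)"
  shows "\<exists>\<delta>>a / 3. \<exists>J. (J = {a / 3 <..< \<delta>} \<or> J = {a / 3 <.. \<delta>}) \<and>
     has_direct_summand R (sRips_homology R 2 (UNIV :: 'a set) 2 s) (elementary_interval R J)"
proof -
  let ?K = "\<lambda>r. sRips UNIV r 2 (s * r) :: 'a set set"
  have ar: "a / 3 < (a / 3 + r0) / 2" "(a / 3 + r0) / 2 \<le> r0" using r0(1) by auto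
  obtain D :: "'a list set" where D: "finite D"
    "\<And>w. w \<in> cycles 2 (?K (a / 3)) \<Longrightarrow>
       \<exists>w'\<in>cycles 2 (?K ((a / 3 + r0) / 2)). (\<forall>l. l \<notin> D \<longrightarrow> w' l = \<zero>) \<and> csub w w' \<in> bounds 2 (?K ((a / 3 + r0) / 2))"
  proof (rule cycles_on_finite_net[OF comp ar(1) s(1)], goal_cases)
    case prems: (1 D)
    show ?case by (rule prems(1), rule prems(2), rule prems(3))
  qed
  obtain M where M: "\<And>x y :: 'a. dist x y \<le> M"
    using compact_imp_bounded[OF comp] unfolding bounded_two_points by auto
  define rd where "rd = max (max (M + 1) ((M + 1) / s)) a"
  have "(M + 1) / s \<le> rd" by (simp add: rd_def)
  then have "s * ((M + 1) / s) \<le> s * rd" using s(1) by (intro mult_left_mono) auto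
  then have "M + 1 \<le> s * rd" using s(1) by simp
  then have big: "dist x y < rd" "dist x y < s * rd" for x y :: 'a
    using M[of x y] by (auto simp: rd_def intro: le_less_trans)
  have "a \<le> rd" by (simp add: rd_def)
  then have rd: "a / 3 < rd" "0 < rd" using a by auto
  have "z \<in> bounds 2 (?K rd)"
    by (rule cycles_bound_in_full_complex) (use sRips_full[OF _ _ big] zc[OF rd(1)] s(1) rd in auto)
  note die = this
  show ?thesis
    unfolding sRips_homology_def
  proof (rule persistent_class_gives_summand[where K = ?K and z = z and D = D and rd = rd])
    show "?K r \<subseteq> ?K r'" if "0 < r" "r \<le> r'" for r r' using that s(1) by (intro sRips_mono) auto
    show "0 < a / 3" using a by simp
    show "z \<in> cycles 2 (?K r)" if "a / 3 < r" for r
    proof (rule zc[OF that])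
      have "0 < r" using that a by linarith
      then show "0 < s * r" using s(1) by simp
    qed
    show "csub z w \<notin> bounds 2 (?K r0)" if "w \<in> cycles 2 (?K (a / 3))" for w
      by (rule essential_cycle_not_early[OF s(2) z that])
  qed (fact r0(1) D ar rd(2) die)+
qed

end

section \<open>The direct summand\<close>

theorem corollary5p3:
  fixes F :: "('f, 'm) ring_scheme"
    and \<alpha> :: "real \<Rightarrow> 'a::metric_space"
    and k :: nat and \<beta> :: "nat \<Rightarrow> real \<Rightarrow> 'a" and c :: "nat \<Rightarrow> 'f"
  assumes "field F"
    and "compact (UNIV :: 'a set)"
    and "geodesic_space TYPE('a)"
    and "semi_locally_simply_connected TYPE('a)"
    and "geodesic_circle \<alpha>"
    and "bottleneck_loop \<alpha>"
    and "\<forall>i\<in>{1..k}. loop (\<beta> i) \<and> path_length (\<beta> i) \<le> path_length \<alpha> \<and>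
           \<not> homotopic_loops UNIV (\<beta> i) \<alpha> \<and> \<not> homotopic_loops UNIV (\<beta> i) (reversepath \<alpha>)"
    and "\<forall>i\<in>{1..k}. c i \<in> carrier F"
    and "\<exists>i\<in>{1..k}. c i \<noteq> \<zero>\<^bsub>F\<^esub>"
    and "loop_class F \<alpha> =
           (\<Oplus>\<^bsub>singular_homology F 1 (euclidean :: 'a topology)\<^esub>i\<in>{1..k}.
              c i \<odot>\<^bsub>singular_homology F 1 (euclidean :: 'a topology)\<^esub> loop_class F (\<beta> i))"
    and "\<forall>U. nbhd_of U (path_image \<alpha>) \<longrightarrow>
           (\<exists>V. V \<subseteq> U \<and> nbhd_of V (path_image \<alpha>) \<and> geodesically_convex V)"
  shows "\<exists>S>0. \<forall>s. 0 < s \<and> s < S \<longrightarrow>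
           (\<exists>\<delta>>enn2real (path_length \<alpha>) / 3. \<exists>J.
              (J = {enn2real (path_length \<alpha>) / 3 <..< \<delta>} \<or>
               J = {enn2real (path_length \<alpha>) / 3 <.. \<delta>}) \<and>
              has_direct_summand F (sRips_homology F 2 (UNIV :: 'a set) 2 s)
                (elementary_interval F J))"
proof -
  obtain a where a: "0 < a" "\<And>s t. s \<in> {0..1} \<Longrightarrow> t \<in> {0..1} \<Longrightarrow> dist (\<alpha> s) (\<alpha> t) = circle_dist a (a * s) (a * t)"
    using assms(5) unfolding geodesic_circle_def by blast
  interpret circle_in_space \<alpha> a by unfold_locales (use a in auto)
  have \<alpha>: "loop \<alpha>" using assms(6) by (simp add: bottleneck_loop_def)
  obtain U where U: "path_image \<alpha> \<subseteq> interior U" "\<And>q. loop q \<Longrightarrow> path_image q \<subseteq> U \<Longrightarrow>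
       homotopic_loops U q \<alpha> \<or> homotopic_loops U q (reversepath \<alpha>) \<Longrightarrow> path_length q \<le> path_length \<alpha> \<Longrightarrow>
       equal_up_to_reparam q \<alpha> \<or> equal_up_to_reparam q (reversepath \<alpha>)"
    using assms(6) unfolding bottleneck_loop_def nbhd_of_def by blast
  obtain \<rho> where \<rho>: "0 < \<rho>" "tube \<rho> \<subseteq> interior U"
    using tube_in_open[OF open_interior U(1) assms(2)] by blast
  obtain \<delta> where \<delta>: "0 < \<delta>"
    "\<And>(x::'a) p. loop p \<Longrightarrow> path_image p \<subseteq> ball x \<delta> \<Longrightarrow> \<exists>b. homotopic_loops (ball x \<rho>) p (\<lambda>_. b)"
    using uniformly_semi_locally_simply_connected[OF assms(4,2) \<rho>(1)] by blast
  obtain N :: nat where "10 * a / \<delta> < real N" using reals_Archimedean2 by blast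
  moreover have "0 < 10 * a / \<delta>" using a(1) \<delta>(1) by simp
  ultimately have N0: "0 < real N" "10 * a < real N * \<delta>"
    using \<delta>(1) by (linarith, simp add: pos_divide_less_eq)
  then have N: "0 < N" "a / (3 * real N) < \<delta> / 10" using a(1) by (auto simp: field_simps)
  define e where "e = min (min (\<delta> / 10) \<rho>) (a / (100 * real N))"
  have e: "0 < e" "e \<le> \<delta> / 10" "e \<le> \<rho>" "e \<le> a / (100 * real N)"
    using \<delta>(1) \<rho>(1) a(1) N(1) by (auto simp: e_def)
  define ang where "ang x = (SOME t. dist x (A t) < e)" for x
  have ang: "dist x (A (ang x)) < e" if "x \<in> tube e" for x
    using that unfolding tube_def ang_def by (auto intro: someI_ex)
  have "nbhd_of (tube e) (path_image \<alpha>)"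
    using range_A_tube[OF e(1)] open_tube[of e] path_image_\<alpha> by (simp add: nbhd_of_def interior_open)
  then obtain V where V: "V \<subseteq> tube e" "path_image \<alpha> \<subseteq> interior V" "geodesically_convex V"
    using assms(11) unfolding nbhd_of_def by blast
  obtain \<eta>' where \<eta>': "0 < \<eta>'" "tube \<eta>' \<subseteq> interior V"
    using tube_in_open[OF open_interior V(2) assms(2)] by blast
  define \<eta> where "\<eta> = min \<eta>' e"
  have \<eta>: "0 < \<eta>" "\<eta> \<le> e" "tube \<eta> \<subseteq> V"
    using \<eta>' e(1) tube_mono[of \<eta> \<eta>'] interior_subset[of V] by (auto simp: \<eta>_def)
  interpret bottleneck_circle \<alpha> a \<delta> \<rho> e N ang U V
  proof unfold_locales
    show "tube \<rho> \<subseteq> U" using \<rho>(2) interior_subset[of U] by blast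
  qed (fact assms(2,3) \<delta>(2) N e ang U(2) V(1,3))+
  obtain r0 where r0: "a / 3 < r0" "r0 \<le> a * (1/3 + 1/50)"
    "\<And>x y z. x \<in> tube (\<eta>/2) \<Longrightarrow> y \<in> tube (\<eta>/2) \<Longrightarrow> z \<in> tube (\<eta>/2) \<Longrightarrow>
       dist x y < r0 \<Longrightarrow> dist y z < r0 \<Longrightarrow> dist z x < r0 \<Longrightarrow> wind x y z \<noteq> 0 \<Longrightarrow> x \<in> tube (\<eta>/4)"
    using winding_triangles_isolated[OF \<eta>] by blast
  define \<kappa> where "\<kappa> = min (\<eta> / 4) (a / 50)"
  have \<kappa>_pos: "0 < \<kappa>" and \<kappa>: "\<kappa> \<le> \<eta> / 4" "\<kappa> \<le> a / 50" using \<eta>(1) a(1) by (auto simp: \<kappa>_def)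
  interpret field F by (fact assms(1))
  interpret winding_cocycle_field \<alpha> a \<delta> \<rho> e N ang U V \<eta> r0 \<kappa> F
    by unfold_locales (fact \<eta> r0 \<kappa>)+
  obtain d where d: "d \<in> carrier (singular_chains F 2 (euclidean :: 'a topology))"
    "\<And>\<tau>. loop_chain F \<alpha> \<tau> \<ominus>\<^bsub>F\<^esub> (\<Oplus>\<^bsub>F\<^esub>i\<in>{1..k}. c i \<otimes>\<^bsub>F\<^esub> loop_chain F (\<beta> i) \<tau>) = singular_bd F 2 d \<tau>"
    using homologous_loops_bound[OF \<alpha> _ _ assms(10)] assms(7,8) by blast
  obtain z where z: "\<And>r t. a / 3 < r \<Longrightarrow> 0 < t \<Longrightarrow> z \<in> simplicial_cycles F 2 (sRips UNIV r 2 t)"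
    "\<And>\<sigma>. \<sigma> \<in> positive_sets \<Longrightarrow> z (rep \<sigma>) = (if \<sigma> = {\<alpha> 0, \<alpha> (1/3), \<alpha> (2/3)} then \<one>\<^bsub>F\<^esub> else \<zero>\<^bsub>F\<^esub>)"
  proof (rule essential_cycle[where k = k and \<beta> = \<beta> and coef = c and c = d])
    show "loop (\<beta> i)" "path_length (\<beta> i) \<le> ennreal a" "\<not> homotopic_loops UNIV (\<beta> i) \<alpha>"
      "\<not> homotopic_loops UNIV (\<beta> i) (reversepath \<alpha>)" "c i \<in> carrier F" if "i \<in> {1..k}" for i
      using assms(7,8) that by (auto simp flip: path_length_\<alpha>)
  qed (use \<alpha> d in auto)
  have r0p: "0 < r0" using r0(1) a(1) by linarith
  have al: "enn2real (path_length \<alpha>) = a" using a(1) by (simp add: path_length_\<alpha>)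
  show ?thesis
    unfolding al
  proof (rule exI[of _ "\<kappa> / r0"], intro conjI allI impI)
    show "0 < \<kappa> / r0" using \<kappa>_pos r0p by simp
    fix s assume s: "0 < s \<and> s < \<kappa> / r0"
    then have "s * r0 \<le> \<kappa>" using r0p by (simp add: field_simps)
    then show "\<exists>\<delta>>a / 3. \<exists>J. (J = {a / 3 <..< \<delta>} \<or> J = {a / 3 <.. \<delta>}) \<and>
       has_direct_summand F (sRips_homology F 2 (UNIV :: 'a set) 2 s) (elementary_interval F J)"
      using s by (intro summand_from_essential_cycle[OF _ _ z]) auto
  qed
qed

end
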